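(* Let $G$ denote one of the two types $O$ (orthogonal) or $Sp$ (symplectic). Let $N\ge 1$, $M\ge 0$ be integers (both even in the case $Sp$), and let $\lambda,\mu$ be partitions with $\lambda_i\ge\mu_i$ for all $i$, such that $\lambda$ is admissible for $G_{N+M}$ and $\mu$ is admissible for $G_M$. Let $\Omega$ be a standard tableau of shape $\lambda/\mu$ with $n$ boxes, with contents $c_k(\Omega)$. Consider the two ordered products of operators on $(\mathbb C^N)^{\otimes n}$, with the pairs $(k,l)$ ordered lexicographically from left to right, $$A=\prod_{1\le k<l\le n}^{\longrightarrow}\Bigl(1-\frac{Q_{kl}}{c_k(\Omega)+c_l(\Omega)+t_k(\Omega)+t_l(\Omega)+N+M}\Bigr),$$ $$B=\prod_{1\le k<l\le n}^{\longrightarrow}\Bigl(1-\frac{P_{kl}}{c_k(\Omega)-c_l(\Omega)+t_k(\Omega)-t_l(\Omega)}\Bigr),$$ where $t_1(\Omega),\dots,t_n(\Omega)$ are complex variables. a) If $G_N=O_N$ and the variables are constrained by $t_k(\Omega)=t_l(\Omega)$ whenever $k$ and $l$ occur in the same column of $\Omega$, then the product $A\cdot B$, as a rational function of the constrained variables, is regular at $t_1(\Omega)=\dots=t_n(\Omega)=-\frac12$. b) If $G_N=Sp_N$ and the variables are constrained by $t_k(\Omega)=t_l(\Omega)$ whenever $k$ and $l$ occur in the same row of $\Omega$, then the product $A\cdot B$, as a rational function of the constrained variables, is regular at $t_1(\Omega)=\dots=t_n(\Omega)=\frac12$. c) In each case let $F_\Omega(M)$ be the operator value of the (constrained) product $A\cdot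 B$ at $t_1(\Omega)=\dots=t_n(\Omega)=\mp\frac12$ (upper sign for $O_N$, lower sign for $Sp_N$). Then $F_\Omega(M)$ is divisible on the left and on the right by $E_\Omega$; that is, $F_\Omega(M)=E_\Omega X=YE_\Omega$ for some linear operators $X,Y$ on $(\mathbb C^N)^{\otimes n}$.
   Context: **Groups.** $\mathbb C^N$ carries a non-degenerate bilinear form $\langle\,,\rangle$, symmetric for type $O$ and alternating for type $Sp$; $G_N\subset GL_N$ is the subgroup preserving it ($G_N=O_N$ or $Sp_N$). $G_0$ is trivial. A partition $\nu$ (with conjugate $\nu'$) is *admissible* for $G_K$ if $\nu_1'+\nu_2'\le K$ for $G_K=O_K$, and $2\nu'_1\le K$ for $G_K=Sp_K$. **Tableaux.** $\lambda/\mu=\{(i,j)\in\mathbb Z^2: i\ge1,\ \lambda_i\ge j>\mu_i\}$ (row index $i$, column index $j$) has $n$ elements. A standard tableau of shape $\lambda/\mu$ is a bijection $\Omega:\lambda/\mu\to\{1,\dots,n\}$ increasing along rows and down columns. The content is $c_k(\Omega)=j-i$ if $k=\Omega(i,j)$. **Operators.** $P_{kl}$ is the operator on $(\mathbb C^N)^{\otimes n}$ exchanging the $k$th and $l$th tensor factors. Let $u_1,\dots,u_N$ be a basis of $\mathbb C^N$ and $v_1,\dots,v_N$ the dual basis, $\langle u_i,v_j\rangle=\delta_{ij}$; put $w(N)=\sum_i u_i\otimes v_i$ and $Q(N):u\otimes v\mapsto\langle u,v\rangle\,w(N)$ on $\mathbb C^N\otimes\mathbb C^N$. For $k<l$, $Q_{kl}$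 acts as $Q(N)$ in the $k$th and $l$th tensor factors of $(\mathbb C^N)^{\otimes n}$ and as the identity in the others. **The operator $E_\Omega$.** For a partition $\lambda$ of $l$ let $U_\lambda$ be the irreducible complex representation of $S_l$ labeled by $\lambda$, with an $S_l$-invariant inner product. For a standard tableau $\Lambda$ of shape $\lambda$ let $u_\Lambda\in U_\lambda$ be a unit vector (unique up to phase) which, for each $k=1,\dots,l-1$, lies in an irreducible $\mathbb CS_k$-submodule of $U_\lambda$ labeled by the shape of the tableau obtained from $\Lambda$ by removing the numbers $k+1,\dots,l$. Put $e_\Lambda=\sum_{s\in S_l}(u_\Lambda,s\cdot u_\Lambda)\,s\in\mathbb CS_l$. For $\Omega$ of skew shape $\lambda/\mu$, with $\lambda,\mu$ partitions of $l,m$ and $n=l-m$: choose any standard tableau $\Upsilon$ of shape $\mu$ and let $\Lambda$ be the standard tableau of shape $\lambda$ equal to $\Upsilon$ on $\mu$ and to $\Omega+m$ on $\lambda/\mu$. Let $\iota_m:\mathbb CS_n\to\mathbb CS_l$ be the embedding with $S_n$ permuting $\{m+1,\dots,l\}$, and let $\theta_m:\mathbb CS_l\to\mathbb C[S_m\times\iota_m(S_n)]$ be the linear map fixing $s\in S_m\times\iota_m(S_n)$ and sending all other $s\in S_l$ to $0$. Then $e_\Omega\in\mathbb CS_n$ is the unique element with $\theta_m(e_\Lambda)=e_\Upsilon\cdot\iota_m(e_\Omega)$; it does not depend on $\Upsilon$. $E_\Omega$ is the operator on $(\mathbb C^N)^{\otimes n}$ by which $e_\Omega$ acts when $S_n$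 permutes tensor factors. *)

theory Defs
  imports
    "HOL-Analysis.Analysis"
    "HOL-Combinatorics.Permutations"
    "HOL-Library.Function_Algebras"
begin

section \<open>Complex-valued functions as a vector space\<close>

definition cscale :: "complex \<Rightarrow> ('a \<Rightarrow> complex) \<Rightarrow> ('a \<Rightarrow> complex)" where
  "cscale c f = (\<lambda>x. c * f x)"

global_interpretation cfun: vector_space cscale
  by unfold_locales (auto simp: cscale_def fun_eq_iff algebra_simps)


section \<open>Partitions, diagrams and tableaux\<close>

text \<open>A partition is a function whose values at 1, 2, ... are its parts; the value at 0 is
  irrelevant.\<close>

definition is_partition :: "(nat \<Rightarrow> nat) \<Rightarrow> bool" where
  "is_partition \<nu> \<longleftrightarrow> (\<forall>i\<ge>1. \<nu> (Suc i) \<le> \<nu> i) \<and> finite {i. 1 \<le> i \<and> \<nu> i \<noteq> 0}"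

definition conjugate :: "(nat \<Rightarrow> nat) \<Rightarrow> nat \<Rightarrow> nat" where
  "conjugate \<nu> j = card {i. 1 \<le> i \<and> j \<le> \<nu> i}"

definition skew_diagram :: "(nat \<Rightarrow> nat) \<Rightarrow> (nat \<Rightarrow> nat) \<Rightarrow> (nat \<times> nat) set" where
  "skew_diagram lam mu = {(i, j). 1 \<le> i \<and> mu i < j \<and> j \<le> lam i}"

definition diagram :: "(nat \<Rightarrow> nat) \<Rightarrow> (nat \<times> nat) set" where
  "diagram \<nu> = skew_diagram \<nu> (\<lambda>_. 0)"

text \<open>Tableaux are functions on boxes; only the values on the diagram \<open>D\<close> matter.\<close>

definition standard_tableau :: "(nat \<times> nat) set \<Rightarrow> (nat \<times> nat \<Rightarrow> nat) \<Rightarrow> bool" where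
  "standard_tableau D \<Omega> \<longleftrightarrow>
     bij_betw \<Omega> D {1..card D} \<and>
     (\<forall>i j j'. (i, j) \<in> D \<longrightarrow> (i, j') \<in> D \<longrightarrow> j < j' \<longrightarrow> \<Omega> (i, j) < \<Omega> (i, j')) \<and>
     (\<forall>i i' j. (i, j) \<in> D \<longrightarrow> (i', j) \<in> D \<longrightarrow> i < i' \<longrightarrow> \<Omega> (i, j) < \<Omega> (i', j))"

definition row_of :: "(nat \<times> nat) set \<Rightarrow> (nat \<times> nat \<Rightarrow> nat) \<Rightarrow> nat \<Rightarrow> nat" where
  "row_of D \<Omega> k = fst (inv_into D \<Omega> k)"

definition col_of :: "(nat \<times> nat) set \<Rightarrow> (nat \<times> nat \<Rightarrow> nat) \<Rightarrow> nat \<Rightarrow> nat" where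
  "col_of D \<Omega> k = snd (inv_into D \<Omega> k)"

definition box_content :: "(nat \<times> nat) set \<Rightarrow> (nat \<times> nat \<Rightarrow> nat) \<Rightarrow> nat \<Rightarrow> int" where
  "box_content D \<Omega> k = int (col_of D \<Omega> k) - int (row_of D \<Omega> k)"


section \<open>The group algebra of the symmetric group\<close>

text \<open>\<open>S\<^sub>l\<close> is the set of permutations of \<open>{1..l}\<close>, extended by the identity, so that
  \<open>S\<^sub>k \<subseteq> S\<^sub>l\<close> for \<open>k \<le> l\<close>. An element of \<open>\<complex>S\<^sub>l\<close> is its coefficient function.\<close>

definition Sym :: "nat \<Rightarrow> (nat \<Rightarrow> nat) set" where
  "Sym l = {s. s permutes {1..l}}"

type_synonym gralg = "(nat \<Rightarrow> nat) \<Rightarrow> complex"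

definition group_algebra :: "nat \<Rightarrow> gralg set" where
  "group_algebra l = {f. \<forall>s. s \<notin> Sym l \<longrightarrow> f s = 0}"

definition gmult :: "nat \<Rightarrow> gralg \<Rightarrow> gralg \<Rightarrow> gralg" where
  "gmult l f g = (\<lambda>s. \<Sum>p\<in>Sym l. f p * g (inv p \<circ> s))"

definition gact :: "(nat \<Rightarrow> nat) \<Rightarrow> gralg \<Rightarrow> gralg" where
  "gact s f = (\<lambda>x. f (inv s \<circ> x))"

text \<open>An inner product on \<open>\<complex>S\<^sub>l\<close> that is invariant under left multiplication by \<open>S\<^sub>l\<close>,
  linear in the second argument.\<close>

definition gip :: "nat \<Rightarrow> gralg \<Rightarrow> gralg \<Rightarrow> complex" where
  "gip l f g = (\<Sum>s\<in>Sym l. cnj (f s) * g s)"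


section \<open>The irreducible module labeled by a diagram\<close>

text \<open>The irreducible module labeled by a Young diagram \<open>D\<close> with \<open>k\<close> boxes is realized as the
  left ideal of \<open>\<complex>S\<^sub>k\<close> generated by the Young symmetrizer (row symmetrizer times column
  antisymmetrizer) of the tableau of shape \<open>D\<close> filled row by row. A single row thus labels the
  trivial and a single column the sign representation.\<close>

definition row_tableau :: "(nat \<times> nat) set \<Rightarrow> nat \<times> nat \<Rightarrow> nat" where
  "row_tableau D = (\<lambda>(i, j). card {(i', j') \<in> D. i' < i \<or> (i' = i \<and> j' \<le> j)})"

definition row_group :: "(nat \<times> nat) set \<Rightarrow> (nat \<Rightarrow> nat) set" where
  "row_group D = {p \<in> Sym (card D). \<forall>b\<in>D. \<exists>b'\<in>D.
     fst b' = fst b \<and> p (row_tableau D b) = row_tableau D b'}"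

definition col_group :: "(nat \<times> nat) set \<Rightarrow> (nat \<Rightarrow> nat) set" where
  "col_group D = {p \<in> Sym (card D). \<forall>b\<in>D. \<exists>b'\<in>D.
     snd b' = snd b \<and> p (row_tableau D b) = row_tableau D b'}"

definition young_symmetrizer :: "(nat \<times> nat) set \<Rightarrow> gralg" where
  "young_symmetrizer D =
     gmult (card D)
       (\<lambda>p. if p \<in> row_group D then 1 else 0)
       (\<lambda>p. if p \<in> col_group D then of_int (sign p) else 0)"

definition irrep :: "(nat \<times> nat) set \<Rightarrow> gralg set" where
  "irrep D = {gmult (card D) f (young_symmetrizer D) | f. f \<in> group_algebra (card D)}"

definition submodule :: "nat \<Rightarrow> gralg set \<Rightarrow> bool" where
  "submodule k W \<longleftrightarrow> cfun.subspace W \<and> (\<forall>s\<in>Sym k. \<forall>f\<in>W. gact s f \<in> W)"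

text \<open>\<open>W\<close> is isomorphic to the irreducible \<open>S\<^sub>k\<close>-module labeled by \<open>D\<close>, where \<open>k = card D\<close>.
  A linear map on the subspace \<open>W\<close> always extends to the ambient function space, so linearity
  of \<open>\<phi>\<close> there is no restriction.\<close>

definition labeled_by :: "gralg set \<Rightarrow> (nat \<times> nat) set \<Rightarrow> bool" where
  "labeled_by W D \<longleftrightarrow>
     (\<exists>\<phi>. Vector_Spaces.linear cscale cscale \<phi> \<and> bij_betw \<phi> W (irrep D) \<and>
          (\<forall>s\<in>Sym (card D). \<forall>f\<in>W. \<phi> (gact s f) = gact s (\<phi> f)))"


section \<open>The elements \<open>e\<^sub>\<Lambda>\<close> and \<open>e\<^sub>\<Omega>\<close>\<close>

definition young_vector :: "(nat \<times> nat) set \<Rightarrow> (nat \<times> nat \<Rightarrow> nat) \<Rightarrow> gralg \<Rightarrow> bool" where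
  "young_vector D \<Lambda> u \<longleftrightarrow>
     u \<in> irrep D \<and> gip (card D) u u = 1 \<and>
     (\<forall>k\<in>{1..<card D}. \<exists>W. W \<subseteq> irrep D \<and> submodule k W \<and> labeled_by W {b \<in> D. \<Lambda> b \<le> k} \<and> u \<in> W)"

text \<open>The vector is unique up to a phase, which cancels in the coefficients of \<open>e\<^sub>\<Lambda>\<close>.\<close>

definition u_vec :: "(nat \<times> nat) set \<Rightarrow> (nat \<times> nat \<Rightarrow> nat) \<Rightarrow> gralg" where
  "u_vec D \<Lambda> = (SOME u. young_vector D \<Lambda> u)"

definition e_straight :: "(nat \<times> nat) set \<Rightarrow> (nat \<times> nat \<Rightarrow> nat) \<Rightarrow> gralg" where
  "e_straight D \<Lambda> =
     (\<lambda>s. if s \<in> Sym (card D) then gip (card D) (u_vec D \<Lambda>) (gact s (u_vec D \<Lambda>)) else 0)"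

text \<open>The permutation \<open>s\<close> of \<open>{1..n}\<close> transported to \<open>{m+1..m+n}\<close>.\<close>

definition shift_perm :: "nat \<Rightarrow> (nat \<Rightarrow> nat) \<Rightarrow> nat \<Rightarrow> nat" where
  "shift_perm m s = (\<lambda>i. if i \<le> m then i else m + s (i - m))"

definition iota :: "nat \<Rightarrow> nat \<Rightarrow> gralg \<Rightarrow> gralg" where
  "iota m n f = (\<lambda>p. \<Sum>s | s \<in> Sym n \<and> shift_perm m s = p. f s)"

definition theta :: "nat \<Rightarrow> nat \<Rightarrow> gralg \<Rightarrow> gralg" where
  "theta m n f = (\<lambda>p. if \<exists>s\<in>Sym m. \<exists>t\<in>Sym n. p = s \<circ> shift_perm m t then f p else 0)"

definition glue_tableau ::
  "(nat \<times> nat) set \<Rightarrow> (nat \<times> nat \<Rightarrow> nat) \<Rightarrow> (nat \<times> nat \<Rightarrow> nat) \<Rightarrow> nat \<times> nat \<Rightarrow> nat" where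
  "glue_tableau D \<Upsilon> \<Omega> = (\<lambda>b. if b \<in> D then \<Upsilon> b else \<Omega> b + card D)"

definition e_skew ::
  "(nat \<Rightarrow> nat) \<Rightarrow> (nat \<Rightarrow> nat) \<Rightarrow> (nat \<times> nat \<Rightarrow> nat) \<Rightarrow> (nat \<times> nat \<Rightarrow> nat) \<Rightarrow> gralg" where
  "e_skew lam mu \<Upsilon> \<Omega> =
     (let l = card (diagram lam); m = card (diagram mu); n = card (skew_diagram lam mu) in
      THE e. e \<in> group_algebra n \<and>
        theta m n (e_straight (diagram lam) (glue_tableau (diagram mu) \<Upsilon> \<Omega>)) =
        gmult l (e_straight (diagram mu) \<Upsilon>) (iota m n e))"


section \<open>Operators on tensor powers\<close>

text \<open>The \<open>n\<close>-th tensor power of \<open>\<complex>\<^sup>N\<close>, \<open>N = CARD('N)\<close>, consists of the coordinate functions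
  on the multi-indices \<open>x\<close>, \<open>x 1, ..., x n \<in> 'N\<close>.\<close>

type_synonym 'N tensor = "(nat \<Rightarrow> 'N) \<Rightarrow> complex"

definition tensor_power :: "nat \<Rightarrow> 'N tensor set" where
  "tensor_power n = {f. \<forall>x. x \<notin> ({1..n} \<rightarrow>\<^sub>E UNIV) \<longrightarrow> f x = 0}"

definition pure_tensor :: "nat \<Rightarrow> (nat \<Rightarrow> complex ^ 'N) \<Rightarrow> 'N::finite tensor" where
  "pure_tensor n z = (\<lambda>x. if x \<in> ({1..n} \<rightarrow>\<^sub>E UNIV) then \<Prod>i\<in>{1..n}. z i $ x i else 0)"

text \<open>As for \<open>labeled_by\<close>, linearity on the ambient function space is no restriction on the
  operator induced on the tensor power.\<close>

definition tensor_operator :: "nat \<Rightarrow> ('N tensor \<Rightarrow> 'N tensor) \<Rightarrow> bool" where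
  "tensor_operator n X \<longleftrightarrow>
     Vector_Spaces.linear cscale cscale X \<and> (\<forall>f\<in>tensor_power n. X f \<in> tensor_power n)"

text \<open>A permutation \<open>s\<close> moves the \<open>k\<close>-th tensor factor to the place \<open>s k\<close>.\<close>

definition perm_op :: "(nat \<Rightarrow> nat) \<Rightarrow> 'N tensor \<Rightarrow> 'N tensor" where
  "perm_op s f = (\<lambda>x. f (x \<circ> s))"

definition P_op :: "nat \<Rightarrow> nat \<Rightarrow> 'N tensor \<Rightarrow> 'N tensor" where
  "P_op k l = perm_op (Transposition.transpose k l)"

definition w_coord :: "('N \<Rightarrow> complex ^ 'N) \<Rightarrow> ('N \<Rightarrow> complex ^ 'N) \<Rightarrow> 'N \<Rightarrow> 'N::finite \<Rightarrow> complex" where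
  "w_coord u v a b = (\<Sum>i\<in>UNIV. u i $ a * v i $ b)"

definition Q_op ::
  "(complex ^ 'N \<Rightarrow> complex ^ 'N \<Rightarrow> complex) \<Rightarrow> ('N \<Rightarrow> complex ^ 'N) \<Rightarrow> ('N \<Rightarrow> complex ^ 'N)
   \<Rightarrow> nat \<Rightarrow> nat \<Rightarrow> 'N::finite tensor \<Rightarrow> 'N tensor" where
  "Q_op form u v k l f =
     (\<lambda>x. w_coord u v (x k) (x l) *
          (\<Sum>a\<in>UNIV. \<Sum>b\<in>UNIV. form (axis a 1) (axis b 1) * f (x(k := a, l := b))))"

definition algebra_op :: "nat \<Rightarrow> gralg \<Rightarrow> 'N tensor \<Rightarrow> 'N tensor" where
  "algebra_op n e f = (\<lambda>x. \<Sum>s\<in>Sym n. e s * perm_op s f x)"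

definition E_op ::
  "(nat \<Rightarrow> nat) \<Rightarrow> (nat \<Rightarrow> nat) \<Rightarrow> (nat \<times> nat \<Rightarrow> nat) \<Rightarrow> (nat \<times> nat \<Rightarrow> nat)
   \<Rightarrow> 'N tensor \<Rightarrow> 'N tensor" where
  "E_op lam mu \<Upsilon> \<Omega> = algebra_op (card (skew_diagram lam mu)) (e_skew lam mu \<Upsilon> \<Omega>)"


section \<open>Types of groups and bilinear forms\<close>

datatype gtype = Orth | Symp

fun admissible :: "gtype \<Rightarrow> nat \<Rightarrow> (nat \<Rightarrow> nat) \<Rightarrow> bool" where
  "admissible Orth K \<nu> \<longleftrightarrow> conjugate \<nu> 1 + conjugate \<nu> 2 \<le> K"
| "admissible Symp K \<nu> \<longleftrightarrow> 2 * conjugate \<nu> 1 \<le> K"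

definition bilinear_form :: "(complex ^ 'N \<Rightarrow> complex ^ 'N \<Rightarrow> complex) \<Rightarrow> bool" where
  "bilinear_form form \<longleftrightarrow>
     (\<forall>y. Vector_Spaces.linear (*s) (*) (\<lambda>x. form x y)) \<and>
     (\<forall>x. Vector_Spaces.linear (*s) (*) (\<lambda>y. form x y))"

definition nondegenerate :: "(complex ^ 'N \<Rightarrow> complex ^ 'N \<Rightarrow> complex) \<Rightarrow> bool" where
  "nondegenerate form \<longleftrightarrow>
     (\<forall>x. (\<forall>y. form x y = 0) \<longrightarrow> x = 0) \<and> (\<forall>y. (\<forall>x. form x y = 0) \<longrightarrow> y = 0)"

fun form_of_type :: "gtype \<Rightarrow> (complex ^ 'N \<Rightarrow> complex ^ 'N \<Rightarrow> complex) \<Rightarrow> bool" where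
  "form_of_type Orth form \<longleftrightarrow>
     bilinear_form form \<and> nondegenerate form \<and> (\<forall>x y. form x y = form y x)"
| "form_of_type Symp form \<longleftrightarrow>
     bilinear_form form \<and> nondegenerate form \<and> (\<forall>x. form x x = 0)"

definition dual_bases ::
  "(complex ^ 'N \<Rightarrow> complex ^ 'N \<Rightarrow> complex) \<Rightarrow> ('N::finite \<Rightarrow> complex ^ 'N) \<Rightarrow> ('N \<Rightarrow> complex ^ 'N) \<Rightarrow> bool" where
  "dual_bases form u v \<longleftrightarrow>
     inj u \<and> vec.independent (range u) \<and> vec.span (range u) = UNIV \<and>
     (\<forall>i j. form (u i) (v j) = (if i = j then 1 else 0))"

text \<open>The coordinate formulas for \<open>P_op\<close> and \<open>Q_op\<close> say what they should on pure tensors.\<close>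

lemma P_op_pure_tensor:
  assumes "k \<in> {1..n}" "l \<in> {1..n}"
  shows "P_op k l (pure_tensor n z) = pure_tensor n (z \<circ> Transposition.transpose k l)"
proof (rule ext)
  fix x :: "nat \<Rightarrow> 'a"
  let ?s = "Transposition.transpose k l"
  have s: "?s permutes {1..n}"
    using assms by (rule permutes_swap_id)
  have inv: "?s (?s i) = i" for i
    by simp
  have iff: "x \<circ> ?s \<in> {1..n} \<rightarrow>\<^sub>E UNIV \<longleftrightarrow> x \<in> {1..n} \<rightarrow>\<^sub>E UNIV"
  proof -
    have "i \<notin> {1..n} \<Longrightarrow> ?s i = i" for i
      using s by (simp add: permutes_def)
    then show ?thesis
      by (auto simp: PiE_def extensional_def)
  qed
  have "(\<Prod>i\<in>{1..n}. z i $ x (?s i)) = (\<Prod>i\<in>{1..n}. z (?s i) $ x i)"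
    by (subst prod.permute[OF s]) (simp add: o_def)
  then show "P_op k l (pure_tensor n z) x = pure_tensor n (z \<circ> ?s) x"
    unfolding P_op_def perm_op_def pure_tensor_def iff by simp
qed

lemma sum_fun_apply: "(\<Sum>i\<in>I. f i) x = (\<Sum>i\<in>I. f i x)"
  by (induction I rule: infinite_finite_induct) auto

lemma bilinear_form_coords:
  fixes form :: "complex ^ 'N::finite \<Rightarrow> complex ^ 'N \<Rightarrow> complex" and x y :: "complex ^ 'N"
  assumes "bilinear_form form"
  shows "form x y = (\<Sum>a\<in>UNIV. \<Sum>b\<in>UNIV. form (axis a 1) (axis b 1) * (x $ a * y $ b))"
proof -
  interpret L: Vector_Spaces.linear "(*s)" "(*)" "\<lambda>x. form x y" for y
    using assms by (auto simp: bilinear_form_def)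
  interpret R: Vector_Spaces.linear "(*s)" "(*)" "\<lambda>y. form x y" for x
    using assms by (auto simp: bilinear_form_def)
  have "form x y = form (\<Sum>a\<in>UNIV. x $ a *s axis a 1) (\<Sum>b\<in>UNIV. y $ b *s axis b 1)"
    by (simp only: basis_expansion)
  also have "\<dots> = (\<Sum>a\<in>UNIV. \<Sum>b\<in>UNIV. form (axis a 1) (axis b 1) * (x $ a * y $ b))"
    by (subst sum.swap) (simp add: L.sum L.scale R.sum R.scale sum_distrib_left mult_ac)
  finally show "form x y = (\<Sum>a\<in>UNIV. \<Sum>b\<in>UNIV. form (axis a 1) (axis b 1) * (x $ a * y $ b))".
qed

lemma Q_op_pure_tensor:
  fixes form :: "complex ^ 'N::finite \<Rightarrow> complex ^ 'N \<Rightarrow> complex"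
  assumes "bilinear_form form" and k: "k \<in> {1..n}" and l: "l \<in> {1..n}" and "k < l"
  shows "Q_op form u v k l (pure_tensor n z) =
    (\<Sum>i\<in>UNIV. cscale (form (z k) (z l)) (pure_tensor n (z(k := u i, l := v i))))"
proof (rule ext)
  fix x :: "nat \<Rightarrow> 'N"
  have ne: "k \<noteq> l" using \<open>k < l\<close> by simp
  define R where "R = (\<Prod>i\<in>{1..n} - {k, l}. z i $ x i)"
  have fac: "(\<Prod>i\<in>{1..n}. g i) = g k * (g l * (\<Prod>i\<in>{1..n} - {k, l}. g i))"
    for g :: "nat \<Rightarrow> complex"
  proof -
    have "(\<Prod>i\<in>{1..n}. g i) = g k * (\<Prod>i\<in>{1..n} - {k}. g i)"
      using k by (subst prod.remove[of _ k]) auto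
    also have "(\<Prod>i\<in>{1..n} - {k}. g i) = g l * (\<Prod>i\<in>{1..n} - {k} - {l}. g i)"
      using l ne by (subst prod.remove[of _ l]) auto
    also have "{1..n} - {k} - {l} = {1..n} - {k, l}" by auto
    finally show ?thesis .
  qed
  have iff: "x(k := a, l := b) \<in> {1..n} \<rightarrow>\<^sub>E UNIV \<longleftrightarrow> x \<in> {1..n} \<rightarrow>\<^sub>E UNIV" for a b
    using k l by (auto simp: PiE_def extensional_def)
  show "Q_op form u v k l (pure_tensor n z) x =
    (\<Sum>i\<in>UNIV. cscale (form (z k) (z l)) (pure_tensor n (z(k := u i, l := v i)))) x"
  proof (cases "x \<in> {1..n} \<rightarrow>\<^sub>E UNIV")
    case True
    have pt: "pure_tensor n z (x(k := a, l := b)) = z k $ a * z l $ b * R" for a b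
    proof -
      have "(\<Prod>i\<in>{1..n} - {k, l}. z i $ (x(k := a, l := b)) i) = R"
        unfolding R_def by (rule prod.cong) auto
      then show ?thesis
        using True ne unfolding pure_tensor_def iff by (simp add: fac del: One_nat_def)
    qed
    have pw: "pure_tensor n (z(k := u i, l := v i)) x = u i $ x k * v i $ x l * R" for i
    proof -
      have "(\<Prod>j\<in>{1..n} - {k, l}. (z(k := u i, l := v i)) j $ x j) = R"
        unfolding R_def by (rule prod.cong) auto
      then show ?thesis
        using True ne unfolding pure_tensor_def by (simp add: fac del: One_nat_def)
    qed
    have "Q_op form u v k l (pure_tensor n z) x =
        w_coord u v (x k) (x l) * (form (z k) (z l) * R)"
      unfolding Q_op_def pt bilinear_form_coords[OF assms(1), of "z k" "z l"]
      by (simp add: sum_distrib_left sum_distrib_right mult_ac)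
    also have "\<dots> = (\<Sum>i\<in>UNIV. cscale (form (z k) (z l)) (pure_tensor n (z(k := u i, l := v i)))) x"
      unfolding sum_fun_apply cscale_def pw w_coord_def
      by (simp add: sum_distrib_right sum_distrib_left mult_ac)
    finally show ?thesis .
  next
    case False
    then show ?thesis
      unfolding Q_op_def sum_fun_apply cscale_def pure_tensor_def iff by simp
  qed
qed


section \<open>Rational functions and regularity\<close>

text \<open>Polynomial functions in the variables \<open>t k\<close>, \<open>k \<in> V\<close>.\<close>

inductive polynomial_fun :: "nat set \<Rightarrow> ((nat \<Rightarrow> complex) \<Rightarrow> complex) \<Rightarrow> bool" for V where
  const: "polynomial_fun V (\<lambda>t. c)"
| var: "k \<in> V \<Longrightarrow> polynomial_fun V (\<lambda>t. t k)"
| add: "polynomial_fun V p \<Longrightarrow> polynomial_fun V q \<Longrightarrow> polynomial_fun V (\<lambda>t. p t + q t)"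
| mult: "polynomial_fun V p \<Longrightarrow> polynomial_fun V q \<Longrightarrow> polynomial_fun V (\<lambda>t. p t * q t)"

text \<open>A rational function on a linear space of constrained variables is given by its values
  \<open>r t\<close> on the set \<open>G\<close> of those points \<open>t\<close> of the space where the denominators in its
  defining expression are nonzero (a nonempty Zariski open subset of the space). It is regular
  at \<open>a\<close>, with value \<open>y\<close> there, if it can be written as \<open>p / q\<close> with \<open>q a \<noteq> 0\<close> and
  \<open>p a / q a = y\<close>.\<close>

definition has_regular_value ::
  "nat set \<Rightarrow> (nat \<Rightarrow> complex) set \<Rightarrow> ((nat \<Rightarrow> complex) \<Rightarrow> complex) \<Rightarrow> (nat \<Rightarrow> complex) \<Rightarrow> complex \<Rightarrow> bool" where
  "has_regular_value V G r a y \<longleftrightarrow>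
     (\<exists>p q. polynomial_fun V p \<and> polynomial_fun V q \<and> q a \<noteq> 0 \<and>
            (\<forall>t\<in>G. q t * r t = p t) \<and> y = p a / q a)"

definition regular_at ::
  "nat set \<Rightarrow> (nat \<Rightarrow> complex) set \<Rightarrow> ((nat \<Rightarrow> complex) \<Rightarrow> complex) \<Rightarrow> (nat \<Rightarrow> complex) \<Rightarrow> bool" where
  "regular_at V G r a \<longleftrightarrow> (\<exists>y. has_regular_value V G r a y)"

definition regular_value ::
  "nat set \<Rightarrow> (nat \<Rightarrow> complex) set \<Rightarrow> ((nat \<Rightarrow> complex) \<Rightarrow> complex) \<Rightarrow> (nat \<Rightarrow> complex) \<Rightarrow> complex" where
  "regular_value V G r a = (THE y. has_regular_value V G r a y)"

text \<open>For operator-valued rational functions, regularity and values are those of all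
  coordinates \<open>R t f x\<close>, hence of all matrix entries.\<close>

definition regular_operator_at ::
  "nat \<Rightarrow> (nat \<Rightarrow> complex) set \<Rightarrow> ((nat \<Rightarrow> complex) \<Rightarrow> 'N tensor \<Rightarrow> 'N tensor) \<Rightarrow> (nat \<Rightarrow> complex) \<Rightarrow> bool" where
  "regular_operator_at n G R a \<longleftrightarrow>
     (\<forall>f\<in>tensor_power n. \<forall>x. regular_at {1..n} G (\<lambda>t. R t f x) a)"

definition operator_value ::
  "nat \<Rightarrow> (nat \<Rightarrow> complex) set \<Rightarrow> ((nat \<Rightarrow> complex) \<Rightarrow> 'N tensor \<Rightarrow> 'N tensor) \<Rightarrow> (nat \<Rightarrow> complex)
   \<Rightarrow> 'N tensor \<Rightarrow> 'N tensor" where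
  "operator_value n G R a = (\<lambda>f x. regular_value {1..n} G (\<lambda>t. R t f x) a)"


section \<open>The products \<open>A\<close> and \<open>B\<close>\<close>

text \<open>Here \<open>c\<close> is the sequence of contents and \<open>K = N + M\<close>.\<close>

definition A_denom :: "(nat \<Rightarrow> int) \<Rightarrow> nat \<Rightarrow> (nat \<Rightarrow> complex) \<Rightarrow> nat \<Rightarrow> nat \<Rightarrow> complex" where
  "A_denom c K t k l = of_int (c k) + of_int (c l) + t k + t l + of_nat K"

definition B_denom :: "(nat \<Rightarrow> int) \<Rightarrow> (nat \<Rightarrow> complex) \<Rightarrow> nat \<Rightarrow> nat \<Rightarrow> complex" where
  "B_denom c t k l = of_int (c k) - of_int (c l) + t k - t l"

definition lex_pairs :: "nat \<Rightarrow> (nat \<times> nat) list" where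
  "lex_pairs n = [(k, l). k \<leftarrow> [1..<Suc n], l \<leftarrow> [Suc k..<Suc n]]"

definition ordered_prod :: "nat \<Rightarrow> (nat \<Rightarrow> nat \<Rightarrow> 'a \<Rightarrow> 'a) \<Rightarrow> 'a \<Rightarrow> 'a" where
  "ordered_prod n X = foldr (\<lambda>(k, l) Y. X k l \<circ> Y) (lex_pairs n) id"

definition A_prod ::
  "(complex ^ 'N \<Rightarrow> complex ^ 'N \<Rightarrow> complex) \<Rightarrow> ('N \<Rightarrow> complex ^ 'N) \<Rightarrow> ('N \<Rightarrow> complex ^ 'N)
   \<Rightarrow> nat \<Rightarrow> (nat \<Rightarrow> int) \<Rightarrow> nat \<Rightarrow> (nat \<Rightarrow> complex) \<Rightarrow> 'N::finite tensor \<Rightarrow> 'N tensor" where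
  "A_prod form u v n c K t =
     ordered_prod n (\<lambda>k l f. f - cscale (1 / A_denom c K t k l) (Q_op form u v k l f))"

definition B_prod :: "nat \<Rightarrow> (nat \<Rightarrow> int) \<Rightarrow> (nat \<Rightarrow> complex) \<Rightarrow> 'N tensor \<Rightarrow> 'N tensor" where
  "B_prod n c t =
     ordered_prod n (\<lambda>k l f. f - cscale (1 / B_denom c t k l) (P_op k l f))"

fun constrained ::
  "gtype \<Rightarrow> (nat \<times> nat) set \<Rightarrow> (nat \<times> nat \<Rightarrow> nat) \<Rightarrow> (nat \<Rightarrow> complex) \<Rightarrow> bool" where
  "constrained Orth D \<Omega> t \<longleftrightarrow>
     (\<forall>k\<in>{1..card D}. \<forall>l\<in>{1..card D}. col_of D \<Omega> k = col_of D \<Omega> l \<longrightarrow> t k = t l)"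
| "constrained Symp D \<Omega> t \<longleftrightarrow>
     (\<forall>k\<in>{1..card D}. \<forall>l\<in>{1..card D}. row_of D \<Omega> k = row_of D \<Omega> l \<longrightarrow> t k = t l)"

definition generic_points ::
  "gtype \<Rightarrow> (nat \<times> nat) set \<Rightarrow> (nat \<times> nat \<Rightarrow> nat) \<Rightarrow> nat \<Rightarrow> (nat \<Rightarrow> complex) set" where
  "generic_points G D \<Omega> K =
     {t. constrained G D \<Omega> t \<and>
         (\<forall>k l. 1 \<le> k \<and> k < l \<and> l \<le> card D \<longrightarrow>
            A_denom (box_content D \<Omega>) K t k l \<noteq> 0 \<and> B_denom (box_content D \<Omega>) t k l \<noteq> 0)}"

fun special_point :: "gtype \<Rightarrow> nat \<Rightarrow> complex" where
  "special_point Orth = (\<lambda>_. - 1 / 2)"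
| "special_point Symp = (\<lambda>_. 1 / 2)"

end

theory Submission
  imports Defs
begin

text \<open>
  With \<open>x\<^sub>k = c\<^sub>k + t\<^sub>k + K/2\<close>, \<open>K = N + M\<close>, the factors are \<open>R\<^sub>k\<^sub>l = 1 - P\<^sub>k\<^sub>l/(x\<^sub>k - x\<^sub>l)\<close> and
  \<open>S\<^sub>k\<^sub>l = 1 - Q\<^sub>k\<^sub>l/(x\<^sub>k + x\<^sub>l)\<close>, which satisfy the Yang-Baxter equation and the mixed relation
  \<open>S\<^sub>a\<^sub>c S\<^sub>b\<^sub>c R\<^sub>a\<^sub>b = R\<^sub>a\<^sub>b S\<^sub>b\<^sub>c S\<^sub>a\<^sub>c\<close>. Hence exchanging two neighbouring labels \<open>a\<close>, \<open>b\<close> whose contents differ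
  by more than one changes \<open>A\<close> and \<open>B\<close> only by factors that are regular and invertible at the
  special point, and the labels may be assumed to be listed line by line, the lines being the
  columns for \<open>O\<close> and the rows for \<open>Sp\<close>.
  Along a line the differences of the \<open>x\<^sub>k\<close> are constant, the product of the \<open>R\<^sub>k\<^sub>l\<close> is proportional to
  an (anti)symmetrizer, and the product of the factors between two lines fuses to a regular
  function. \<open>P\<close> acts on the fused line by \<open>\<epsilon>\<close> and on the image of \<open>Q\<close> by \<open>\<delta> \<noteq> \<epsilon>\<close>, so the fused line
  kills the \<open>Q\<^sub>k\<^sub>l\<close> inside it; by admissibility no other \<open>x\<^sub>k + x\<^sub>l\<close> vanishes at the special point than
  those with \<open>k\<close>, \<open>l\<close> in the first column.

  The value of \<open>B\<close> is the image of an element \<open>b\<close> of the group algebra. For a straight tableau \<open>\<Lambda>\<close>,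
  left and right multiplication by the Jucys-Murphy elements act on \<open>b\<close> by the contents, the
  identity has coefficient 1 in \<open>b\<close>, and \<open>e\<^sub>\<Lambda>\<close> is the only element with these properties. The
  coefficients of \<open>b\<close> for a skew tableau are those for \<open>\<Lambda>\<close> at the permutations of the last \<open>n\<close>
  labels, just as \<open>e\<^sub>\<Omega>\<close> is cut out of \<open>e\<^sub>\<Lambda>\<close>.
\<close>

section \<open>Complex algebras\<close>

text \<open>Group algebra elements act on functions of permutations by left translation and tensors
  are functions of multi-indices, so one type of operators and one list of relations serve both. A
  regular value is witnessed by some fraction p / q, and a priori another fraction could give
  another value; a sequence of generic points tending to the special point excludes this. Uniqueness
  lets two factorizations of one product be evaluated separately and compared, which is how
  divisibility from the left and from the right comes out of the same value. The vectors that define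
  e for a straight tableau are given only through modules isomorphic to left ideals of Young
  symmetrizers. They are reached through the sum of all transpositions of the k-th symmetric group:
  it is central, acts on such a module by the sum of the contents, and consecutive sums differ by a
  Jucys-Murphy element. That the contents on both sides and the coefficient at the identity
  determine an element rests on positivity: the coefficient at the identity of X times its adjoint
  is the sum of the squared moduli of the coefficients of X.\<close>

class calg = ring_1 +
  fixes scaleC :: "complex \<Rightarrow> 'a \<Rightarrow> 'a" (infixr "*\<^sub>C" 75)
  assumes cs_add_right: "c *\<^sub>C (x + y) = c *\<^sub>C x + c *\<^sub>C y"
    and cs_add_left: "(c + d) *\<^sub>C x = c *\<^sub>C x + d *\<^sub>C x"
    and cs_cs [simp]: "c *\<^sub>C d *\<^sub>C x = (c * d) *\<^sub>C x"
    and cs_one [simp]: "1 *\<^sub>C x = x"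
    and mult_cs_left [simp]: "(c *\<^sub>C x) * y = c *\<^sub>C (x * y)"
    and mult_cs_right [simp]: "x * (c *\<^sub>C y) = c *\<^sub>C (x * y)"
begin

lemma cs_zero_right [simp]: "c *\<^sub>C 0 = 0"
  using cs_add_right[of c 0 0] by simp

lemma cs_zero_left [simp]: "0 *\<^sub>C x = 0"
  using cs_add_left[of 0 0 x] by simp

lemma cs_minus_left [simp]: "(- c) *\<^sub>C x = - (c *\<^sub>C x)"
  using cs_add_left[of c "- c" x] by (simp add: eq_neg_iff_add_eq_0 add.commute)

lemma cs_minus_right [simp]: "c *\<^sub>C (- x) = - (c *\<^sub>C x)"
  using cs_add_right[of c x "- x"] by (simp add: eq_neg_iff_add_eq_0 add.commute)

lemma cs_diff_right: "c *\<^sub>C (x - y) = c *\<^sub>C x - c *\<^sub>C y"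
  using cs_add_right[of c x "- y"] by simp

lemma cs_diff_left: "(c - d) *\<^sub>C x = c *\<^sub>C x - d *\<^sub>C x"
  using cs_add_left[of c "- d" x] by simp

lemma cs_sum_right: "c *\<^sub>C sum f I = (\<Sum>i\<in>I. c *\<^sub>C f i)"
  by (induction I rule: infinite_finite_induct) (auto simp: cs_add_right)

lemma cs_cancel: "c \<noteq> 0 \<Longrightarrow> c *\<^sub>C x = c *\<^sub>C y \<longleftrightarrow> x = y"
proof
  assume "c \<noteq> 0" "c *\<^sub>C x = c *\<^sub>C y"
  then have "inverse c *\<^sub>C c *\<^sub>C x = inverse c *\<^sub>C c *\<^sub>C y" by simp
  then show "x = y" using \<open>c \<noteq> 0\<close> by simp
qed simp

lemma cs_eq_iff: "c \<noteq> 0 \<Longrightarrow> c *\<^sub>C x = y \<longleftrightarrow> x = (1 / c) *\<^sub>C y"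
  using cs_cancel[of c x "(1 / c) *\<^sub>C y"] by simp

lemma of_nat_mult_cs: "of_nat n * x = of_nat n *\<^sub>C x"
  by (induction n) (auto simp: distrib_right cs_add_left)

end

lemma linear_cscaleI:
  assumes "\<And>f g. X (f + g) = X f + X g" "\<And>c f. X (cscale c f) = cscale c (X f)"
  shows "Vector_Spaces.linear cscale cscale X"
  using assms by unfold_locales auto

lemma linear_cscaleD:
  assumes "Vector_Spaces.linear cscale cscale X"
  shows "X (f + g) = X f + X g" "X (cscale c f) = cscale c (X f)"
proof -
  interpret Vector_Spaces.linear cscale cscale X by fact
  show "X (f + g) = X f + X g" "X (cscale c f) = cscale c (X f)"
    by (simp_all add: add scale)
qed

section \<open>Linear operators on spaces of complex functions\<close>

typedef 'a endo = "{X :: ('a \<Rightarrow> complex) \<Rightarrow> ('a \<Rightarrow> complex). Vector_Spaces.linear cscale cscale X}"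
  morphisms ap Endo
  by (rule exI[of _ "\<lambda>f. f"]) (auto intro!: linear_cscaleI)

setup_lifting type_definition_endo

lemma ap_linear: "Vector_Spaces.linear cscale cscale (ap X)"
  using ap[of X] by simp

lemma cscale_simps:
  "cscale c (f + g) = cscale c f + cscale c g" "cscale (c + d) f = cscale c f + cscale d f"
  "cscale c (f - g) = cscale c f - cscale c g" "cscale c (- f) = - cscale c f"
  "cscale c (cscale d f) = cscale (c * d) f" "cscale 1 f = f" "cscale c 0 = 0" "cscale 0 f = 0"
  by (auto simp: cscale_def fun_eq_iff algebra_simps)

instantiation endo :: (type) calg
begin

lift_definition zero_endo :: "'a endo" is "\<lambda>f. 0"
  by (auto intro!: linear_cscaleI simp: cscale_simps)
lift_definition one_endo :: "'a endo" is "\<lambda>f. f"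
  by (auto intro!: linear_cscaleI simp: cscale_simps)
lift_definition plus_endo :: "'a endo \<Rightarrow> 'a endo \<Rightarrow> 'a endo" is "\<lambda>X Y f. X f + Y f"
  by (auto intro!: linear_cscaleI simp: cscale_simps linear_cscaleD algebra_simps)
lift_definition uminus_endo :: "'a endo \<Rightarrow> 'a endo" is "\<lambda>X f. - X f"
  by (auto intro!: linear_cscaleI simp: cscale_simps linear_cscaleD algebra_simps)
lift_definition minus_endo :: "'a endo \<Rightarrow> 'a endo \<Rightarrow> 'a endo" is "\<lambda>X Y f. X f - Y f"
  by (auto intro!: linear_cscaleI simp: cscale_simps linear_cscaleD algebra_simps)
lift_definition times_endo :: "'a endo \<Rightarrow> 'a endo \<Rightarrow> 'a endo" is "\<lambda>X Y f. X (Y f)"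
  by (rule linear_cscaleI) (metis linear_cscaleD)+
lift_definition scaleC_endo :: "complex \<Rightarrow> 'a endo \<Rightarrow> 'a endo" is "\<lambda>c X f. cscale c (X f)"
  by (rule linear_cscaleI) (metis linear_cscaleD cscale_simps(1,5) mult.commute)+

instance
proof
  show "(0::'a endo) \<noteq> 1"
    by (transfer fixing:) (simp add: fun_eq_iff exI[of _ "\<lambda>_. 1"])
qed (transfer; auto simp: linear_cscaleD cscale_simps algebra_simps fun_eq_iff)+

end

lemma ap_simps [simp]:
  "ap 0 f = 0" "ap 1 f = f" "ap (X + Y) f = ap X f + ap Y f" "ap (X - Y) f = ap X f - ap Y f"
  "ap (- X) f = - ap X f" "ap (X * Y) f = ap X (ap Y f)" "ap (c *\<^sub>C X) f = cscale c (ap X f)"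
  by (transfer; simp)+

lemma ap_sum_left: "ap (sum X I) f = (\<Sum>i\<in>I. ap (X i) f)"
  by (induction I rule: infinite_finite_induct) auto

lemma endo_eqI: "(\<And>f x. ap X f x = ap Y f x) \<Longrightarrow> X = Y"
  by transfer (auto simp: fun_eq_iff)

section \<open>Products of R-matrices along lists of labels\<close>

text \<open>Three models occur: transpositions in the group algebra, swaps of tensor factors, and
  group algebra transpositions with every label shifted past the inner diagram.\<close>

locale transpositions =
  fixes P :: "nat \<Rightarrow> nat \<Rightarrow> 'r::calg"
  assumes P_sym: "P a b = P b a"
    and P_sq: "a \<noteq> b \<Longrightarrow> P a b * P a b = 1"
    and P_conj: "a \<noteq> b \<Longrightarrow> a \<noteq> c \<Longrightarrow> b \<noteq> c \<Longrightarrow> P a b * P a c = P b c * P a b"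
    and P_comm: "a \<noteq> c \<Longrightarrow> a \<noteq> d \<Longrightarrow> b \<noteq> c \<Longrightarrow> b \<noteq> d \<Longrightarrow> P a b * P c d = P c d * P a b"
begin

definition R :: "(nat \<Rightarrow> complex) \<Rightarrow> nat \<Rightarrow> nat \<Rightarrow> 'r" where
  "R x a b = 1 - (1 / (x a - x b)) *\<^sub>C P a b"

text \<open>Both sides expand over the permutations of three labels; \<open>u\<close> and
  \<open>v\<close> are the two 3-cycles. Their coefficients agree on both sides by the partial
  fraction identity \<open>rel\<close>.\<close>

lemma yang_baxter:
  assumes "distinct [a, b, c]" and "x a \<noteq> x b" "x a \<noteq> x c" "x b \<noteq> x c"
  shows "R x a b * R x a c * R x b c = R x b c * R x a c * R x a b"
proof -
  define u where "u = P a b * P a c"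
  define v where "v = P a c * P a b"
  have ne: "a \<noteq> b" "a \<noteq> c" "b \<noteq> c" using assms by auto
  have u: "P a c * P b c = u" "P b c * P a b = u"
    using P_conj[of a b c] P_conj[of c a b] ne by (auto simp: u_def P_sym)
  have v: "P b c * P a c = v" "P a b * P b c = v"
    using P_conj[of a c b] P_conj[of b a c] ne by (auto simp: v_def P_sym)
  have w: "P a b * u = P a c" "P b c * v = P a c"
    using u v P_sq ne by (simp_all add: u_def flip: v mult.assoc)
  have w': "u * P b c = P a c"
    using P_sq[OF ne(3)] by (simp add: u(1)[symmetric] mult.assoc)
  have w'': "v * P a b = P a c"
    using P_sq[OF ne(1)] by (simp add: v_def mult.assoc)
  define \<alpha> \<beta> \<gamma> where "\<alpha> = 1 / (x a - x b)" and "\<beta> = 1 / (x a - x c)" and "\<gamma> = 1 / (x b - x c)"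
  have rel: "\<alpha> * \<gamma> = \<alpha> * \<beta> + \<beta> * \<gamma>"
    using assms(2-4) by (simp add: \<alpha>_def \<beta>_def \<gamma>_def divide_simps)
  have "R x a b * R x a c * R x b c = 1 - \<alpha> *\<^sub>C P a b - \<beta> *\<^sub>C P a c - \<gamma> *\<^sub>C P b c
     + (\<alpha> * \<beta> + \<beta> * \<gamma>) *\<^sub>C u + (\<alpha> * \<gamma>) *\<^sub>C v - (\<alpha> * \<beta> * \<gamma>) *\<^sub>C P a c"
    by (simp add: R_def \<alpha>_def[symmetric] \<beta>_def[symmetric] \<gamma>_def[symmetric] algebra_simps cs_add_left
        cs_diff_right cs_add_right u v w w' u_def[symmetric] mult.assoc)
  moreover have "R x b c * R x a c * R x a b = 1 - \<alpha> *\<^sub>C P a b - \<beta> *\<^sub>C P a c - \<gamma> *\<^sub>C P b c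
     + (\<alpha> * \<gamma>) *\<^sub>C u + (\<alpha> * \<beta> + \<beta> * \<gamma>) *\<^sub>C v - (\<alpha> * \<beta> * \<gamma>) *\<^sub>C P a c"
    by (simp add: R_def \<alpha>_def[symmetric] \<beta>_def[symmetric] \<gamma>_def[symmetric] algebra_simps cs_add_left
        cs_diff_right cs_add_right u v w w'' v_def[symmetric] mult.assoc)
  ultimately show ?thesis by (simp add: rel)
qed

text \<open>The scalar vanishes exactly when the parameters differ by 1 or -1: there
  \<open>R\<close> is a multiple of a projector and an exchange of labels is no longer
  reversible.\<close>

lemma R_unitary:
  assumes "a \<noteq> b" "x a \<noteq> x b"
  shows "R x a b * R x b a = (1 - 1 / (x a - x b)\<^sup>2) *\<^sub>C 1"
proof -
  have "1 / (x b - x a) = - (1 / (x a - x b))"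
    by (metis minus_diff_eq minus_divide_right)
  then have "R x a b * R x b a = (1 - (1 / (x a - x b)) *\<^sub>C P a b) * (1 + (1 / (x a - x b)) *\<^sub>C P a b)"
    by (simp add: R_def P_sym[of b a])
  then show ?thesis
    by (simp add: left_diff_distrib distrib_left P_sq[OF assms(1)]
        cs_diff_left cs_diff_right power2_eq_square)
qed

lemma R_commute:
  assumes "a \<noteq> c" "a \<noteq> d" "b \<noteq> c" "b \<noteq> d"
  shows "R x a b * R x c d = R x c d * R x a b"
  using P_comm[OF assms] by (simp add: R_def left_diff_distrib right_diff_distrib cs_diff_right mult.commute)

definition rowR :: "(nat \<Rightarrow> complex) \<Rightarrow> nat \<Rightarrow> nat list \<Rightarrow> 'r" where
  "rowR x a bs = (\<Prod>b\<leftarrow>bs. R x a b)"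

definition colR :: "(nat \<Rightarrow> complex) \<Rightarrow> nat list \<Rightarrow> nat \<Rightarrow> 'r" where
  "colR x as p = (\<Prod>a\<leftarrow>as. R x a p)"

text \<open>The factors follow the order of the list, while each label keeps its own parameter. Thus
  \<open>[1..<Suc n]\<close> gives the product \<open>B\<close>, and other lists give the product
  for relabelled boxes.\<close>

fun Bl :: "(nat \<Rightarrow> complex) \<Rightarrow> nat list \<Rightarrow> 'r" where
  "Bl x [] = 1"
| "Bl x (a # as) = rowR x a as * Bl x as"

lemma rowR_simps [simp]:
  "rowR x a [] = 1" "rowR x a (b # bs) = R x a b * rowR x a bs"
  "rowR x a (bs @ cs) = rowR x a bs * rowR x a cs"
  by (simp_all add: rowR_def)

lemma colR_simps [simp]:
  "colR x [] p = 1" "colR x (a # as) p = R x a p * colR x as p"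
  "colR x (as @ bs) p = colR x as p * colR x bs p"
  by (simp_all add: colR_def)

lemma mult_cong_right: "(a::'r) = b \<Longrightarrow> a * c = b * c"
  by simp

lemma comm_mult: "(a::'r) * b = b * a \<Longrightarrow> a * c = c * a \<Longrightarrow> a * (b * c) = (b * c) * a"
  by (metis mult.assoc)

lemma rowR_commute:
  assumes "\<forall>b\<in>set bs. Z * R x a b = R x a b * Z"
  shows "Z * rowR x a bs = rowR x a bs * Z"
  using assms by (induction bs) (auto intro: comm_mult)

lemma colR_commute:
  assumes "\<forall>b\<in>set bs. Z * R x b p = R x b p * Z"
  shows "Z * colR x bs p = colR x bs p * Z"
  using assms by (induction bs) (auto intro: comm_mult)

lemma Bl_commute:
  assumes "\<forall>a\<in>set as. \<forall>b\<in>set as. a \<noteq> b \<longrightarrow> Z * R x a b = R x a b * Z" "distinct as"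
  shows "Z * Bl x as = Bl x as * Z"
  using assms by (induction as) (auto intro!: comm_mult rowR_commute)

text \<open>Each label \<open>c\<close> of \<open>ys\<close> costs one Yang-Baxter equation; between
  the equations, factors without a common label are commuted into place.\<close>

lemma rowR_swap:
  assumes "distinct (a # b # ys)" "inj_on x (set (a # b # ys))"
  shows "R x a b * (rowR x a ys * rowR x b ys) = rowR x b ys * rowR x a ys * R x a b"
  using assms
proof (induction ys)
  case (Cons c ys)
  have ne: "x a \<noteq> x b" "x a \<noteq> x c" "x b \<noteq> x c"
    using Cons.prems by (auto simp: inj_on_insert)
  have c1: "rowR x a ys * R x b c = R x b c * rowR x a ys"
    using Cons.prems(1) by (intro rowR_commute[symmetric] ballI R_commute) auto
  have c2: "rowR x b ys * R x a c = R x a c * rowR x b ys"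
    using Cons.prems(1) by (intro rowR_commute[symmetric] ballI R_commute) auto
  have IH: "R x a b * (rowR x a ys * rowR x b ys) = rowR x b ys * rowR x a ys * R x a b"
    using Cons.prems by (intro Cons.IH) (auto simp: inj_on_insert)
  have "R x a b * (rowR x a (c # ys) * rowR x b (c # ys))
      = R x a b * R x a c * (rowR x a ys * R x b c) * rowR x b ys"
    by (simp add: mult.assoc)
  also have "\<dots> = (R x a b * R x a c * R x b c) * (rowR x a ys * rowR x b ys)"
    by (simp add: c1 mult.assoc)
  also have "\<dots> = R x b c * R x a c * (R x a b * (rowR x a ys * rowR x b ys))"
    using Cons.prems(1) ne by (subst yang_baxter) (auto simp: mult.assoc)
  also have "\<dots> = R x b c * (R x a c * rowR x b ys) * rowR x a ys * R x a b"
    by (simp add: IH mult.assoc)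
  also have "\<dots> = rowR x b (c # ys) * rowR x a (c # ys) * R x a b"
    by (simp add: c2[symmetric] mult.assoc)
  finally show ?case .
qed simp

text \<open>Passing to the right of the remaining product, the row of \<open>a\<close> crosses each
  later row by \<open>rowR_swap\<close> and comes out reversed.\<close>

lemma rowR_Bl:
  assumes "distinct (a # as)" "inj_on x (set (a # as))"
  shows "rowR x a as * Bl x as = Bl x as * rowR x a (rev as)"
  using assms
proof (induction as)
  case (Cons b bs)
  have c: "R x a b * Bl x bs = Bl x bs * R x a b"
    using Cons.prems(1) by (intro Bl_commute ballI R_commute impI) auto
  have IH: "rowR x a bs * Bl x bs = Bl x bs * rowR x a (rev bs)"
    using Cons.prems by (intro Cons.IH) (auto simp: inj_on_insert)
  have "rowR x a (b # bs) * Bl x (b # bs) = R x a b * (rowR x a bs * rowR x b bs) * Bl x bs"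
    by (simp add: mult.assoc)
  also have "\<dots> = rowR x b bs * rowR x a bs * (R x a b * Bl x bs)"
    using rowR_swap[OF Cons.prems] by (simp add: mult.assoc)
  also have "\<dots> = rowR x b bs * (rowR x a bs * Bl x bs) * R x a b"
    by (simp add: c mult.assoc)
  also have "\<dots> = Bl x (b # bs) * rowR x a (rev (b # bs))"
    by (simp add: IH mult.assoc)
  finally show ?case .
qed simp

text \<open>The factors of \<open>Bl\<close> in the opposite order. That both orders give the same
  product makes the coefficients of the product invariant under inversion of permutations.\<close>

fun Blr :: "(nat \<Rightarrow> complex) \<Rightarrow> nat list \<Rightarrow> 'r" where
  "Blr x [] = 1"
| "Blr x (a # as) = Blr x as * rowR x a (rev as)"

lemma Bl_eq_Blr: "distinct as \<Longrightarrow> inj_on x (set as) \<Longrightarrow> Bl x as = Blr x as"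
proof (induction as)
  case (Cons a as)
  then show ?case using rowR_Bl[of a as x] by (simp add: inj_on_insert)
qed simp

definition CR :: "(nat \<Rightarrow> complex) \<Rightarrow> nat list \<Rightarrow> nat list \<Rightarrow> 'r" where
  "CR x as ps = (\<Prod>p\<leftarrow>ps. colR x as p)"

lemma CR_simps [simp]:
  "CR x as [] = 1" "CR x as (p # ps) = colR x as p * CR x as ps" "CR x [] ps = 1"
  by (induction ps) (simp_all add: CR_def)

text \<open>Two factors of the rectangle with different labels on both sides commute, so it can be
  read by columns, as defined, or by rows.\<close>

lemma CR_Cons_left:
  assumes "distinct (a # as @ ps)"
  shows "CR x (a # as) ps = rowR x a ps * CR x as ps"
  using assms
proof (induction ps)
  case (Cons p ps)
  have c: "colR x as p * rowR x a ps = rowR x a ps * colR x as p"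
    using Cons.prems by (intro rowR_commute ballI colR_commute[symmetric] R_commute) auto
  then show ?case
    using Cons by (simp add: mult.assoc) (metis c mult.assoc)
qed simp

lemma Bl_append:
  assumes "distinct (as @ ps)"
  shows "Bl x (as @ ps) = Bl x as * CR x as ps * Bl x ps"
  using assms
proof (induction as)
  case (Cons a as)
  have "Bl x as * rowR x a ps = rowR x a ps * Bl x as"
    using Cons.prems by (intro rowR_commute ballI Bl_commute[symmetric] R_commute impI) auto
  with Cons show ?case
    by (simp add: CR_Cons_left mult.assoc) (metis mult.assoc)
qed simp

text \<open>On the right of the product, \<open>R x b a\<close> crosses the rows of \<open>a\<close>
  and \<open>b\<close> and exchanges them; the remaining \<open>R x a b\<close> travels to the left
  through all preceding rows by the Yang-Baxter equation.\<close>

lemma Bl_swap: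
  assumes "distinct (xs @ [a, b] @ ys)" "inj_on x (set (xs @ [a, b] @ ys))"
  shows "Bl x (xs @ [a, b] @ ys) * R x b a = R x a b * Bl x (xs @ [b, a] @ ys)"
  using assms
proof (induction xs)
  case Nil
  have c: "Bl x ys * R x b a = R x b a * Bl x ys"
    using Nil.prems(1) by (intro Bl_commute[symmetric] ballI R_commute impI) auto
  have s: "R x b a * (rowR x b ys * rowR x a ys) = rowR x a ys * rowR x b ys * R x b a"
    using Nil.prems by (intro rowR_swap) (auto simp: inj_on_insert insert_commute)
  have "Bl x (a # b # ys) * R x b a = R x a b * (rowR x a ys * rowR x b ys * R x b a) * Bl x ys"
    by (simp add: mult.assoc c)
  then show ?case by (simp only: s[symmetric]) (simp add: mult.assoc)
next
  case (Cons z xs)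
  let ?B = "Bl x (xs @ [a, b] @ ys)" and ?B' = "Bl x (xs @ [b, a] @ ys)"
  have IH: "?B * R x b a = R x a b * ?B'"
    using Cons.prems by (intro Cons.IH) (auto simp: inj_on_insert)
  have c: "R x a b * rowR x z ys = rowR x z ys * R x a b" "R x a b * rowR x z xs = rowR x z xs * R x a b"
    using Cons.prems by (auto intro!: rowR_commute R_commute)
  have ne: "x z \<noteq> x a" "x z \<noteq> x b" "x a \<noteq> x b"
    using Cons.prems by (auto simp: inj_on_insert)
  have yb: "R x z a * R x z b * R x a b = R x a b * R x z b * R x z a"
    using Cons.prems(1) ne by (intro yang_baxter) auto
  have "Bl x ((z # xs) @ [a, b] @ ys) * R x b a
      = rowR x z xs * (R x z a * R x z b) * rowR x z ys * (?B * R x b a)"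
    by (simp add: mult.assoc)
  also have "\<dots> = rowR x z xs * (R x z a * R x z b) * (rowR x z ys * R x a b) * ?B'"
    by (simp only: IH mult.assoc)
  also have "\<dots> = rowR x z xs * (R x z a * R x z b * R x a b) * rowR x z ys * ?B'"
    by (simp only: c(1)[symmetric] mult.assoc)
  also have "\<dots> = (rowR x z xs * R x a b) * R x z b * R x z a * rowR x z ys * ?B'"
    by (simp only: yb) (simp only: mult.assoc)
  also have "\<dots> = R x a b * Bl x ((z # xs) @ [b, a] @ ys)"
    by (simp add: c(2)[symmetric] mult.assoc)
  finally show ?case .
qed

text \<open>The factor of two neighbours can be brought to either end. On a line it is 1 plus or
  minus a transposition, and this decides how the transposition acts on the whole product.\<close>

lemma Bl_adjacent:
  assumes "distinct (xs @ [a, b] @ ys)" "inj_on x (set (xs @ [a, b] @ ys))"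
  shows "\<exists>Z. Bl x (xs @ [a, b] @ ys) = Z * R x a b"
    and "\<exists>Z. Bl x (xs @ [a, b] @ ys) = R x a b * Z"
proof -
  show "\<exists>Z. Bl x (xs @ [a, b] @ ys) = Z * R x a b"
    using assms
  proof (induction xs)
    case Nil
    have c: "R x a b * Bl x ys = Bl x ys * R x a b"
      using Nil.prems(1) by (intro Bl_commute ballI R_commute impI) auto
    have "Bl x (a # b # ys) = rowR x b ys * rowR x a ys * (R x a b * Bl x ys)"
      using rowR_swap[of a b ys x, THEN mult_cong_right, of "Bl x ys"] Nil.prems by (simp add: mult.assoc)
    then show ?case by (metis c append_Cons append_Nil mult.assoc)
  next
    case (Cons z xs)
    then obtain Z where "Bl x (xs @ [a, b] @ ys) = Z * R x a b"
      by (force simp: inj_on_insert)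
    then show ?case by (auto simp flip: mult.assoc)
  qed
  show "\<exists>Z. Bl x (xs @ [a, b] @ ys) = R x a b * Z"
    using assms
  proof (induction xs)
    case Nil
    show ?case by (auto simp: mult.assoc)
  next
    case (Cons z xs)
    then obtain Z where Z: "Bl x (xs @ [a, b] @ ys) = R x a b * Z"
      by (force simp: inj_on_insert)
    have c: "R x a b * rowR x z ys = rowR x z ys * R x a b" "R x a b * rowR x z xs = rowR x z xs * R x a b"
      using Cons.prems by (auto intro!: rowR_commute R_commute)
    have ne: "x z \<noteq> x a" "x z \<noteq> x b" "x a \<noteq> x b"
      using Cons.prems by (auto simp: inj_on_insert)
    have yb: "R x z a * R x z b * R x a b = R x a b * R x z b * R x z a"
      using Cons.prems(1) ne by (intro yang_baxter) auto
    have "Bl x ((z # xs) @ [a, b] @ ys) = rowR x z xs * (R x z a * R x z b) * (rowR x z ys * R x a b) * Z"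
      using Z by (simp add: mult.assoc)
    also have "\<dots> = rowR x z xs * (R x z a * R x z b * R x a b) * rowR x z ys * Z"
      by (simp only: c(1)[symmetric] mult.assoc)
    also have "\<dots> = (rowR x z xs * R x a b) * R x z b * R x z a * rowR x z ys * Z"
      by (simp only: yb) (simp only: mult.assoc)
    also have "\<dots> = R x a b * (rowR x z xs * R x z b * R x z a * rowR x z ys * Z)"
      by (simp only: c(2)[symmetric] mult.assoc)
    finally show ?case by blast
  qed
qed

end

text \<open>Relations of the Brauer algebra. The sign \<open>\<delta>\<close> will be the effect of
  the flip on the invariant tensor w: 1 for a symmetric form and -1 for an alternating one. In
  \<open>Q_Q\<close>, two contractions sharing a label straighten to a swap and a
  contraction.\<close>

locale brauer = transpositions P for P :: "nat \<Rightarrow> nat \<Rightarrow> 'r::calg" +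
  fixes Q :: "nat \<Rightarrow> nat \<Rightarrow> 'r" and \<delta> :: complex
  assumes Q_sym: "Q a b = Q b a"
    and P_Q: "a \<noteq> b \<Longrightarrow> P a b * Q a b = \<delta> *\<^sub>C Q a b"
    and Q_P: "a \<noteq> b \<Longrightarrow> Q a b * P a b = \<delta> *\<^sub>C Q a b"
    and P_Q_conj: "a \<noteq> b \<Longrightarrow> a \<noteq> c \<Longrightarrow> b \<noteq> c \<Longrightarrow> P a b * Q a c = Q b c * P a b"
    and P_Q_comm: "a \<noteq> c \<Longrightarrow> a \<noteq> d \<Longrightarrow> b \<noteq> c \<Longrightarrow> b \<noteq> d \<Longrightarrow> P a b * Q c d = Q c d * P a b"
    and Q_Q_comm: "a \<noteq> c \<Longrightarrow> a \<noteq> d \<Longrightarrow> b \<noteq> c \<Longrightarrow> b \<noteq> d \<Longrightarrow> Q a b * Q c d = Q c d * Q a b"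
    and Q_Q: "a \<noteq> b \<Longrightarrow> a \<noteq> c \<Longrightarrow> b \<noteq> c \<Longrightarrow> Q a c * Q b c = P a b * Q b c"
begin

definition S :: "(nat \<Rightarrow> complex) \<Rightarrow> nat \<Rightarrow> nat \<Rightarrow> 'r" where
  "S x a b = 1 - (1 / (x a + x b)) *\<^sub>C Q a b"

lemma S_sym: "S x a b = S x b a"
  by (simp add: S_def Q_sym[of a b] add.commute)

text \<open>Products of two contractions reduce to a contraction times \<open>p\<close>, so both
  sides lie in the span of 1, \<open>p\<close>, \<open>A\<close>, \<open>B\<close>,
  \<open>A * p\<close> and \<open>B * p\<close>. The identity \<open>rel\<close> is the one behind
  the Yang-Baxter equation with \<open>x c\<close> replaced by \<open>- x c\<close>.\<close>

lemma reflection: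
  assumes "distinct [a, b, c]" and "x a \<noteq> x b" "x a + x c \<noteq> 0" "x b + x c \<noteq> 0"
  shows "S x a c * S x b c * R x a b = R x a b * S x b c * S x a c"
proof -
  have ne: "a \<noteq> b" "a \<noteq> c" "b \<noteq> c" using assms by auto
  define p A B where "p = P a b" and "A = Q a c" and "B = Q b c"
  have r: "p * A = B * p" "p * B = A * p" "A * B = A * p" "B * A = B * p" "p * p = 1"
    using P_Q_conj[of a b c] P_Q_conj[of b a c] Q_Q[of a b c] Q_Q[of b a c] P_sq[of a b] ne
    by (auto simp: p_def A_def B_def P_sym)
  have r': "A * (B * p) = A" "p * (B * A) = A" "A * (p * p) = A"
    using r by (simp_all add: mult.assoc) (metis mult.assoc mult_1_left mult.right_neutral r)+
  define \<alpha> \<beta> \<gamma> where "\<alpha> = 1 / (x a - x b)" and "\<beta> = 1 / (x a + x c)" and "\<gamma> = 1 / (x b + x c)"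
  have rel: "\<alpha> * \<gamma> = \<alpha> * \<beta> + \<beta> * \<gamma>"
    using assms(2-4) by (simp add: \<alpha>_def \<beta>_def \<gamma>_def divide_simps)
  have "S x a c * S x b c * R x a b = 1 - \<alpha> *\<^sub>C p - \<beta> *\<^sub>C A - \<gamma> *\<^sub>C B
     + (\<alpha> * \<beta> + \<beta> * \<gamma>) *\<^sub>C (A * p) + (\<alpha> * \<gamma>) *\<^sub>C (B * p) - (\<alpha> * \<beta> * \<gamma>) *\<^sub>C A"
    by (simp add: R_def S_def \<alpha>_def[symmetric] \<beta>_def[symmetric] \<gamma>_def[symmetric] algebra_simps
        cs_add_left cs_diff_right cs_add_right mult.assoc r r' flip: p_def A_def B_def)
  moreover have "R x a b * S x b c * S x a c = 1 - \<alpha> *\<^sub>C p - \<beta> *\<^sub>C A - \<gamma> *\<^sub>C B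
     + (\<alpha> * \<gamma>) *\<^sub>C (A * p) + (\<alpha> * \<beta> + \<beta> * \<gamma>) *\<^sub>C (B * p) - (\<alpha> * \<beta> * \<gamma>) *\<^sub>C A"
    by (simp add: R_def S_def \<alpha>_def[symmetric] \<beta>_def[symmetric] \<gamma>_def[symmetric] algebra_simps
        cs_add_left cs_diff_right cs_add_right mult.assoc r r' flip: p_def A_def B_def)
  ultimately show ?thesis by (simp add: rel)
qed

lemma S_R_same: "a \<noteq> b \<Longrightarrow> S x a b * R x a b = R x a b * S x a b"
  using P_Q[of a b] Q_P[of a b]
  by (simp add: R_def S_def left_diff_distrib right_diff_distrib cs_diff_right mult.commute)

lemma S_R_commute:
  assumes "a \<noteq> c" "a \<noteq> d" "b \<noteq> c" "b \<noteq> d"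
  shows "R x a b * S x c d = S x c d * R x a b"
  using P_Q_comm[OF assms] by (simp add: R_def S_def left_diff_distrib right_diff_distrib cs_diff_right mult.commute)

lemma S_commute:
  assumes "a \<noteq> c" "a \<noteq> d" "b \<noteq> c" "b \<noteq> d"
  shows "S x a b * S x c d = S x c d * S x a b"
  using Q_Q_comm[OF assms] by (simp add: S_def left_diff_distrib right_diff_distrib cs_diff_right mult.commute)

definition rowS :: "(nat \<Rightarrow> complex) \<Rightarrow> nat \<Rightarrow> nat list \<Rightarrow> 'r" where
  "rowS x a bs = (\<Prod>b\<leftarrow>bs. S x a b)"

definition colS :: "(nat \<Rightarrow> complex) \<Rightarrow> nat list \<Rightarrow> nat \<Rightarrow> 'r" where
  "colS x as p = (\<Prod>a\<leftarrow>as. S x a p)"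

fun Al :: "(nat \<Rightarrow> complex) \<Rightarrow> nat list \<Rightarrow> 'r" where
  "Al x [] = 1"
| "Al x (a # as) = rowS x a as * Al x as"

lemma rowS_simps [simp]:
  "rowS x a [] = 1" "rowS x a (b # bs) = S x a b * rowS x a bs"
  "rowS x a (bs @ cs) = rowS x a bs * rowS x a cs"
  by (simp_all add: rowS_def)

lemma colS_simps [simp]:
  "colS x [] p = 1" "colS x (a # as) p = S x a p * colS x as p"
  by (simp_all add: colS_def)

lemma rowS_commute:
  assumes "\<forall>b\<in>set bs. Z * S x a b = S x a b * Z"
  shows "Z * rowS x a bs = rowS x a bs * Z"
  using assms by (induction bs) (auto intro: comm_mult)

lemma colS_commute:
  assumes "\<forall>b\<in>set bs. Z * S x b p = S x b p * Z"
  shows "Z * colS x bs p = colS x bs p * Z"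
  using assms by (induction bs) (auto intro: comm_mult)

lemma Al_commute:
  assumes "\<forall>a\<in>set as. \<forall>b\<in>set as. a \<noteq> b \<longrightarrow> Z * S x a b = S x a b * Z" "distinct as"
  shows "Z * Al x as = Al x as * Z"
  using assms by (induction as) (auto intro!: comm_mult rowS_commute)

definition CS :: "(nat \<Rightarrow> complex) \<Rightarrow> nat list \<Rightarrow> nat list \<Rightarrow> 'r" where
  "CS x as ps = (\<Prod>p\<leftarrow>ps. colS x as p)"

lemma CS_simps [simp]:
  "CS x as [] = 1" "CS x as (p # ps) = colS x as p * CS x as ps" "CS x [] ps = 1"
  by (induction ps) (simp_all add: CS_def)

lemma CS_Cons_left:
  assumes "distinct (a # as @ ps)"
  shows "CS x (a # as) ps = rowS x a ps * CS x as ps"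
  using assms
proof (induction ps)
  case (Cons p ps)
  have c: "colS x as p * rowS x a ps = rowS x a ps * colS x as p"
    using Cons.prems by (intro rowS_commute ballI colS_commute[symmetric] S_commute) auto
  then show ?case
    using Cons by (simp add: mult.assoc) (metis c mult.assoc)
qed simp

lemma Al_append:
  assumes "distinct (as @ ps)"
  shows "Al x (as @ ps) = Al x as * CS x as ps * Al x ps"
  using assms
proof (induction as)
  case (Cons a as)
  have "Al x as * rowS x a ps = rowS x a ps * Al x as"
    using Cons.prems by (intro rowS_commute ballI Al_commute[symmetric] S_commute impI) auto
  with Cons show ?case
    by (simp add: CS_Cons_left mult.assoc) (metis mult.assoc)
qed simp

definition nonopposite :: "(nat \<Rightarrow> complex) \<Rightarrow> nat set \<Rightarrow> bool" where
  "nonopposite x U \<longleftrightarrow> (\<forall>a\<in>U. \<forall>b\<in>U. a \<noteq> b \<longrightarrow> x a + x b \<noteq> 0)"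

lemma rowS_swap:
  assumes "distinct (a # b # ys)" "x a \<noteq> x b" "nonopposite x (set (a # b # ys))"
  shows "rowS x a ys * rowS x b ys * R x a b = R x a b * (rowS x b ys * rowS x a ys)"
  using assms
proof (induction ys)
  case (Cons c ys)
  have ne: "x a + x c \<noteq> 0" "x b + x c \<noteq> 0"
    using Cons.prems by (auto simp: nonopposite_def)
  have c1: "rowS x a ys * S x b c = S x b c * rowS x a ys"
    using Cons.prems(1) by (intro rowS_commute[symmetric] ballI S_commute) auto
  have c2: "rowS x b ys * S x a c = S x a c * rowS x b ys"
    using Cons.prems(1) by (intro rowS_commute[symmetric] ballI S_commute) auto
  have IH: "rowS x a ys * rowS x b ys * R x a b = R x a b * (rowS x b ys * rowS x a ys)"
    using Cons.prems by (intro Cons.IH) (auto simp: nonopposite_def)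
  have "rowS x a (c # ys) * rowS x b (c # ys) * R x a b
      = S x a c * (rowS x a ys * S x b c) * rowS x b ys * R x a b"
    by (simp add: mult.assoc)
  also have "\<dots> = S x a c * S x b c * (rowS x a ys * rowS x b ys * R x a b)"
    by (simp only: c1) (simp only: mult.assoc)
  also have "\<dots> = (S x a c * S x b c * R x a b) * (rowS x b ys * rowS x a ys)"
    by (simp only: IH) (simp only: mult.assoc)
  also have "\<dots> = R x a b * S x b c * (S x a c * rowS x b ys) * rowS x a ys"
    using Cons.prems ne by (subst reflection) (auto simp: mult.assoc)
  also have "\<dots> = R x a b * (rowS x b (c # ys) * rowS x a (c # ys))"
    by (simp only: c2[symmetric]) (simp add: mult.assoc)
  finally show ?case .
qed simp

lemma Al_swap:
  assumes "distinct (xs @ [a, b] @ ys)" "x a \<noteq> x b" "nonopposite x (set (xs @ [a, b] @ ys))"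
  shows "Al x (xs @ [a, b] @ ys) * R x a b = R x a b * Al x (xs @ [b, a] @ ys)"
  using assms
proof (induction xs)
  case Nil
  have c: "Al x ys * R x a b = R x a b * Al x ys"
    using Nil.prems(1) by (intro Al_commute[symmetric] ballI S_R_commute impI) auto
  have s: "rowS x a ys * rowS x b ys * R x a b = R x a b * (rowS x b ys * rowS x a ys)"
    using Nil.prems by (intro rowS_swap) (auto simp: nonopposite_def)
  have "Al x (a # b # ys) * R x a b = S x a b * (rowS x a ys * rowS x b ys * R x a b) * Al x ys"
    by (simp add: mult.assoc c)
  also have "\<dots> = (S x a b * R x a b) * (rowS x b ys * rowS x a ys * Al x ys)"
    by (simp only: s) (simp only: mult.assoc)
  also have "\<dots> = R x a b * (S x b a * (rowS x b ys * rowS x a ys * Al x ys))"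
    using Nil.prems by (subst S_R_same) (auto simp: mult.assoc S_sym)
  finally show ?case by (simp add: mult.assoc)
next
  case (Cons z xs)
  let ?B = "Al x (xs @ [a, b] @ ys)" and ?B' = "Al x (xs @ [b, a] @ ys)"
  have IH: "?B * R x a b = R x a b * ?B'"
    using Cons.prems by (intro Cons.IH) (auto simp: nonopposite_def)
  have c: "R x a b * rowS x z ys = rowS x z ys * R x a b" "R x a b * rowS x z xs = rowS x z xs * R x a b"
    using Cons.prems by (auto intro!: rowS_commute S_R_commute)
  have yb: "S x z a * S x z b * R x a b = R x a b * S x z b * S x z a"
    using reflection[of a b z x] Cons.prems by (auto simp: nonopposite_def S_sym)
  have "Al x ((z # xs) @ [a, b] @ ys) * R x a b
      = rowS x z xs * (S x z a * S x z b) * rowS x z ys * (?B * R x a b)"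
    by (simp add: mult.assoc)
  also have "\<dots> = rowS x z xs * (S x z a * S x z b) * (rowS x z ys * R x a b) * ?B'"
    by (simp only: IH mult.assoc)
  also have "\<dots> = rowS x z xs * (S x z a * S x z b * R x a b) * rowS x z ys * ?B'"
    by (simp only: c(1)[symmetric] mult.assoc)
  also have "\<dots> = (rowS x z xs * R x a b) * S x z b * S x z a * rowS x z ys * ?B'"
    by (simp only: yb) (simp only: mult.assoc)
  also have "\<dots> = R x a b * Al x ((z # xs) @ [b, a] @ ys)"
    by (simp add: c(2)[symmetric] mult.assoc)
  finally show ?case .
qed

lemma Al_move:
  assumes "distinct (xs @ a # bs @ ys)" "inj_on x (set (a # bs))" "nonopposite x (set (xs @ a # bs @ ys))"
  shows "Al x (xs @ a # bs @ ys) * rowR x a bs = rowR x a bs * Al x (xs @ bs @ a # ys)"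
  using assms
proof (induction bs arbitrary: xs)
  case (Cons b bs)
  have 1: "Al x (xs @ [a, b] @ bs @ ys) * R x a b = R x a b * Al x (xs @ [b, a] @ bs @ ys)"
    using Cons.prems by (intro Al_swap) (auto simp: inj_on_insert)
  have "insert b (set xs \<union> insert a (set bs \<union> set ys)) = set xs \<union> insert a (insert b (set bs \<union> set ys))"
    by auto
  then have 2: "Al x ((xs @ [b]) @ a # bs @ ys) * rowR x a bs = rowR x a bs * Al x ((xs @ [b]) @ bs @ a # ys)"
    using Cons.prems by (intro Cons.IH) (auto simp: inj_on_insert)
  have "Al x (xs @ a # (b # bs) @ ys) * rowR x a (b # bs) = R x a b * (Al x ((xs @ [b]) @ a # bs @ ys) * rowR x a bs)"
    using 1[THEN mult_cong_right] by (simp add: mult.assoc)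
  also have "\<dots> = rowR x a (b # bs) * Al x (xs @ (b # bs) @ a # ys)"
    by (simp only: 2) (simp add: mult.assoc)
  finally show ?case .
qed simp

text \<open>Carried to the left through \<open>A\<close>, the product of the \<open>R\<close> of a
  block stays as it is and the labels of the block inside \<open>A\<close> are reversed. For the
  full list this turns \<open>A * B\<close> into \<open>B\<close> times a reversed
  \<open>A\<close>.\<close>

lemma Al_Bl:
  assumes "distinct (xs @ as @ ys)" "inj_on x (set as)" "nonopposite x (set (xs @ as @ ys))"
  shows "Al x (xs @ as @ ys) * Bl x as = Bl x as * Al x (xs @ rev as @ ys)"
  using assms
proof (induction as arbitrary: ys)
  case (Cons a as)
  have 1: "Al x (xs @ a # as @ ys) * rowR x a as = rowR x a as * Al x (xs @ as @ a # ys)"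
    using Cons.prems by (intro Al_move) auto
  have 2: "Al x (xs @ as @ a # ys) * Bl x as = Bl x as * Al x (xs @ rev as @ a # ys)"
    using Cons.prems by (intro Cons.IH) (auto simp: inj_on_insert)
  have "Al x (xs @ (a # as) @ ys) * Bl x (a # as) = rowR x a as * (Al x (xs @ as @ a # ys) * Bl x as)"
    using 1[THEN mult_cong_right] by (simp add: mult.assoc)
  also have "\<dots> = Bl x (a # as) * Al x (xs @ rev (a # as) @ ys)"
    by (simp only: 2) (simp add: mult.assoc)
  finally show ?case .
qed simp

end

section \<open>Fusion along a line\<close>

text \<open>The step \<open>\<epsilon>\<close> will be 1 along rows and -1 along columns, the change
  of the content from box to box.\<close>

definition line :: "complex \<Rightarrow> (nat \<Rightarrow> complex) \<Rightarrow> nat list \<Rightarrow> bool" where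
  "line \<epsilon> x L \<longleftrightarrow> successively (\<lambda>a b. x b = x a + \<epsilon>) L"

lemma line_append: "line \<epsilon> x (xs @ ys) \<Longrightarrow> line \<epsilon> x xs \<and> line \<epsilon> x ys"
  by (simp add: line_def successively_append_iff)

lemma line_nth:
  assumes "line \<epsilon> x L" "i < length L"
  shows "x (L ! i) = x (hd L) + \<epsilon> * of_nat i"
  using assms(2)
proof (induction i)
  case 0
  then show ?case by (simp add: hd_conv_nth)
next
  case (Suc i)
  then have "x (L ! Suc i) = x (L ! i) + \<epsilon>"
    using assms(1) by (auto simp: line_def successively_conv_nth)
  with Suc show ?case by (simp add: algebra_simps)
qed

lemma line_last: "line \<epsilon> x L \<Longrightarrow> L \<noteq> [] \<Longrightarrow> x (last L) = x (hd L) + \<epsilon> * of_nat (length L - 1)"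
  by (simp add: line_nth last_conv_nth)

context transpositions
begin

section \<open>Fused factors between a line and a further label\<close>

definition Y :: "nat list \<Rightarrow> nat \<Rightarrow> 'r" where
  "Y L p = (\<Sum>a\<in>set L. P a p)"

text \<open>What the product of the factors \<open>R x a p\<close> over a line becomes next to the
  fused line: only the denominator of the last label survives, the others cancel.\<close>

definition T :: "(nat \<Rightarrow> complex) \<Rightarrow> nat list \<Rightarrow> nat \<Rightarrow> 'r" where
  "T x L p = 1 - (1 / (x (last L) - x p)) *\<^sub>C Y L p"

definition prodT :: "(nat \<Rightarrow> complex) \<Rightarrow> nat list \<Rightarrow> nat list \<Rightarrow> 'r" where
  "prodT x L ps = (\<Prod>p\<leftarrow>ps. T x L p)"

lemma prodT_simps [simp]: "prodT x L [] = 1" "prodT x L (p # ps) = T x L p * prodT x L ps"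
  by (simp_all add: prodT_def)

text \<open>Conjugation by a transposition inside \<open>L\<close> only permutes the
  summands.\<close>

lemma Y_commute:
  assumes "a \<in> set L" "b \<in> set L" "a \<noteq> b" "p \<notin> set L"
  shows "P a b * Y L p = Y L p * P a b"
proof -
  let ?t = "Transposition.transpose a b"
  have t: "?t permutes set L" using assms by (intro permutes_swap_id)
  have "P a b * P c p = P (?t c) p * P a b" if "c \<in> set L" for c
  proof -
    have ne: "a \<noteq> p" "b \<noteq> p" "c \<noteq> p" using that assms by auto
    consider "c = a" | "c = b" | "c \<noteq> a" "c \<noteq> b" by blast
    then show ?thesis
    proof cases
      case 1
      then show ?thesis using P_conj[of a b p] ne assms by (simp add: P_sym)
    next
      case 2
      then show ?thesis using P_conj[of b a p] ne assms by (simp add: P_sym)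
    next
      case 3
      then show ?thesis using ne assms by (simp add: P_comm)
    qed
  qed
  then have "P a b * Y L p = (\<Sum>c\<in>set L. P (?t c) p) * P a b"
    by (simp add: Y_def sum_distrib_left sum_distrib_right)
  also have "(\<Sum>c\<in>set L. P (?t c) p) = Y L p"
    unfolding Y_def using sum.permute[OF t, of "\<lambda>c. P c p"] by (simp add: o_def)
  finally show ?thesis .
qed

lemma Y_commute_Bl:
  assumes "distinct L" "p \<notin> set L"
  shows "Y L p * Bl x L = Bl x L * Y L p"
  using assms Y_commute[of _ L _ p]
  by (intro Bl_commute) (auto simp: R_def left_diff_distrib right_diff_distrib)

lemma T_commute_Bl:
  assumes "distinct L" "p \<notin> set L"
  shows "T y L p * Bl x L = Bl x L * T y L p"
  using Y_commute_Bl[OF assms] by (simp add: T_def left_diff_distrib right_diff_distrib)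

lemma Y_conj:
  assumes "p \<noteq> q" "p \<notin> set L" "q \<notin> set L"
  shows "P p q * Y L p = Y L q * P p q"
proof -
  have "P p q * P a p = P a q * P p q" if "a \<in> set L" for a
    using P_conj[of p q a] that assms by (auto simp: P_sym)
  then show ?thesis by (simp add: Y_def sum_distrib_left sum_distrib_right)
qed

end

locale fusion = transpositions P for P :: "nat \<Rightarrow> nat \<Rightarrow> 'r::calg" +
  fixes \<epsilon> :: complex
  assumes eps: "\<epsilon> * \<epsilon> = 1"
begin

lemma eps_nz: "\<epsilon> \<noteq> 0"
  using eps by auto

lemma eps_inverse: "c / \<epsilon> = c * \<epsilon>"
  using eps eps_nz by (simp add: field_simps)

lemma cs_eps [simp]: "\<epsilon> *\<^sub>C \<epsilon> *\<^sub>C X = X" "(\<epsilon> * \<epsilon>) *\<^sub>C X = X"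
  by (simp_all add: eps)

lemma line_adjacent:
  assumes "line \<epsilon> x L" "distinct L" "inj_on x (set L)" "Suc i < length L"
  shows "Bl x L * P (L ! i) (L ! Suc i) = \<epsilon> *\<^sub>C Bl x L"
    and "P (L ! i) (L ! Suc i) * Bl x L = \<epsilon> *\<^sub>C Bl x L"
proof -
  let ?a = "L ! i" and ?b = "L ! Suc i"
  have L: "L = take i L @ [?a, ?b] @ drop (Suc (Suc i)) L"
    using assms(4) by (simp add: Cons_nth_drop_Suc)
  have ne: "?a \<noteq> ?b" using assms by (simp add: nth_eq_iff_index_eq)
  have "x ?b = x ?a + \<epsilon>" using assms(1,4) by (simp add: line_def successively_conv_nth)
  then have R: "R x ?a ?b = 1 + \<epsilon> *\<^sub>C P ?a ?b"
    by (simp add: R_def eps_inverse)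
  obtain Z Z' where Z: "Bl x L = Z * R x ?a ?b" "Bl x L = R x ?a ?b * Z'"
    using Bl_adjacent[of "take i L" ?a ?b "drop (Suc (Suc i)) L" x] assms(2,3) L by metis
  have RP: "R x ?a ?b * P ?a ?b = \<epsilon> *\<^sub>C R x ?a ?b" "P ?a ?b * R x ?a ?b = \<epsilon> *\<^sub>C R x ?a ?b"
    using P_sq[OF ne] by (simp_all add: R distrib_left distrib_right cs_add_right eps add.commute)
  show "Bl x L * P ?a ?b = \<epsilon> *\<^sub>C Bl x L"
    by (simp add: Z(1) mult.assoc RP)
  show "P ?a ?b * Bl x L = \<epsilon> *\<^sub>C Bl x L"
    by (subst (1 2) Z(2)) (simp add: RP flip: mult.assoc)
qed

text \<open>The relation \<open>Rl\<close> holds between neighbours. It is transitive because the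
  transposition of \<open>a\<close> and \<open>c\<close> is \<open>P a b * P b c * P a b\<close> and
  the cube of \<open>\<epsilon>\<close> is \<open>\<epsilon>\<close>; hence it holds along the whole
  line.\<close>

lemma line_P:
  assumes L: "line \<epsilon> x L" "distinct L" "inj_on x (set L)" and ab: "a \<in> set L" "b \<in> set L" "a \<noteq> b"
  shows "Bl x L * P a b = \<epsilon> *\<^sub>C Bl x L" "P a b * Bl x L = \<epsilon> *\<^sub>C Bl x L"
proof -
  have conj: "P a c = P a b * P b c * P a b" if "a \<noteq> b" "b \<noteq> c" "a \<noteq> c" for a b c
    using P_conj[of b a c] P_sq[of a b] that by (simp add: P_sym mult.assoc)
  define Rl where "Rl a b \<longleftrightarrow> a = b \<or> Bl x L * P a b = \<epsilon> *\<^sub>C Bl x L \<and> P a b * Bl x L = \<epsilon> *\<^sub>C Bl x L" for a b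
  have "Rl a c" if "Rl a b" "Rl b c" for a b c
  proof (cases "a = b \<or> b = c \<or> a = c")
    case False
    with that have *: "Bl x L * P a b = \<epsilon> *\<^sub>C Bl x L" "P a b * Bl x L = \<epsilon> *\<^sub>C Bl x L"
      "Bl x L * P b c = \<epsilon> *\<^sub>C Bl x L" "P b c * Bl x L = \<epsilon> *\<^sub>C Bl x L"
      by (auto simp: Rl_def)
    have "Bl x L * (P a b * P b c * P a b) = \<epsilon> *\<^sub>C Bl x L"
      by (simp add: * eps flip: mult.assoc)
    moreover have "P a b * P b c * P a b * Bl x L = \<epsilon> *\<^sub>C Bl x L"
      by (simp add: * eps mult.assoc)
    ultimately show ?thesis using conj[of a b c] False by (simp add: Rl_def)
  qed (use that in \<open>auto simp: Rl_def\<close>)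
  then have "transp Rl" by (auto intro: transpI)
  moreover have "successively Rl L"
    using line_adjacent[OF L] by (auto simp: successively_conv_nth Rl_def)
  ultimately have sw: "sorted_wrt Rl L" by (simp add: successively_conv_sorted_wrt)
  obtain i j where ij: "a = L ! i" "b = L ! j" "i < length L" "j < length L"
    using ab by (auto simp: in_set_conv_nth)
  then have "i \<noteq> j" using ab by auto
  then have "Rl a b \<or> Rl b a"
    using ij sw by (auto simp: sorted_wrt_iff_nth_less) (metis linorder_neqE_nat)
  then show "Bl x L * P a b = \<epsilon> *\<^sub>C Bl x L" "P a b * Bl x L = \<epsilon> *\<^sub>C Bl x L"
    using ab by (auto simp: Rl_def P_sym)
qed

text \<open>The factor at index \<open>i\<close> acts on \<open>Z\<close> as (i + 2) / (i + 1), and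
  the product of these telescopes.\<close>

lemma absorb_rowR:
  assumes Z: "\<And>b. b \<in> set as \<Longrightarrow> Z * P a b = \<epsilon> *\<^sub>C Z"
    and x: "\<And>i. i < length as \<Longrightarrow> x (as ! i) = x a + \<epsilon> * of_nat (Suc i)"
  shows "Z * rowR x a as = of_nat (Suc (length as)) *\<^sub>C Z"
  using assms
proof (induction as rule: rev_induct)
  case (snoc b as)
  have IH: "Z * rowR x a as = of_nat (Suc (length as)) *\<^sub>C Z"
  proof (intro snoc.IH)
    fix i assume "i < length as"
    then show "x (as ! i) = x a + \<epsilon> * of_nat (Suc i)"
      using snoc.prems(2)[of i] by (simp add: nth_append)
  qed (use snoc.prems(1) in simp)
  have "x b = x a + \<epsilon> * of_nat (Suc (length as))"
    using snoc.prems(2)[of "length as"] by simp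
  then have "1 / (x a - x b) = - (\<epsilon> / of_nat (Suc (length as)))"
    using eps eps_nz by (simp add: divide_simps del: of_nat_Suc)
  then have "Z * R x a b = (1 + 1 / of_nat (Suc (length as))) *\<^sub>C Z"
    using snoc.prems(1)[of b] by (simp add: R_def right_diff_distrib distrib_left cs_add_left eps)
  then have "Z * rowR x a (as @ [b]) = (of_nat (Suc (length as)) * (1 + 1 / of_nat (Suc (length as)))) *\<^sub>C Z"
    using IH by (simp flip: mult.assoc)
  also have "of_nat (Suc (length as)) * (1 + 1 / of_nat (Suc (length as))) = (of_nat (Suc (length (as @ [b]))) :: complex)"
    by (simp add: divide_simps del: of_nat_Suc) (simp add: algebra_simps)
  finally show ?case .
qed simp

lemma line_Cons: "line \<epsilon> x (a # as) \<Longrightarrow> i < length as \<Longrightarrow> x (as ! i) = x a + \<epsilon> * of_nat (Suc i)"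
  using line_nth[of \<epsilon> x "a # as" "Suc i"] by simp

text \<open>With the fused line itself for \<open>Z\<close> this says that it is a multiple of an
  idempotent. The factorial is the order of the symmetric group of the line.\<close>

lemma absorb_Bl:
  assumes "\<And>a b. a \<in> set L \<Longrightarrow> b \<in> set L \<Longrightarrow> a \<noteq> b \<Longrightarrow> Z * P a b = \<epsilon> *\<^sub>C Z"
    and "line \<epsilon> x L" "distinct L"
  shows "Z * Bl x L = fact (length L) *\<^sub>C Z"
  using assms
proof (induction L)
  case (Cons a as)
  have "Z * rowR x a as = of_nat (Suc (length as)) *\<^sub>C Z"
    using Cons.prems by (intro absorb_rowR line_Cons) auto
  moreover have "Z * Bl x as = fact (length as) *\<^sub>C Z"
    using Cons.prems by (intro Cons.IH) (auto simp: line_def successively_Cons)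
  ultimately show ?case
    by (simp flip: mult.assoc)
qed simp

text \<open>Fusion. Next to the fused line, \<open>P b p * P a p\<close> equals
  \<open>P b a * P b p\<close> and reduces to \<open>\<epsilon>\<close> times \<open>P b p\<close>.
  So the product of the old fused factor and the new one stays linear in transpositions, and partial
  fractions merge the denominators \<open>w - \<epsilon>\<close> and \<open>w\<close> into
  \<open>w\<close>.\<close>

lemma line_colR:
  assumes "line \<epsilon> x L" "distinct (L @ [p])" "inj_on x (set (L @ [p]))" "L \<noteq> []"
  shows "Bl x L * colR x L p = Bl x L * T x L p"
  using assms(4,1-3)
proof (induction L rule: rev_nonempty_induct)
  case (single a)
  then show ?case by (simp add: T_def R_def Y_def)
next
  case (snoc a L)
  let ?H = "Bl x (L @ [a])"
  have ln: "line \<epsilon> x (L @ [a])" "line \<epsilon> x L" and di: "distinct (L @ [a])" "distinct L"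
    and inj: "inj_on x (set (L @ [a]))"
    using snoc.prems line_append[of \<epsilon> x L "[a]"] by (auto simp: inj_on_insert)
  have HP: "?H * P b c = \<epsilon> *\<^sub>C ?H" if "b \<in> set (L @ [a])" "c \<in> set (L @ [a])" "b \<noteq> c" for b c
    using line_P[OF ln(1) di(1) inj that] by simp
  have IH: "Bl x L * colR x L p = Bl x L * T x L p"
    using snoc ln(2) by (auto simp: inj_on_insert)
  have HH: "?H * Bl x L = fact (length L) *\<^sub>C ?H"
    using HP ln(2) di(2) by (intro absorb_Bl) auto
  \<comment> \<open>The induction hypothesis is about the shorter line. Multiplying it from the left
    by \<open>?H\<close> yields the factorial on both sides, which is cancelled.\<close>
  have "fact (length L) *\<^sub>C (?H * colR x L p) = fact (length L) *\<^sub>C (?H * T x L p)"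
    using arg_cong[OF IH, of "\<lambda>z. ?H * z"] HH by (simp flip: mult.assoc)
  then have 1: "?H * colR x L p = ?H * T x L p"
    by (subst (asm) cs_cancel) auto
  have x: "x a = x (last L) + \<epsilon>"
    using ln(1) snoc.hyps by (simp add: line_def successively_append_iff)
  have "x (last L) \<noteq> x p"
  proof
    assume eq: "x (last L) = x p"
    have "last L = p"
      using last_in_set[OF snoc.hyps(1)] by (intro inj_onD[OF snoc.prems(3) eq]) auto
    then show False using snoc.prems(2) last_in_set[OF snoc.hyps(1)] by auto
  qed
  then have ne: "x a - x p \<noteq> 0" "x a - x p - \<epsilon> \<noteq> 0"
    using snoc.prems x by (auto simp: inj_on_insert)
  have "?H * (P b p * P a p) = \<epsilon> *\<^sub>C (?H * P b p)" if "b \<in> set L" for b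
  proof -
    have b: "b \<noteq> p" "a \<noteq> p" "a \<noteq> b" using that snoc.prems by auto
    have "P b p * P a p = P b a * P b p"
      using P_conj[of p b a] b by (simp add: P_sym)
    then show ?thesis using HP[of b a] that b by (simp flip: mult.assoc)
  qed
  then have HY: "?H * (Y L p * P a p) = \<epsilon> *\<^sub>C (?H * Y L p)"
    by (simp add: Y_def sum_distrib_left sum_distrib_right cs_sum_right)
  define w where "w = x a - x p"
  have "?H * colR x (L @ [a]) p = ?H * T x L p * R x a p"
    by (simp add: 1 flip: mult.assoc)
  also have "\<dots> = ?H - (1 / (w - \<epsilon>)) *\<^sub>C (?H * Y L p) - (1 / w) *\<^sub>C (?H * P a p)
      + (1 / (w - \<epsilon>) * (1 / w) * \<epsilon>) *\<^sub>C (?H * Y L p)"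
    using x by (simp add: T_def R_def w_def left_diff_distrib right_diff_distrib mult.assoc HY cs_diff_right diff_diff_eq algebra_simps)
  also have "\<dots> = ?H - (1 / w) *\<^sub>C (?H * P a p) - (1 / (w - \<epsilon>) - 1 / (w - \<epsilon>) * (1 / w) * \<epsilon>) *\<^sub>C (?H * Y L p)"
    by (simp add: cs_diff_left)
  also have "1 / (w - \<epsilon>) - 1 / (w - \<epsilon>) * (1 / w) * \<epsilon> = 1 / w"
    using ne by (simp add: w_def divide_simps)
  also have "?H - (1 / w) *\<^sub>C (?H * P a p) - (1 / w) *\<^sub>C (?H * Y L p) = ?H * T x (L @ [a]) p"
    using di by (simp add: T_def w_def Y_def right_diff_distrib distrib_left cs_add_right)
  finally show ?case .
qed

lemma line_CR:
  assumes "line \<epsilon> x L" "distinct (L @ ms)" "inj_on x (set (L @ ms))" "L \<noteq> []"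
  shows "Bl x L * CR x L ms = Bl x L * prodT x L ms"
  using assms(2,3)
proof (induction ms)
  case (Cons p ms)
  have 1: "Bl x L * colR x L p = T x L p * Bl x L"
    using line_colR[OF assms(1) _ _ assms(4), of p] Cons.prems T_commute_Bl[of L p x x]
    by (auto simp: inj_on_insert inj_on_Un)
  have "Bl x L * CR x L (p # ms) = T x L p * (Bl x L * CR x L ms)"
    using 1[THEN mult_cong_right] by (simp add: mult.assoc)
  also have "\<dots> = T x L p * Bl x L * prodT x L ms"
    using Cons by (simp add: inj_on_insert inj_on_Un mult.assoc)
  also have "\<dots> = Bl x L * prodT x L (p # ms)"
    using Cons.prems T_commute_Bl[of L p x x] by (simp add: mult.assoc)
  finally show ?case .
qed simp

lemma CR_Bl:
  assumes "distinct (L @ ms)" "inj_on x (set (L @ ms))"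
  shows "CR x L ms * Bl x ms = Bl x ms * CR x L (rev ms)"
  using assms
proof (induction L)
  case (Cons a L)
  have 1: "rowR x a ms * Bl x ms = Bl x ms * rowR x a (rev ms)"
    using Cons.prems by (intro rowR_Bl) (auto simp: inj_on_insert inj_on_Un)
  have "CR x (a # L) ms * Bl x ms = rowR x a ms * (CR x L ms * Bl x ms)"
    using Cons.prems by (subst CR_Cons_left) (auto simp: mult.assoc)
  also have "\<dots> = (rowR x a ms * Bl x ms) * CR x L (rev ms)"
    using Cons by (simp add: inj_on_insert mult.assoc)
  also have "\<dots> = Bl x ms * CR x (a # L) (rev ms)"
    unfolding 1 using Cons.prems by (subst CR_Cons_left) (auto simp: mult.assoc)
  finally show ?case .
qed simp

text \<open>The second form, with the rest of the product in front, shows what the remaining lines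
  do to the value from the left.\<close>

lemma Bl_line_append:
  assumes "line \<epsilon> x L" "distinct (L @ ms)" "inj_on x (set (L @ ms))" "L \<noteq> []"
  shows "Bl x (L @ ms) = Bl x L * prodT x L ms * Bl x ms"
    and "Bl x (L @ ms) = Bl x ms * (Bl x L * prodT x L (rev ms))"
proof -
  show "Bl x (L @ ms) = Bl x L * prodT x L ms * Bl x ms"
    using line_CR[OF assms] by (simp add: Bl_append[OF assms(2)])
  have c: "Bl x L * Bl x ms = Bl x ms * Bl x L"
    using assms(2) by (intro Bl_commute ballI impI Bl_commute[symmetric] R_commute) auto
  have "Bl x (L @ ms) = (Bl x L * Bl x ms) * CR x L (rev ms)"
    using CR_Bl[OF assms(2,3)] by (simp add: Bl_append[OF assms(2)] mult.assoc)
  also have "\<dots> = Bl x ms * (Bl x L * CR x L (rev ms))"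
    by (simp add: c mult.assoc)
  also have "Bl x L * CR x L (rev ms) = Bl x L * prodT x L (rev ms)"
    using assms by (intro line_CR) auto
  finally show "Bl x (L @ ms) = Bl x ms * (Bl x L * prodT x L (rev ms))" .
qed

text \<open>On the fused line \<open>Y\<close> satisfies a quadratic equation with roots
  \<open>\<epsilon> * r\<close> and \<open>- \<epsilon>\<close>, where \<open>r\<close> is the
  length. The hypothesis makes \<open>T\<close> equal to 1 - Y / (\<epsilon> r), which removes the
  root \<open>\<epsilon> * r\<close>.\<close>

lemma Y_T_Bl:
  assumes "line \<epsilon> x L" "distinct (L @ [p])" "inj_on x (set L)" "L \<noteq> []"
    and w: "y (last L) - y p = \<epsilon> * of_nat (length L)"
  shows "Y L p * (Bl x L * T y L p) = - (\<epsilon> *\<^sub>C (Bl x L * T y L p))"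
proof -
  let ?H = "Bl x L" and ?r = "of_nat (length L) :: complex"
  have r: "?r \<noteq> 0" using assms(4) by simp
  have "P a p * P b p * ?H = (if a = b then ?H else \<epsilon> *\<^sub>C (P b p * ?H))"
    if "a \<in> set L" "b \<in> set L" for a b
  proof (cases "a = b")
    case True
    then show ?thesis using that assms(2) P_sq[of a p] by (cases "a = p") auto
  next
    case False
    have "P a p * P b p = P b p * P a b"
      using P_conj[of p a b] P_conj[of b p a] False that assms(2) by (cases "p = a"; cases "p = b") (auto simp: P_sym)
    then show ?thesis using line_P(2)[of x L a b] False that assms by (simp add: mult.assoc)
  qed
  moreover have "Y L p * Y L p * ?H = (\<Sum>a\<in>set L. \<Sum>b\<in>set L. P a p * P b p * ?H)"
    unfolding Y_def sum_product by (simp only: sum_distrib_right)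
  ultimately have "Y L p * Y L p * ?H = (\<Sum>a\<in>set L. \<Sum>b\<in>set L. if a = b then ?H else \<epsilon> *\<^sub>C (P b p * ?H))"
    by simp
  also have "\<dots> = (\<Sum>b\<in>set L. \<Sum>a\<in>set L. if a = b then ?H else \<epsilon> *\<^sub>C (P b p * ?H))"
    by (rule sum.swap)
  also have "\<dots> = (\<Sum>b\<in>set L. ?H + (?r - 1) *\<^sub>C \<epsilon> *\<^sub>C (P b p * ?H))"
  proof (rule sum.cong)
    fix b assume b: "b \<in> set L"
    have "card (set L - {b}) = length L - 1" using b assms(2) by (simp add: distinct_card)
    then have "of_nat (card (set L - {b})) = ?r - 1" using r by (simp add: Suc_leI of_nat_diff)
    with b show "(\<Sum>a\<in>set L. if a = b then ?H else \<epsilon> *\<^sub>C (P b p * ?H)) = ?H + (?r - 1) *\<^sub>C \<epsilon> *\<^sub>C (P b p * ?H)"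
      by (subst sum.remove[of _ b]) (auto simp: sum_constant of_nat_mult_cs mult.commute intro!: sum.cong)
  qed simp
  also have "\<dots> = ?r *\<^sub>C ?H + ((?r - 1) * \<epsilon>) *\<^sub>C (Y L p * ?H)"
    using assms(2) by (simp add: sum.distrib of_nat_mult_cs distinct_card Y_def sum_distrib_right cs_sum_right)
  finally have YY: "Y L p * (Y L p * ?H) = ?r *\<^sub>C ?H + ((?r - 1) * \<epsilon>) *\<^sub>C (Y L p * ?H)"
    by (simp add: mult.assoc)
  have T: "?H * T y L p = ?H - (\<epsilon> / ?r) *\<^sub>C (Y L p * ?H)"
    using assms(2) Y_commute_Bl[of L p x]
    by (simp add: T_def w right_diff_distrib) (simp add: eps_inverse flip: divide_divide_eq_left)
  have "Y L p * (?H * T y L p) = Y L p * ?H - (\<epsilon> / ?r * ?r) *\<^sub>C ?H - (\<epsilon> / ?r * ((?r - 1) * \<epsilon>)) *\<^sub>C (Y L p * ?H)"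
    by (simp add: T right_diff_distrib YY cs_add_right)
  also have "\<epsilon> / ?r * ((?r - 1) * \<epsilon>) = 1 - 1 / ?r"
    using r eps by (simp add: field_simps)
  also have "Y L p * ?H - (\<epsilon> / ?r * ?r) *\<^sub>C ?H - (1 - 1 / ?r) *\<^sub>C (Y L p * ?H) = - (\<epsilon> *\<^sub>C (?H * T y L p))"
    using r by (simp add: T cs_diff_right cs_diff_left eps)
  finally show ?thesis .
qed

end

section \<open>Regular functions with values in an algebra\<close>

inductive opoly :: "nat set \<Rightarrow> ((nat \<Rightarrow> complex) \<Rightarrow> 'r::calg) \<Rightarrow> bool" for V where
  const: "opoly V (\<lambda>t. X)"
| scale: "polynomial_fun V p \<Longrightarrow> opoly V r \<Longrightarrow> opoly V (\<lambda>t. p t *\<^sub>C r t)"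
| add: "opoly V r \<Longrightarrow> opoly V s \<Longrightarrow> opoly V (\<lambda>t. r t + s t)"
| mult: "opoly V r \<Longrightarrow> opoly V s \<Longrightarrow> opoly V (\<lambda>t. r t * s t)"

lemma polynomial_fun_diff:
  assumes "polynomial_fun V p" "polynomial_fun V q"
  shows "polynomial_fun V (\<lambda>t. p t - q t)"
  using polynomial_fun.add[OF assms(1) polynomial_fun.mult[OF polynomial_fun.const[of V "-1"] assms(2)]] by simp

lemma polynomial_fun_sum_list:
  "(\<And>p. p \<in> set ps \<Longrightarrow> polynomial_fun V (g p)) \<Longrightarrow> polynomial_fun V (\<lambda>t. \<Sum>p\<leftarrow>ps. g p t)"
  by (induction ps) (auto intro: polynomial_fun.const polynomial_fun.add)

text \<open>Written over constant operators, an operator-valued polynomial has polynomial matrix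
  coefficients, which links it to the scalar notion of regularity.\<close>

lemma opoly_expand:
  assumes "opoly V (r :: _ \<Rightarrow> 'r::calg)"
  shows "\<exists>ps. (\<forall>(p, X)\<in>set ps. polynomial_fun V p) \<and> (\<forall>t. r t = (\<Sum>(p, X)\<leftarrow>ps. p t *\<^sub>C X))"
  using assms
proof induction
  case (const X)
  show ?case by (rule exI[of _ "[(\<lambda>t. 1, X)]"]) (auto intro: polynomial_fun.const)
next
  case (scale p r)
  then obtain ps where ps: "\<forall>(p, X)\<in>set ps. polynomial_fun V p" "\<forall>t. r t = (\<Sum>(p, X)\<leftarrow>ps. p t *\<^sub>C X)"
    by blast
  have "p t *\<^sub>C (\<Sum>(p, X)\<leftarrow>ps. p t *\<^sub>C X) = (\<Sum>(p', X)\<leftarrow>map (\<lambda>(p', X). (\<lambda>t. p t * p' t, X)) ps. p' t *\<^sub>C X)" for t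
    by (induction ps) (auto simp: cs_add_right)
  with ps scale(1) show ?case
    by (intro exI[of _ "map (\<lambda>(p', X). (\<lambda>t. p t * p' t, X)) ps"]) (auto intro: polynomial_fun.mult)
next
  case (add r s)
  then obtain ps qs where "\<forall>(p, X)\<in>set ps. polynomial_fun V p" "\<forall>t. r t = (\<Sum>(p, X)\<leftarrow>ps. p t *\<^sub>C X)"
    "\<forall>(p, X)\<in>set qs. polynomial_fun V p" "\<forall>t. s t = (\<Sum>(p, X)\<leftarrow>qs. p t *\<^sub>C X)" by blast
  then show ?case by (intro exI[of _ "ps @ qs"]) auto
next
  case (mult r s)
  then obtain ps qs where ps: "\<forall>(p, X)\<in>set ps. polynomial_fun V p" "\<forall>t. r t = (\<Sum>(p, X)\<leftarrow>ps. p t *\<^sub>C X)"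
    and qs: "\<forall>(p, X)\<in>set qs. polynomial_fun V p" "\<forall>t. s t = (\<Sum>(p, X)\<leftarrow>qs. p t *\<^sub>C X)" by blast
  define f where "f = (\<lambda>(p :: (nat \<Rightarrow> complex) \<Rightarrow> complex, X :: 'r). map (\<lambda>(q, Y). (\<lambda>t. p t * q t, X * Y)) qs)"
  have 1: "(\<Sum>(p, X)\<leftarrow>f (p, X). p t *\<^sub>C X) = (p t *\<^sub>C X) * (\<Sum>(p, X)\<leftarrow>qs. p t *\<^sub>C X)" for p X t
    unfolding f_def by (induction qs) (auto simp: algebra_simps cs_add_right)
  have "(\<Sum>(p, X)\<leftarrow>ps. p t *\<^sub>C X) * (\<Sum>(p, X)\<leftarrow>qs. p t *\<^sub>C X) = (\<Sum>(p, X)\<leftarrow>concat (map f ps). p t *\<^sub>C X)" for t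
    by (induction ps) (auto simp: distrib_right 1 simp del: mult_cs_left)
  with ps qs show ?case
    by (intro exI[of _ "concat (map f ps)"]) (fastforce simp: f_def intro: polynomial_fun.mult)
qed

text \<open>The operator form of \<open>has_regular_value\<close>, with one denominator for all
  coefficients. By itself it does not pin down \<open>y\<close> (for empty \<open>G\<close> every
  \<open>y\<close> qualifies); uniqueness enters as \<open>reg_unique\<close>.\<close>

definition regv :: "nat set \<Rightarrow> (nat \<Rightarrow> complex) set \<Rightarrow> (nat \<Rightarrow> complex) \<Rightarrow> ((nat \<Rightarrow> complex) \<Rightarrow> 'r::calg) \<Rightarrow> 'r \<Rightarrow> bool" where
  "regv V G z r y \<longleftrightarrow> (\<exists>q p. polynomial_fun V q \<and> q z \<noteq> 0 \<and> opoly V p \<and>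
     (\<forall>t\<in>G. q t *\<^sub>C r t = p t) \<and> y = (1 / q z) *\<^sub>C p z)"

lemma regvI:
  assumes "polynomial_fun V q" "q z \<noteq> 0" "opoly V p" "\<forall>t\<in>G. q t *\<^sub>C r t = p t" "q z *\<^sub>C y = p z"
  shows "regv V G z r y"
  unfolding regv_def using assms by (intro exI[of _ q] exI[of _ p]) (auto simp flip: assms(5))

lemma regv_iff: "regv V G z r y \<longleftrightarrow> (\<exists>q p. polynomial_fun V q \<and> q z \<noteq> 0 \<and> opoly V p \<and>
     (\<forall>t\<in>G. q t *\<^sub>C r t = p t) \<and> q z *\<^sub>C y = p z)"
  unfolding regv_def by (intro ex_cong1) (auto simp: cs_eq_iff)

lemma regv_const: "regv V G z (\<lambda>t. X) X"
  by (rule regvI[of V "\<lambda>_. 1" _ "\<lambda>_. X"]) (auto intro: polynomial_fun.const opoly.const)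

lemma regv_cong: "regv V G z r y \<Longrightarrow> (\<And>t. t \<in> G \<Longrightarrow> r t = s t) \<Longrightarrow> regv V G z s y"
  by (auto simp: regv_iff)

lemma regv_add:
  assumes "regv V G z r y" "regv V G z r' y'"
  shows "regv V G z (\<lambda>t. r t + r' t) (y + y')"
proof -
  obtain q p where a: "polynomial_fun V q" "q z \<noteq> 0" "opoly V p" "\<forall>t\<in>G. q t *\<^sub>C r t = p t" "q z *\<^sub>C y = p z"
    using assms(1) unfolding regv_iff by blast
  obtain q' p' where b: "polynomial_fun V q'" "q' z \<noteq> 0" "opoly V p'" "\<forall>t\<in>G. q' t *\<^sub>C r' t = p' t" "q' z *\<^sub>C y' = p' z"
    using assms(2) unfolding regv_iff by blast
  show ?thesis
    by (rule regvI[of V "\<lambda>t. q t * q' t" _ "\<lambda>t. q' t *\<^sub>C p t + q t *\<^sub>C p' t"])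
       (auto intro!: polynomial_fun.intros opoly.intros a b simp: a(2) b(2) cs_add_right mult.commute
         simp flip: a(4)[rule_format] a(5) b(4)[rule_format] b(5))
qed

lemma regv_mult:
  assumes "regv V G z r y" "regv V G z r' y'"
  shows "regv V G z (\<lambda>t. r t * r' t) (y * y')"
proof -
  obtain q p where a: "polynomial_fun V q" "q z \<noteq> 0" "opoly V p" "\<forall>t\<in>G. q t *\<^sub>C r t = p t" "q z *\<^sub>C y = p z"
    using assms(1) unfolding regv_iff by blast
  obtain q' p' where b: "polynomial_fun V q'" "q' z \<noteq> 0" "opoly V p'" "\<forall>t\<in>G. q' t *\<^sub>C r' t = p' t" "q' z *\<^sub>C y' = p' z"
    using assms(2) unfolding regv_iff by blast
  show ?thesis
    by (rule regvI[of V "\<lambda>t. q t * q' t" _ "\<lambda>t. p t * p' t"])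
       (auto intro!: polynomial_fun.intros opoly.intros a b simp: a(2) b(2) mult.commute
         simp flip: a(4)[rule_format] a(5) b(4)[rule_format] b(5))
qed

lemma regv_divide:
  assumes "regv V G z r' y'" "polynomial_fun V q" "q z \<noteq> 0" "\<And>t. t \<in> G \<Longrightarrow> q t *\<^sub>C r t = r' t"
  shows "regv V G z r ((1 / q z) *\<^sub>C y')"
proof -
  obtain q' p' where b: "polynomial_fun V q'" "q' z \<noteq> 0" "opoly V p'" "\<forall>t\<in>G. q' t *\<^sub>C r' t = p' t" "q' z *\<^sub>C y' = p' z"
    using assms(1) unfolding regv_iff by blast
  show ?thesis
    by (rule regvI[of V "\<lambda>t. q' t * q t" _ p'])
       (use assms b in \<open>auto intro!: polynomial_fun.intros simp flip: assms(4) b(4)[rule_format] b(5)\<close>)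
qed

lemma regv_scale:
  assumes "regv V G z r y" "polynomial_fun V q"
  shows "regv V G z (\<lambda>t. q t *\<^sub>C r t) (q z *\<^sub>C y)"
proof -
  have "regv V G z (\<lambda>t. q t *\<^sub>C 1) (q z *\<^sub>C 1)"
    by (rule regvI[of V "\<lambda>_. 1" _ "\<lambda>t. q t *\<^sub>C 1"]) (auto intro!: polynomial_fun.intros opoly.intros assms)
  from regv_mult[OF this assms(1)] show ?thesis by simp
qed

lemma regv_prod_list:
  assumes "\<And>p. p \<in> set ps \<Longrightarrow> regv V G z (\<lambda>t. f t p) (g p)"
  shows "regv V G z (\<lambda>t. \<Prod>p\<leftarrow>ps. f t p) (\<Prod>p\<leftarrow>ps. g p)"
  using assms by (induction ps) (auto intro: regv_const regv_mult)

lemma regv_one_minus: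
  assumes "polynomial_fun V d" "d z \<noteq> 0" "\<And>t. t \<in> G \<Longrightarrow> d t \<noteq> 0"
  shows "regv V G z (\<lambda>t. 1 - (1 / d t) *\<^sub>C X) (1 - (1 / d z) *\<^sub>C X)"
proof -
  have "regv V G z (\<lambda>t. d t *\<^sub>C 1 + (- X)) (d z *\<^sub>C 1 + (- X))"
    by (intro regv_add regv_const regv_scale assms)
  from regv_divide[OF this assms(1,2), of "\<lambda>t. 1 - (1 / d t) *\<^sub>C X"] show ?thesis
    using assms(2,3) by (simp add: cs_diff_right)
qed

section \<open>Regularity along lines and transport along swaps\<close>

text \<open>\<open>G\<close> holds the generic points and \<open>z\<close> is the special one. The
  parameters are distinct on \<open>G\<close> but may collide at \<open>z\<close>, which is where
  factors of \<open>B\<close> have poles.\<close>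

locale shape = fusion P \<epsilon> for P :: "nat \<Rightarrow> nat \<Rightarrow> 'r::calg" and \<epsilon> +
  fixes V :: "nat set" and G :: "(nat \<Rightarrow> complex) set" and z :: "nat \<Rightarrow> complex"
    and x :: "(nat \<Rightarrow> complex) \<Rightarrow> nat \<Rightarrow> complex" and U :: "nat set"
  assumes x_poly: "k \<in> U \<Longrightarrow> polynomial_fun V (\<lambda>t. x t k)"
    and x_inj: "t \<in> G \<Longrightarrow> inj_on (x t) U"
begin

abbreviation reg :: "((nat \<Rightarrow> complex) \<Rightarrow> 'r) \<Rightarrow> 'r \<Rightarrow> bool" where
  "reg \<equiv> regv V G z"

lemma x_inj': "t \<in> G \<Longrightarrow> W \<subseteq> U \<Longrightarrow> inj_on (x t) W"
  using x_inj inj_on_subset by blast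

lemma x_diff_poly: "a \<in> U \<Longrightarrow> b \<in> U \<Longrightarrow> polynomial_fun V (\<lambda>t. x t a - x t b)"
  by (intro polynomial_fun_diff x_poly)

lemma x_diff: "t \<in> G \<Longrightarrow> a \<in> U \<Longrightarrow> b \<in> U \<Longrightarrow> a \<noteq> b \<Longrightarrow> x t a - x t b \<noteq> 0"
  using x_inj by (auto dest: inj_onD)

lemma reg_R:
  assumes "a \<in> U" "b \<in> U" "a \<noteq> b" "x z a \<noteq> x z b"
  shows "reg (\<lambda>t. R (x t) a b) (R (x z) a b)"
  unfolding R_def using assms x_diff by (intro regv_one_minus x_diff_poly) auto

lemma reg_T:
  assumes "set L \<subseteq> U" "L \<noteq> []" "p \<in> U" "p \<notin> set L" "x z (last L) \<noteq> x z p"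
  shows "reg (\<lambda>t. T (x t) L p) (T (x z) L p)"
proof -
  have "last L \<in> U" "last L \<noteq> p" using assms last_in_set[OF assms(2)] by auto
  then show ?thesis
    unfolding T_def using assms x_diff by (intro regv_one_minus x_diff_poly) auto
qed

lemma reg_prodT:
  assumes "set L \<subseteq> U" "L \<noteq> []" "set ps \<subseteq> U" "set ps \<inter> set L = {}" "\<forall>p\<in>set ps. x z (last L) \<noteq> x z p"
  shows "reg (\<lambda>t. prodT (x t) L ps) (prodT (x z) L ps)"
  unfolding prodT_def using assms by (intro regv_prod_list reg_T) auto

lemma reg_Bl:
  assumes "set as \<subseteq> U" "distinct as" "inj_on (x z) (set as)"
  shows "reg (\<lambda>t. Bl (x t) as) (Bl (x z) as)"
  using assms
proof (induction as)
  case (Cons a as)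
  have "reg (\<lambda>t. rowR (x t) a as) (rowR (x z) a as)"
    unfolding rowR_def using Cons.prems by (intro regv_prod_list reg_R) (auto simp: inj_on_insert)
  with Cons show ?case by (auto intro!: regv_mult simp: inj_on_insert)
qed (auto intro: regv_const)

lemma line_inj: "line \<epsilon> y L \<Longrightarrow> distinct L \<Longrightarrow> inj_on y (set L)"
  using eps_nz by (auto simp: inj_on_def in_set_conv_nth line_nth nth_eq_iff_index_eq)

definition all_line :: "nat list \<Rightarrow> bool" where
  "all_line L \<longleftrightarrow> (\<forall>t\<in>insert z G. line \<epsilon> (x t) L)"

text \<open>The condition on \<open>last L\<close> says that no denominator of a fused factor
  vanishes at \<open>z\<close>; denominators inside a line cannot vanish.\<close>

fun lines_ok :: "nat list list \<Rightarrow> bool" where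
  "lines_ok [] \<longleftrightarrow> True"
| "lines_ok (L # Ls) \<longleftrightarrow> L \<noteq> [] \<and> all_line L \<and> set L \<subseteq> U \<and> distinct (L @ concat Ls) \<and>
     (\<forall>p\<in>set (concat Ls). x z (last L) \<noteq> x z p) \<and> lines_ok Ls"

lemma lines_ok_subset: "lines_ok Ls \<Longrightarrow> set (concat Ls) \<subseteq> U \<and> distinct (concat Ls)"
  by (induction Ls) auto

fun bval :: "nat list list \<Rightarrow> 'r" where
  "bval [] = 1"
| "bval (L # Ls) = Bl (x z) L * prodT (x z) L (concat Ls) * bval Ls"

lemma reg_line_factor:
  assumes "lines_ok (L # Ls)" "set ps = set (concat Ls)"
  shows "reg (\<lambda>t. Bl (x t) L * prodT (x t) L ps) (Bl (x z) L * prodT (x z) L ps)"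
proof -
  have 1: "reg (\<lambda>t. Bl (x t) L) (Bl (x z) L)"
    using assms by (intro reg_Bl line_inj) (auto simp: all_line_def)
  have 2: "reg (\<lambda>t. prodT (x t) L ps) (prodT (x z) L ps)"
    using assms lines_ok_subset[of Ls] by (intro reg_prodT) auto
  from regv_mult[OF 1 2] show ?thesis .
qed

lemma reg_lines:
  assumes "lines_ok Ls"
  shows "reg (\<lambda>t. Bl (x t) (concat Ls)) (bval Ls)"
  using assms
proof (induction Ls)
  case (Cons L Ls)
  have "reg (\<lambda>t. Bl (x t) L * prodT (x t) L (concat Ls) * Bl (x t) (concat Ls)) (bval (L # Ls))"
    using regv_mult[OF reg_line_factor[OF Cons.prems refl] Cons.IH] Cons.prems by simp
  moreover have "Bl (x t) L * prodT (x t) L (concat Ls) * Bl (x t) (concat Ls) = Bl (x t) (concat (L # Ls))"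
    if "t \<in> G" for t
    using Cons.prems that lines_ok_subset[of Ls]
    by (simp add: all_line_def) (intro Bl_line_append(1)[symmetric] x_inj'; auto)
  ultimately show ?case by (rule regv_cong)
qed (auto intro: regv_const)

text \<open>This is \<open>Bl_swap\<close> multiplied by \<open>R x a b\<close>, with
  \<open>R_unitary\<close> for the resulting scalar, and cleared of denominators so that it can be
  carried to \<open>z\<close>.\<close>

lemma swap_identity:
  assumes ks: "distinct (xs @ [a, b] @ ys)" "set (xs @ [a, b] @ ys) \<subseteq> U" and t: "t \<in> G"
  shows "((x t a - x t b)\<^sup>2 - 1) *\<^sub>C Bl (x t) (xs @ [a, b] @ ys)
    = (x t a - x t b)\<^sup>2 *\<^sub>C (R (x t) a b * Bl (x t) (xs @ [b, a] @ ys) * R (x t) a b)"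
proof -
  have ne: "a \<noteq> b" using ks by auto
  have d: "x t a \<noteq> x t b" using x_diff[OF t, of a b] ks by auto
  have "Bl (x t) (xs @ [a, b] @ ys) * R (x t) b a * R (x t) a b
      = R (x t) a b * Bl (x t) (xs @ [b, a] @ ys) * R (x t) a b"
    using Bl_swap[OF ks(1) x_inj'[OF t ks(2)]] by simp
  moreover have "Bl (x t) (xs @ [a, b] @ ys) * R (x t) b a * R (x t) a b
      = (1 - 1 / (x t a - x t b)\<^sup>2) *\<^sub>C Bl (x t) (xs @ [a, b] @ ys)"
    using R_unitary[of b a "x t"] ne d by (simp add: mult.assoc power2_commute)
  ultimately have "R (x t) a b * Bl (x t) (xs @ [b, a] @ ys) * R (x t) a b
      = (1 - 1 / (x t a - x t b)\<^sup>2) *\<^sub>C Bl (x t) (xs @ [a, b] @ ys)"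
    by simp
  moreover have "(x t a - x t b)\<^sup>2 * (1 - 1 / (x t a - x t b)\<^sup>2) = (x t a - x t b)\<^sup>2 - 1"
    using d by (simp add: right_diff_distrib)
  ultimately show ?thesis by (simp only: cs_cs)
qed

text \<open>At difference 0 the factor \<open>R\<close> has a pole, at 1 and -1 it is not
  invertible; for all other differences an exchange is harmless.\<close>

definition far :: "nat \<Rightarrow> nat \<Rightarrow> bool" where
  "far a b \<longleftrightarrow> x z a - x z b \<notin> {0, 1, - 1}"

definition kap :: "nat \<Rightarrow> nat \<Rightarrow> complex" where
  "kap a b = (x z a - x z b)\<^sup>2 / ((x z a - x z b)\<^sup>2 - 1)"

lemma far_square: "far a b \<Longrightarrow> (x z a - x z b)\<^sup>2 - 1 \<noteq> 0"
  by (auto simp: far_def power2_eq_1_iff)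

lemma reg_swap:
  assumes ks: "distinct (xs @ [a, b] @ ys)" "set (xs @ [a, b] @ ys) \<subseteq> U" and far: "far a b"
    and y: "reg r y"
    and eq: "\<And>t. t \<in> G \<Longrightarrow> ((x t a - x t b)\<^sup>2 - 1) *\<^sub>C r' t
      = (x t a - x t b)\<^sup>2 *\<^sub>C (R (x t) a b * r t * R (x t) a b)"
  shows "reg r' (kap a b *\<^sub>C (R (x z) a b * y * R (x z) a b))"
proof -
  have R: "reg (\<lambda>t. R (x t) a b) (R (x z) a b)"
    using ks far by (intro reg_R) (auto simp: far_def)
  have sq: "polynomial_fun V (\<lambda>t. (x t a - x t b)\<^sup>2)"
    using ks(2) unfolding power2_eq_square by (intro polynomial_fun.mult x_diff_poly) auto
  have "reg (\<lambda>t. (x t a - x t b)\<^sup>2 *\<^sub>C (R (x t) a b * r t * R (x t) a b))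
      ((x z a - x z b)\<^sup>2 *\<^sub>C (R (x z) a b * y * R (x z) a b))"
    by (intro regv_scale regv_mult R y sq)
  from regv_divide[OF this polynomial_fun_diff[OF sq polynomial_fun.const[of V 1]] far_square[OF far], of r'] eq
  show ?thesis by (simp add: kap_def)
qed

lemma R_inverse:
  assumes "far a b" "a \<noteq> b"
  shows "kap a b *\<^sub>C (R (x z) a b * R (x z) b a) = 1" "kap a b *\<^sub>C (R (x z) b a * R (x z) a b) = 1"
proof -
  have d: "x z a - x z b \<noteq> 0" "x z a \<noteq> x z b" using assms by (auto simp: far_def)
  have k: "kap a b * (1 - 1 / (x z a - x z b)\<^sup>2) = 1"
    using far_square[OF assms(1)] d by (simp add: kap_def divide_simps)
  show "kap a b *\<^sub>C (R (x z) a b * R (x z) b a) = 1" "kap a b *\<^sub>C (R (x z) b a * R (x z) a b) = 1"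
    using R_unitary[of a b "x z"] R_unitary[of b a "x z"] assms d k by (auto simp: power2_commute)
qed

section \<open>Jucys-Murphy elements relative to an ordering of the labels\<close>

definition JM :: "nat list \<Rightarrow> nat \<Rightarrow> 'r" where
  "JM ks k = (\<Sum>j\<in>set (takeWhile (\<lambda>j. j \<noteq> k) ks). P j k)"

definition JM_eigen :: "nat list \<Rightarrow> complex \<Rightarrow> 'r \<Rightarrow> bool" where
  "JM_eigen ks c b \<longleftrightarrow> (\<forall>k\<in>set ks. JM ks k * b = (x z k - c) *\<^sub>C b)"

lemma JM_append:
  "k \<notin> set xs \<Longrightarrow> distinct (xs @ takeWhile (\<lambda>j. j \<noteq> k) ys) \<Longrightarrow> JM (xs @ ys) k = Y xs k + JM ys k"
  by (simp add: JM_def Y_def takeWhile_append sum.union_disjoint)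

lemma JM_append_left: "k \<in> set xs \<Longrightarrow> JM (xs @ ys) k = JM xs k"
  by (simp add: JM_def takeWhile_append1)

text \<open>\<open>R x a b\<close> at the special point is the classical intertwiner: the new vector
  has the eigenvalues of \<open>a\<close> and \<open>b\<close> in exchanged places. A label other
  than \<open>a\<close> and \<open>b\<close> has both or neither of them before it, so its
  Jucys-Murphy element commutes with \<open>P a b\<close>.\<close>

lemma JM_eigen_swap:
  assumes ks: "distinct (xs @ [a, b] @ ys)" and far: "far a b"
    and b: "JM_eigen (xs @ [b, a] @ ys) c v"
  shows "JM_eigen (xs @ [a, b] @ ys) c (R (x z) a b * v)"
  unfolding JM_eigen_def
proof
  fix k assume k: "k \<in> set (xs @ [a, b] @ ys)"
  let ?ks = "xs @ [a, b] @ ys" and ?ks' = "xs @ [b, a] @ ys" and ?d = "x z a - x z b"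
  have ne: "a \<noteq> b" "a \<notin> set xs" "b \<notin> set xs" using ks by auto
  have d: "?d \<noteq> 0" using far by (auto simp: far_def)
  have ev: "JM ?ks' k * v = (x z k - c) *\<^sub>C v" if "k \<in> set ?ks'" for k
    using b that by (auto simp: JM_eigen_def)
  have Ja: "JM ?ks' a = Y xs a + P a b" "JM ?ks a = Y xs a"
    and Jb: "JM ?ks' b = Y xs b" "JM ?ks b = Y xs b + P a b"
    using ne by (auto simp: JM_def Y_def takeWhile_append P_sym[of b a] add.commute)
  \<comment> \<open>With \<open>b\<close> in front, the element of \<open>a\<close> also contains
    \<open>P a b\<close>; it is split off here because in the new ordering it belongs to the element
    of \<open>b\<close>.\<close>
  have va: "Y xs a * v = (x z a - c) *\<^sub>C v - P a b * v"
    using ev[of a] unfolding Ja by (simp add: distrib_right eq_diff_eq)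
  have vb: "Y xs b * v = (x z b - c) *\<^sub>C v"
    using ev[of b] unfolding Jb by simp
  have cnj: "Y xs a * P a b = P a b * Y xs b" "Y xs b * P a b = P a b * Y xs a"
    using Y_conj[of a b xs] Y_conj[of b a xs] ne by (auto simp: P_sym)
  have pp: "P a b * P a b = 1" using ne by (simp add: P_sq)
  have Yv: "Y xs a * (P a b * v) = (x z b - c) *\<^sub>C (P a b * v)"
    "Y xs b * (P a b * v) = (x z a - c) *\<^sub>C (P a b * v) - v"
    using va vb cnj pp by (auto simp flip: mult.assoc simp: mult.assoc[of _ _ v] right_diff_distrib)
  define \<beta> where "\<beta> = 1 / ?d"
  have \<beta>: "1 + \<beta> * (x z b - c) = \<beta> * (x z a - c)" "1 - \<beta> * (x z a - c) = - (\<beta> * (x z b - c))"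
    using d by (simp_all add: \<beta>_def field_simps)
  have Rv: "R (x z) a b * v = v - \<beta> *\<^sub>C (P a b * v)"
    by (simp add: R_def \<beta>_def left_diff_distrib)
  consider "k = a" | "k = b" | "k \<noteq> a" "k \<noteq> b" by blast
  then show "JM ?ks k * (R (x z) a b * v) = (x z k - c) *\<^sub>C (R (x z) a b * v)"
  proof cases
    case 1
    have "Y xs a * (v - \<beta> *\<^sub>C (P a b * v))
        = (x z a - c) *\<^sub>C v - (1 + \<beta> * (x z b - c)) *\<^sub>C (P a b * v)"
      by (simp only: right_diff_distrib mult_cs_right va Yv cs_add_left cs_cs cs_one diff_diff_eq)
    also have "\<dots> = (x z a - c) *\<^sub>C (v - \<beta> *\<^sub>C (P a b * v))"
      unfolding \<beta>(1) by (simp only: cs_diff_right cs_cs mult.commute)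
    finally show ?thesis unfolding Rv 1 Ja .
  next
    case 2
    have "(Y xs b + P a b) * (v - \<beta> *\<^sub>C (P a b * v)) = (x z b - c) *\<^sub>C v + P a b * v
        - \<beta> *\<^sub>C ((x z a - c) *\<^sub>C (P a b * v) - v) - \<beta> *\<^sub>C (P a b * P a b * v)"
      by (simp only: distrib_right right_diff_distrib mult_cs_right vb Yv mult.assoc) (simp add: cs_diff_right cs_add_right)
    also have "\<dots> = (x z b - c) *\<^sub>C v + (1 - \<beta> * (x z a - c)) *\<^sub>C (P a b * v)"
      by (simp add: pp cs_diff_left cs_diff_right right_diff_distrib)
    also have "\<dots> = (x z b - c) *\<^sub>C (v - \<beta> *\<^sub>C (P a b * v))"
      unfolding \<beta>(2) by (simp only: cs_diff_right cs_cs mult.commute cs_minus_left) simp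
    finally show ?thesis unfolding Rv 2 Jb .
  next
    case 3
    have "P a b * JM ?ks' k = JM ?ks k * P a b" "JM ?ks' k = JM ?ks k"
    proof -
      have sets: "set (takeWhile (\<lambda>j. j \<noteq> k) ?ks') = set (takeWhile (\<lambda>j. j \<noteq> k) ?ks)"
        using 3 by (auto simp: takeWhile_append)
      then show eq: "JM ?ks' k = JM ?ks k" by (simp add: JM_def)
      show "P a b * JM ?ks' k = JM ?ks k * P a b"
      proof (cases "k \<in> set xs")
        case True
        have "P a b * P j k = P j k * P a b" if "j \<in> set (takeWhile (\<lambda>j. j \<noteq> k) xs)" for j
          using that set_takeWhileD[OF that] ne 3 by (intro P_comm) auto
        then show ?thesis
          using True by (simp add: JM_append_left JM_def sum_distrib_left sum_distrib_right)
      next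
        case False
        let ?L = "takeWhile (\<lambda>j. j \<noteq> k) ?ks"
        have "a \<in> set ?L" "b \<in> set ?L" "k \<notin> set ?L"
          using False 3 by (auto simp: takeWhile_append dest: set_takeWhileD)
        then have "P a b * Y ?L k = Y ?L k * P a b" using ne by (intro Y_commute) auto
        then show ?thesis unfolding eq by (simp add: JM_def Y_def)
      qed
    qed
    then have "JM ?ks k * (R (x z) a b * v) = R (x z) a b * (JM ?ks' k * v)"
      by (simp add: R_def left_diff_distrib right_diff_distrib flip: mult.assoc)
    also have "\<dots> = (x z k - c) *\<^sub>C (R (x z) a b * v)" using ev[of k] k by auto
    finally show ?thesis .
  qed
qed

end

context shape
begin

fun straight :: "nat list list \<Rightarrow> bool" where
  "straight (L # L' # Ls) \<longleftrightarrow> x z (hd L') = x z (hd L) - \<epsilon> \<and> straight (L' # Ls)"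
| "straight _ \<longleftrightarrow> True"

lemma takeWhile_neq_nth:
  assumes "distinct L" "i < length L"
  shows "takeWhile (\<lambda>j. j \<noteq> L ! i) L = take i L"
  using assms by (intro takeWhile_eq_take_P_nth) (auto simp: nth_eq_iff_index_eq)

text \<open>Each predecessor on its own line adds \<open>\<epsilon>\<close> to the eigenvalue of a
  label and each earlier line adds \<open>- \<epsilon>\<close>; by \<open>straight\<close> the
  parameters of the line heads drop by the same \<open>\<epsilon>\<close>.\<close>

lemma JM_of_relations:
  assumes "lines_ok Ls" "straight Ls"
    and "\<forall>L\<in>set Ls. \<forall>a\<in>set L. \<forall>b\<in>set L. a \<noteq> b \<longrightarrow> P a b * v = \<epsilon> *\<^sub>C v"
    and "sorted_wrt (\<lambda>L L'. \<forall>k\<in>set L'. Y L k * v = - (\<epsilon> *\<^sub>C v)) Ls"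
  shows "JM_eigen (concat Ls) (x z (hd (hd Ls))) v"
  using assms
proof (induction Ls)
  case (Cons L Ls)
  have L: "L \<noteq> []" "line \<epsilon> (x z) L" "distinct L" "distinct (L @ concat Ls)"
    using Cons.prems(1) by (auto simp: all_line_def)
  have IH: "JM (concat Ls) k * v = (x z k - x z (hd (hd Ls))) *\<^sub>C v" if "k \<in> set (concat Ls)" for k
  proof -
    have "straight Ls" using Cons.prems(2) by (cases Ls) auto
    then have "JM_eigen (concat Ls) (x z (hd (hd Ls))) v"
      using Cons.prems by (intro Cons.IH) auto
    then show ?thesis using that by (auto simp: JM_eigen_def)
  qed
  have "JM (concat (L # Ls)) k * v = (x z k - x z (hd L)) *\<^sub>C v" if k: "k \<in> set (concat (L # Ls))" for k
  proof (cases "k \<in> set L")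
    case True
    then obtain i where i: "k = L ! i" "i < length L" by (auto simp: in_set_conv_nth)
    have tw: "takeWhile (\<lambda>j. j \<noteq> k) L = take i L"
      using takeWhile_neq_nth[OF L(3) i(2)] i(1) by simp
    have "P j k * v = \<epsilon> *\<^sub>C v" if "j \<in> set (take i L)" for j
    proof -
      have "distinct (take i L @ drop i L)" using L(3) by simp
      moreover have "k \<in> set (drop i L)" using i by (metis Cons_nth_drop_Suc list.set_intros(1))
      ultimately have "j \<noteq> k" using that by (auto simp del: append_take_drop_id)
      then show ?thesis using Cons.prems(3) that True by (auto dest: in_set_takeD)
    qed
    then have "JM L k * v = of_nat (card (set (take i L))) *\<^sub>C \<epsilon> *\<^sub>C v"
      by (simp add: JM_def tw sum_distrib_right of_nat_mult_cs mult.commute)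
    then show ?thesis
      using True i L(3) line_nth[OF L(2) i(2)] by (simp add: JM_append_left distinct_card mult.commute)
  next
    case False
    then have k': "k \<in> set (concat Ls)" and ne: "Ls \<noteq> []" using k by auto
    then obtain L' where L': "k \<in> set L'" "L' \<in> set Ls" by auto
    then have YL: "Y L k * v = - (\<epsilon> *\<^sub>C v)" using Cons.prems(4) by auto
    have "distinct (L @ takeWhile (\<lambda>j. j \<noteq> k) (concat Ls))"
      using L(4) by (fastforce simp: disjoint_iff dest: set_takeWhileD)
    then have "JM (concat (L # Ls)) k * v = - (\<epsilon> *\<^sub>C v) + (x z k - x z (hd (hd Ls))) *\<^sub>C v"
      using False by (simp add: JM_append distrib_right YL IH[OF k'])
    also have "\<dots> = (x z k - (x z (hd (hd Ls)) + \<epsilon>)) *\<^sub>C v"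
      by (simp add: cs_diff_left cs_add_left)
    also have "x z (hd (hd Ls)) + \<epsilon> = x z (hd L)"
      using Cons.prems(2) ne by (cases Ls) auto
    finally show ?thesis .
  qed
  then show ?case by (simp add: JM_eigen_def)
qed (simp add: JM_eigen_def)

end

locale separated_shape = shape P \<epsilon> V G z x U for P :: "nat \<Rightarrow> nat \<Rightarrow> 'r::calg" and \<epsilon> V G z x U +
  assumes reg_unique: "reg r y \<Longrightarrow> reg r y' \<Longrightarrow> y = y'"
begin

text \<open>Both factorizations of the product are regular at \<open>z\<close>; uniqueness
  identifies their values, although the identity between them is available only at generic
  points.\<close>

lemma bval_right:
  assumes "lines_ok (L # Ls)"
  shows "bval (L # Ls) = bval Ls * (Bl (x z) L * prodT (x z) L (rev (concat Ls)))"
proof (rule reg_unique[OF reg_lines[OF assms]])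
  have "reg (\<lambda>t. Bl (x t) (concat Ls) * (Bl (x t) L * prodT (x t) L (rev (concat Ls))))
      (bval Ls * (Bl (x z) L * prodT (x z) L (rev (concat Ls))))"
    using assms by (intro regv_mult reg_lines reg_line_factor[OF assms]) auto
  then show "reg (\<lambda>t. Bl (x t) (concat (L # Ls))) (bval Ls * (Bl (x z) L * prodT (x z) L (rev (concat Ls))))"
    by (rule regv_cong)
      (use assms lines_ok_subset[of Ls] in \<open>simp add: all_line_def; intro Bl_line_append(2)[symmetric] x_inj'; auto\<close>)
qed

text \<open>For the head \<open>p\<close> of the next line, \<open>Y_T_Bl\<close> applies to the
  fused factor of \<open>p\<close>. Conjugation with transpositions of that line gives the relation
  for its other labels. For a line further down, \<open>Y M k\<close> already acts by
  \<open>- \<epsilon>\<close>, and moving \<open>Y L k\<close> past it exchanges \<open>k\<close>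
  for labels of \<open>M\<close>.\<close>

lemma line_relations:
  assumes "lines_ok Ls" "straight Ls"
  shows "(\<forall>L\<in>set Ls. \<forall>a\<in>set L. \<forall>b\<in>set L. a \<noteq> b \<longrightarrow> P a b * bval Ls = \<epsilon> *\<^sub>C bval Ls) \<and>
    sorted_wrt (\<lambda>L L'. \<forall>k\<in>set L'. Y L k * bval Ls = - (\<epsilon> *\<^sub>C bval Ls)) Ls"
  using assms
proof (induction Ls)
  case Nil
  then show ?case by simp
next
  case (Cons L Ls)
  let ?b = "bval (L # Ls)" and ?c = "bval Ls"
  note ok = Cons.prems(1)
  note [simp del] = bval.simps
  have st: "straight Ls" using Cons.prems(2) by (cases Ls) auto
  have L: "L \<noteq> []" "line \<epsilon> (x z) L" "distinct L" "distinct (L @ concat Ls)" "lines_ok Ls"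
    using ok by (auto simp: all_line_def)
  have inj: "inj_on (x z) (set L)" using line_inj L by blast
  obtain W where W: "?b = ?c * W" using bval_right[OF ok] by blast
  obtain Z where Z: "?b = Bl (x z) L * Z" by (simp add: bval.simps mult.assoc)
  have IH1: "\<And>L' a b. L' \<in> set Ls \<Longrightarrow> a \<in> set L' \<Longrightarrow> b \<in> set L' \<Longrightarrow> a \<noteq> b \<Longrightarrow> P a b * ?b = \<epsilon> *\<^sub>C ?b"
    and IH2: "sorted_wrt (\<lambda>L L'. \<forall>k\<in>set L'. Y L k * ?b = - (\<epsilon> *\<^sub>C ?b)) Ls"
    using Cons.IH[OF L(5) st] by (auto simp: W simp flip: mult.assoc elim!: sorted_wrt_mono_rel[rotated])
  have PL: "P a b * ?b = \<epsilon> *\<^sub>C ?b" if "a \<in> set L" "b \<in> set L" "a \<noteq> b" for a b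
    using line_P(2)[OF L(2,3) inj that] by (simp add: Z flip: mult.assoc)
  have YL: "Y L k * ?b = - (\<epsilon> *\<^sub>C ?b)" if k: "k \<in> set L'" "L' \<in> set Ls" for k L'
  proof -
    obtain M Ms where Ls: "Ls = M # Ms" using k by (cases Ls) auto
    obtain p M' where M: "M = p # M'" using L(5) Ls by (cases M) auto
    have p: "p \<notin> set L" using L(4) by (auto simp: Ls M)
    have "x z p = x z (hd L) - \<epsilon>" using Cons.prems(2) by (simp add: Ls M)
    then have "x z (last L) - x z p = \<epsilon> * of_nat (length L)"
      using line_last[OF L(2,1)] L(1) by (cases L) (simp_all add: algebra_simps)
    then have "Y L p * (Bl (x z) L * T (x z) L p) = - (\<epsilon> *\<^sub>C (Bl (x z) L * T (x z) L p))"
      using L inj p by (intro Y_T_Bl) auto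
    from this[THEN mult_cong_right, of "prodT (x z) L (M' @ concat Ms) * ?c"]
    have Yp: "Y L p * ?b = - (\<epsilon> *\<^sub>C ?b)"
      by (simp add: Ls M bval.simps mult.assoc)
    have YM: "Y L q * ?b = - (\<epsilon> *\<^sub>C ?b)" if q: "q \<in> set M" for q
    proof (cases "q = p")
      case False
      have "q \<notin> set L" using q L(4) by (auto simp: Ls)
      have pq: "P p q * ?b = \<epsilon> *\<^sub>C ?b" using IH1[of M p q] q False by (simp add: Ls M)
      have "\<epsilon> *\<^sub>C (Y L q * ?b) = Y L q * P p q * ?b" by (simp add: pq mult.assoc)
      also have "\<dots> = P p q * (Y L p * ?b)"
        using Y_conj[of p q L] False p \<open>q \<notin> set L\<close> by (simp flip: mult.assoc)
      also have "\<dots> = \<epsilon> *\<^sub>C (- (\<epsilon> *\<^sub>C ?b))" by (simp add: Yp pq)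
      finally show ?thesis by (subst (asm) cs_cancel[OF eps_nz])
    qed (simp add: Yp)
    show ?thesis
    proof (cases "k \<in> set M")
      case False
      then have "L' \<in> set Ms" using k by (auto simp: Ls)
      then have YMk: "Y M k * ?b = - (\<epsilon> *\<^sub>C ?b)" using IH2 k by (auto simp: Ls)
      have k': "k \<notin> set L" "k \<notin> set M" "set L \<inter> set M = {}"
        using L(4) k \<open>L' \<in> set Ms\<close> by (auto simp: Ls)
      have "Y L k * P j k = P j k * Y L j" if "j \<in> set M" for j
        using that k' by (intro Y_conj[symmetric]) auto
      then have "Y L k * Y M k * ?b = (\<Sum>j\<in>set M. P j k * (Y L j * ?b))"
        by (simp add: Y_def[of M] sum_distrib_left sum_distrib_right mult.assoc)
      also have "\<dots> = - (\<epsilon> *\<^sub>C (Y M k * ?b))"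
        by (simp add: YM Y_def[of M] sum_distrib_right cs_sum_right sum_negf)
      finally have "\<epsilon> *\<^sub>C (Y L k * ?b) = \<epsilon> *\<^sub>C (- (\<epsilon> *\<^sub>C ?b))"
        by (simp add: YMk mult.assoc) (metis minus_minus)
      then show ?thesis by (subst (asm) cs_cancel[OF eps_nz])
    qed (use YM in auto)
  qed
  have "sorted_wrt (\<lambda>L L'. \<forall>k\<in>set L'. Y L k * ?b = - (\<epsilon> *\<^sub>C ?b)) (L # Ls)"
    using IH2 YL by simp
  then show ?case using IH1 PL by simp
qed

end

section \<open>The product of both factors\<close>

locale brauer_shape = separated_shape P \<epsilon> V G z x U + brauer P Q \<delta>
  for P Q :: "nat \<Rightarrow> nat \<Rightarrow> 'r::calg" and \<epsilon> \<delta> V G z x U +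
  assumes eps_delta: "\<epsilon> \<noteq> \<delta>" and x_nonopposite: "t \<in> G \<Longrightarrow> nonopposite (x t) U"
begin

lemma x_nonopposite': "t \<in> G \<Longrightarrow> W \<subseteq> U \<Longrightarrow> nonopposite (x t) W"
  using x_nonopposite unfolding nonopposite_def by blast

lemma reg_S:
  assumes "a \<in> U" "b \<in> U" "a \<noteq> b" "x z a + x z b \<noteq> 0"
  shows "reg (\<lambda>t. S (x t) a b) (S (x z) a b)"
  unfolding S_def using assms x_nonopposite
  by (intro regv_one_minus polynomial_fun.add x_poly) (auto simp: nonopposite_def)

lemma reg_Al:
  assumes "set as \<subseteq> U" "distinct as" "nonopposite (x z) (set as)"
  shows "reg (\<lambda>t. Al (x t) as) (Al (x z) as)"
  using assms
proof (induction as)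
  case (Cons a as)
  have "reg (\<lambda>t. rowS (x t) a as) (rowS (x z) a as)"
    unfolding rowS_def using Cons.prems by (intro regv_prod_list reg_S) (auto simp: nonopposite_def)
  with Cons show ?case by (auto intro!: regv_mult simp: nonopposite_def)
qed (auto intro: regv_const)

lemma reg_CS:
  assumes "set as \<subseteq> U" "set ps \<subseteq> U" "\<forall>a\<in>set as. \<forall>p\<in>set ps. a \<noteq> p \<and> x z a + x z p \<noteq> 0"
  shows "reg (\<lambda>t. CS (x t) as ps) (CS (x z) as ps)"
  unfolding CS_def colS_def using assms by (intro regv_prod_list reg_S) auto

text \<open>Since \<open>P\<close> acts by \<open>\<epsilon>\<close> on a line and by \<open>\<delta> \<noteq> \<epsilon>\<close> on the image of \<open>Q\<close>, the fused line
  kills \<open>Q\<close>; this removes all the singular factors.\<close>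

lemma line_Q:
  assumes L: "line \<epsilon> y L" "distinct L" and ab: "a \<in> set L" "b \<in> set L" "a \<noteq> b"
  shows "Bl y L * Q a b = 0" "Q a b * Bl y L = 0"
proof -
  have z: "X = 0" if "\<epsilon> *\<^sub>C X = \<delta> *\<^sub>C X" for X :: 'r
  proof -
    have "(\<epsilon> - \<delta>) *\<^sub>C X = (\<epsilon> - \<delta>) *\<^sub>C 0" using that by (simp add: cs_diff_left)
    then show ?thesis using eps_delta by (subst (asm) cs_cancel) auto
  qed
  note HP = line_P[OF L line_inj[OF L] ab]
  have "Bl y L * P a b * Q a b = \<delta> *\<^sub>C (Bl y L * Q a b)" by (simp add: P_Q ab mult.assoc)
  then show "Bl y L * Q a b = 0" by (intro z) (simp add: HP)
  have "Q a b * P a b * Bl y L = \<delta> *\<^sub>C (Q a b * Bl y L)" by (simp add: Q_P ab)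
  then show "Q a b * Bl y L = 0" by (intro z) (simp add: HP mult.assoc)
qed

text \<open>Each factor acts as 1 because its contraction is killed, whatever the parameters
  \<open>w\<close> are and even where a denominator is zero.\<close>

lemma line_rowS:
  assumes "line \<epsilon> y L" "distinct L" "a \<in> set L" "set bs \<subseteq> set L" "a \<notin> set bs"
  shows "Bl y L * rowS w a bs = Bl y L \<and> rowS w a bs * Bl y L = Bl y L"
  using assms(4,5)
proof (induction bs)
  case (Cons b bs)
  have S: "Bl y L * S w a b = Bl y L" "S w a b * Bl y L = Bl y L"
    using line_Q[of y L a b] assms Cons.prems by (auto simp: S_def left_diff_distrib right_diff_distrib)
  have IH: "Bl y L * rowS w a bs = Bl y L" "rowS w a bs * Bl y L = Bl y L"
    using Cons by auto
  have "Bl y L * rowS w a (b # bs) = Bl y L" by (simp add: S IH flip: mult.assoc)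
  moreover have "rowS w a (b # bs) * Bl y L = Bl y L" by (simp add: S IH mult.assoc)
  ultimately show ?case ..
qed auto

lemma line_Al:
  assumes "line \<epsilon> y L" "distinct L" "set as \<subseteq> set L" "distinct as"
  shows "Bl y L * Al w as = Bl y L \<and> Al w as * Bl y L = Bl y L"
  using assms(3,4)
proof (induction as)
  case (Cons a as)
  have S: "Bl y L * rowS w a as = Bl y L" "rowS w a as * Bl y L = Bl y L"
    using line_rowS[of y L a as w] assms Cons.prems by auto
  have IH: "Bl y L * Al w as = Bl y L" "Al w as * Bl y L = Bl y L"
    using Cons by auto
  have "Bl y L * Al w (a # as) = Bl y L" by (simp add: S IH flip: mult.assoc)
  moreover have "Al w (a # as) * Bl y L = Bl y L" by (simp add: S IH mult.assoc)
  ultimately show ?case ..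
qed auto

text \<open>The multipliers express divisibility of the value of \<open>A * B\<close> by the value
  \<open>b\<close> of \<open>B\<close> alone; \<open>b\<close> is matched with the operator of the
  tableau later.\<close>

definition good :: "nat list \<Rightarrow> 'r \<Rightarrow> bool" where
  "good ks b \<longleftrightarrow> reg (\<lambda>t. Bl (x t) ks) b \<and>
     (\<exists>y X X'. reg (\<lambda>t. Al (x t) ks * Bl (x t) ks) y \<and> y = X * b \<and> y = b * X')"

text \<open>The fused line \<open>?H\<close> acts on \<open>B\<close> from either side by
  \<open>fact (length L)\<close>, so it may be inserted next to \<open>B\<close>. Carried through
  \<open>A\<close> by \<open>Al_Bl\<close> it meets the factors of \<open>A\<close> inside
  \<open>L\<close> and absorbs them; what remains is regular. \<open>L\<close> may be empty, for the
  case that \<open>A\<close> has no singular factor.\<close>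

lemma good_base:
  assumes ks: "distinct (L @ ms)" "set (L @ ms) \<subseteq> U" and L: "all_line L"
    and b: "reg (\<lambda>t. Bl (x t) (L @ ms)) b"
    and nonop: "\<And>k l. k \<in> set (L @ ms) \<Longrightarrow> l \<in> set (L @ ms) \<Longrightarrow> k \<noteq> l \<Longrightarrow> \<not> (k \<in> set L \<and> l \<in> set L) \<Longrightarrow> x z k + x z l \<noteq> 0"
  shows "good (L @ ms) b"
proof -
  define c where "c = (1 / fact (length L) :: complex)"
  let ?A = "\<lambda>t. Al (x t) (L @ ms)" and ?B = "\<lambda>t. Bl (x t) (L @ ms)" and ?H = "\<lambda>t. Bl (x t) L"
  let ?X = "\<lambda>t. c *\<^sub>C (?H t * CS (x t) (rev L) ms * Al (x t) ms)"
  let ?X' = "\<lambda>t. c *\<^sub>C (Al (x t) (rev ms) * CS (x t) (rev ms) L * ?H t)"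
  have di: "distinct L" "distinct ms" "distinct (rev L @ ms)" "distinct (rev ms @ L)" using ks(1) by auto
  have nonop': "x z k + x z l \<noteq> 0" "x z l + x z k \<noteq> 0" "k \<noteq> l" if "k \<in> set L" "l \<in> set ms" for k l
    using nonop[of k l] nonop[of l k] that ks(1) by auto
  have nonop'': "nonopposite (x z) (set ms)" "nonopposite (x z) (set (rev ms))"
    using nonop ks(1) by (auto simp: nonopposite_def disjoint_iff)
  have H: "reg ?H (?H z)"
    using ks L by (intro reg_Bl line_inj) (auto simp: all_line_def)
  have "reg (\<lambda>t. c *\<^sub>C (?H t * CS (x t) (rev L) ms * Al (x t) ms)) (?X z)"
    using ks(2) di nonop' nonop'' by (intro regv_scale[where q = "\<lambda>_. c"] polynomial_fun.const regv_mult H reg_CS reg_Al) auto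
  from regv_mult[OF this b] have 1: "reg (\<lambda>t. ?X t * ?B t) (?X z * b)" .
  have "reg (\<lambda>t. c *\<^sub>C (Al (x t) (rev ms) * CS (x t) (rev ms) L * ?H t)) (?X' z)"
    using ks(2) di nonop' nonop'' by (intro regv_scale[where q = "\<lambda>_. c"] polynomial_fun.const regv_mult H reg_CS reg_Al) auto
  from regv_mult[OF b this] have 2: "reg (\<lambda>t. ?B t * ?X' t) (b * ?X' z)" .
  have eq: "?A t * ?B t = ?X t * ?B t \<and> ?A t * ?B t = ?B t * ?X' t" if t: "t \<in> G" for t
  proof -
    have ln: "line \<epsilon> (x t) L" using L t by (simp add: all_line_def)
    have inj: "inj_on (x t) (set (L @ ms))" "inj_on (x t) (set L)"
      using x_inj'[OF t] ks(2) by auto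
    have no: "nonopposite (x t) (set (L @ ms))" by (rule x_nonopposite'[OF t ks(2)])
    then have no': "nonopposite (x t) (set (rev ms @ L))" by (simp add: Un_commute)
    have HP: "?H t * P a b = \<epsilon> *\<^sub>C ?H t" if "a \<in> set L" "b \<in> set L" "a \<noteq> b" for a b
      using line_P[OF ln di(1) inj(2) that] by simp
    have HH: "?H t * ?H t = fact (length L) *\<^sub>C ?H t"
      using HP ln di(1) by (rule absorb_Bl)
    have HB: "?H t * ?B t = fact (length L) *\<^sub>C ?B t"
      using HH by (simp add: Bl_append[OF ks(1)] flip: mult.assoc)
    have BH: "?B t * ?H t = fact (length L) *\<^sub>C ?B t"
    proof (cases "L = []")
      case False
      have "?H t * prodT (x t) L ps = prodT (x t) L ps * ?H t" if "set ps \<inter> set L = {}" for ps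
        using that by (induction ps) (use di(1) in \<open>auto intro!: comm_mult T_commute_Bl[symmetric]\<close>)
      from this[of "rev ms"] have "?B t = Bl (x t) ms * prodT (x t) L (rev ms) * ?H t"
        using Bl_line_append(2)[OF ln ks(1) inj(1) False] ks(1) by (simp add: Int_commute mult.assoc)
      then show ?thesis using HH by (simp add: mult.assoc)
    qed simp
    have AH: "?A t * ?H t = ?H t * CS (x t) (rev L) ms * Al (x t) ms"
      using Al_Bl[of "[]" L ms "x t"] ks inj(2) no line_Al[OF ln di(1), of "rev L" "x t"]
      by (simp add: Al_append[OF di(3)] di(1) flip: mult.assoc)
    have "Al (x t) (rev ms @ L) * ?H t = ?H t * Al (x t) (rev ms @ rev L)"
      using Al_Bl[of "rev ms" L "[]" "x t"] inj(2) no' di by simp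
    then have HA: "?H t * Al (x t) (rev ms @ rev L) = Al (x t) (rev ms) * CS (x t) (rev ms) L * ?H t"
      using line_Al[OF ln di(1), of L "x t"] di by (simp add: Al_append[OF di(4)] mult.assoc)
    have AB: "?A t * ?B t = ?B t * Al (x t) (rev ms @ rev L)"
      using Al_Bl[of "[]" "L @ ms" "[]" "x t"] ks inj(1) no by simp
    have "fact (length L) *\<^sub>C (?A t * ?B t) = ?A t * ?H t * ?B t"
      by (simp add: HB mult.assoc)
    then have A1: "?A t * ?B t = ?X t * ?B t"
      unfolding AH by (subst (asm) cs_eq_iff) (auto simp: c_def)
    have "fact (length L) *\<^sub>C (?A t * ?B t) = ?B t * (?H t * Al (x t) (rev ms @ rev L))"
      by (simp add: AB BH flip: mult.assoc)
    then have A2: "?A t * ?B t = ?B t * ?X' t"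
      unfolding HA by (subst (asm) cs_eq_iff) (auto simp: c_def)
    show ?thesis using A1 A2 by blast
  qed
  have "reg (\<lambda>t. ?A t * ?B t) (?X z * b)" "reg (\<lambda>t. ?A t * ?B t) (b * ?X' z)"
    by (rule regv_cong[OF 1], erule eq[THEN conjunct1, symmetric])
      (rule regv_cong[OF 2], erule eq[THEN conjunct2, symmetric])
  moreover from this have "?X z * b = b * ?X' z" by (rule reg_unique)
  ultimately show ?thesis using b unfolding good_def
    by (intro conjI exI[of _ "?X z * b"] exI[of _ "?X z"] exI[of _ "?X' z"]) (assumption | rule refl)+
qed

text \<open>\<open>R\<close> at \<open>z\<close> is invertible with inverse \<open>kap a b\<close>
  times \<open>R x b a\<close>, so the multipliers are conjugated along with the value.\<close>

lemma good_swap: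
  assumes ks: "distinct (xs @ [a, b] @ ys)" "set (xs @ [a, b] @ ys) \<subseteq> U" and far: "far a b"
    and good: "good (xs @ [b, a] @ ys) v"
  shows "good (xs @ [a, b] @ ys) (kap a b *\<^sub>C (R (x z) a b * v * R (x z) a b))"
proof -
  let ?ks = "xs @ [a, b] @ ys" and ?ks' = "xs @ [b, a] @ ys" and ?R = "R (x z) a b"
  let ?v = "kap a b *\<^sub>C (?R * v * ?R)"
  have ne: "a \<noteq> b" using ks by auto
  obtain y X X' where y: "reg (\<lambda>t. Al (x t) ?ks' * Bl (x t) ?ks') y" "y = X * v" "y = v * X'"
    and v: "reg (\<lambda>t. Bl (x t) ?ks') v"
    using good unfolding good_def by (elim conjE exE) (rule that)
  have 1: "reg (\<lambda>t. Bl (x t) ?ks) ?v"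
    by (rule reg_swap[OF ks far v]) (rule swap_identity[OF ks])
  have "((x t a - x t b)\<^sup>2 - 1) *\<^sub>C (Al (x t) ?ks * Bl (x t) ?ks)
      = (x t a - x t b)\<^sup>2 *\<^sub>C (R (x t) a b * (Al (x t) ?ks' * Bl (x t) ?ks') * R (x t) a b)"
    if t: "t \<in> G" for t
  proof -
    have Al: "Al (x t) ?ks * R (x t) a b = R (x t) a b * Al (x t) ?ks'"
      using ks x_diff[OF t, of a b] x_nonopposite'[OF t ks(2)] by (intro Al_swap) auto
    have "((x t a - x t b)\<^sup>2 - 1) *\<^sub>C (Al (x t) ?ks * Bl (x t) ?ks)
        = Al (x t) ?ks * (((x t a - x t b)\<^sup>2 - 1) *\<^sub>C Bl (x t) ?ks)"
      by simp
    also have "\<dots> = (x t a - x t b)\<^sup>2 *\<^sub>C ((Al (x t) ?ks * R (x t) a b) * Bl (x t) ?ks' * R (x t) a b)"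
      unfolding swap_identity[OF ks t] by (simp add: mult.assoc)
    finally show ?thesis unfolding Al by (simp add: mult.assoc)
  qed
  then have 2: "reg (\<lambda>t. Al (x t) ?ks * Bl (x t) ?ks) (kap a b *\<^sub>C (?R * y * ?R))"
    by (rule reg_swap[OF ks far y(1)])
  note inv = R_inverse[OF far ne]
  have "kap a b *\<^sub>C (?R * y * ?R) = (kap a b *\<^sub>C (?R * X * R (x z) b a)) * ?v"
    using arg_cong[OF inv(2), of "\<lambda>w. ?R * X * w * (v * ?R)"] by (simp add: y(2) mult.assoc)
  moreover have "kap a b *\<^sub>C (?R * y * ?R) = ?v * (kap a b *\<^sub>C (R (x z) b a * X' * ?R))"
    using arg_cong[OF inv(1), of "\<lambda>w. ?R * v * w * (X' * ?R)"] by (simp add: y(3) mult.assoc)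
  ultimately show ?thesis using 1 2 unfolding good_def
    by (intro conjI exI[of _ "kap a b *\<^sub>C (?R * y * ?R)"] exI[of _ "kap a b *\<^sub>C (?R * X * R (x z) b a)"]
      exI[of _ "kap a b *\<^sub>C (R (x z) b a * X' * ?R)"]) assumption+
qed

end

section \<open>Labelled boxes\<close>

text \<open>The box with label \<open>k\<close> is the \<open>ps k\<close>-th one on the line \<open>ln k\<close>; the lines are the rows for
  the symplectic and the columns for the orthogonal groups.\<close>

locale labels =
  fixes n :: nat and ln ps :: "nat \<Rightarrow> nat"
  assumes label_mono: "k \<in> {1..n} \<Longrightarrow> l \<in> {1..n} \<Longrightarrow> ln k \<le> ln l \<Longrightarrow> ps k \<le> ps l \<Longrightarrow> k \<le> l"
    and label_convex: "k \<in> {1..n} \<Longrightarrow> l \<in> {1..n} \<Longrightarrow> ln k \<le> i \<Longrightarrow> i \<le> ln l \<Longrightarrow> ps k \<le> j \<Longrightarrow> j \<le> ps l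
      \<Longrightarrow> \<exists>m\<in>{1..n}. ln m = i \<and> ps m = j"
begin

lemma label_eq: "k \<in> {1..n} \<Longrightarrow> l \<in> {1..n} \<Longrightarrow> ln k = ln l \<Longrightarrow> ps k = ps l \<Longrightarrow> k = l"
  using label_mono by (metis le_antisym order_refl)

lemma label_same_line:
  "k \<in> {1..n} \<Longrightarrow> l \<in> {1..n} \<Longrightarrow> ln k = ln l \<Longrightarrow> k < l \<longleftrightarrow> ps k < ps l"
  using label_mono by (metis label_eq le_antisym less_le linorder_le_less_linear)

section \<open>Reading the labels line by line\<close>

definition lineL :: "nat \<Rightarrow> nat list" where
  "lineL i = filter (\<lambda>k. ln k = i) [1..<Suc n]"

definition linesL :: "nat \<Rightarrow> nat \<Rightarrow> nat list list" where
  "linesL i B = filter (\<lambda>L. L \<noteq> []) (map lineL [i..<B])"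

lemma set_lineL: "set (lineL i) = {k \<in> {1..n}. ln k = i}"
  by (auto simp: lineL_def)

lemma sorted_lineL: "sorted_wrt (<) (lineL i)"
  unfolding lineL_def by (intro sorted_wrt_filter sorted_wrt_upt)

lemma distinct_lineL: "distinct (lineL i)"
  by (simp add: lineL_def)

lemma concat_filter_nonempty: "concat (filter (\<lambda>L. L \<noteq> []) xss) = concat xss"
  by (induction xss) auto

lemma concat_linesL: "concat (linesL i B) = concat (map lineL [i..<B])"
  by (simp add: linesL_def concat_filter_nonempty)

lemma set_linesL: "set (concat (linesL i B)) = {k \<in> {1..n}. i \<le> ln k \<and> ln k < B}"
  by (auto simp: concat_linesL set_lineL)

lemma linesL_Cons:
  "i < B \<Longrightarrow> linesL i B = (if lineL i = [] then linesL (Suc i) B else lineL i # linesL (Suc i) B)"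
  by (simp add: linesL_def upt_conv_Cons)

lemma distinct_linesL: "distinct (concat (linesL i B))"
proof (induction "B - i" arbitrary: i)
  case (Suc d)
  then have "distinct (concat (linesL (Suc i) B))" by simp
  then show ?case
    using Suc.hyps(2) set_linesL[of "Suc i" B] by (auto simp: linesL_Cons distinct_lineL set_lineL)
qed (simp add: linesL_def)

text \<open>Boxes in this position are incomparable, so a standard tableau may list them either way,
  and their contents differ by at least two.\<close>

definition inverted :: "nat \<Rightarrow> nat \<Rightarrow> bool" where
  "inverted a b \<longleftrightarrow> a \<in> {1..n} \<and> b \<in> {1..n} \<and> ln b < ln a \<and> ps a < ps b"

lemma invertedI: "a \<in> {1..n} \<Longrightarrow> b \<in> {1..n} \<Longrightarrow> a < b \<Longrightarrow> ln b < ln a \<Longrightarrow> inverted a b"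
  using label_mono[of b a] by (auto simp: inverted_def not_le[symmetric])

context
  fixes Pr :: "nat list \<Rightarrow> bool"
  assumes step: "\<And>xs a b ys. Pr (xs @ [b, a] @ ys) \<Longrightarrow> inverted a b \<Longrightarrow> Pr (xs @ [a, b] @ ys)"
begin

lemma reach_move: "Pr (xs @ F @ [k] @ ys) \<Longrightarrow> \<forall>f\<in>set F. inverted k f \<Longrightarrow> Pr (xs @ [k] @ F @ ys)"
proof (induction F arbitrary: xs)
  case (Cons f F)
  have "Pr ((xs @ [f]) @ [k] @ F @ ys)" using Cons by (intro Cons.IH) auto
  then show ?case using step[of xs f k "F @ ys"] Cons.prems by simp
qed simp

text \<open>Going through \<open>ks\<close>, a label on another line has to jump over the labels of
  line \<open>i\<close> behind it. These are larger, so every exchange concerns an inverted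
  pair.\<close>

lemma reach_line:
  assumes "Pr (xs @ filter (\<lambda>k. ln k = i) ks @ filter (\<lambda>k. ln k \<noteq> i) ks)"
    and "sorted_wrt (<) ks" "set ks \<subseteq> {1..n}" "\<forall>k\<in>set ks. i \<le> ln k"
  shows "Pr (xs @ ks)"
  using assms
proof (induction ks arbitrary: xs)
  case (Cons k ks)
  let ?F = "filter (\<lambda>k. ln k = i) ks" and ?R = "filter (\<lambda>k. ln k \<noteq> i) ks"
  have "Pr ((xs @ [k]) @ ?F @ ?R)"
  proof (cases "ln k = i")
    case False
    then have "Pr (xs @ ?F @ [k] @ ?R)" using Cons.prems by simp
    moreover have "\<forall>f\<in>set ?F. inverted k f"
      using Cons.prems False by (auto intro!: invertedI simp: le_less)
    ultimately show ?thesis using reach_move[of xs ?F k ?R] by simp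
  qed (use Cons.prems in simp)
  then have "Pr ((xs @ [k]) @ ks)" using Cons.prems by (intro Cons.IH) auto
  then show ?case by simp
qed simp

lemma reach_lines:
  assumes "Pr (xs @ concat (map (\<lambda>j. filter (\<lambda>k. ln k = j) ks) [i..<B]))"
    and "sorted_wrt (<) ks" "set ks \<subseteq> {1..n}" "\<forall>k\<in>set ks. i \<le> ln k \<and> ln k < B"
  shows "Pr (xs @ ks)"
  using assms
proof (induction "B - i" arbitrary: i xs ks)
  case 0
  then have "ks = []" by (cases ks) auto
  then show ?case using 0 by simp
next
  case (Suc d)
  let ?F = "filter (\<lambda>k. ln k = i) ks" and ?R = "filter (\<lambda>k. ln k \<noteq> i) ks"
  have iB: "i < B" using Suc.hyps(2) by simp
  have "map (\<lambda>j. filter (\<lambda>k. ln k = j) ks) [Suc i..<B] = map (\<lambda>j. filter (\<lambda>k. ln k = j) ?R) [Suc i..<B]"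
    by (auto intro!: filter_cong)
  then have pr: "Pr ((xs @ ?F) @ concat (map (\<lambda>j. filter (\<lambda>k. ln k = j) ?R) [Suc i..<B]))"
    using Suc.prems(1) iB by (simp only: upt_conv_Cons list.map concat.simps append_assoc)
  have "d = B - Suc i" using Suc.hyps(2) by simp
  moreover note pr
  moreover have "sorted_wrt (<) ?R" using Suc.prems(2) by (rule sorted_wrt_filter)
  moreover have "set ?R \<subseteq> {1..n}" using Suc.prems(3) by auto
  moreover have "\<forall>k\<in>set ?R. Suc i \<le> ln k \<and> ln k < B" using Suc.prems(4) by fastforce
  ultimately have "Pr ((xs @ ?F) @ ?R)"
    by (rule Suc.hyps(1)[of "Suc i"])
  then show ?case using Suc.prems(2-4) by (intro reach_line[of xs i ks]) auto
qed

text \<open>A sort by lines, run backwards, so that properties are carried from the line reading to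
  the natural order and every exchange is between inverted neighbours.\<close>

lemma reach:
  assumes "Pr (concat (linesL i B))" "\<forall>k\<in>{1..n}. i \<le> ln k \<and> ln k < B"
  shows "Pr [1..<Suc n]"
proof -
  have lineL: "lineL = (\<lambda>j. filter (\<lambda>k. ln k = j) [1..<Suc n])"
    by (simp add: lineL_def fun_eq_iff)
  have "Pr ([] @ [1..<Suc n])"
    by (rule reach_lines[of "[]" "[1..<Suc n]" i B])
      (use assms lineL in \<open>simp_all add: concat_linesL sorted_wrt_upt atLeastLessThanSuc_atLeastAtMost del: upt_Suc\<close>)
  then show ?thesis by simp
qed

end

end

locale labelled_shape = shape P \<epsilon> V G z x "{1..n}" + labels n ln ps
  for P :: "nat \<Rightarrow> nat \<Rightarrow> 'r::calg" and \<epsilon> V G z x n ln ps +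
  fixes C :: complex
  assumes x_z: "k \<in> {1..n} \<Longrightarrow> x z k = C + \<epsilon> * (of_nat (ps k) - of_nat (ln k))"
    and x_line: "k \<in> {1..n} \<Longrightarrow> l \<in> {1..n} \<Longrightarrow> ln k = ln l \<Longrightarrow> ps l = Suc (ps k) \<Longrightarrow> t \<in> G \<Longrightarrow> x t l = x t k + \<epsilon>"
begin

lemma eps_cancel: "\<epsilon> * u = \<epsilon> * v \<longleftrightarrow> u = v"
  using eps_nz by simp

lemma eps_cases: "\<epsilon> = 1 \<or> \<epsilon> = -1"
  using eps square_eq_1_iff by blast

text \<open>By convexity a gap would be filled by a box of the line, whose label would lie strictly
  between two consecutive ones.\<close>

lemma lineL_succ:
  assumes "Suc j < length (lineL i)"
  shows "ps (lineL i ! Suc j) = Suc (ps (lineL i ! j))"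
proof -
  let ?a = "lineL i ! j" and ?b = "lineL i ! Suc j"
  have ab: "?a \<in> set (lineL i)" "?b \<in> set (lineL i)" using assms by auto
  then have ab': "?a \<in> {1..n}" "?b \<in> {1..n}" "ln ?a = i" "ln ?b = i" by (auto simp: set_lineL)
  have lt: "?a < ?b" using sorted_lineL[of i] assms by (simp add: sorted_wrt_iff_nth_less)
  then have 1: "ps ?a < ps ?b" using label_same_line[of ?a ?b] ab' by simp
  show ?thesis
  proof (rule ccontr)
    assume "\<not> ?thesis"
    with 1 have "Suc (ps ?a) < ps ?b" by simp
    then obtain m where m: "m \<in> {1..n}" "ln m = i" "ps m = Suc (ps ?a)"
      using label_convex[of ?a ?b i "Suc (ps ?a)"] ab' by auto
    then have "?a < m" "m < ?b" using label_same_line[of _ m] label_same_line[of m] ab' \<open>Suc (ps ?a) < ps ?b\<close> by auto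
    moreover have "m \<in> set (lineL i)" using m by (simp add: set_lineL)
    then obtain q where "q < length (lineL i)" "m = lineL i ! q" by (auto simp: in_set_conv_nth)
    ultimately have "j < q" "q < Suc j"
      using sorted_lineL[of i] assms
      by (auto simp: sorted_wrt_iff_nth_less) (metis linorder_neqE_nat less_irrefl less_trans Suc_lessD)+
    then show False by simp
  qed
qed

lemma all_line_lineL: "all_line (lineL i)"
  unfolding all_line_def line_def successively_conv_nth
proof (intro ballI allI impI)
  fix t j assume t: "t \<in> insert z G" and j: "Suc j < length (lineL i)"
  have "lineL i ! j \<in> set (lineL i)" "lineL i ! Suc j \<in> set (lineL i)" using j by auto
  then have "lineL i ! j \<in> {1..n}" "lineL i ! Suc j \<in> {1..n}" "ln (lineL i ! j) = i" "ln (lineL i ! Suc j) = i"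
    by (auto simp: set_lineL)
  then show "x t (lineL i ! Suc j) = x t (lineL i ! j) + \<epsilon>"
    using t x_line[of "lineL i ! j" "lineL i ! Suc j" t] lineL_succ[OF j] by (auto simp: x_z algebra_simps)
qed

text \<open>Equal parameters put \<open>p\<close> at a position beyond the end of line
  \<open>i\<close>, on a later line. By convexity line \<open>i\<close> would have a box at that
  position too.\<close>

lemma x_last_lineL:
  assumes L: "lineL i \<noteq> []" and p: "p \<in> {1..n}" "i < ln p"
  shows "x z (last (lineL i)) \<noteq> x z p"
proof
  let ?a = "last (lineL i)"
  assume eq: "x z ?a = x z p"
  have a: "?a \<in> {1..n}" "ln ?a = i" using last_in_set[OF L] by (auto simp: set_lineL)
  have "of_nat (ps ?a + ln p) = (of_nat (ps p + i) :: complex)"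
  proof -
    have "\<epsilon> * (of_nat (ps ?a) - of_nat i) = \<epsilon> * (of_nat (ps p) - of_nat (ln p))"
      using eq a p by (simp add: x_z)
    then show ?thesis unfolding eps_cancel by (simp add: algebra_simps)
  qed
  then have "ps ?a + ln p = ps p + i" by (simp only: of_nat_eq_iff)
  then have lt: "ps ?a < ps p" using p by simp
  then obtain m where m: "m \<in> {1..n}" "ln m = i" "ps m = ps p"
    using label_convex[of ?a p i "ps p"] a p by auto
  then have "?a < m" using label_same_line[of ?a m] a lt by simp
  moreover have "m \<in> set (lineL i)" using m by (simp add: set_lineL)
  then obtain q where "q < length (lineL i)" "m = lineL i ! q" by (auto simp: in_set_conv_nth)
  then have "m \<le> ?a" using sorted_lineL[of i] L
    by (cases "q = length (lineL i) - 1") (auto simp: last_conv_nth sorted_wrt_iff_nth_less intro!: less_imp_le)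
  ultimately show False by simp
qed

lemma lines_ok_linesL: "lines_ok (linesL i B)"
proof (induction "B - i" arbitrary: i)
  case 0
  then have "linesL i B = []" by (simp add: linesL_def)
  then show ?case by (simp only: lines_ok.simps)
next
  case (Suc d)
  then have IH: "lines_ok (linesL (Suc i) B)" by simp
  have d: "distinct (concat (linesL i B))" by (rule distinct_linesL)
  show ?case
  proof (cases "lineL i = []")
    case False
    then have eq: "linesL i B = lineL i # linesL (Suc i) B" using Suc.hyps(2) by (simp add: linesL_Cons)
    have "x z (last (lineL i)) \<noteq> x z p" if "p \<in> set (concat (linesL (Suc i) B))" for p
    proof (rule x_last_lineL[OF False])
      show "p \<in> {1..n}" "i < ln p" using that unfolding set_linesL by auto
    qed
    then show ?thesis
      using IH False d all_line_lineL set_lineL[of i] unfolding eq by (subst lines_ok.simps) auto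
  qed (use IH Suc.hyps(2) in \<open>simp add: linesL_Cons\<close>)
qed

text \<open>Both the line and the position contribute at least one to the difference of the
  contents, with the same sign.\<close>

lemma inverted_far:
  assumes "inverted a b"
  shows "far a b"
proof -
  have ab: "a \<in> {1..n}" "b \<in> {1..n}" "ln b < ln a" "ps a < ps b" using assms by (auto simp: inverted_def)
  define k :: int where "k = (int (ps a) - int (ps b)) + (int (ln b) - int (ln a))"
  have "k \<le> -2" using ab by (simp add: k_def)
  then have k: "k \<notin> {0, 1, -1}" by auto
  have "x z a - x z b = \<epsilon> * of_int k" using ab by (simp add: x_z k_def algebra_simps)
  moreover have "(of_int k :: complex) \<notin> {0, 1, -1}"
  proof -
    have "(of_int k :: complex) \<noteq> of_int 0" "(of_int k :: complex) \<noteq> of_int 1"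
      "(of_int k :: complex) \<noteq> of_int (- 1)"
      using k by (simp_all only: of_int_eq_iff) auto
    then show ?thesis by simp
  qed
  then have "(of_int k :: complex) \<notin> {0, 1, -1}" "- (of_int k :: complex) \<notin> {0, 1, -1}"
    by (auto simp: minus_equation_iff[of _ 1] minus_equation_iff[of _ "-1"])
  ultimately show ?thesis using eps_cases by (auto simp: far_def)
qed

end

section \<open>Labels of a straight shape\<close>

locale straight_labels = labels +
  assumes label_pos: "k \<in> {1..n} \<Longrightarrow> 1 \<le> ln k \<and> 1 \<le> ps k"
    and label_down: "k \<in> {1..n} \<Longrightarrow> 1 \<le> i \<Longrightarrow> i \<le> ln k \<Longrightarrow> 1 \<le> j \<Longrightarrow> j \<le> ps k \<Longrightarrow> \<exists>m\<in>{1..n}. ln m = i \<and> ps m = j"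
begin

lemma hd_lineL:
  assumes "lineL i \<noteq> []"
  shows "hd (lineL i) \<in> {1..n}" "ln (hd (lineL i)) = i" "ps (hd (lineL i)) = 1" "1 \<le> i"
proof -
  let ?a = "hd (lineL i)"
  have "?a \<in> set (lineL i)" using assms by simp
  then show a: "?a \<in> {1..n}" "ln ?a = i" by (auto simp: set_lineL)
  show "1 \<le> i" using label_pos[OF a(1)] a(2) by simp
  then obtain m where m: "m \<in> {1..n}" "ln m = i" "ps m = 1"
    using label_down[OF a(1), of i 1] a label_pos[OF a(1)] by auto
  then have "m \<in> set (lineL i)" by (simp add: set_lineL)
  then have "?a \<le> m" using sorted_lineL[of i] by (cases "lineL i") auto
  moreover have "m \<le> ?a" using label_mono[of m ?a] m a label_pos[OF a(1)] by simp
  ultimately show "ps ?a = 1" using m by simp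
qed

lemma lineL_nonempty_down: "lineL i \<noteq> [] \<Longrightarrow> 1 \<le> j \<Longrightarrow> j \<le> i \<Longrightarrow> lineL j \<noteq> []"
  using hd_lineL[of i] label_down[of "hd (lineL i)" j 1] set_lineL[of j] by fastforce

lemma linesL_empty: "lineL i = [] \<Longrightarrow> 1 \<le> i \<Longrightarrow> linesL i B = []"
  using lineL_nonempty_down by (fastforce simp: linesL_def filter_empty_conv)

end

locale positive_shape =
  labelled_shape P \<epsilon> V G z x n ln ps C
  for P :: "nat \<Rightarrow> nat \<Rightarrow> 'r::calg" and \<epsilon> V G z x n ln ps C +
  assumes ln_pos: "k \<in> {1..n} \<Longrightarrow> 1 \<le> ln k"
begin

definition ln_bound :: nat where
  "ln_bound = Suc (Max (ln ` {1..n}))"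

lemma labels_list_props:
  "distinct (concat (linesL 1 ln_bound))"
  "set (concat (linesL 1 ln_bound)) = {1..n}"
  "\<forall>k\<in>{1..n}. 1 \<le> ln k \<and> ln k < ln_bound"
proof -
  show 1: "\<forall>k\<in>{1..n}. 1 \<le> ln k \<and> ln k < ln_bound"
    using ln_pos by (auto simp: ln_bound_def less_Suc_eq_le)
  show "distinct (concat (linesL 1 ln_bound))" by (rule distinct_linesL)
  show "set (concat (linesL 1 ln_bound)) = {1..n}"
    unfolding set_linesL using 1 by auto
qed

text \<open>The version of \<open>reach\<close> used for the values: it keeps track of the
  distinctness of the list and replaces inverted pairs by \<open>far\<close> ones.\<close>

lemma reach_all:
  assumes base: "Pr (concat (linesL 1 ln_bound))"
    and step: "\<And>xs a b ys. distinct (xs @ [a, b] @ ys) \<Longrightarrow> set (xs @ [a, b] @ ys) \<subseteq> {1..n} \<Longrightarrow> far a b \<Longrightarrow>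
      Pr (xs @ [b, a] @ ys) \<Longrightarrow> Pr (xs @ [a, b] @ ys)"
  shows "Pr [1..<Suc n]"
proof -
  define Pr' where "Pr' ks \<longleftrightarrow> distinct ks \<and> set ks \<subseteq> {1..n} \<and> Pr ks" for ks
  have "Pr' [1..<Suc n]"
  proof (rule reach[where Pr = Pr' and i = 1 and B = "ln_bound"])
    show "Pr' (xs @ [a, b] @ ys)" if "Pr' (xs @ [b, a] @ ys)" "inverted a b" for xs a b ys
      using that step[of xs a b ys] inverted_far[of a b] by (auto simp: Pr'_def)
    show "Pr' (concat (linesL 1 ln_bound))"
      using base labels_list_props by (simp add: Pr'_def)
  qed (rule labels_list_props)
  then show ?thesis by (simp add: Pr'_def)
qed

lemma hd_concat_linesL:
  assumes "straight_labels n ln ps" "linesL 1 ln_bound \<noteq> []"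
  shows "x z (hd (hd (linesL 1 ln_bound))) = C"
proof -
  interpret straight_labels n ln ps by fact
  have "1 < ln_bound"
    using assms(2) by (cases "1 < ln_bound") (simp_all add: linesL_def)
  moreover have ne: "lineL 1 \<noteq> []" using linesL_empty[of 1] assms(2) by blast
  ultimately have "hd (linesL 1 ln_bound) = lineL 1" by (simp add: linesL_Cons)
  then show ?thesis using hd_lineL[OF ne] by (simp add: x_z)
qed

lemma straight_linesL:
  assumes "straight_labels n ln ps" "1 \<le> i"
  shows "straight (linesL i B)"
proof -
  interpret straight_labels n ln ps by fact
  have hdx: "x z (hd (lineL i)) = C + \<epsilon> * (1 - of_nat i)" if "lineL i \<noteq> []" for i
    using hd_lineL[OF that] by (simp add: x_z)
  show ?thesis
    using assms(2)
  proof (induction "B - i" arbitrary: i)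
    case 0
    then have "linesL i B = []" by (simp add: linesL_def)
    then show ?case by (simp only: straight.simps)
  next
    case (Suc d)
    then have IH: "straight (linesL (Suc i) B)" by simp
    show ?case
    proof (cases "lineL i = []")
      case True
      then have "linesL i B = []" using linesL_empty Suc.prems by blast
      then show ?thesis by (simp only: straight.simps)
    next
      case False
      then have eq: "linesL i B = lineL i # linesL (Suc i) B" using Suc.hyps(2) by (simp add: linesL_Cons)
      show ?thesis
      proof (cases "linesL (Suc i) B")
        case Nil
        then show ?thesis by (simp only: eq straight.simps)
      next
        case (Cons L' Ls)
        have ne: "lineL (Suc i) \<noteq> []" using linesL_empty[of "Suc i" B] Cons by auto
        moreover have "Suc i < B" using Cons by (cases "Suc i < B") (simp_all add: linesL_def)
        ultimately have "L' = lineL (Suc i)" using Cons by (simp add: linesL_Cons)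
        have "x z (hd L') = x z (hd (lineL i)) - \<epsilon>"
          unfolding \<open>L' = lineL (Suc i)\<close> hdx[OF ne] hdx[OF False] by (simp add: algebra_simps)
        then show ?thesis using IH unfolding eq Cons by simp
      qed
    qed
  qed
qed

lemma JM_base:
  assumes "straight_labels n ln ps"
    and "\<forall>L\<in>set (linesL 1 ln_bound). \<forall>a\<in>set L. \<forall>b\<in>set L. a \<noteq> b \<longrightarrow> P a b * v = \<epsilon> *\<^sub>C v"
    and "sorted_wrt (\<lambda>L L'. \<forall>k\<in>set L'. Y L k * v = - (\<epsilon> *\<^sub>C v)) (linesL 1 ln_bound)"
  shows "JM_eigen (concat (linesL 1 ln_bound)) C v"
proof (cases "linesL 1 ln_bound = []")
  case False
  then show ?thesis
    using JM_of_relations[OF lines_ok_linesL straight_linesL[OF assms(1) order_refl] assms(2,3)]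
      hd_concat_linesL[OF assms(1)] by simp
qed (simp add: JM_eigen_def)

end

locale separated_labelled_shape =
  positive_shape P \<epsilon> V G z x n ln ps C + separated_shape P \<epsilon> V G z x "{1..n}"
  for P :: "nat \<Rightarrow> nat \<Rightarrow> 'r::calg" and \<epsilon> V G z x n ln ps C
begin

lemma ex_value: "\<exists>b. reg (\<lambda>t. Bl (x t) [1..<Suc n]) b"
proof (rule reach_all)
  show "\<exists>b. reg (\<lambda>t. Bl (x t) (concat (linesL 1 ln_bound))) b"
    using reg_lines[OF lines_ok_linesL] by blast
next
  fix xs a b ys
  assume *: "distinct (xs @ [a, b] @ ys)" "set (xs @ [a, b] @ ys) \<subseteq> {1..n}" "far a b"
    "\<exists>v. reg (\<lambda>t. Bl (x t) (xs @ [b, a] @ ys)) v"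
  then obtain v where v: "reg (\<lambda>t. Bl (x t) (xs @ [b, a] @ ys)) v" by blast
  show "\<exists>v. reg (\<lambda>t. Bl (x t) (xs @ [a, b] @ ys)) v"
    by (rule exI) (rule reg_swap[OF *(1-3) v], rule swap_identity[OF *(1,2)])
qed

text \<open>In the transported value, \<open>kap\<close> and the right factor \<open>R\<close> do
  not interfere with multiplication from the left, so the left factor alone changes the ordering of
  the Jucys-Murphy elements.\<close>

lemma straight_value:
  assumes "straight_labels n ln ps" and b: "reg (\<lambda>t. Bl (x t) [1..<Suc n]) b"
  shows "JM_eigen [1..<Suc n] C b"
proof -
  let ?Ls = "linesL 1 ln_bound"
  have base: "JM_eigen (concat ?Ls) C (bval ?Ls)"
    using JM_base[OF assms(1)] line_relations[OF lines_ok_linesL straight_linesL[OF assms(1) order_refl]] by blast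
  have "\<exists>b. reg (\<lambda>t. Bl (x t) [1..<Suc n]) b \<and> JM_eigen [1..<Suc n] C b"
  proof (rule reach_all)
    show "\<exists>b. reg (\<lambda>t. Bl (x t) (concat ?Ls)) b \<and> JM_eigen (concat ?Ls) C b"
      using base reg_lines[OF lines_ok_linesL] by blast
  next
    fix xs a b ys
    assume *: "distinct (xs @ [a, b] @ ys)" "set (xs @ [a, b] @ ys) \<subseteq> {1..n}" "far a b"
      "\<exists>v. reg (\<lambda>t. Bl (x t) (xs @ [b, a] @ ys)) v \<and> JM_eigen (xs @ [b, a] @ ys) C v"
    then obtain v where v: "reg (\<lambda>t. Bl (x t) (xs @ [b, a] @ ys)) v" "JM_eigen (xs @ [b, a] @ ys) C v" by blast
    have "JM_eigen (xs @ [a, b] @ ys) C (R (x z) a b * v)"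
      by (rule JM_eigen_swap[OF *(1,3) v(2)])
    then have "JM_eigen (xs @ [a, b] @ ys) C (kap a b *\<^sub>C (R (x z) a b * v * R (x z) a b))"
      by (auto simp: JM_eigen_def mult.commute simp flip: mult.assoc)
    then show "\<exists>v. reg (\<lambda>t. Bl (x t) (xs @ [a, b] @ ys)) v \<and> JM_eigen (xs @ [a, b] @ ys) C v"
      using reg_swap[OF *(1-3) v(1) swap_identity[OF *(1,2)]] by blast
  qed
  then show ?thesis using reg_unique[OF b] by blast
qed

end

locale brauer_labelled_shape =
  separated_labelled_shape P \<epsilon> V G z x n ln ps C + brauer_shape P Q \<epsilon> \<delta> V G z x "{1..n}"
  for P Q :: "nat \<Rightarrow> nat \<Rightarrow> 'r::calg" and \<epsilon> \<delta> V G z x n ln ps C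
begin

text \<open>\<open>sing\<close> says that the first line has to be fused before \<open>A\<close> can
  be evaluated; it stands for the orthogonal case, where sums of parameters in the first column may
  vanish. Otherwise the singular line is taken to be empty.\<close>

lemma ex_good:
  assumes nonop: "\<And>k l. k \<in> {1..n} \<Longrightarrow> l \<in> {1..n} \<Longrightarrow> k \<noteq> l \<Longrightarrow> \<not> (sing \<and> ln k = 1 \<and> ln l = 1) \<Longrightarrow> x z k + x z l \<noteq> 0"
  shows "\<exists>b. good [1..<Suc n] b"
proof (rule reach_all)
  let ?ks = "concat (linesL 1 ln_bound)"
  define L where "L = (if sing then lineL 1 else [])"
  define ms where "ms = (if sing then concat (linesL 2 ln_bound) else ?ks)"
  have 1: "?ks = L @ ms"
  proof (cases "1 < ln_bound")
    case False
    then have "set (lineL 1) = {}" using labels_list_props(3) unfolding set_lineL by auto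
    then have "lineL 1 = []" by simp
    then show ?thesis using False by (simp add: L_def ms_def linesL_def)
  qed (simp add: L_def ms_def linesL_Cons numeral_2_eq_2)
  have L: "all_line L"
    using all_line_lineL by (auto simp: L_def all_line_def line_def)
  have "good (L @ ms) (bval (linesL 1 ln_bound))"
  proof (rule good_base[OF _ _ L])
    show "distinct (L @ ms)" "set (L @ ms) \<subseteq> {1..n}" using labels_list_props unfolding 1 by auto
    show "reg (\<lambda>t. Bl (x t) (L @ ms)) (bval (linesL 1 ln_bound))"
      using reg_lines[OF lines_ok_linesL] unfolding 1[symmetric] .
    fix k l assume *: "k \<in> set (L @ ms)" "l \<in> set (L @ ms)" "k \<noteq> l" "\<not> (k \<in> set L \<and> l \<in> set L)"
    then have "k \<in> {1..n}" "l \<in> {1..n}" using labels_list_props(2) unfolding 1 by auto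
    moreover from this have "\<not> (sing \<and> ln k = 1 \<and> ln l = 1)" using *(4) by (auto simp: L_def set_lineL)
    ultimately show "x z k + x z l \<noteq> 0" using nonop *(3) by blast
  qed
  then show "\<exists>b. good ?ks b" unfolding 1 by blast
qed (use good_swap in blast)

end

section \<open>The group algebra as an algebra of operators\<close>

lemma Sym_id [simp]: "id \<in> Sym l"
  by (simp add: Sym_def permutes_id)

lemma Sym_comp [intro]: "s \<in> Sym l \<Longrightarrow> t \<in> Sym l \<Longrightarrow> s \<circ> t \<in> Sym l"
  by (simp add: Sym_def permutes_compose)

lemma Sym_inv [intro]: "s \<in> Sym l \<Longrightarrow> inv s \<in> Sym l"
  by (simp add: Sym_def permutes_inv)

lemma Sym_bij: "s \<in> Sym l \<Longrightarrow> bij s"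
  by (auto simp: Sym_def permutes_bij)

lemma Sym_mono: "m \<le> l \<Longrightarrow> Sym m \<subseteq> Sym l"
  by (auto simp: Sym_def intro: permutes_subset)

lemma Sym_transpose [intro]: "a \<in> {1..l} \<Longrightarrow> b \<in> {1..l} \<Longrightarrow> Transposition.transpose a b \<in> Sym l"
  by (simp add: Sym_def permutes_swap_id)

lemma finite_Sym [simp]: "finite (Sym l)"
  by (simp add: Sym_def finite_permutations)

lemma Sym_inv_o [simp]:
  assumes "s \<in> Sym l"
  shows "inv s \<circ> s = id" "s \<circ> inv s = id" "inv (inv s) = s" "inv s \<circ> (s \<circ> t) = t" "s \<circ> (inv s \<circ> t) = t"
    "t \<circ> s \<circ> inv s = t" "t \<circ> inv s \<circ> s = t"
proof -
  have b: "bij s" using assms by (rule Sym_bij)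
  then have i: "inv s \<circ> s = id" "s \<circ> inv s = id"
    by (simp_all add: bij_is_inj bij_is_surj surj_iff[THEN iffD1])
  show "inv s \<circ> s = id" "s \<circ> inv s = id" by (fact i)+
  show "inv (inv s) = s" using b by (rule inv_inv_eq)
  show "inv s \<circ> (s \<circ> t) = t" "s \<circ> (inv s \<circ> t) = t"
    by (simp_all only: o_assoc i id_o)
  show "t \<circ> s \<circ> inv s = t" "t \<circ> inv s \<circ> s = t"
    by (simp_all only: o_assoc[symmetric] i o_id)
qed

lemma Sym_inv_comp: "s \<in> Sym l \<Longrightarrow> t \<in> Sym l \<Longrightarrow> inv (s \<circ> t) = inv t \<circ> inv s"
  by (intro o_inv_distrib Sym_bij)

lemma Sym_comp_iff': "s \<in> Sym l \<Longrightarrow> t \<circ> s \<in> Sym l \<longleftrightarrow> t \<in> Sym l"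
  by (metis Sym_comp Sym_inv Sym_inv_o(6))

lemma Sym_inv_iff: "bij s \<Longrightarrow> inv s \<in> Sym l \<longleftrightarrow> s \<in> Sym l"
  by (metis Sym_inv inv_inv_eq)

lemma sum_Sym_comp: "s \<in> Sym l \<Longrightarrow> (\<Sum>p\<in>Sym l. f (s \<circ> p)) = (\<Sum>p\<in>Sym l. f p)"
  by (rule sum.reindex_bij_witness[of _ "\<lambda>p. inv s \<circ> p" "\<lambda>p. s \<circ> p"]) auto

lemma sum_Sym_inv: "(\<Sum>p\<in>Sym l. f (inv p)) = (\<Sum>p\<in>Sym l. f p)"
  by (rule sum.reindex_bij_witness[of _ inv inv]) auto

lift_definition Gact :: "(nat \<Rightarrow> nat) \<Rightarrow> (nat \<Rightarrow> nat) endo" is gact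
  by (intro linear_cscaleI) (auto simp: gact_def cscale_def fun_eq_iff)

lemma ap_Gact [simp]: "ap (Gact s) f = gact s f"
  by transfer simp

lemma Gact_id [simp]: "Gact id = 1"
  by (rule endo_eqI) (simp add: gact_def)

lemma Gact_mult: "s \<in> Sym l \<Longrightarrow> t \<in> Sym l \<Longrightarrow> Gact s * Gact t = Gact (s \<circ> t)"
  by (rule endo_eqI) (simp add: gact_def Sym_inv_comp[of s l t] o_assoc)

definition unitvec :: gralg where
  "unitvec = (\<lambda>s. if s = id then 1 else 0)"

definition co :: "(nat \<Rightarrow> nat) endo \<Rightarrow> gralg" where
  "co X = ap X unitvec"

definition opg :: "nat \<Rightarrow> gralg \<Rightarrow> (nat \<Rightarrow> nat) endo" where
  "opg l f = (\<Sum>s\<in>Sym l. f s *\<^sub>C Gact s)"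

text \<open>All group algebras live inside one type of operators, so the inclusion of one symmetric
  group in a larger one is an inclusion of sets. An element is recovered from its coefficients
  \<open>co\<close>.\<close>

definition AA :: "nat \<Rightarrow> (nat \<Rightarrow> nat) endo set" where
  "AA l = range (opg l)"

lemma co_simps [simp]:
  "co 0 s = 0" "co (X + Y) s = co X s + co Y s" "co (X - Y) s = co X s - co Y s"
  "co (- X) s = - co X s" "co (c *\<^sub>C X) s = c * co X s"
  by (simp_all add: co_def cscale_def)

lemma co_sum: "co (sum F I) s = (\<Sum>i\<in>I. co (F i) s)"
  by (induction I rule: infinite_finite_induct) auto

lemma co_Gact_mult: "co (Gact s * X) t = co X (inv s \<circ> t)"
  by (simp add: co_def gact_def)

lemma co_Gact: "s \<in> Sym l \<Longrightarrow> co (Gact s) t = (if t = s then 1 else 0)"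
proof -
  assume s: "s \<in> Sym l"
  then have "inv s \<circ> t = id \<longleftrightarrow> t = s" by (metis Sym_inv_o(1,5) comp_id)
  then show ?thesis by (simp add: co_def gact_def unitvec_def)
qed

lemma co_opg: "co (opg l f) s = (if s \<in> Sym l then f s else 0)"
proof -
  have "co (opg l f) s = (\<Sum>t\<in>Sym l. if s = t then f t else 0)"
    unfolding opg_def co_sum by (intro sum.cong) (auto simp: co_Gact)
  then show ?thesis by simp
qed

lemma opg_cong: "(\<And>s. s \<in> Sym l \<Longrightarrow> f s = g s) \<Longrightarrow> opg l f = opg l g"
  by (simp add: opg_def)

lemma opg_in_AA [simp, intro]: "opg l f \<in> AA l"
  by (simp add: AA_def)

lemma opg_co: "X \<in> AA l \<Longrightarrow> opg l (co X) = X"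
  by (auto simp: AA_def co_opg intro: opg_cong)

lemma co_outside: "X \<in> AA l \<Longrightarrow> s \<notin> Sym l \<Longrightarrow> co X s = 0"
  by (auto simp: AA_def co_opg)

lemma AA_eqI: "X \<in> AA l \<Longrightarrow> Y \<in> AA l \<Longrightarrow> (\<And>s. s \<in> Sym l \<Longrightarrow> co X s = co Y s) \<Longrightarrow> X = Y"
  by (metis opg_co opg_cong)

lemma ap_opg: "ap (opg l f) g = gmult l f g"
  by (auto simp: opg_def ap_sum_left gmult_def cscale_def gact_def sum_fun_apply)

lemma co_mult: "X \<in> AA l \<Longrightarrow> co (X * Y) s = (\<Sum>p\<in>Sym l. co X p * co Y (inv p \<circ> s))"
  using opg_co[of X l] ap_opg[of l "co X" "co Y"] by (simp add: co_def gmult_def)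

lemma AA_add [intro]: "X \<in> AA l \<Longrightarrow> Y \<in> AA l \<Longrightarrow> X + Y \<in> AA l"
proof -
  have "opg l f + opg l g = opg l (\<lambda>s. f s + g s)" for f g
    by (simp add: opg_def cs_add_left sum.distrib)
  then show "X \<in> AA l \<Longrightarrow> Y \<in> AA l \<Longrightarrow> X + Y \<in> AA l" by (auto simp: AA_def)
qed

lemma AA_scale [intro]: "X \<in> AA l \<Longrightarrow> c *\<^sub>C X \<in> AA l"
proof -
  have "c *\<^sub>C opg l f = opg l (\<lambda>s. c * f s)" for f
    by (simp add: opg_def cs_sum_right)
  then show "X \<in> AA l \<Longrightarrow> c *\<^sub>C X \<in> AA l" by (auto simp: AA_def)
qed

lemma AA_diff [intro]: "X \<in> AA l \<Longrightarrow> Y \<in> AA l \<Longrightarrow> X - Y \<in> AA l"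
  using AA_add[of X l "- Y"] AA_scale[of Y l "- 1"] by simp

lemma AA_Gact [intro]: "s \<in> Sym l \<Longrightarrow> Gact s \<in> AA l"
proof -
  assume s: "s \<in> Sym l"
  have "opg l (\<lambda>t. if t = s then 1 else 0) = Gact s"
    using s by (simp add: opg_def if_distrib[of "\<lambda>c. c *\<^sub>C _"] cong: if_cong)
  then show ?thesis by (metis opg_in_AA)
qed

lemma AA_one [simp, intro]: "1 \<in> AA l"
  using AA_Gact[OF Sym_id] by simp

lemma AA_zero [simp, intro]: "0 \<in> AA l"
  using AA_scale[OF AA_one, of 0] by simp

lemma AA_sum [intro]: "(\<And>i. i \<in> I \<Longrightarrow> F i \<in> AA l) \<Longrightarrow> sum F I \<in> AA l"
  by (induction I rule: infinite_finite_induct) auto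

lemma AA_mult [intro]:
  assumes "X \<in> AA l" "Y \<in> AA l"
  shows "X * Y \<in> AA l"
proof -
  have "opg l f * opg l g = (\<Sum>s\<in>Sym l. \<Sum>t\<in>Sym l. (f s * g t) *\<^sub>C Gact (s \<circ> t))" for f g
    unfolding opg_def sum_product by (intro sum.cong) (simp_all add: Gact_mult[of _ l] mult.commute)
  then have "X * Y = (\<Sum>s\<in>Sym l. \<Sum>t\<in>Sym l. (co X s * co Y t) *\<^sub>C Gact (s \<circ> t))"
    using opg_co[OF assms(1)] opg_co[OF assms(2)] by metis
  then show ?thesis by (auto intro!: AA_sum AA_scale AA_Gact)
qed

lemma AA_mono: "m \<le> l \<Longrightarrow> X \<in> AA m \<Longrightarrow> X \<in> AA l"
proof -
  assume "m \<le> l" "X \<in> AA m"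
  then have "X = (\<Sum>s\<in>Sym m. co X s *\<^sub>C Gact s)" using opg_co[of X m] by (simp add: opg_def)
  moreover have "(\<Sum>s\<in>Sym m. co X s *\<^sub>C Gact s) \<in> AA l"
    using Sym_mono[OF \<open>m \<le> l\<close>] by (intro AA_sum AA_scale AA_Gact) auto
  ultimately show ?thesis by metis
qed

section \<open>The coefficient at the identity as a trace\<close>

definition tau :: "(nat \<Rightarrow> nat) endo \<Rightarrow> complex" where
  "tau X = co X id"

lemma tau_simps [simp]:
  "tau 0 = 0" "tau (X + Y) = tau X + tau Y" "tau (X - Y) = tau X - tau Y" "tau (c *\<^sub>C X) = c * tau X"
  by (simp_all add: tau_def)

lemma tau_mult: "X \<in> AA l \<Longrightarrow> tau (X * Y) = (\<Sum>p\<in>Sym l. co X p * co Y (inv p))"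
  by (simp add: tau_def co_mult)

lemma tau_commute: "X \<in> AA l \<Longrightarrow> Y \<in> AA l \<Longrightarrow> tau (X * Y) = tau (Y * X)"
  unfolding tau_mult by (subst sum_Sym_inv[symmetric]) (simp add: mult.commute)

lemma tau_Gact: "X \<in> AA l \<Longrightarrow> s \<in> Sym l \<Longrightarrow> tau (X * Gact (inv s)) = co X s"
proof -
  assume *: "X \<in> AA l" "s \<in> Sym l"
  then have "inv p = inv s \<longleftrightarrow> p = s" if "p \<in> Sym l" for p
    using that Sym_inv_o(3) by metis
  then have "co X p * co (Gact (inv s)) (inv p) = (if p = s then co X p else 0)" if "p \<in> Sym l" for p
    using * that by (simp add: co_Gact[of "inv s" l] Sym_inv)
  then have "tau (X * Gact (inv s)) = (\<Sum>p\<in>Sym l. if p = s then co X p else 0)"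
    using * by (simp add: tau_mult[of X l])
  then show ?thesis using * by simp
qed

lemma tau_nondegenerate: "X \<in> AA l \<Longrightarrow> (\<And>s. s \<in> Sym l \<Longrightarrow> tau (X * Gact s) = 0) \<Longrightarrow> X = 0"
  by (rule AA_eqI[of _ l]) (auto simp: tau_Gact[symmetric] Sym_inv)

text \<open>For \<open>h\<close> complex conjugation this is the adjoint; for \<open>h\<close> the
  identity it is the linear anti-automorphism inverting permutations. An element fixed by both has
  real coefficients.\<close>

definition twist :: "(complex \<Rightarrow> complex) \<Rightarrow> nat \<Rightarrow> (nat \<Rightarrow> nat) endo \<Rightarrow> (nat \<Rightarrow> nat) endo" where
  "twist h l X = opg l (\<lambda>s. h (co X (inv s)))"

lemma twist_in_AA [simp, intro]: "twist h l X \<in> AA l"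
  by (simp add: twist_def)

lemma co_twist: "s \<in> Sym l \<Longrightarrow> co (twist h l X) s = h (co X (inv s))"
  by (simp add: twist_def co_opg)

locale field_twist =
  fixes h :: "complex \<Rightarrow> complex"
  assumes h_add: "h (a + b) = h a + h b" and h_mult: "h (a * b) = h a * h b" and h_zero: "h 0 = 0"
    and h_one: "h 1 = 1" and h_inv: "h (h a) = a"
begin

lemma h_sum: "h (sum f I) = (\<Sum>i\<in>I. h (f i))"
  by (induction I rule: infinite_finite_induct) (auto simp: h_add h_zero)

lemma twist_mult:
  assumes "X \<in> AA l" "Y \<in> AA l"
  shows "twist h l (X * Y) = twist h l Y * twist h l X"
proof (rule AA_eqI)
  fix s assume s: "s \<in> Sym l"
  have "co (twist h l Y * twist h l X) s = (\<Sum>q\<in>Sym l. h (co Y (inv q)) * h (co X (inv s \<circ> q)))"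
    using s by (auto simp: co_mult[of _ l] co_twist Sym_inv_comp[of _ l] intro!: sum.cong)
      (simp add: co_twist Sym_comp Sym_inv Sym_inv_comp[of _ l])
  also have "\<dots> = (\<Sum>p\<in>Sym l. h (co Y (inv (s \<circ> p))) * h (co X (inv s \<circ> (s \<circ> p))))"
    using s by (subst sum_Sym_comp[of s l, symmetric]) auto
  also have "\<dots> = (\<Sum>p\<in>Sym l. h (co X p) * h (co Y (inv p \<circ> inv s)))"
    using s by (intro sum.cong) (auto simp: Sym_inv_comp[of _ l] mult.commute)
  also have "\<dots> = co (twist h l (X * Y)) s"
    using s assms by (simp add: co_twist co_mult[of X l] h_sum h_mult)
  finally show "co (twist h l (X * Y)) s = co (twist h l Y * twist h l X) s" by simp
qed (auto intro: AA_mult)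

lemma twist_add: "twist h l (X + Y) = twist h l X + twist h l Y"
  by (intro AA_eqI[of _ l]) (auto simp: co_twist h_add)

lemma twist_scale: "twist h l (c *\<^sub>C X) = h c *\<^sub>C twist h l X"
  by (intro AA_eqI[of _ l]) (auto simp: co_twist h_mult)

lemma twist_Gact: "s \<in> Sym l \<Longrightarrow> twist h l (Gact s) = Gact (inv s)"
proof (rule AA_eqI[of _ l])
  fix t assume *: "s \<in> Sym l" "t \<in> Sym l"
  then have "inv t = s \<longleftrightarrow> t = inv s" by (metis Sym_inv_o(3))
  then show "co (twist h l (Gact s)) t = co (Gact (inv s)) t"
    using * by (auto simp: co_twist co_Gact[of _ l] h_one h_zero Sym_inv)
qed auto

lemma twist_one: "twist h l 1 = 1"
  using twist_Gact[OF Sym_id] by simp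

lemma twist_zero: "twist h l 0 = 0"
  by (intro AA_eqI[of _ l]) (auto simp: co_twist h_zero)

lemma twist_sum: "twist h l (sum F I) = (\<Sum>i\<in>I. twist h l (F i))"
  by (induction I rule: infinite_finite_induct) (auto simp: twist_add twist_zero)

end

interpretation conj: field_twist cnj
  by unfold_locales auto

interpretation plain: field_twist "\<lambda>c. c"
  by unfold_locales auto

abbreviation star :: "nat \<Rightarrow> (nat \<Rightarrow> nat) endo \<Rightarrow> (nat \<Rightarrow> nat) endo" where
  "star \<equiv> twist cnj"

lemma tau_star: "X \<in> AA l \<Longrightarrow> tau (X * star l X) = of_real (\<Sum>p\<in>Sym l. (cmod (co X p))\<^sup>2)"
  by (auto simp: tau_mult co_twist Sym_inv complex_norm_square simp del: of_real_power intro!: sum.cong)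

lemma tau_star_zero: "X \<in> AA l \<Longrightarrow> tau (X * star l X) = 0 \<Longrightarrow> X = 0"
  by (intro AA_eqI[of X l]) (auto simp: tau_star sum_nonneg_eq_0_iff simp del: of_real_sum)

section \<open>Restriction of coefficients, a conditional expectation onto the smaller group
  algebra\<close>

definition res :: "nat \<Rightarrow> (nat \<Rightarrow> nat) endo \<Rightarrow> (nat \<Rightarrow> nat) endo" where
  "res m X = opg m (co X)"

lemma res_in_AA [simp, intro]: "res m X \<in> AA m"
  by (simp add: res_def)

lemma co_res: "s \<in> Sym m \<Longrightarrow> co (res m X) s = co X s"
  by (simp add: res_def co_opg)

lemma res_id: "X \<in> AA m \<Longrightarrow> res m X = X"
  by (simp add: res_def opg_co)

lemma res_add: "res m (X + Y) = res m X + res m Y"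
  by (intro AA_eqI[of _ m]) (auto simp: co_res)

lemma res_scale: "res m (c *\<^sub>C X) = c *\<^sub>C res m X"
  by (intro AA_eqI[of _ m]) (auto simp: co_res)

lemma tau_res: "tau (res m X) = tau X"
  by (simp add: tau_def co_res)

lemma res_mult_left:
  assumes "X \<in> AA m"
  shows "res m (X * Y) = X * res m Y"
  using assms by (intro AA_eqI[of _ m] AA_mult) (auto simp: co_res co_mult[OF assms] Sym_comp Sym_inv intro!: sum.cong)

text \<open>If a product with a factor in \<open>Sym m\<close> lies in \<open>Sym m\<close>, so does
  the other factor; coefficients of \<open>Y\<close> outside \<open>Sym m\<close> therefore do not
  contribute.\<close>

lemma res_mult_right:
  assumes "X \<in> AA m" "Y \<in> AA l" "m \<le> l"
  shows "res m (Y * X) = res m Y * X"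
proof (rule AA_eqI[of _ m])
  fix s assume s: "s \<in> Sym m"
  have "co X (inv q \<circ> s) = 0" if "q \<in> Sym l - Sym m" for q
    using that s Sym_comp_iff'[OF s, of "inv q"] Sym_inv_iff[OF Sym_bij, of q l m]
    by (intro co_outside[OF assms(1)]) auto
  then have "(\<Sum>q\<in>Sym l. co Y q * co X (inv q \<circ> s)) = (\<Sum>q\<in>Sym m. co Y q * co X (inv q \<circ> s))"
    using Sym_mono[OF assms(3)] by (intro sum.mono_neutral_right) auto
  then show "co (res m (Y * X)) s = co (res m Y * X) s"
    using s assms by (simp add: co_res co_mult[of _ l] co_mult[of _ m])
qed (use assms in auto)

section \<open>Jucys-Murphy elements\<close>

definition Pg :: "nat \<Rightarrow> nat \<Rightarrow> (nat \<Rightarrow> nat) endo" where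
  "Pg a b = Gact (Transposition.transpose a b)"

lemma Pg_sym: "Pg a b = Pg b a"
  by (simp add: Pg_def transpose_commute)

lemma Pg_in_AA [intro]: "a \<in> {1..l} \<Longrightarrow> b \<in> {1..l} \<Longrightarrow> Pg a b \<in> AA l"
  unfolding Pg_def by (intro AA_Gact Sym_transpose)

lemma Gact_mult_bij: "bij s \<Longrightarrow> bij t \<Longrightarrow> Gact s * Gact t = Gact (s \<circ> t)"
  by (rule endo_eqI) (simp add: gact_def o_inv_distrib o_assoc)

lemma Gact_Pg:
  assumes "bij s"
  shows "Gact s * Pg a b = Pg (s a) (s b) * Gact s"
proof -
  have "s \<circ> Transposition.transpose a b = Transposition.transpose (s a) (s b) \<circ> s"
    using assms by (auto simp: fun_eq_iff Transposition.transpose_def bij_def inj_eq)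
  then show ?thesis using assms by (simp add: Pg_def Gact_mult_bij)
qed

lemma transpositions_Pg: "transpositions Pg"
proof
  show "Pg a b = Pg b a" for a b by (rule Pg_sym)
  show "Pg a b * Pg a b = 1" for a b
    by (simp add: Pg_def Gact_mult_bij flip: Gact_id)
  show "Pg a b * Pg a c = Pg b c * Pg a b" if "a \<noteq> b" "a \<noteq> c" "b \<noteq> c" for a b c
    using Gact_Pg[of "Transposition.transpose a b" a c] that by (simp flip: Pg_def)
  show "Pg a b * Pg c d = Pg c d * Pg a b" if "a \<noteq> c" "a \<noteq> d" "b \<noteq> c" "b \<noteq> d" for a b c d
    using Gact_Pg[of "Transposition.transpose a b" c d] that by (simp add: Transposition.transpose_def flip: Pg_def)
qed

interpretation Gr: transpositions Pg
  by (rule transpositions_Pg)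

definition XX :: "nat \<Rightarrow> (nat \<Rightarrow> nat) endo" where
  "XX k = (\<Sum>j\<in>{1..<k}. Pg j k)"

lemma XX_in_AA [intro]: "k \<le> l \<Longrightarrow> XX k \<in> AA l"
  unfolding XX_def by (intro AA_sum Pg_in_AA) auto

lemma (in field_twist) twist_Pg: "a \<in> {1..l} \<Longrightarrow> b \<in> {1..l} \<Longrightarrow> twist h l (Pg a b) = Pg a b"
  unfolding Pg_def by (simp add: twist_Gact Sym_transpose)

lemma (in field_twist) twist_XX: "k \<le> l \<Longrightarrow> twist h l (XX k) = XX k"
  unfolding XX_def twist_sum by (intro sum.cong twist_Pg) auto

text \<open>Conjugation by a permutation fixing \<open>Suc l\<close> permutes the summands.\<close>

lemma XX_commute: "X \<in> AA l \<Longrightarrow> XX (Suc l) * X = X * XX (Suc l)"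
proof -
  assume X: "X \<in> AA l"
  have "XX (Suc l) * Gact s = Gact s * XX (Suc l)" if s: "s \<in> Sym l" for s
  proof -
    have p: "s permutes {1..<Suc l}" using s by (simp add: Sym_def atLeastLessThanSuc_atLeastAtMost)
    then have "s (Suc l) = Suc l" by (simp add: permutes_def)
    then have "Gact s * XX (Suc l) = (\<Sum>j\<in>{1..<Suc l}. Pg (s j) (Suc l)) * Gact s"
      unfolding XX_def sum_distrib_left sum_distrib_right using Gact_Pg[OF Sym_bij[OF s], of _ "Suc l"] by simp
    also have "(\<Sum>j\<in>{1..<Suc l}. Pg (s j) (Suc l)) = XX (Suc l)"
      unfolding XX_def using sum.permute[OF p, of "\<lambda>j. Pg j (Suc l)"] by (simp add: o_def)
    finally show ?thesis by simp
  qed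
  then have "XX (Suc l) * opg l (co X) = opg l (co X) * XX (Suc l)"
    by (simp add: opg_def sum_distrib_left sum_distrib_right)
  then show ?thesis by (simp add: opg_co[OF X])
qed

text \<open>The relation of the degenerate affine Hecke algebra; the extra 1 is the summand
  \<open>Pg l (Suc l)\<close> times itself.\<close>

lemma XX_Suc: "1 \<le> l \<Longrightarrow> Pg l (Suc l) * XX (Suc l) = XX l * Pg l (Suc l) + 1"
proof -
  assume l: "1 \<le> l"
  have "{1..<Suc l} = insert l {1..<l}" using l by auto
  then have "XX (Suc l) = Pg l (Suc l) + (\<Sum>j\<in>{1..<l}. Pg j (Suc l))" by (simp add: XX_def)
  moreover have "Pg l (Suc l) * Pg j (Suc l) = Pg j l * Pg l (Suc l)" if "j \<in> {1..<l}" for j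
    using Gr.P_conj[of "Suc l" l j] that by (simp add: Pg_sym)
  then have "Pg l (Suc l) * (\<Sum>j\<in>{1..<l}. Pg j (Suc l)) = XX l * Pg l (Suc l)"
    by (simp add: XX_def sum_distrib_left sum_distrib_right)
  moreover have "Pg l (Suc l) * Pg l (Suc l) = 1" by (simp add: Gr.P_sq)
  ultimately show ?thesis by (simp add: distrib_left add.commute)
qed

text \<open>The Hecke relation gives \<open>Y = Z * ?D\<close>, while \<open>Y * ?D = 0\<close> and
  \<open>?D\<close> is self-adjoint because \<open>c\<close> is real. So \<open>Y\<close> times its
  adjoint contains \<open>Y * ?D\<close> and vanishes, and positivity gives
  \<open>Y = 0\<close>.\<close>

lemma XX_eigen_consecutive:
  assumes Y: "Y \<in> AA (Suc l)" and l: "1 \<le> l"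
    and ev: "Y * XX l = c *\<^sub>C Y" "Y * XX (Suc l) = c *\<^sub>C Y" and c: "cnj c = c"
  shows "Y = 0"
proof -
  define Z where "Z = Y * Pg l (Suc l)"
  let ?D = "XX (Suc l) - c *\<^sub>C 1"
  have in_AA: "Z \<in> AA (Suc l)" "?D \<in> AA (Suc l)" using Y l by (auto simp: Z_def intro!: AA_mult)
  have ZD: "Z * ?D = Y"
    using XX_Suc[OF l] ev(1) by (simp add: Z_def right_diff_distrib mult.assoc distrib_left)
      (simp add: flip: mult.assoc)
  have YD: "Y * ?D = 0" using ev(2) by (simp add: right_diff_distrib)
  have "star (Suc l) ?D = ?D"
    using conj.twist_add[of "Suc l" "XX (Suc l)" "(- c) *\<^sub>C 1"] c
    by (simp add: conj.twist_scale conj.twist_one conj.twist_XX del: cs_minus_left) simp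
  then have "star (Suc l) Y = ?D * star (Suc l) Z"
    using conj.twist_mult[OF in_AA] by (simp add: ZD)
  then have "Y * star (Suc l) Y = (Y * ?D) * star (Suc l) Z" by (simp add: mult.assoc)
  then show ?thesis using tau_star_zero[OF Y] by (simp add: YD)
qed

section \<open>Elements with a prescribed weight on both sides\<close>

definition weight :: "nat \<Rightarrow> (nat \<Rightarrow> complex) \<Rightarrow> (nat \<Rightarrow> nat) endo \<Rightarrow> bool" where
  "weight l c X \<longleftrightarrow> (\<forall>k\<in>{1..l}. XX k * X = c k *\<^sub>C X)"

definition right_weight :: "nat \<Rightarrow> (nat \<Rightarrow> complex) \<Rightarrow> (nat \<Rightarrow> nat) endo \<Rightarrow> bool" where
  "right_weight l c X \<longleftrightarrow> (\<forall>k\<in>{1..l}. X * XX k = c k *\<^sub>C X)"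

lemma Sym_Suc_fix:
  assumes "s \<in> Sym (Suc l)" "s (Suc l) = Suc l"
  shows "s \<in> Sym l"
proof -
  have "s permutes {1..l}"
  proof (rule permutes_superset[of s "{1..Suc l}"])
    show "s permutes {1..Suc l}" using assms by (simp add: Sym_def)
    fix x assume "x \<in> {1..Suc l} - {1..l}"
    then have "x = Suc l" by (auto simp: le_Suc_eq)
    then show "s x = x" using assms(2) by simp
  qed
  then show ?thesis by (simp add: Sym_def)
qed

text \<open>The group is the union of \<open>Sym l\<close> and a single double coset. The
  transposition \<open>g\<close> brings the image of \<open>Suc l\<close> to
  \<open>l\<close>.\<close>

lemma Sym_Suc_decompose:
  assumes "q \<in> Sym (Suc l)" "q \<notin> Sym l" "1 \<le> l"
  shows "\<exists>g\<in>Sym l. \<exists>h\<in>Sym l. q = g \<circ> Transposition.transpose l (Suc l) \<circ> h"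
proof -
  let ?a = "q (Suc l)" and ?s = "Transposition.transpose l (Suc l)"
  have q: "q permutes {1..Suc l}" using assms by (simp add: Sym_def)
  have a: "?a \<noteq> Suc l"
    using Sym_Suc_fix[of q l] assms by blast
  have "?a \<in> {1..Suc l}" using permutes_in_image[OF q, of "Suc l"] by simp
  then have a': "?a \<in> {1..l}" using a by (auto simp: le_Suc_eq)
  define g where "g = Transposition.transpose ?a l"
  have g: "g \<in> Sym l" using a' assms by (auto simp: g_def)
  have sS: "?s \<in> Sym (Suc l)" by (intro Sym_transpose) (use assms in auto)
  define h where "h = ?s \<circ> (g \<circ> q)"
  have hS: "h \<in> Sym (Suc l)" using sS g assms Sym_mono[of l "Suc l"] by (auto simp: h_def)
  have "h (Suc l) = Suc l" by (simp add: h_def g_def)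
  then have "h \<in> Sym l" using Sym_Suc_fix hS by blast
  moreover have "g \<circ> g = id" by (simp add: g_def)
  then have "g \<circ> ?s \<circ> h = q" by (simp add: h_def fun_eq_iff)
  ultimately show ?thesis using g by metis
qed

text \<open>By induction the restriction of \<open>e\<close> to \<open>Sym l\<close> vanishes. It
  remains to see that the trace of \<open>e\<close> against the double coset of
  \<open>Pg l (Suc l)\<close> vanishes; otherwise \<open>e\<close> could be moved to a nonzero
  element with equal eigenvalues for two consecutive Jucys-Murphy elements.\<close>

lemma weight_unique_zero:
  assumes "e \<in> AA l" "weight l c e" "right_weight l c e" "tau e = 0" and c: "\<And>k. cnj (c k) = c k"
  shows "e = 0"
  using assms(1-4)
proof (induction l arbitrary: e)
  case 0
  have "Sym 0 = {id}" by (auto simp: Sym_def)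
  then show ?case using 0 by (intro AA_eqI[of e 0]) (auto simp: tau_def)
next
  case (Suc l)
  note e = Suc.prems
  have ev: "XX k * e = c k *\<^sub>C e" "e * XX k = c k *\<^sub>C e" if "k \<in> {1..Suc l}" for k
    using e that by (auto simp: weight_def right_weight_def)
  have r0: "res l e = 0"
  proof (rule Suc.IH)
    have "XX k * res l e = c k *\<^sub>C res l e" "res l e * XX k = c k *\<^sub>C res l e" if "k \<in> {1..l}" for k
      using ev[of k] that res_mult_left[of "XX k" l e] res_mult_right[of "XX k" l e "Suc l"] e(1)
      by (auto simp: XX_in_AA res_scale)
    then show "weight l c (res l e)" "right_weight l c (res l e)"
      by (auto simp: weight_def right_weight_def)
  qed (use e tau_res in auto)
  show ?case
  proof (cases "l = 0")
    case True
    have "Sym (Suc 0) = {id}" by (auto simp: Sym_def)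
    then show ?thesis using e True by (intro AA_eqI[of e "Suc 0"]) (auto simp: tau_def)
  next
    case False
    then have l: "1 \<le> l" by simp
    let ?s = "Pg l (Suc l)"
    have s: "?s \<in> AA (Suc l)" using l by auto
    have up: "X \<in> AA l \<Longrightarrow> X \<in> AA (Suc l)" for X by (rule AA_mono[of l]) auto
    have zero: "tau (e * x * ?s * h) = 0" if x: "x \<in> AA l" and h: "h \<in> AA l" for x h
    proof -
      \<comment> \<open>\<open>r\<close> represents the functional on \<open>AA l\<close> that takes
        \<open>y\<close> to the trace of \<open>e * y * ?s * h\<close>; it has to be shown
        zero.\<close>
      define r where "r = res l (?s * h * e)"
      have rA: "r \<in> AA l" by (simp add: r_def)
      have L: "tau (e * y * ?s * h) = tau (r * y)" if y: "y \<in> AA l" for y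
      proof -
        have "tau (e * y * ?s * h) = tau ((e * y) * (?s * h))" by (simp add: mult.assoc)
        also have "\<dots> = tau ((?s * h) * (e * y))"
          using e(1) s up[OF y] up[OF h] by (intro tau_commute[of _ "Suc l"]) auto
        also have "\<dots> = tau (res l ((?s * h * e) * y))" by (simp add: tau_res mult.assoc)
        also have "\<dots> = tau (r * y)"
          unfolding r_def using e(1) s up[OF h] y by (subst res_mult_right[of _ _ _ "Suc l"]) auto
        finally show ?thesis .
      qed
      \<comment> \<open>Moving \<open>XX l\<close> through \<open>?s\<close> by the Hecke relation
        produces \<open>XX (Suc l)\<close>, which by cyclicity of the trace meets \<open>e\<close>
        and gives \<open>c (Suc l)\<close>; the remaining term involves only the restriction of
        \<open>e\<close>, which is zero.\<close>
      have "tau (r * (y * (c (Suc l) *\<^sub>C 1 - XX l))) = 0" if y: "y \<in> AA l" for y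
      proof -
        have X1: "XX (Suc l) * h = h * XX (Suc l)" by (rule XX_commute[OF h])
        have "XX l * ?s = ?s * XX (Suc l) - 1" using XX_Suc[OF l] by simp
        then have "(c (Suc l) *\<^sub>C 1 - XX l) * ?s * h = c (Suc l) *\<^sub>C (?s * h) - ?s * h * XX (Suc l) + h"
          by (simp add: left_diff_distrib mult.assoc X1 flip: X1)
        then have "e * (y * ((c (Suc l) *\<^sub>C 1 - XX l) * ?s * h))
            = c (Suc l) *\<^sub>C (e * y * ?s * h) - (e * y * ?s * h) * XX (Suc l) + e * (y * h)"
          by (simp only: distrib_left right_diff_distrib mult_cs_right mult.assoc)
        then have 1: "e * (y * (c (Suc l) *\<^sub>C 1 - XX l)) * ?s * h
            = c (Suc l) *\<^sub>C (e * y * ?s * h) - (e * y * ?s * h) * XX (Suc l) + e * (y * h)"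
          by (simp only: mult.assoc)
        have "tau ((e * y * ?s * h) * XX (Suc l)) = tau (XX (Suc l) * (e * y * ?s * h))"
          using e(1) s up[OF y] up[OF h] by (intro tau_commute[of _ "Suc l"]) auto
        also have "\<dots> = c (Suc l) * tau (e * y * ?s * h)"
          using ev(1)[of "Suc l"] by (simp flip: mult.assoc)
        finally have 2: "tau ((e * y * ?s * h) * XX (Suc l)) = c (Suc l) * tau (e * y * ?s * h)" .
        have "tau (e * (y * h)) = tau (res l (e * (y * h)))" by (simp add: tau_res)
        also have "\<dots> = 0"
          using e(1) y h r0 by (subst res_mult_right[of _ _ _ "Suc l"]) auto
        finally have "tau (e * (y * (c (Suc l) *\<^sub>C 1 - XX l)) * ?s * h) = 0"
          unfolding 1 by (simp add: 2)
        then show ?thesis using L[of "y * (c (Suc l) *\<^sub>C 1 - XX l)"] y by auto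
      qed
      then have "tau (((c (Suc l) *\<^sub>C 1 - XX l) * r) * y) = 0" if "y \<in> AA l" for y
        using that rA tau_commute[of "c (Suc l) *\<^sub>C 1 - XX l" l "r * y"] by (auto simp: mult.assoc AA_diff AA_mult AA_scale XX_in_AA)
      then have "(c (Suc l) *\<^sub>C 1 - XX l) * r = 0"
        using rA by (intro tau_nondegenerate[of _ l]) auto
      then have Xr: "XX l * r = c (Suc l) *\<^sub>C r" by (simp add: left_diff_distrib)
      \<comment> \<open>The eigenvalue of \<open>r\<close> under \<open>XX l\<close> is that of
        \<open>e\<close> under \<open>XX (Suc l)\<close>, so \<open>e * ?x\<close> has it for both
        from the right and is zero; taking \<open>y = ?x\<close> above leaves the squared norm of
        \<open>r\<close>.\<close>
      let ?x = "star l r"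
      have "?x * XX l = c (Suc l) *\<^sub>C ?x"
        using conj.twist_mult[of "XX l" l r] rA Xr c by (simp add: XX_in_AA conj.twist_XX conj.twist_scale)
      then have "(e * ?x) * XX l = c (Suc l) *\<^sub>C (e * ?x)" by (simp add: mult.assoc)
      moreover have "(e * ?x) * XX (Suc l) = c (Suc l) *\<^sub>C (e * ?x)"
        using XX_commute[of ?x l] ev(2)[of "Suc l"] by (simp add: mult.assoc flip: mult.assoc[of e "XX (Suc l)"]) 
          (metis ev(2) mult.assoc mult_cs_left atLeastAtMost_iff le_refl le_add2 plus_1_eq_Suc)
      ultimately have "e * ?x = 0"
        using e(1) up[of ?x] l c by (intro XX_eigen_consecutive[of _ l "c (Suc l)"]) auto
      then have "tau (r * ?x) = 0" using L[of ?x] by simp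
      then have "r = 0" using tau_star_zero[OF rA] by simp
      then show ?thesis using L[OF x] by simp
    qed
    show ?thesis
    proof (rule tau_nondegenerate[OF e(1)])
      fix q assume q: "q \<in> Sym (Suc l)"
      show "tau (e * Gact q) = 0"
      proof (cases "q \<in> Sym l")
        case True
        have "tau (e * Gact q) = tau (res l (e * Gact q))" by (simp add: tau_res)
        also have "\<dots> = 0" using e(1) True r0 by (subst res_mult_right[of _ _ _ "Suc l"]) auto
        finally show ?thesis .
      next
        case False
        then obtain g h where gh: "g \<in> Sym l" "h \<in> Sym l" "q = g \<circ> Transposition.transpose l (Suc l) \<circ> h"
          using Sym_Suc_decompose[OF q False l] by blast
        then have "Gact q = Gact g * ?s * Gact h"
          by (simp add: Pg_def Gact_mult_bij Sym_bij bij_comp)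
        then show ?thesis using zero[of "Gact g" "Gact h"] gh by (auto simp: mult.assoc)
      qed
    qed
  qed
qed

section \<open>Tableaux\<close>

definition convex_diagram :: "(nat \<times> nat) set \<Rightarrow> bool" where
  "convex_diagram D \<longleftrightarrow> finite D \<and>
     (\<forall>i j i' j' p q. (i, j) \<in> D \<longrightarrow> (i', j') \<in> D \<longrightarrow> i \<le> p \<longrightarrow> p \<le> i' \<longrightarrow> j \<le> q \<longrightarrow> q \<le> j' \<longrightarrow> (p, q) \<in> D)"

lemma convex_diagramD:
  "convex_diagram D \<Longrightarrow> (i, j) \<in> D \<Longrightarrow> (i', j') \<in> D \<Longrightarrow> i \<le> p \<Longrightarrow> p \<le> i' \<Longrightarrow> j \<le> q \<Longrightarrow> q \<le> j' \<Longrightarrow> (p, q) \<in> D"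
  unfolding convex_diagram_def by blast

definition young_diagram :: "(nat \<times> nat) set \<Rightarrow> bool" where
  "young_diagram D \<longleftrightarrow> finite D \<and>
     (\<forall>i j p q. (i, j) \<in> D \<longrightarrow> 1 \<le> i \<and> 1 \<le> j \<and> (1 \<le> p \<longrightarrow> p \<le> i \<longrightarrow> 1 \<le> q \<longrightarrow> q \<le> j \<longrightarrow> (p, q) \<in> D))"

lemma young_pos: "young_diagram D \<Longrightarrow> (i, j) \<in> D \<Longrightarrow> 1 \<le> i \<and> 1 \<le> j"
  unfolding young_diagram_def by blast

lemma young_down: "young_diagram D \<Longrightarrow> (i, j) \<in> D \<Longrightarrow> 1 \<le> p \<Longrightarrow> p \<le> i \<Longrightarrow> 1 \<le> q \<Longrightarrow> q \<le> j \<Longrightarrow> (p, q) \<in> D"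
  unfolding young_diagram_def by blast

lemma young_convex: "young_diagram D \<Longrightarrow> convex_diagram D"
  unfolding convex_diagram_def young_diagram_def by (meson le_trans)

locale tableau =
  fixes D :: "(nat \<times> nat) set" and \<Omega> :: "nat \<times> nat \<Rightarrow> nat"
  assumes convex: "convex_diagram D" and std: "standard_tableau D \<Omega>"
begin

abbreviation "rw \<equiv> row_of D \<Omega>"
abbreviation "cl \<equiv> col_of D \<Omega>"

lemma bij: "bij_betw \<Omega> D {1..card D}"
  using std by (simp add: standard_tableau_def)

lemma box: "k \<in> {1..card D} \<Longrightarrow> (rw k, cl k) \<in> D \<and> \<Omega> (rw k, cl k) = k"
  using bij by (auto simp: row_of_def col_of_def bij_betw_def inv_into_into f_inv_into_f)

lemma label: "b \<in> D \<Longrightarrow> \<Omega> b \<in> {1..card D} \<and> rw (\<Omega> b) = fst b \<and> cl (\<Omega> b) = snd b"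
  using bij by (auto simp: row_of_def col_of_def bij_betw_def)

lemma label_inject: "k \<in> {1..card D} \<Longrightarrow> l \<in> {1..card D} \<Longrightarrow> rw k = rw l \<Longrightarrow> cl k = cl l \<Longrightarrow> k = l"
  using box by metis

lemma Omega_mono:
  assumes "(i, j) \<in> D" "(i', j') \<in> D" "i \<le> i'" "j \<le> j'"
  shows "\<Omega> (i, j) \<le> \<Omega> (i', j')"
proof -
  have m: "(i, j') \<in> D" using assms by (intro convex_diagramD[OF convex assms(1,2)]) auto
  have "\<Omega> (i, j) \<le> \<Omega> (i, j')"
    using assms m std by (cases "j = j'") (auto simp: standard_tableau_def le_less)
  also have "\<dots> \<le> \<Omega> (i', j')"
    using assms m std by (cases "i = i'") (auto simp: standard_tableau_def le_less)
  finally show ?thesis .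
qed

lemma labels_rows: "labels (card D) rw cl"
proof
  fix k l assume kl: "k \<in> {1..card D}" "l \<in> {1..card D}"
  show "k \<le> l" if "rw k \<le> rw l" "cl k \<le> cl l"
    using Omega_mono[of "rw k" "cl k" "rw l" "cl l"] box[OF kl(1)] box[OF kl(2)] that by simp
  show "\<exists>m\<in>{1..card D}. rw m = i \<and> cl m = j" if "rw k \<le> i" "i \<le> rw l" "cl k \<le> j" "j \<le> cl l" for i j
    using convex_diagramD[OF convex, of "rw k" "cl k" "rw l" "cl l" i j] box[OF kl(1)] box[OF kl(2)] that
      label[of "(i, j)"] by (metis fst_conv snd_conv)
qed

lemma labels_cols: "labels (card D) cl rw"
proof -
  interpret labels "card D" rw cl by (rule labels_rows)
  show ?thesis
  proof
    show "k \<le> l" if "k \<in> {1..card D}" "l \<in> {1..card D}" "cl k \<le> cl l" "rw k \<le> rw l" for k l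
      using label_mono that by blast
    show "\<exists>m\<in>{1..card D}. cl m = i \<and> rw m = j"
      if "k \<in> {1..card D}" "l \<in> {1..card D}" "cl k \<le> i" "i \<le> cl l" "rw k \<le> j" "j \<le> rw l" for k l i j
      using label_convex[OF that(1,2,5,6,3,4)] by blast
  qed
qed

lemma straight_labels:
  assumes "young_diagram D"
  shows "straight_labels (card D) rw cl" "straight_labels (card D) cl rw"
proof -
  have down: "\<exists>m\<in>{1..card D}. rw m = i \<and> cl m = j"
    if "k \<in> {1..card D}" "1 \<le> i" "i \<le> rw k" "1 \<le> j" "j \<le> cl k" for k i j
    using young_down[OF assms, of "rw k" "cl k" i j] box[OF that(1)] that label[of "(i, j)"]
    by (metis fst_conv snd_conv)
  have pos: "1 \<le> rw k \<and> 1 \<le> cl k" if "k \<in> {1..card D}" for k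
    using young_pos[OF assms] box[OF that] by blast
  show "straight_labels (card D) rw cl"
    unfolding straight_labels_def straight_labels_axioms_def using labels_rows down pos by blast
  show "straight_labels (card D) cl rw"
    unfolding straight_labels_def straight_labels_axioms_def using labels_cols down pos by blast
qed

end

lemma standard_row_tableau:
  assumes "finite D"
  shows "standard_tableau D (row_tableau D)"
proof -
  define A where "A b = {c \<in> D. fst c < fst b \<or> fst c = fst b \<and> snd c \<le> snd b}" for b
  have rt: "row_tableau D b = card (A b)" for b
    unfolding row_tableau_def A_def by (cases b) (auto intro!: arg_cong[of _ _ card])
  have lt: "row_tableau D b < row_tableau D c"
    if "b \<in> D" "c \<in> D" "fst b < fst c \<or> fst b = fst c \<and> snd b < snd c" for b c
    unfolding rt
  proof (rule psubset_card_mono)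
    have "A b \<subseteq> A c" "c \<in> A c" "c \<notin> A b" using that by (auto simp: A_def)
    then show "A b \<subset> A c" by blast
  qed (use assms in \<open>simp add: A_def\<close>)
  have inj: "inj_on (row_tableau D) D"
  proof (rule inj_onI)
    fix b c assume *: "b \<in> D" "c \<in> D" "row_tableau D b = row_tableau D c"
    then show "b = c"
      using lt[of b c] lt[of c b] by (cases b; cases c) (metis fst_conv snd_conv less_irrefl linorder_neqE_nat)
  qed
  have "row_tableau D ` D \<subseteq> {1..card D}"
  proof
    fix k assume "k \<in> row_tableau D ` D"
    then obtain b where b: "b \<in> D" "k = card (A b)" by (auto simp: rt)
    have A: "b \<in> A b" "A b \<subseteq> D" using b by (auto simp: A_def)
    then have "finite (A b)" using assms finite_subset by blast
    then have "0 < card (A b)" using A card_gt_0_iff by blast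
    moreover have "card (A b) \<le> card D" using assms A(2) by (rule card_mono)
    ultimately show "k \<in> {1..card D}" using b(2) by simp
  qed
  moreover have "card (row_tableau D ` D) = card {1..card D}" by (simp add: card_image inj)
  ultimately have "row_tableau D ` D = {1..card D}" by (intro card_subset_eq) auto
  then show ?thesis using inj lt by (auto simp: standard_tableau_def bij_betw_def)
qed

section \<open>The Young symmetrizer\<close>

locale young =
  fixes D :: "(nat \<times> nat) set"
  assumes young: "young_diagram D"
begin

lemma finite_D: "finite D"
  using young by (simp add: young_diagram_def)

sublocale rt: tableau D "row_tableau D"
  using young_convex[OF young] standard_row_tableau[OF finite_D] by unfold_locales

abbreviation "n \<equiv> card D"

lemma row_group_eq: "row_group D = {p \<in> Sym n. \<forall>k\<in>{1..n}. rt.rw (p k) = rt.rw k}"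
proof -
  have "(\<forall>b\<in>D. \<exists>b'\<in>D. fst b' = fst b \<and> p (row_tableau D b) = row_tableau D b')
      \<longleftrightarrow> (\<forall>k\<in>{1..n}. rt.rw (p k) = rt.rw k)" if "p \<in> Sym n" for p
  proof
    assume *: "\<forall>b\<in>D. \<exists>b'\<in>D. fst b' = fst b \<and> p (row_tableau D b) = row_tableau D b'"
    show "\<forall>k\<in>{1..n}. rt.rw (p k) = rt.rw k"
      using * rt.box rt.label by (metis fst_conv)
  next
    assume *: "\<forall>k\<in>{1..n}. rt.rw (p k) = rt.rw k"
    show "\<forall>b\<in>D. \<exists>b'\<in>D. fst b' = fst b \<and> p (row_tableau D b) = row_tableau D b'"
    proof
      fix b assume b: "b \<in> D"
      then have "p (row_tableau D b) \<in> {1..n}"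
        using rt.label[OF b] that permutes_in_image[of p "{1..n}"] by (auto simp: Sym_def)
      then show "\<exists>b'\<in>D. fst b' = fst b \<and> p (row_tableau D b) = row_tableau D b'"
        using rt.box rt.label[OF b] * by (metis fst_conv)
    qed
  qed
  then show ?thesis by (auto simp: row_group_def)
qed

lemma col_group_eq: "col_group D = {p \<in> Sym n. \<forall>k\<in>{1..n}. rt.cl (p k) = rt.cl k}"
proof -
  have "(\<forall>b\<in>D. \<exists>b'\<in>D. snd b' = snd b \<and> p (row_tableau D b) = row_tableau D b')
      \<longleftrightarrow> (\<forall>k\<in>{1..n}. rt.cl (p k) = rt.cl k)" if "p \<in> Sym n" for p
  proof
    assume *: "\<forall>b\<in>D. \<exists>b'\<in>D. snd b' = snd b \<and> p (row_tableau D b) = row_tableau D b'"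
    show "\<forall>k\<in>{1..n}. rt.cl (p k) = rt.cl k"
      using * rt.box rt.label by (metis snd_conv)
  next
    assume *: "\<forall>k\<in>{1..n}. rt.cl (p k) = rt.cl k"
    show "\<forall>b\<in>D. \<exists>b'\<in>D. snd b' = snd b \<and> p (row_tableau D b) = row_tableau D b'"
    proof
      fix b assume b: "b \<in> D"
      then have "p (row_tableau D b) \<in> {1..n}"
        using rt.label[OF b] that permutes_in_image[of p "{1..n}"] by (auto simp: Sym_def)
      then show "\<exists>b'\<in>D. snd b' = snd b \<and> p (row_tableau D b) = row_tableau D b'"
        using rt.box rt.label[OF b] * by (metis snd_conv)
    qed
  qed
  then show ?thesis by (auto simp: col_group_def)
qed

lemma Sym_range: "p \<in> Sym n \<Longrightarrow> k \<in> {1..n} \<Longrightarrow> p k \<in> {1..n}"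
  using permutes_in_image[of p "{1..n}" k] by (simp add: Sym_def)

lemma Sym_cancel: "p \<in> Sym n \<Longrightarrow> p (inv p k) = k" "p \<in> Sym n \<Longrightarrow> inv p (p k) = k"
  using Sym_inv_o(1,2)[of p n] by (metis comp_apply id_apply)+

lemma group_closed:
  assumes H: "H = {p \<in> Sym n. \<forall>k\<in>{1..n}. f (p k) = f k}"
  shows "g \<in> H \<Longrightarrow> p \<in> H \<Longrightarrow> g \<circ> p \<in> H" "g \<in> H \<Longrightarrow> inv g \<in> H"
    "a \<in> {1..n} \<Longrightarrow> b \<in> {1..n} \<Longrightarrow> f a = f b \<Longrightarrow> Transposition.transpose a b \<in> H"
proof -
  show "g \<circ> p \<in> H" if "g \<in> H" "p \<in> H"
    unfolding H
  proof (intro CollectI conjI ballI)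
    show "g \<circ> p \<in> Sym n" using that by (auto simp: H)
    fix k assume "k \<in> {1..n}"
    then show "f ((g \<circ> p) k) = f k" using that Sym_range[of p k] by (auto simp: H)
  qed
  show "inv g \<in> H" if "g \<in> H"
    unfolding H
  proof (intro CollectI conjI ballI)
    show i: "inv g \<in> Sym n" using that by (auto simp: H)
    fix k assume k: "k \<in> {1..n}"
    then have "f (g (inv g k)) = f (inv g k)" using that Sym_range[OF i k] by (simp add: H)
    then show "f (inv g k) = f k" using that by (simp add: H Sym_cancel)
  qed
  show "Transposition.transpose a b \<in> H" if "a \<in> {1..n}" "b \<in> {1..n}" "f a = f b"
    using that Sym_transpose[OF that(1,2)] unfolding H by (auto simp: Transposition.transpose_def)
qed

lemmas row_closed = group_closed[OF row_group_eq] and col_closed = group_closed[OF col_group_eq]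

lemma row_Sym: "p \<in> row_group D \<Longrightarrow> p \<in> Sym n" and col_Sym: "p \<in> col_group D \<Longrightarrow> p \<in> Sym n"
  by (auto simp: row_group_eq col_group_eq)

lemma finite_groups [simp]: "finite (row_group D)" "finite (col_group D)"
  by (auto simp: row_group_eq col_group_eq)

definition Rop :: "(nat \<Rightarrow> nat) endo" where
  "Rop = (\<Sum>p\<in>row_group D. Gact p)"

definition Cop :: "(nat \<Rightarrow> nat) endo" where
  "Cop = (\<Sum>p\<in>col_group D. of_int (sign p) *\<^sub>C Gact p)"

definition Yd :: "(nat \<Rightarrow> nat) endo" where
  "Yd = Rop * Cop"

lemma Rop_eq: "Rop = opg n (\<lambda>p. if p \<in> row_group D then 1 else 0)"
  unfolding Rop_def opg_def by (rule sum.mono_neutral_cong_left) (auto simp: row_group_eq)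

lemma Cop_eq: "Cop = opg n (\<lambda>p. if p \<in> col_group D then of_int (sign p) else 0)"
  unfolding Cop_def opg_def by (rule sum.mono_neutral_cong_left) (auto simp: col_group_eq)

lemma ops_in_AA [simp, intro]: "Rop \<in> AA n" "Cop \<in> AA n" "Yd \<in> AA n"
  by (auto simp: Rop_eq Cop_eq Yd_def intro!: AA_mult)

lemma co_Rop: "co Rop = (\<lambda>p. if p \<in> row_group D then 1 else 0)"
  by (auto simp: Rop_eq co_opg row_group_eq fun_eq_iff)

lemma co_Cop: "co Cop = (\<lambda>p. if p \<in> col_group D then of_int (sign p) else 0)"
  by (auto simp: Cop_eq co_opg col_group_eq fun_eq_iff)

lemma co_Yd: "co Yd = young_symmetrizer D"
proof -
  have "co Yd = ap Rop (co Cop)" by (simp add: Yd_def co_def)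
  then show ?thesis by (simp add: Rop_eq ap_opg young_symmetrizer_def co_Cop)
qed

text \<open>A permutation preserving all rows and all columns is the identity, so only one pair of
  factors has product 1. In particular the Young symmetrizer is not zero.\<close>

lemma co_Yd_id: "co Yd id = 1"
proof -
  have "co Rop p * co Cop (inv p) = (if p = id then 1 else 0)" if p: "p \<in> Sym n" for p
  proof (cases "p = id")
    case False
    have "\<not> (p \<in> row_group D \<and> inv p \<in> col_group D)"
    proof
      assume *: "p \<in> row_group D \<and> inv p \<in> col_group D"
      then have "p \<in> col_group D" using col_closed(2)[of "inv p"] p by simp
      then have "p k = k" if "k \<in> {1..n}" for k
        using * that rt.label_inject[OF Sym_range[OF p that] that] \<open>p \<in> col_group D\<close>
        by (simp add: row_group_eq col_group_eq)
      moreover have "p k = k" if "k \<notin> {1..n}" for k using p that by (auto simp: Sym_def permutes_def)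
      ultimately show False using False by (auto simp: fun_eq_iff)
    qed
    then show ?thesis using False by (auto simp: co_Rop co_Cop)
  qed (simp add: co_Rop co_Cop row_group_eq col_group_eq)
  then show ?thesis by (simp add: Yd_def co_mult[of Rop n])
qed

lemma Gact_Rop:
  assumes g: "g \<in> row_group D"
  shows "Gact g * Rop = Rop"
proof -
  have "Gact g * Rop = (\<Sum>p\<in>row_group D. Gact (g \<circ> p))"
    unfolding Rop_def sum_distrib_left using g row_Sym by (intro sum.cong) (auto simp: Gact_mult[of _ n])
  also have "\<dots> = Rop"
    unfolding Rop_def using g row_closed row_Sym[OF g]
    by (intro sum.reindex_bij_witness[of _ "\<lambda>p. inv g \<circ> p" "\<lambda>p. g \<circ> p"]) auto
  finally show ?thesis .
qed

lemma Pg_Cop: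
  assumes "a \<in> {1..n}" "b \<in> {1..n}" "rt.cl a = rt.cl b" "a \<noteq> b"
  shows "Pg a b * Cop = - Cop"
proof -
  let ?g = "Transposition.transpose a b"
  have g: "?g \<in> col_group D" using col_closed(3) assms by blast
  have sg: "sign (?g \<circ> p) = - sign p" if "p \<in> col_group D" for p
  proof -
    have "permutation p" using col_Sym[OF that] by (auto simp: Sym_def permutation_permutes)
    moreover have "permutation ?g" by (rule permutation_swap_id)
    ultimately show ?thesis using assms(4) by (simp add: sign_compose sign_swap_id)
  qed
  have "Pg a b * Cop = (\<Sum>p\<in>col_group D. of_int (sign p) *\<^sub>C Gact (?g \<circ> p))"
    unfolding Cop_def Pg_def sum_distrib_left using col_Sym[OF g] col_Sym by (intro sum.cong) (auto simp: Gact_mult[of _ n])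
  also have "\<dots> = (\<Sum>p\<in>col_group D. of_int (- sign p) *\<^sub>C Gact p)"
    using g col_closed col_Sym[OF g] sg
    by (intro sum.reindex_bij_witness[of _ "\<lambda>p. inv ?g \<circ> p" "\<lambda>p. ?g \<circ> p"]) auto
  also have "\<dots> = - Cop" by (simp add: Cop_def sum_negf)
  finally show ?thesis .
qed

lemma Pg_Yd:
  assumes "a \<in> {1..n}" "b \<in> {1..n}" "rt.rw a = rt.rw b"
  shows "Pg a b * Yd = Yd"
  using Gact_Rop[OF row_closed(3)[OF assms]] by (simp add: Yd_def Pg_def flip: mult.assoc)

text \<open>A Garnir relation: in the sum below, the transposition of \<open>k\<close> with the box above it in
  row \<open>i\<close>, up to the row group, contributes a sign; the other terms cancel in pairs.\<close>

lemma garnir: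
  assumes k: "k \<in> {1..n}" and i: "1 \<le> i" "i < rt.rw k"
  defines "L \<equiv> {a \<in> {1..n}. rt.rw a = i}"
  shows "(\<Sum>a\<in>L. Pg a k) * Yd = - Yd"
proof -
  \<comment> \<open>The label in row \<open>i\<close> straight above \<open>k'\<close>; the box
    exists because \<open>D\<close> is a Young diagram.\<close>
  define m where "m k' = row_tableau D (i, rt.cl k')" for k'
  have m: "m k' \<in> L \<and> rt.cl (m k') = rt.cl k'" if "k' \<in> {1..n}" "rt.rw k' = rt.rw k" for k'
  proof -
    have "(i, rt.cl k') \<in> D"
      using young_down[OF young, of "rt.rw k'" "rt.cl k'" i "rt.cl k'"] rt.box[OF that(1)] i that
        young_pos[OF young, of "rt.rw k'" "rt.cl k'"] by auto
    from rt.label[OF this] show ?thesis by (simp add: m_def L_def)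
  qed
  have finL: "finite L" by (simp add: L_def)
  \<comment> \<open>In the summand of \<open>g\<close> the label \<open>k\<close> becomes
    \<open>inv g k\<close>, and \<open>\<beta> g\<close> lies above that in row \<open>i\<close>.
    For \<open>a = \<beta> g\<close> the transposition belongs to the column group.\<close>
  define \<beta> where "\<beta> g = m (inv g k)" for g
  define T where "T g a = Gact g * (Pg a (inv g k) * Cop)" for g a
  have inv_k: "inv g k \<in> {1..n}" "rt.rw (inv g k) = rt.rw k" if "g \<in> row_group D" for g
  proof -
    have "inv g \<in> row_group D" using that by (rule row_closed(2))
    then show "inv g k \<in> {1..n}" "rt.rw (inv g k) = rt.rw k"
      using k Sym_range[of "inv g" k] by (simp_all add: row_group_eq)
  qed
  have \<beta>: "\<beta> g \<in> L" "rt.cl (\<beta> g) = rt.cl (inv g k)" if "g \<in> row_group D" for g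
    using m[OF inv_k[OF that]] by (auto simp: \<beta>_def)
  have nL: "inv g k \<notin> L" if "g \<in> row_group D" for g
    using inv_k[OF that] i by (auto simp: L_def)
  have T\<beta>: "T g (\<beta> g) = - (Gact g * Cop)" if g: "g \<in> row_group D" for g
  proof -
    have "Pg (\<beta> g) (inv g k) * Cop = - Cop"
      using \<beta>[OF g] inv_k[OF g] nL[OF g] by (intro Pg_Cop) (auto simp: L_def)
    then show ?thesis by (simp add: T_def)
  qed
  \<comment> \<open>Composing \<open>g\<close> with the transposition of \<open>a\<close> and
    \<open>\<beta> g\<close> keeps \<open>\<beta> g\<close> and changes the sign of
    \<open>T g a\<close>, because that transposition acts on \<open>Pg a (inv g k) * Cop\<close> by
    -1. This is the pairing under which the other terms cancel.\<close>
  have swap: "g \<circ> Transposition.transpose a (\<beta> g) \<in> row_group D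
      \<and> \<beta> (g \<circ> Transposition.transpose a (\<beta> g)) = \<beta> g \<and> T (g \<circ> Transposition.transpose a (\<beta> g)) a = - T g a"
    if g: "g \<in> row_group D" and a: "a \<in> L" "a \<noteq> \<beta> g" for g a
  proof -
    let ?b = "\<beta> g" and ?k = "inv g k"
    let ?t = "Transposition.transpose a ?b"
    have b: "?b \<in> L" using \<beta>[OF g] by simp
    have ne: "a \<noteq> ?k" "?b \<noteq> ?k" using nL[OF g] a b by auto
    have t: "?t \<in> row_group D" using a b by (intro row_closed(3)) (auto simp: L_def)
    have inv: "inv (g \<circ> ?t) k = ?k"
      using Sym_inv_comp[OF row_Sym[OF g] row_Sym[OF t]] ne by (simp add: Transposition.transpose_def)
    have "Pg ?b ?k * Cop = - Cop"
      using \<beta>[OF g] inv_k[OF g] nL[OF g] by (intro Pg_Cop) (auto simp: L_def)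
    then have 1: "- (Pg a ?k * (Pg ?b ?k * Cop)) = Pg a ?k * Cop" by simp
    have "Pg ?k a * Pg ?k ?b = Pg a ?b * Pg ?k a"
      using ne a(2) by (intro Gr.P_conj) simp_all
    then have "Pg a ?k * Pg ?b ?k = Pg a ?b * Pg a ?k"
      by (simp only: Pg_sym[of a ?k] Pg_sym[of ?b ?k])
    then have "Pg a ?k * (Pg ?b ?k * Cop) = Pg a ?b * (Pg a ?k * Cop)"
      by (simp only: mult.assoc[symmetric])
    with 1 have "Pg a ?b * (Pg a ?k * Cop) = - (Pg a ?k * Cop)" by (metis minus_minus)
    from arg_cong[OF this, of "\<lambda>w. Gact g * w"]
    have "Gact g * Pg a ?b * (Pg a ?k * Cop) = - (Gact g * (Pg a ?k * Cop))"
      by (simp add: mult.assoc)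
    moreover have "Gact g * Pg a ?b = Gact (g \<circ> ?t)"
      using row_Sym[OF g] row_Sym[OF t] by (simp add: Pg_def Gact_mult)
    ultimately have "T (g \<circ> ?t) a = - T g a" by (simp add: T_def inv)
    then show ?thesis using row_closed(1)[OF g t] inv by (simp add: \<beta>_def)
  qed
  have T_sum: "(\<Sum>g\<in>row_group D. T g a) = (\<Sum>g\<in>row_group D. if \<beta> g = a then - (Gact g * Cop) else 0)"
    if a: "a \<in> L" for a
  proof -
    let ?\<Gamma> = "{g \<in> row_group D. \<beta> g \<noteq> a}"
    let ?\<iota> = "\<lambda>g. g \<circ> Transposition.transpose a (\<beta> g)"
    have \<iota>: "?\<iota> g \<in> ?\<Gamma>" "?\<iota> (?\<iota> g) = g" "T (?\<iota> g) a = - T g a" if "g \<in> ?\<Gamma>" for g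
      using swap[of g a] that a by (auto simp: o_assoc[symmetric])
    define W where "W = (\<Sum>g\<in>?\<Gamma>. T g a)"
    have "W = (\<Sum>g\<in>?\<Gamma>. - T g a)"
      unfolding W_def using \<iota> by (intro sum.reindex_bij_witness[of _ ?\<iota> ?\<iota>]) auto
    then have "W = - W" by (simp add: W_def sum_negf)
    then have "W + W = W + - W" by (rule arg_cong)
    then have "2 *\<^sub>C W = 2 *\<^sub>C 0" using cs_add_left[of 1 1 W] by simp
    then have zero: "(\<Sum>g\<in>?\<Gamma>. T g a) = 0" by (subst (asm) cs_cancel) (auto simp: W_def)
    have "(\<Sum>g\<in>row_group D. T g a) = (\<Sum>g\<in>?\<Gamma>. T g a) + (\<Sum>g\<in>{g \<in> row_group D. \<beta> g = a}. T g a)"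
      by (subst sum.union_disjoint[symmetric]) (auto intro!: sum.cong)
    also have "\<dots> = (\<Sum>g\<in>{g \<in> row_group D. \<beta> g = a}. - (Gact g * Cop))"
      using T\<beta> by (auto simp: zero intro!: sum.cong)
    also have "\<dots> = (\<Sum>g\<in>row_group D. if \<beta> g = a then - (Gact g * Cop) else 0)"
      by (simp add: sum.inter_filter)
    finally show ?thesis .
  qed
  \<comment> \<open>Moving \<open>Gact g\<close> past the transposition replaces \<open>a\<close> by
    \<open>g a\<close> and \<open>inv g k\<close> by \<open>k\<close>, and \<open>g\<close> permutes
    the labels of row \<open>i\<close>.\<close>
  have PG: "(\<Sum>a\<in>L. Pg a k) * Gact g * Cop = (\<Sum>a\<in>L. T g a)" if g: "g \<in> row_group D" for g
  proof -
    have gS: "g \<in> Sym n" by (rule row_Sym[OF g])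
    have "T g a = Pg (g a) k * Gact g * Cop" for a
      using Gact_Pg[OF Sym_bij[OF gS], of a "inv g k"] Sym_cancel[OF gS] by (simp add: T_def flip: mult.assoc)
    then have "(\<Sum>a\<in>L. T g a) = (\<Sum>a\<in>L. Pg (g a) k) * Gact g * Cop"
      by (simp add: sum_distrib_right)
    also have "(\<Sum>a\<in>L. Pg (g a) k) = (\<Sum>a\<in>L. Pg a k)"
    proof (rule sum.reindex_bij_witness[of _ "inv g" g])
      show "inv g a \<in> L" if "a \<in> L" for a
        using that row_closed(2)[OF g] Sym_range[of "inv g" a] by (auto simp: L_def row_group_eq)
      show "g a \<in> L" if "a \<in> L" for a
        using that g Sym_range[of g a] by (auto simp: L_def row_group_eq)
    qed (use Sym_cancel[OF gS] in auto)
    finally show ?thesis by simp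
  qed
  have "(\<Sum>a\<in>L. Pg a k) * Yd = (\<Sum>g\<in>row_group D. (\<Sum>a\<in>L. Pg a k) * Gact g * Cop)"
    by (simp add: Yd_def Rop_def sum_distrib_left sum_distrib_right mult.assoc)
  also have "\<dots> = (\<Sum>g\<in>row_group D. \<Sum>a\<in>L. T g a)" by (intro sum.cong PG) auto
  also have "\<dots> = (\<Sum>a\<in>L. \<Sum>g\<in>row_group D. T g a)" by (rule sum.swap)
  also have "\<dots> = (\<Sum>a\<in>L. \<Sum>g\<in>row_group D. if \<beta> g = a then - (Gact g * Cop) else 0)"
    by (intro sum.cong T_sum) auto
  also have "\<dots> = (\<Sum>g\<in>row_group D. \<Sum>a\<in>L. if \<beta> g = a then - (Gact g * Cop) else 0)"
    by (rule sum.swap)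
  also have "\<dots> = (\<Sum>g\<in>row_group D. - (Gact g * Cop))"
    using \<beta> finL by (intro sum.cong) auto
  also have "\<dots> = - Yd" by (simp add: Yd_def Rop_def sum_distrib_right sum_negf)
  finally show ?thesis .
qed

end

section \<open>Weight vectors\<close>

lemma XX_eq_takeWhile:
  assumes "k \<in> {1..n}"
  shows "set (takeWhile (\<lambda>j. j \<noteq> k) [1..<Suc n]) = {1..<k}"
proof -
  have "[1..<Suc n] = [1..<k] @ k # [Suc k..<Suc n]"
    using assms upt_add_eq_append[of 1 k "Suc n - k"] by (simp add: upt_conv_Cons del: upt_Suc)
  moreover have "takeWhile (\<lambda>j. j \<noteq> k) ([1..<k] @ k # [Suc k..<Suc n]) = [1..<k]"
    by (subst takeWhile_append2) (auto simp del: upt_Suc)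
  ultimately have "takeWhile (\<lambda>j. j \<noteq> k) [1..<Suc n] = [1..<k]" by metis
  then show ?thesis by simp
qed

text \<open>This property identifies both \<open>e_straight\<close> and the value of the product for
  a straight tableau.\<close>

definition unit_weight :: "nat \<Rightarrow> (nat \<Rightarrow> complex) \<Rightarrow> (nat \<Rightarrow> nat) endo \<Rightarrow> bool" where
  "unit_weight l c E \<longleftrightarrow> E \<in> AA l \<and> weight l c E \<and> right_weight l c E \<and> tau E = 1"

lemma weight_mult: "weight l c X \<Longrightarrow> weight l c (X * Z)"
  by (auto simp: weight_def simp flip: mult.assoc)

lemma weight_scale: "weight l c X \<Longrightarrow> weight l c (d *\<^sub>C X)"
  by (auto simp: weight_def mult.commute)

lemma weight_diff: "weight l c X \<Longrightarrow> weight l c Y \<Longrightarrow> weight l c (X - Y)"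
  by (auto simp: weight_def right_diff_distrib cs_diff_right)

lemma right_weight_mult: "right_weight l c X \<Longrightarrow> right_weight l c (Z * X)"
  by (auto simp: right_weight_def mult.assoc)

lemma right_weight_scale: "right_weight l c X \<Longrightarrow> right_weight l c (d *\<^sub>C X)"
  by (auto simp: right_weight_def mult.commute)

lemma right_weight_diff: "right_weight l c X \<Longrightarrow> right_weight l c Y \<Longrightarrow> right_weight l c (X - Y)"
  by (auto simp: right_weight_def left_diff_distrib cs_diff_right)

lemma weight_mono: "weight l c X \<Longrightarrow> k \<le> l \<Longrightarrow> weight k c X"
  by (auto simp: weight_def)

lemma (in field_twist) twist_weight:
  assumes "X \<in> AA l" "\<And>k. h (c k) = c k" "k \<le> l"
  shows "weight k c X \<Longrightarrow> right_weight k c (twist h l X)" "right_weight k c X \<Longrightarrow> weight k c (twist h l X)"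
proof -
  have "twist h l (XX j * X) = twist h l X * XX j" "twist h l (X * XX j) = XX j * twist h l X" if "j \<in> {1..k}" for j
    using that assms by (auto simp: twist_mult XX_in_AA twist_XX)
  then show "weight k c X \<Longrightarrow> right_weight k c (twist h l X)" "right_weight k c X \<Longrightarrow> weight k c (twist h l X)"
    using assms(2) by (auto simp: weight_def right_weight_def twist_scale)
qed

lemma res_weight:
  assumes "Z \<in> AA l" "k \<le> l"
  shows "weight k c Z \<Longrightarrow> weight k c (res k Z)" "right_weight k c Z \<Longrightarrow> right_weight k c (res k Z)"
  using assms
  by (auto simp: weight_def right_weight_def res_scale XX_in_AA
      simp flip: res_mult_left[of _ k] res_mult_right[of _ k Z l])

locale real_weight =
  fixes c :: "nat \<Rightarrow> complex"
  assumes c_real: "cnj (c k) = c k"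
begin

lemma weight_eqI:
  assumes "E \<in> AA l" "weight l c E" "right_weight l c E" "F \<in> AA l" "weight l c F" "right_weight l c F" "tau E = tau F"
  shows "E = F"
proof -
  have "E - F = 0"
    using assms by (intro weight_unique_zero[of _ l c] weight_diff right_weight_diff AA_diff c_real) auto
  then show ?thesis by simp
qed

lemma unit_weight_unique: "unit_weight l c E \<Longrightarrow> unit_weight l c F \<Longrightarrow> E = F"
  unfolding unit_weight_def by (intro weight_eqI[of E l F]) auto

lemma unit_weight_twist:
  assumes E: "unit_weight l c E"
  shows "star l E = E" "twist (\<lambda>c. c) l E = E"
proof -
  have "unit_weight l c (star l E)"
    using E conj.twist_weight[of E l c l] c_real by (auto simp: unit_weight_def tau_def co_twist)
  then show "star l E = E" using E unit_weight_unique by blast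
  have "unit_weight l c (twist (\<lambda>c. c) l E)"
    using E plain.twist_weight[of E l c l] by (auto simp: unit_weight_def tau_def co_twist)
  then show "twist (\<lambda>c. c) l E = E" using E unit_weight_unique by blast
qed

text \<open>Weights on both sides survive the restriction, so it is a multiple of \<open>E\<close>;
  the trace gives the factor.\<close>

lemma res_star:
  assumes "unit_weight k c E" "X \<in> AA l" "weight k c X" "k \<le> l"
  shows "res k (X * star l X) = tau (X * star l X) *\<^sub>C E"
  using assms c_real conj.twist_weight(1)[of X l c k]
  by (intro weight_eqI[of _ k])
    (auto simp: unit_weight_def tau_res AA_mult intro!: res_weight[of _ l] weight_mult weight_scale
      right_weight_mult right_weight_scale)

text \<open>Up to the factor \<open>H\<close>, \<open>E\<close> is idempotent. The part
  \<open>X'\<close> of \<open>X\<close> killed by \<open>E\<close> has the same weight, so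
  \<open>X'\<close> times its adjoint restricts to a multiple of \<open>E\<close>. Multiplying by
  \<open>E\<close> gives zero, hence the multiple, which is the squared norm of \<open>X'\<close>,
  is zero.\<close>

lemma unit_weight_mult:
  assumes E: "unit_weight k c E" and X: "X \<in> AA l" "weight k c X" and "k \<le> l"
  shows "E * X = tau (E * E) *\<^sub>C X" "tau (E * E) \<noteq> 0"
proof -
  define H where "H = tau (E * E)"
  have EA: "E \<in> AA k" "E \<in> AA l" and w: "weight k c E" "right_weight k c E" and t: "tau E = 1"
    using E AA_mono[OF \<open>k \<le> l\<close>] by (auto simp: unit_weight_def)
  have H: "H \<noteq> 0"
    unfolding H_def using tau_star_zero[OF EA(1)] unit_weight_twist(1)[OF E] t by auto
  have EE: "E * E = H *\<^sub>C E"
    using EA w t unfolding H_def by (intro weight_eqI[of _ k] weight_mult right_weight_mult weight_scale right_weight_scale AA_mult AA_scale) auto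
  define X' where "X' = X - (1 / H) *\<^sub>C (E * X)"
  have X': "X' \<in> AA l" "weight k c X'"
    using X EA w unfolding X'_def by (auto intro!: weight_diff weight_scale weight_mult)
  have "E * X' = 0"
    using EE H by (simp add: X'_def right_diff_distrib) (simp flip: mult.assoc)
  then have "0 = res k (E * (X' * star l X'))" by (simp add: res_def co_def opg_def flip: mult.assoc)
  also have "\<dots> = E * res k (X' * star l X')" by (rule res_mult_left[OF EA(1)])
  also have "\<dots> = (tau (X' * star l X') * H) *\<^sub>C E"
    using res_star[OF E X' \<open>k \<le> l\<close>] EE by simp
  finally have "0 = tau ((tau (X' * star l X') * H) *\<^sub>C E)" by simp
  then have "tau (X' * star l X') = 0" using H t by simp
  then have "X' = 0" using tau_star_zero[OF X'(1)] by simp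
  then have "X = (1 / H) *\<^sub>C (E * X)" by (simp add: X'_def)
  then show "E * X = tau (E * E) *\<^sub>C X" "tau (E * E) \<noteq> 0"
    using H unfolding H_def[symmetric] by (metis cs_eq_iff)+
qed

lemma unit_weight_exists:
  assumes "u \<in> AA l" "weight l c u" "u \<noteq> 0"
  shows "\<exists>E. unit_weight l c E"
proof -
  let ?N = "tau (u * star l u)"
  have N: "?N \<noteq> 0" using tau_star_zero[OF assms(1)] assms(3) by blast
  have "unit_weight l c ((1 / ?N) *\<^sub>C (u * star l u))"
    using assms N c_real conj.twist_weight(1)[of u l c l]
    by (auto simp: unit_weight_def intro!: weight_mult weight_scale right_weight_mult right_weight_scale)
  then show ?thesis by blast
qed

text \<open>The isomorphism sends \<open>X * u\<close> to a multiple of \<open>X * u'\<close>. The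
  formula for \<open>\<phi>\<close> makes sense on all functions: multiplying by the adjoint of
  \<open>u\<close> and restricting turns \<open>X * u\<close> into
  \<open>N *\<^sub>C (X * E)\<close>, and \<open>E\<close> acts on \<open>u'\<close> by
  \<open>H\<close>.\<close>

lemma cyclic_labeled:
  assumes u: "u \<in> AA l" "weight k c u" "u \<noteq> 0" and u': "u' \<in> AA k" "weight k c u'" "u' \<noteq> 0" and kl: "k \<le> l"
    and D: "card D = k" "irrep D = {co (X * u') | X. X \<in> AA k}"
  shows "labeled_by {co (X * u) | X. X \<in> AA k} D"
proof -
  obtain E where E: "unit_weight k c E" using unit_weight_exists[OF u'] by blast
  define \<phi> where "\<phi> f = co (res k (opg l f * star l u) * u')" for f
  define H where "H = tau (E * E)"
  define N where "N = tau (u * star l u)"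
  have EA: "E \<in> AA k" using E by (simp add: unit_weight_def)
  have N: "N \<noteq> 0" using tau_star_zero[OF u(1)] u(3) by (auto simp: N_def)
  note Eu = unit_weight_mult(1)[OF E u(1,2) kl, folded H_def] unit_weight_mult(1)[OF E u'(1,2) order_refl, folded H_def]
  have H: "H \<noteq> 0" unfolding H_def by (rule unit_weight_mult(2)[OF E u'(1,2) order_refl])
  have up: "X \<in> AA k \<Longrightarrow> X \<in> AA l" for X by (rule AA_mono[OF kl])
  have \<phi>: "\<phi> (co (X * u)) = cscale (N * H) (co (X * u'))" if X: "X \<in> AA k" for X
  proof -
    have "opg l (co (X * u)) = X * u" using up[OF X] u(1) by (intro opg_co) auto
    then have "res k (opg l (co (X * u)) * star l u) = N *\<^sub>C (X * E)"
      using res_star[OF E u(1,2) kl] by (simp add: mult.assoc res_mult_left[OF X] N_def)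
    then show ?thesis by (simp add: \<phi>_def mult.assoc Eu) (simp add: co_def mult.commute)
  qed
  have inj: "co (X * u) = co (Z * u)" if X: "X \<in> AA k" and Z: "Z \<in> AA k" and eq: "co (X * u') = co (Z * u')" for X Z
  proof -
    have "X * u' = Z * u'"
      using X Z u'(1) eq by (intro AA_eqI[of _ k] AA_mult) auto
    then have "(X - Z) * (u' * star k u') = 0" by (simp add: left_diff_distrib flip: mult.assoc)
    moreover have "u' * star k u' = tau (u' * star k u') *\<^sub>C E"
      using res_star[OF E u'(1,2) order_refl] u'(1) by (simp add: res_id AA_mult)
    moreover have "tau (u' * star k u') \<noteq> 0" using tau_star_zero[OF u'(1)] u'(3) by auto
    ultimately have "tau (u' * star k u') *\<^sub>C ((X - Z) * E) = tau (u' * star k u') *\<^sub>C 0"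
      by (metis cs_zero_right mult_cs_right)
    then have "(X - Z) * E = 0" using \<open>tau (u' * star k u') \<noteq> 0\<close> by (subst (asm) cs_cancel)
    then have "H *\<^sub>C ((X - Z) * u) = H *\<^sub>C 0"
      using Eu(1) by (metis cs_zero_right mult.assoc mult_cs_right mult_zero_left)
    then have "(X - Z) * u = 0" using H by (subst (asm) cs_cancel)
    then show ?thesis by (simp add: left_diff_distrib)
  qed
  have "Vector_Spaces.linear cscale cscale \<phi>"
  proof (rule linear_cscaleI)
    have "opg l (f + g) = opg l f + opg l g" "opg l (cscale d f) = d *\<^sub>C opg l f" for f g d
      by (simp_all add: opg_def cs_add_left sum.distrib cs_sum_right cscale_def)
    then show "\<phi> (f + g) = \<phi> f + \<phi> g" "\<phi> (cscale d f) = cscale d (\<phi> f)" for f g d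
      by (simp_all add: \<phi>_def distrib_right res_add res_scale co_def)
  qed
  moreover have "bij_betw \<phi> {co (X * u) | X. X \<in> AA k} (irrep D)"
    unfolding bij_betw_def
  proof
    show "inj_on \<phi> {co (X * u) | X. X \<in> AA k}"
    proof (rule inj_onI)
      fix f g assume "f \<in> {co (X * u) | X. X \<in> AA k}" "g \<in> {co (X * u) | X. X \<in> AA k}" and eq: "\<phi> f = \<phi> g"
      then obtain X Z where XZ: "X \<in> AA k" "Z \<in> AA k" "f = co (X * u)" "g = co (Z * u)" by blast
      then have "cscale (N * H) (co (X * u')) = cscale (N * H) (co (Z * u'))"
        using eq \<phi>[OF XZ(1)] \<phi>[OF XZ(2)] by simp
      then have "co (X * u') = co (Z * u')"
        using N H by (simp add: cscale_def fun_eq_iff)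
      then show "f = g" using inj XZ by blast
    qed
    show "\<phi> ` {co (X * u) | X. X \<in> AA k} = irrep D"
    proof
      show "\<phi> ` {co (X * u) | X. X \<in> AA k} \<subseteq> irrep D"
      proof
        fix g assume "g \<in> \<phi> ` {co (X * u) | X. X \<in> AA k}"
        then obtain X where X: "X \<in> AA k" "g = cscale (N * H) (co (X * u'))" using \<phi> by auto
        then have "g = co (((N * H) *\<^sub>C X) * u')" by (simp add: co_def)
        then show "g \<in> irrep D" using X unfolding D by blast
      qed
      show "irrep D \<subseteq> \<phi> ` {co (X * u) | X. X \<in> AA k}"
      proof
        fix g assume "g \<in> irrep D"
        then obtain X where X: "X \<in> AA k" "g = co (X * u')" unfolding D by blast
        have "\<phi> (co (((1 / (N * H)) *\<^sub>C X) * u)) = g"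
          using X N H by (subst \<phi>) (auto simp: co_def cscale_def fun_eq_iff)
        then show "g \<in> \<phi> ` {co (X * u) | X. X \<in> AA k}" using X by blast
      qed
    qed
  qed
  moreover have "\<phi> (gact s f) = gact s (\<phi> f)" if s: "s \<in> Sym k" and f: "f \<in> {co (X * u) | X. X \<in> AA k}" for s f
  proof -
    obtain X where X: "X \<in> AA k" "f = co (X * u)" using f by blast
    have "gact s f = co ((Gact s * X) * u)" by (simp add: X co_def)
    then have "\<phi> (gact s f) = cscale (N * H) (co (Gact s * X * u'))" using X s by (simp only: \<phi> AA_mult AA_Gact)
    also have "\<dots> = gact s (\<phi> f)" using X by (simp add: \<phi>) (simp add: co_def cscale_def gact_def)
    finally show ?thesis .
  qed
  ultimately show ?thesis unfolding labeled_by_def D(1) by blast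
qed

end

lemma irrep_eq:
  assumes "young_diagram D"
  shows "irrep D = {co (X * young.Yd D) | X. X \<in> AA (card D)}"
proof -
  interpret young D by unfold_locales fact
  have 1: "gmult n f (young_symmetrizer D) = co (opg n f * Yd)" for f
    by (simp add: co_Yd[symmetric] co_def ap_opg)
  have 2: "co X \<in> group_algebra n" if "X \<in> AA n" for X
    using co_outside[OF that] by (simp add: group_algebra_def)
  show ?thesis
    unfolding irrep_def 1
  proof (intro Collect_cong iffI)
    fix g assume "\<exists>f. g = co (opg n f * Yd) \<and> f \<in> group_algebra n"
    then show "\<exists>X. g = co (X * Yd) \<and> X \<in> AA n" by blast
  next
    fix g assume "\<exists>X. g = co (X * Yd) \<and> X \<in> AA n"
    then obtain X where "g = co (X * Yd)" "X \<in> AA n" by blast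
    then show "\<exists>f. g = co (opg n f * Yd) \<and> f \<in> group_algebra n"
      using 2 opg_co by (intro exI[of _ "co X"]) simp
  qed
qed

locale young_tableau = tableau +
  assumes young: "young_diagram D"
begin

sublocale Y: young D
  using young by unfold_locales

abbreviation "n \<equiv> card D"

definition cn :: "nat \<Rightarrow> complex" where
  "cn k = of_int (box_content D \<Omega> k)"

lemma cn_eq: "cn k = of_nat (cl k) - of_nat (rw k)"
  by (simp add: cn_def box_content_def)

sublocale real_weight cn
  by unfold_locales (simp add: cn_def)

text \<open>The permutation carrying the row by row filling to \<open>\<Omega>\<close>, so that
  relations of the Young symmetrizer become relations in the labels of
  \<open>\<Omega>\<close>.\<close>

definition \<sigma> :: "nat \<Rightarrow> nat" where
  "\<sigma> k = (if k \<in> {1..n} then \<Omega> (Y.rt.rw k, Y.rt.cl k) else k)"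

lemma \<sigma>_row: "k \<in> {1..n} \<Longrightarrow> \<sigma> k \<in> {1..n} \<and> rw (\<sigma> k) = Y.rt.rw k"
  using Y.rt.box[of k] label by (auto simp: \<sigma>_def)

lemma \<sigma>_Sym: "\<sigma> \<in> Sym n"
proof -
  have "inj_on \<sigma> {1..n}"
  proof (rule inj_onI)
    fix k l assume kl: "k \<in> {1..n}" "l \<in> {1..n}" "\<sigma> k = \<sigma> l"
    have "(Y.rt.rw k, Y.rt.cl k) = (Y.rt.rw l, Y.rt.cl l)"
    proof (rule inj_onD[of \<Omega> D])
      show "inj_on \<Omega> D" using bij by (simp add: bij_betw_def)
      show "\<Omega> (Y.rt.rw k, Y.rt.cl k) = \<Omega> (Y.rt.rw l, Y.rt.cl l)" using kl by (simp add: \<sigma>_def)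
    qed (use Y.rt.box[OF kl(1)] Y.rt.box[OF kl(2)] in blast)+
    then show "k = l" using Y.rt.label_inject[OF kl(1,2)] by simp
  qed
  moreover have "\<sigma> ` {1..n} \<subseteq> {1..n}" using \<sigma>_row by blast
  ultimately have "bij_betw \<sigma> {1..n} {1..n}"
    by (simp add: bij_betw_def endo_inj_surj)
  then show ?thesis unfolding Sym_def by (auto intro: bij_imp_permutes simp: \<sigma>_def)
qed

lemma \<sigma>_surj: "k \<in> {1..n} \<Longrightarrow> \<exists>k'\<in>{1..n}. k = \<sigma> k'"
  using \<sigma>_Sym permutes_image[of \<sigma> "{1..n}"] by (auto simp: Sym_def)

text \<open>The translated symmetrizer \<open>?v\<close> is symmetric along rows and satisfies the
  Garnir relations between rows; these are the hypotheses of \<open>JM_base\<close> for the row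
  reading. The exchanges multiply it by invertible elements, so that \<open>F * Y.Yd\<close> still
  generates the same left ideal.\<close>

lemma weight_generator:
  "\<exists>F\<in>AA n. \<exists>F'\<in>AA n. F * F' = 1 \<and> F' * F = 1 \<and> weight n cn (F * Y.Yd)"
proof -
  interpret labels n rw cl by (rule labels_rows)
  interpret SL: straight_labels n rw cl by (rule straight_labels(1)[OF young])
  \<comment> \<open>Only one point matters here: there are no variables and no generic points, and
    the contents themselves serve as parameters.\<close>
  interpret S: positive_shape Pg 1 "{}" "{}" "\<lambda>_. 0" "\<lambda>_. cn" n rw cl 0
    by unfold_locales (use young_pos[OF young] box in \<open>auto simp: cn_eq intro: polynomial_fun.const\<close>)
  let ?v = "Gact \<sigma> * Y.Yd"
  have sb: "bij \<sigma>" using \<sigma>_Sym by (rule Sym_bij)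
  have rel1: "Pg a b * ?v = ?v" if ab: "a \<in> {1..n}" "b \<in> {1..n}" "rw a = rw b" for a b
  proof -
    obtain a' b' where "a = \<sigma> a'" "b = \<sigma> b'" "a' \<in> {1..n}" "b' \<in> {1..n}" using \<sigma>_surj ab by metis
    moreover from this have "Pg a b * ?v = Gact \<sigma> * (Pg a' b' * Y.Yd)"
      using Gact_Pg[OF sb, of a' b'] by (simp flip: mult.assoc)
    ultimately show ?thesis using Y.Pg_Yd[of a' b'] \<sigma>_row ab(3) by auto
  qed
  have rel2: "(\<Sum>a\<in>{a \<in> {1..n}. rw a = i}. Pg a k) * ?v = - ?v"
    if k: "k \<in> {1..n}" "1 \<le> i" "i < rw k" for k i
  proof -
    obtain k' where k': "k = \<sigma> k'" "k' \<in> {1..n}" using \<sigma>_surj k by metis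
    let ?L' = "{a \<in> {1..n}. Y.rt.rw a = i}"
    have "(\<Sum>a\<in>{a \<in> {1..n}. rw a = i}. Pg a k) = (\<Sum>a\<in>?L'. Pg (\<sigma> a) k)"
    proof (rule sum.reindex_bij_betw[symmetric])
      show "bij_betw \<sigma> ?L' {a \<in> {1..n}. rw a = i}"
      proof (rule bij_betw_imageI)
        show "inj_on \<sigma> ?L'" using sb by (auto simp: bij_def intro: inj_on_subset)
        show "\<sigma> ` ?L' = {a \<in> {1..n}. rw a = i}"
        proof
          show "\<sigma> ` ?L' \<subseteq> {a \<in> {1..n}. rw a = i}" using \<sigma>_row by auto
          show "{a \<in> {1..n}. rw a = i} \<subseteq> \<sigma> ` ?L'"
          proof
            fix a assume a: "a \<in> {a \<in> {1..n}. rw a = i}"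
            then obtain a' where a': "a' \<in> {1..n}" "a = \<sigma> a'" using \<sigma>_surj[of a] by blast
            then have "a' \<in> ?L'" using a \<sigma>_row[OF a'(1)] by simp
            then show "a \<in> \<sigma> ` ?L'" using a'(2) by blast
          qed
        qed
      qed
    qed
    moreover have "Pg (\<sigma> a) k * Gact \<sigma> = Gact \<sigma> * Pg a k'" for a
      using Gact_Pg[OF sb] k' by simp
    ultimately have "(\<Sum>a\<in>{a \<in> {1..n}. rw a = i}. Pg a k) * ?v = Gact \<sigma> * ((\<Sum>a\<in>?L'. Pg a k') * Y.Yd)"
      by (simp add: sum_distrib_left sum_distrib_right flip: mult.assoc)
    also have "(\<Sum>a\<in>?L'. Pg a k') * Y.Yd = - Y.Yd"
      using Y.garnir[of k' i] k k' \<sigma>_row by simp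
    finally show ?thesis by simp
  qed
  have base: "S.JM_eigen (concat (linesL 1 S.ln_bound)) 0 ?v"
  proof (rule S.JM_base)
    show "\<forall>L\<in>set (linesL 1 S.ln_bound). \<forall>a\<in>set L. \<forall>b\<in>set L. a \<noteq> b \<longrightarrow> Pg a b * ?v = 1 *\<^sub>C ?v"
    proof (intro ballI impI)
      fix L a b assume "L \<in> set (linesL 1 S.ln_bound)" "a \<in> set L" "b \<in> set L"
      then obtain i where "a \<in> set (lineL i)" "b \<in> set (lineL i)" unfolding linesL_def by auto
      then show "Pg a b * ?v = 1 *\<^sub>C ?v" unfolding set_lineL cs_one by (intro rel1) auto
    qed
    have "Gr.Y (lineL i) k * ?v = - (1 *\<^sub>C ?v)" if "i < j" "1 \<le> i" "k \<in> set (lineL j)" for i j k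
      using rel2[of k i] that unfolding set_lineL Gr.Y_def cs_one by auto
    then have "sorted_wrt (\<lambda>i j. \<forall>k\<in>set (lineL j). Gr.Y (lineL i) k * ?v = - (1 *\<^sub>C ?v)) [1..<S.ln_bound]"
      by (intro sorted_wrt_mono_rel[OF _ sorted_wrt_upt]) auto
    then show "sorted_wrt (\<lambda>L L'. \<forall>k\<in>set L'. Gr.Y L k * ?v = - (1 *\<^sub>C ?v)) (linesL 1 S.ln_bound)"
      unfolding linesL_def by (intro sorted_wrt_filter) (simp add: sorted_wrt_map)
  qed (rule SL.straight_labels_axioms)
  have "\<exists>F\<in>AA n. \<exists>F'\<in>AA n. F * F' = 1 \<and> F' * F = 1 \<and> S.JM_eigen [1..<Suc n] 0 (F * ?v)"
  proof (rule S.reach_all)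
    show "\<exists>F\<in>AA n. \<exists>F'\<in>AA n. F * F' = 1 \<and> F' * F = 1 \<and> S.JM_eigen (concat (linesL 1 S.ln_bound)) 0 (F * ?v)"
      using base by (intro bexI[of _ 1]) auto
  next
    fix xs a b ys
    assume *: "distinct (xs @ [a, b] @ ys)" "set (xs @ [a, b] @ ys) \<subseteq> {1..n}" "S.far a b"
      and "\<exists>F\<in>AA n. \<exists>F'\<in>AA n. F * F' = 1 \<and> F' * F = 1 \<and> S.JM_eigen (xs @ [b, a] @ ys) 0 (F * ?v)"
    then obtain F F' where F: "F \<in> AA n" "F' \<in> AA n" "F * F' = 1" "F' * F = 1"
      "S.JM_eigen (xs @ [b, a] @ ys) 0 (F * ?v)" by blast
    let ?R = "Gr.R cn a b" and ?R' = "S.kap a b *\<^sub>C Gr.R cn b a"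
    have ne: "a \<noteq> b" using * by auto
    have RA: "?R \<in> AA n" "?R' \<in> AA n" using * by (auto simp: Gr.R_def intro!: AA_diff AA_scale Pg_in_AA)
    have inv: "?R * ?R' = 1" "?R' * ?R = 1" using S.R_inverse[OF *(3) ne] by simp_all
    have "?R * F * (F' * ?R') = ?R * (F * F') * ?R'" "F' * ?R' * (?R * F) = F' * (?R' * ?R) * F"
      by (simp_all only: mult.assoc)
    then have "?R * F * (F' * ?R') = 1" "F' * ?R' * (?R * F) = 1"
      by (simp_all only: F(3,4) inv mult_1_right)
    moreover have "S.JM_eigen (xs @ [a, b] @ ys) 0 (?R * F * ?v)"
      using S.JM_eigen_swap[OF *(1,3) F(5)] by (simp add: mult.assoc)
    ultimately show "\<exists>F\<in>AA n. \<exists>F'\<in>AA n. F * F' = 1 \<and> F' * F = 1 \<and> S.JM_eigen (xs @ [a, b] @ ys) 0 (F * ?v)"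
      using F(1,2) RA by (intro bexI[of _ "?R * F", OF bexI[of _ "F' * ?R'"]] conjI AA_mult)
  qed
  then obtain F F' where F: "F \<in> AA n" "F' \<in> AA n" "F * F' = 1" "F' * F = 1" "S.JM_eigen [1..<Suc n] 0 (F * ?v)"
    by blast
  have "weight n cn (F * Gact \<sigma> * Y.Yd)"
    unfolding weight_def
  proof
    fix k assume k: "k \<in> {1..n}"
    have "S.JM [1..<Suc n] k = XX k" unfolding S.JM_def XX_eq_takeWhile[OF k] XX_def ..
    moreover have "k \<in> set [1..<Suc n]" using k by (auto simp del: upt_Suc)
    ultimately have "XX k * (F * ?v) = (cn k - 0) *\<^sub>C (F * ?v)"
      using F(5)[unfolded S.JM_eigen_def, rule_format, of k] by simp
    then show "XX k * (F * Gact \<sigma> * Y.Yd) = cn k *\<^sub>C (F * Gact \<sigma> * Y.Yd)"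
      by (simp add: mult.assoc)
  qed
  moreover have G: "Gact \<sigma> * Gact (inv \<sigma>) = 1" "Gact (inv \<sigma>) * Gact \<sigma> = 1"
    using \<sigma>_Sym by (simp_all add: Gact_mult[of _ n] Sym_inv)
  have "F * Gact \<sigma> * (Gact (inv \<sigma>) * F') = F * (Gact \<sigma> * Gact (inv \<sigma>)) * F'"
    "Gact (inv \<sigma>) * F' * (F * Gact \<sigma>) = Gact (inv \<sigma>) * (F' * F) * Gact \<sigma>"
    by (simp_all only: mult.assoc)
  then have "F * Gact \<sigma> * (Gact (inv \<sigma>) * F') = 1" "Gact (inv \<sigma>) * F' * (F * Gact \<sigma>) = 1"
    by (simp_all only: F(3,4) G mult_1_right)
  ultimately show ?thesis
    using F(1,2) \<sigma>_Sym
    by (intro bexI[of _ "F * Gact \<sigma>", OF bexI[of _ "Gact (inv \<sigma>) * F'"]] conjI AA_mult AA_Gact Sym_inv)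
qed

lemma weight_vector:
  obtains u where "u \<in> AA n" "weight n cn u" "u \<noteq> 0" "irrep D = {co (X * u) | X. X \<in> AA n}"
proof -
  obtain F F' where F: "F \<in> AA n" "F' \<in> AA n" "F * F' = 1" "F' * F = 1" "weight n cn (F * Y.Yd)"
    using weight_generator by blast
  have "Y.Yd \<noteq> 0" using Y.co_Yd_id by auto
  moreover have "F' * (F * Y.Yd) = Y.Yd" using F(4) by (simp flip: mult.assoc)
  ultimately have "F * Y.Yd \<noteq> 0" by auto
  moreover have "irrep D = {co (X * (F * Y.Yd)) | X. X \<in> AA n}"
  proof -
    have "X * Y.Yd = X * F' * (F * Y.Yd)" for X using F(4) by (simp add: mult.assoc) (simp flip: mult.assoc)
    moreover have "X * (F * Y.Yd) = X * F * Y.Yd" for X by (simp add: mult.assoc)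
    ultimately show ?thesis unfolding irrep_eq[OF young] using F(1,2) by (metis (no_types, lifting) AA_mult)
  qed
  ultimately show ?thesis using F Y.ops_in_AA by (intro that[of "F * Y.Yd"]) auto
qed

end

section \<open>Young vectors\<close>

lemma cs_sum_left: "sum f I *\<^sub>C X = (\<Sum>i\<in>I. f i *\<^sub>C X)"
  by (induction I rule: infinite_finite_induct) (auto simp: cs_add_left)

section \<open>The central sum of all transpositions\<close>

definition TT :: "nat \<Rightarrow> (nat \<Rightarrow> nat) endo" where
  "TT k = (\<Sum>j\<in>{1..k}. XX j)"

lemma TT_in_AA [intro]: "TT k \<in> AA k"
  unfolding TT_def by (intro AA_sum XX_in_AA) auto

lemma TT_Suc: "TT (Suc k) = TT k + XX (Suc k)"
  by (simp add: TT_def)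

text \<open>Twice the sum runs over all ordered pairs of distinct labels, a set mapped to itself by
  every permutation, whereas the condition of increasing order would be disturbed.\<close>

lemma TT_central:
  assumes "X \<in> AA k"
  shows "TT k * X = X * TT k"
proof -
  define S where "S = {(i, j). i \<in> {1..k} \<and> j \<in> {1..k} \<and> i \<noteq> j}"
  have S: "finite S" by (rule finite_subset[of _ "{1..k} \<times> {1..k}"]) (auto simp: S_def)
  have "TT k = (\<Sum>(j, i)\<in>(SIGMA j:{1..k}. {1..<j}). Pg i j)"
    by (simp add: TT_def XX_def sum.Sigma)
  also have "\<dots> = (\<Sum>(i, j)\<in>{p \<in> S. fst p < snd p}. Pg i j)"
    by (rule sum.reindex_bij_witness[of _ prod.swap prod.swap]) (auto simp: S_def)
  finally have T1: "TT k = (\<Sum>(i, j)\<in>{p \<in> S. fst p < snd p}. Pg i j)" .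
  have "(\<Sum>(i, j)\<in>{p \<in> S. fst p < snd p}. Pg i j) = (\<Sum>(i, j)\<in>{p \<in> S. \<not> fst p < snd p}. Pg i j)"
    by (rule sum.reindex_bij_witness[of _ prod.swap prod.swap]) (auto simp: S_def Pg_sym)
  then have "TT k + TT k = (\<Sum>(i, j)\<in>{p \<in> S. fst p < snd p}. Pg i j) + (\<Sum>(i, j)\<in>{p \<in> S. \<not> fst p < snd p}. Pg i j)"
    by (simp add: T1)
  also have "\<dots> = (\<Sum>(i, j)\<in>S. Pg i j)"
    by (subst sum.union_disjoint[symmetric]) (use S in \<open>auto intro!: sum.cong\<close>)
  finally have TS: "TT k + TT k = (\<Sum>(i, j)\<in>S. Pg i j)" .
  have "(TT k + TT k) * Gact s = Gact s * (TT k + TT k)" if s: "s \<in> Sym k" for s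
  proof -
    have b: "bij s" by (rule Sym_bij[OF s])
    have im: "s i \<in> {1..k} \<longleftrightarrow> i \<in> {1..k}" for i
      using s by (intro permutes_in_image) (simp add: Sym_def)
    have im': "inv s i \<in> {1..k} \<longleftrightarrow> i \<in> {1..k}" for i
      using Sym_inv[OF s] by (intro permutes_in_image) (simp add: Sym_def)
    have c: "inv s (s i) = i" "s (inv s i) = i" for i
      using b by (auto simp: bij_is_inj bij_is_surj surj_f_inv_f)
    have inj: "s i = s j \<longleftrightarrow> i = j" "inv s i = inv s j \<longleftrightarrow> i = j" for i j
      by (metis c)+
    have "Gact s * (\<Sum>(i, j)\<in>S. Pg i j) = (\<Sum>(i, j)\<in>S. Pg (s i) (s j)) * Gact s"
      by (simp add: sum_distrib_left sum_distrib_right Gact_Pg[OF b] case_prod_unfold)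
    also have "(\<Sum>(i, j)\<in>S. Pg (s i) (s j)) = (\<Sum>(i, j)\<in>S. Pg i j)"
      by (rule sum.reindex_bij_witness[of _ "\<lambda>(i, j). (inv s i, inv s j)" "\<lambda>(i, j). (s i, s j)"])
        (auto simp: S_def c inj im[unfolded One_nat_def] im'[unfolded One_nat_def] simp del: atLeastAtMost_iff)
    finally show ?thesis by (simp add: TS)
  qed
  then have "(TT k + TT k) * opg k (co X) = opg k (co X) * (TT k + TT k)"
    by (simp add: opg_def sum_distrib_left sum_distrib_right)
  then have "2 *\<^sub>C (TT k * X) = 2 *\<^sub>C (X * TT k)"
    using cs_add_left[of 1 1 "TT k * X"] cs_add_left[of 1 1 "X * TT k"]
    by (simp add: opg_co[OF assms] distrib_left distrib_right)
  then show ?thesis by (subst (asm) cs_cancel) auto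
qed

lemma ap_linear_sum:
  assumes lin: "Vector_Spaces.linear cscale cscale \<phi>"
    and eq: "\<And>s. s \<in> Sym k \<Longrightarrow> \<phi> (gact s f) = gact s (\<phi> f)" and T: "T \<in> AA k"
  shows "\<phi> (ap T f) = ap T (\<phi> f)"
proof -
  interpret Vector_Spaces.linear cscale cscale \<phi> by fact
  have "ap T g = (\<Sum>s\<in>Sym k. cscale (co T s) (gact s g))" for g
    using opg_co[OF T] ap_sum_left[of "\<lambda>s. co T s *\<^sub>C Gact s" "Sym k" g] by (simp add: opg_def)
  then show ?thesis using eq by (simp add: sum scale)
qed

context young_tableau
begin

definition Dk :: "nat \<Rightarrow> (nat \<times> nat) set" where
  "Dk k = {b \<in> D. \<Omega> b \<le> k}"

lemma Dk_tableau:
  assumes "k \<le> n"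
  shows "young_tableau (Dk k) \<Omega>" "card (Dk k) = k"
    "\<And>j. j \<in> {1..k} \<Longrightarrow> young_tableau.cn (Dk k) \<Omega> j = cn j"
proof -
  have bk: "bij_betw \<Omega> (Dk k) {1..k}"
  proof (rule bij_betw_imageI)
    show "inj_on \<Omega> (Dk k)" using bij by (auto simp: bij_betw_def Dk_def intro: inj_on_subset)
    show "\<Omega> ` Dk k = {1..k}"
    proof
      show "\<Omega> ` Dk k \<subseteq> {1..k}" using label by (fastforce simp: Dk_def)
      show "{1..k} \<subseteq> \<Omega> ` Dk k"
      proof
        fix j assume j: "j \<in> {1..k}"
        then have "(rw j, cl j) \<in> D \<and> \<Omega> (rw j, cl j) = j" using assms by (intro box) auto
        then show "j \<in> \<Omega> ` Dk k" using j by (force simp: Dk_def)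
      qed
    qed
  qed
  show card: "card (Dk k) = k" using bij_betw_same_card[OF bk] by simp
  have yd: "young_diagram (Dk k)"
    unfolding young_diagram_def
  proof (intro conjI allI impI)
    show "finite (Dk k)" using Y.finite_D by (simp add: Dk_def)
    fix i j p q assume ij: "(i, j) \<in> Dk k"
    then show "1 \<le> i" "1 \<le> j" using young_pos[OF young] by (auto simp: Dk_def)
    assume pq: "1 \<le> p" "p \<le> i" "1 \<le> q" "q \<le> j"
    then have "(p, q) \<in> D" using young_down[OF young, of i j] ij by (auto simp: Dk_def)
    then show "(p, q) \<in> Dk k" using Omega_mono[of p q i j] ij pq by (auto simp: Dk_def)
  qed
  have st: "standard_tableau (Dk k) \<Omega>"
    unfolding standard_tableau_def card
  proof (intro conjI bk allI impI)
    show "\<Omega> (i, j) < \<Omega> (i, j')" if "(i, j) \<in> Dk k" "(i, j') \<in> Dk k" "j < j'" for i j j'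
      using std that by (simp add: standard_tableau_def Dk_def)
    show "\<Omega> (i, j) < \<Omega> (i', j)" if "(i, j) \<in> Dk k" "(i', j) \<in> Dk k" "i < i'" for i i' j
      using std that by (simp add: standard_tableau_def Dk_def)
  qed
  show t: "young_tableau (Dk k) \<Omega>"
    by unfold_locales (use young_convex[OF yd] st yd in auto)
  then interpret Dt: young_tableau "Dk k" \<Omega> .
  show "Dt.cn j = cn j" if j: "j \<in> {1..k}" for j
  proof -
    have "j \<in> {1..n}" using j assms by simp
    then have b: "(rw j, cl j) \<in> D" "\<Omega> (rw j, cl j) = j" using box by blast+
    then have "(rw j, cl j) \<in> Dk k" using j by (simp add: Dk_def)
    from Dt.label[OF this] show ?thesis unfolding b by (simp add: Dt.cn_eq cn_eq)
  qed
qed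

lemma weight_vector_Dk:
  assumes "k \<le> n"
  obtains u where "u \<in> AA k" "weight k cn u" "u \<noteq> 0" "irrep (Dk k) = {co (X * u) | X. X \<in> AA k}"
proof -
  interpret Dt: young_tableau "Dk k" \<Omega> by (rule Dk_tableau(1)[OF assms])
  obtain u where "u \<in> AA k" "weight k Dt.cn u" "u \<noteq> 0" "irrep (Dk k) = {co (X * u) | X. X \<in> AA k}"
    using Dt.weight_vector unfolding Dk_tableau(2)[OF assms] by blast
  then show ?thesis using Dk_tableau(3)[OF assms] by (intro that) (auto simp: weight_def)
qed

text \<open>A normalized weight vector \<open>w\<close> works: for each \<open>k\<close> it
  generates under \<open>AA k\<close> a submodule, the weight of the generator consists of the
  contents of \<open>Dk k\<close>, and \<open>cyclic_labeled\<close> identifies the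
  submodule.\<close>

lemma young_vector_exists: "\<exists>f. young_vector D \<Omega> f"
proof -
  obtain u where u: "u \<in> AA n" "weight n cn u" "u \<noteq> 0" "irrep D = {co (X * u) | X. X \<in> AA n}"
    by (rule weight_vector)
  define N where "N = (\<Sum>p\<in>Sym n. (cmod (co u p))\<^sup>2)"
  have "tau (u * star n u) = of_real N" unfolding N_def by (rule tau_star[OF u(1)])
  then have "N \<noteq> 0" using tau_star_zero[OF u(1)] u(3) by auto
  then have N: "N > 0" by (simp add: N_def sum_nonneg order_less_le)
  define w where "w = of_real (1 / sqrt N) *\<^sub>C u"
  have w: "w \<in> AA n" "weight n cn w" "w \<noteq> 0"
    using u N cs_cancel[of "of_real (1 / sqrt N)" u 0] by (auto simp: w_def intro!: weight_scale AA_scale)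
  have "w = (of_real (1 / sqrt N) *\<^sub>C 1) * u" by (simp add: w_def)
  then have "co w \<in> irrep D" unfolding u(4) using AA_scale[OF AA_one] by blast
  moreover have "gip n (co w) (co w) = 1"
  proof -
    have "gip n (co w) (co w) = (\<Sum>p\<in>Sym n. of_real ((cmod (co w p))\<^sup>2))"
      by (simp add: gip_def complex_norm_square mult.commute del: of_real_power)
    also have "\<dots> = of_real ((1 / sqrt N)\<^sup>2 * N)"
      using N by (simp add: N_def w_def norm_mult power_mult_distrib sum_distrib_left norm_divide power_divide del: of_real_power)
    also have "\<dots> = 1" using N by (simp add: power_divide)
    finally show ?thesis .
  qed
  moreover have "\<exists>W. W \<subseteq> irrep D \<and> submodule k W \<and> labeled_by W {b \<in> D. \<Omega> b \<le> k} \<and> co w \<in> W"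
    if "k \<in> {1..<n}" for k
  proof (intro exI conjI)
    let ?W = "{co (X * w) | X. X \<in> AA k}"
    have k: "k \<le> n" using that by simp
    have up: "X \<in> AA k \<Longrightarrow> X \<in> AA n" for X by (rule AA_mono[OF k])
    show "?W \<subseteq> irrep D"
    proof
      fix f assume "f \<in> ?W"
      then obtain X where X: "X \<in> AA k" "f = co (X * w)" by blast
      then have "f = co ((of_real (1 / sqrt N) *\<^sub>C X) * u)" by (simp add: w_def)
      then show "f \<in> irrep D" unfolding u(4) using up[OF X(1)] by blast
    qed
    show "co w \<in> ?W" by (rule CollectI, rule exI[of _ 1]) simp
    show "submodule k ?W"
      unfolding submodule_def cfun.subspace_def
    proof (intro conjI ballI allI)
      show "0 \<in> ?W" by (rule CollectI, rule exI[of _ 0]) (simp add: co_def)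
      fix f assume "f \<in> ?W"
      then obtain X where X: "X \<in> AA k" "f = co (X * w)" by blast
      show "cscale d f \<in> ?W" for d
        using X by (intro CollectI exI[of _ "d *\<^sub>C X"]) (auto simp: co_def)
      show "gact s f \<in> ?W" if "s \<in> Sym k" for s
        using X that by (intro CollectI exI[of _ "Gact s * X"]) (auto simp: co_def)
      fix g assume "g \<in> ?W"
      then obtain X' where "X' \<in> AA k" "g = co (X' * w)" by blast
      then show "f + g \<in> ?W"
        using X by (intro CollectI exI[of _ "X + X'"]) (auto simp: co_def distrib_right)
    qed
    obtain u' where u': "u' \<in> AA k" "weight k cn u'" "u' \<noteq> 0" "irrep (Dk k) = {co (X * u') | X. X \<in> AA k}"
      by (rule weight_vector_Dk[OF k])
    then show "labeled_by ?W {b \<in> D. \<Omega> b \<le> k}"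
      using cyclic_labeled[OF w(1) weight_mono[OF w(2) k] w(3) u'(1-3) k Dk_tableau(2)[OF k]]
      unfolding Dk_def by blast
  qed
  ultimately show ?thesis unfolding young_vector_def by blast
qed

text \<open>The central element \<open>TT k\<close> acts on a module labeled by \<open>Dk k\<close>
  by the sum \<open>S k\<close> of its contents, and an isomorphism transports this to
  \<open>W\<close>, hence to \<open>f\<close>. The difference of two consecutive such elements is a
  Jucys-Murphy element.\<close>

lemma young_vector_weight:
  assumes f: "young_vector D \<Omega> f"
  obtains U where "U \<in> AA n" "f = co U" "weight n cn U" "tau (U * star n U) = 1"
proof -
  define S where "S k = (\<Sum>j\<in>{1..k}. cn j)" for k
  obtain u where u: "u \<in> AA n" "weight n cn u" "irrep D = {co (X * u) | X. X \<in> AA n}"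
    by (rule weight_vector)
  have "f \<in> irrep D" using f by (simp add: young_vector_def)
  then obtain X where X: "X \<in> AA n" "f = co (X * u)" unfolding u(3) by blast
  define U where "U = X * u"
  have U: "U \<in> AA n" "f = co U" using X u by (auto simp: U_def)
  have TW: "TT k * w = S k *\<^sub>C w" if "weight l cn w" "k \<le> l" for w l k
    using that by (auto simp: TT_def S_def sum_distrib_right weight_def cs_sum_left intro!: sum.cong)
  have TU: "TT k * U = S k *\<^sub>C U" if k: "k \<le> n" for k
  proof -
    consider "k = 0" | "k = n" | "k \<in> {1..<n}" using k by (cases "k = 0"; cases "k = n") auto
    then show ?thesis
    proof cases
      case 1
      then show ?thesis by (simp add: TT_def S_def)
    next
      case 2
      then have "TT k * U = X * (TT k * u)"
        using TT_central[of X k] X(1) by (simp add: U_def flip: mult.assoc)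
      then show ?thesis using TW[OF u(2), of k] 2 by (simp add: U_def)
    next
      case 3
      then obtain W where W: "W \<subseteq> irrep D" "submodule k W" "labeled_by W (Dk k)" "f \<in> W"
        using f unfolding young_vector_def Dk_def by blast
      then obtain \<phi> where \<phi>: "Vector_Spaces.linear cscale cscale \<phi>" "bij_betw \<phi> W (irrep (Dk k))"
        "\<And>s g. s \<in> Sym k \<Longrightarrow> g \<in> W \<Longrightarrow> \<phi> (gact s g) = gact s (\<phi> g)"
        unfolding labeled_by_def Dk_tableau(2)[OF k] by blast
      obtain u' where u': "u' \<in> AA k" "weight k cn u'" "irrep (Dk k) = {co (X * u') | X. X \<in> AA k}"
        by (rule weight_vector_Dk[OF k])
      obtain X' where X': "X' \<in> AA k" "\<phi> f = co (X' * u')"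
        using \<phi>(2) W(4) unfolding u'(3) bij_betw_def by blast
      have "\<phi> (ap (TT k) f) = ap (TT k) (\<phi> f)"
        using \<phi>(3) W(4) by (intro ap_linear_sum[OF \<phi>(1), of k]) auto
      also have "\<dots> = co (TT k * X' * u')" by (simp add: X' co_def)
      also have "TT k * X' * u' = S k *\<^sub>C (X' * u')"
        using TT_central[OF X'(1)] TW[OF u'(2), of k] by (simp add: mult.assoc)
      also have "co (S k *\<^sub>C (X' * u')) = cscale (S k) (\<phi> f)" by (simp add: X' co_def)
      also have "\<dots> = \<phi> (cscale (S k) f)" using linear_cscaleD(2)[OF \<phi>(1)] by simp
      finally have eq: "\<phi> (ap (TT k) f) = \<phi> (cscale (S k) f)" .
      have W_closed: "cfun.subspace W" "\<And>s g. s \<in> Sym k \<Longrightarrow> g \<in> W \<Longrightarrow> gact s g \<in> W"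
        using W(2) by (auto simp: submodule_def)
      have "ap (TT k) f = (\<Sum>s\<in>Sym k. cscale (co (TT k) s) (gact s f))"
        using opg_co[OF TT_in_AA, of k] ap_sum_left[of "\<lambda>s. co (TT k) s *\<^sub>C Gact s" "Sym k" f] by (simp add: opg_def)
      also have "\<dots> \<in> W"
        using W_closed W(4) by (intro cfun.subspace_sum cfun.subspace_scale) auto
      finally have "ap (TT k) f = cscale (S k) f"
        using eq \<phi>(2) W_closed(1) W(4) by (auto simp: bij_betw_def dest!: inj_onD intro: cfun.subspace_scale)
      then have "co (TT k * U) = co (S k *\<^sub>C U)" by (simp add: U co_def)
      then show ?thesis
        using U(1) AA_mono[OF k TT_in_AA] by (intro AA_eqI[of _ n] AA_mult AA_scale) auto
    qed
  qed
  have "weight n cn U"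
    unfolding weight_def
  proof
    fix k assume k: "k \<in> {1..n}"
    then obtain j where j: "k = Suc j" by (cases k) auto
    have "XX k * U = TT (Suc j) * U - TT j * U" by (simp add: j TT_Suc distrib_right)
    also have "\<dots> = (S (Suc j) - S j) *\<^sub>C U" using TU[of "Suc j"] TU[of j] k j by (simp add: cs_diff_left)
    also have "S (Suc j) - S j = cn k" by (simp add: S_def j)
    finally show "XX k * U = cn k *\<^sub>C U" .
  qed
  moreover have "tau (U * star n U) = 1"
  proof -
    have "gip n (co U) (co U) = 1" using f U by (simp add: young_vector_def)
    moreover have "gip n (co U) (co U) = tau (U * star n U)"
      using U(1) by (auto simp: gip_def tau_mult co_twist Sym_inv mult.commute intro!: sum.cong)
    ultimately show ?thesis by simp
  qed
  ultimately show ?thesis using that U by blast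
qed

text \<open>For a Young vector \<open>U\<close>, \<open>U * star n U\<close> has the weight on both
  sides and trace 1, so it is \<open>E\<close>; its coefficients are the conjugates of those of
  \<open>e_straight\<close>. They are real, since both anti-automorphisms fix
  \<open>E\<close>.\<close>

lemma e_straight_unit:
  obtains E where "unit_weight n cn E" "e_straight D \<Omega> = co E"
proof -
  have "young_vector D \<Omega> (u_vec D \<Omega>)"
    unfolding u_vec_def using young_vector_exists by (rule someI_ex)
  then obtain U where U: "U \<in> AA n" "u_vec D \<Omega> = co U" "weight n cn U" "tau (U * star n U) = 1"
    by (rule young_vector_weight)
  have "U \<noteq> 0" using U(4) by auto
  then obtain E where E: "unit_weight n cn E" using unit_weight_exists U by blast
  then have EA: "E \<in> AA n" by (simp add: unit_weight_def)
  have UE: "U * star n U = E"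
    using res_star[OF E U(1,3) order_refl] U by (simp add: res_id AA_mult)
  have "e_straight D \<Omega> s = co E s" for s
  proof (cases "s \<in> Sym n")
    case True
    have "co E s = (\<Sum>p\<in>Sym n. co U p * cnj (co U (inv s \<circ> p)))"
      unfolding UE[symmetric] co_mult[OF U(1)] using True
      by (intro sum.cong) (auto simp: co_twist Sym_comp Sym_inv Sym_inv_comp[of _ n])
    also have "\<dots> = cnj (e_straight D \<Omega> s)"
      using True by (simp add: e_straight_def gip_def U(2) gact_def mult.commute)
    finally have 1: "co E s = cnj (e_straight D \<Omega> s)" .
    have "cnj (co E s) = co (star n E) (inv s)" using True by (simp add: co_twist Sym_inv)
    also have "\<dots> = co E (inv s)" using unit_weight_twist(1)[OF E] by simp
    also have "\<dots> = co (twist (\<lambda>c. c) n E) s" using True by (simp add: co_twist)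
    also have "\<dots> = co E s" using unit_weight_twist(2)[OF E] by simp
    finally show ?thesis using 1 by simp
  qed (use co_outside[OF EA] in \<open>simp add: e_straight_def\<close>)
  then show ?thesis using that E by blast
qed

end

section \<open>Limits along a curve of generic points\<close>

lemma polynomial_fun_tendsto:
  assumes "polynomial_fun V p" "\<And>k. (\<lambda>j. T j k) \<longlonglongrightarrow> z k"
  shows "(\<lambda>j. p (T j)) \<longlonglongrightarrow> p z"
  using assms(1) by induction (auto intro: tendsto_intros assms(2))

lemma opoly_coordinate:
  assumes "opoly V (r :: _ \<Rightarrow> 'a endo)"
  shows "polynomial_fun V (\<lambda>t. ap (r t) f w)"
proof -
  obtain ps where ps: "\<forall>(p, X)\<in>set ps. polynomial_fun V p" "\<forall>t. r t = (\<Sum>(p, X)\<leftarrow>ps. p t *\<^sub>C X)"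
    using opoly_expand[OF assms] by blast
  have "ap (\<Sum>(p, X)\<leftarrow>ps. p t *\<^sub>C X) f w = (\<Sum>(p, X)\<leftarrow>ps. p t * ap X f w)" for t
    by (induction ps) (auto simp: cscale_def)
  then show ?thesis
    using ps by (simp add: case_prod_unfold) (intro polynomial_fun_sum_list polynomial_fun.mult polynomial_fun.const, auto)
qed

lemma regv_has_regular_value:
  assumes "regv V G z (r :: _ \<Rightarrow> 'a endo) y"
  shows "has_regular_value V G (\<lambda>t. ap (r t) f w) z (ap y f w)"
proof -
  obtain q p where *: "polynomial_fun V q" "q z \<noteq> 0" "opoly V p" "\<forall>t\<in>G. q t *\<^sub>C r t = p t" "y = (1 / q z) *\<^sub>C p z"
    using assms unfolding regv_def by blast
  have "q t * ap (r t) f w = ap (p t) f w" if "t \<in> G" for t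
    using arg_cong[OF *(4)[rule_format, OF that], of "\<lambda>X. ap X f w"] by (simp add: cscale_def)
  then show ?thesis
    unfolding has_regular_value_def using *(1-3,5)
    by (intro exI[of _ "\<lambda>t. ap (p t) f w"] exI[of _ q]) (auto intro: opoly_coordinate simp: cscale_def)
qed

text \<open>Every regular value is the limit along one sequence of generic points tending to the
  special point. This gives uniqueness and lets limits be taken coefficient by coefficient.\<close>

locale curve =
  fixes G :: "(nat \<Rightarrow> complex) set" and T :: "nat \<Rightarrow> nat \<Rightarrow> complex" and z :: "nat \<Rightarrow> complex"
  assumes T_lim: "(\<lambda>j. T j k) \<longlonglongrightarrow> z k"
    and T_generic: "\<forall>\<^sub>F j in sequentially. T j \<in> G"
begin

lemma has_regular_value_tendsto:
  assumes "has_regular_value V G r z y"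
  shows "(\<lambda>j. r (T j)) \<longlonglongrightarrow> y"
proof -
  obtain p q where *: "polynomial_fun V p" "polynomial_fun V q" "q z \<noteq> 0" "\<forall>t\<in>G. q t * r t = p t" "y = p z / q z"
    using assms unfolding has_regular_value_def by blast
  note lim = polynomial_fun_tendsto[OF *(1) T_lim] polynomial_fun_tendsto[OF *(2) T_lim]
  have "(\<lambda>j. p (T j) / q (T j)) \<longlonglongrightarrow> y"
    unfolding *(5) by (intro tendsto_divide lim *(3))
  moreover have "\<forall>\<^sub>F j in sequentially. p (T j) / q (T j) = r (T j)"
    using T_generic tendsto_imp_eventually_ne[OF lim(2) *(3)]
    by eventually_elim (use *(4) in \<open>auto simp: divide_eq_eq mult.commute\<close>)
  ultimately show ?thesis by (rule Lim_transform_eventually)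
qed

lemma regular_value_eq: "has_regular_value V G r z y \<Longrightarrow> regular_value V G r z = y"
  unfolding regular_value_def
  by (rule the_equality) (auto intro: LIMSEQ_unique dest: has_regular_value_tendsto)

lemma regv_tendsto: "regv V G z r y \<Longrightarrow> (\<lambda>j. ap (r (T j)) f w) \<longlonglongrightarrow> ap y f w"
  using has_regular_value_tendsto[OF regv_has_regular_value] .

lemma regv_unique: "regv V G z r y \<Longrightarrow> regv V G z r y' \<Longrightarrow> y = (y' :: 'a endo)"
  by (rule endo_eqI) (blast intro: LIMSEQ_unique regv_tendsto)

end

lemma eventually_affine_nonzero:
  assumes "a \<noteq> 0 \<or> b \<noteq> (0::complex)"
  shows "\<forall>\<^sub>F j in sequentially. a + b / of_nat (Suc j) \<noteq> 0"
proof (cases "a = 0")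
  case False
  have "(\<lambda>j. b * (1 / of_nat (Suc j))) \<longlonglongrightarrow> b * 0"
    by (intro tendsto_mult tendsto_const lim_1_over_n[THEN LIMSEQ_Suc])
  then have "(\<lambda>j. a + b / of_nat (Suc j)) \<longlonglongrightarrow> a + 0"
    by (intro tendsto_add tendsto_const) simp
  then show ?thesis using False by (intro tendsto_imp_eventually_ne) auto
next
  case True
  then show ?thesis using assms by (auto simp del: of_nat_Suc)
qed

section \<open>The shape of a tableau\<close>

fun eps_of :: "gtype \<Rightarrow> complex" where
  "eps_of Orth = - 1"
| "eps_of Symp = 1"

fun line_of :: "gtype \<Rightarrow> (nat \<times> nat) set \<Rightarrow> (nat \<times> nat \<Rightarrow> nat) \<Rightarrow> nat \<Rightarrow> nat" where
  "line_of Orth = col_of"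
| "line_of Symp = row_of"

fun pos_of :: "gtype \<Rightarrow> (nat \<times> nat) set \<Rightarrow> (nat \<times> nat \<Rightarrow> nat) \<Rightarrow> nat \<Rightarrow> nat" where
  "pos_of Orth = row_of"
| "pos_of Symp = col_of"

definition special_value :: "gtype \<Rightarrow> complex" where
  "special_value g = special_point g 0"

lemma special_point_eq: "special_point g k = special_value g"
  by (cases g) (simp_all add: special_value_def)

locale gtableau = tableau D \<Omega> for D \<Omega> +
  fixes g :: gtype and K :: nat
  assumes pos: "(i, j) \<in> D \<Longrightarrow> 1 \<le> i \<and> 1 \<le> j"
begin

abbreviation "n \<equiv> card D"
abbreviation "GG \<equiv> generic_points g D \<Omega> K"
abbreviation "lnl \<equiv> line_of g D \<Omega>"
abbreviation "psl \<equiv> pos_of g D \<Omega>"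

definition xx :: "(nat \<Rightarrow> complex) \<Rightarrow> nat \<Rightarrow> complex" where
  "xx t k = of_int (box_content D \<Omega> k) + t k + of_nat K / 2"

text \<open>The offset from the special point depends only on the line, as the constraint demands,
  and separates different lines. \<open>Suc j\<close> keeps the denominator from being zero.\<close>

definition TT :: "nat \<Rightarrow> nat \<Rightarrow> complex" where
  "TT j k = special_value g + of_nat (lnl k) / of_nat (Suc j)"

lemma content_eq: "of_int (box_content D \<Omega> k) = eps_of g * (of_nat (psl k) - of_nat (lnl k) :: complex)"
  by (cases g) (simp_all add: box_content_def)

lemma A_denom_eq: "A_denom (box_content D \<Omega>) K t k l = xx t k + xx t l"
  and B_denom_eq: "B_denom (box_content D \<Omega>) t k l = xx t k - xx t l"
  by (simp_all add: A_denom_def B_denom_def xx_def)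

lemma constrained_eq: "constrained g D \<Omega> t \<longleftrightarrow> (\<forall>k\<in>{1..n}. \<forall>l\<in>{1..n}. lnl k = lnl l \<longrightarrow> t k = t l)"
  by (cases g) simp_all

lemma generic_points_eq: "t \<in> GG \<longleftrightarrow> constrained g D \<Omega> t \<and>
    (\<forall>k\<in>{1..n}. \<forall>l\<in>{1..n}. k < l \<longrightarrow> xx t k + xx t l \<noteq> 0 \<and> xx t k - xx t l \<noteq> 0)"
  unfolding generic_points_def A_denom_eq B_denom_eq by fastforce

lemma ln_pos': "k \<in> {1..n} \<Longrightarrow> 1 \<le> lnl k"
  using box pos by (cases g) auto

sublocale labels n lnl psl
  using labels_rows labels_cols by (cases g) auto

sublocale curve GG TT "special_point g"
proof
  show "(\<lambda>j. TT j k) \<longlonglongrightarrow> special_point g k" for k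
  proof -
    have "(\<lambda>j. of_nat (lnl k) * (1 / of_nat (Suc j))) \<longlonglongrightarrow> of_nat (lnl k) * (0::complex)"
      by (intro tendsto_mult tendsto_const lim_1_over_n[THEN LIMSEQ_Suc])
    then have "(\<lambda>j. special_value g + of_nat (lnl k) / of_nat (Suc j)) \<longlonglongrightarrow> special_value g + 0"
      by (intro tendsto_add tendsto_const) simp
    then show ?thesis by (simp add: TT_def special_point_eq)
  qed
  \<comment> \<open>Lines are numbered from 1, so the slope is never zero, even where the sum
    vanishes at the special point.\<close>
  have sum: "\<forall>\<^sub>F j in sequentially. xx (TT j) k + xx (TT j) l \<noteq> 0" if kl: "k \<in> {1..n}" for k l
  proof -
    let ?a = "of_int (box_content D \<Omega> k) + of_int (box_content D \<Omega> l) + 2 * special_value g + of_nat K"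
    let ?b = "of_nat (lnl k + lnl l) :: complex"
    have "?b \<noteq> 0" using ln_pos'[OF kl] unfolding of_nat_eq_0_iff by simp
    then have "\<forall>\<^sub>F j in sequentially. ?a + ?b / of_nat (Suc j) \<noteq> 0" by (intro eventually_affine_nonzero) blast
    moreover have "xx (TT j) k + xx (TT j) l = ?a + ?b / of_nat (Suc j)" for j
      by (simp add: xx_def TT_def add_divide_distrib del: of_nat_Suc)
    ultimately show ?thesis by simp
  qed
  \<comment> \<open>If both the constant and the slope vanish, the labels share their line and their
    content, hence their box.\<close>
  have diff: "\<forall>\<^sub>F j in sequentially. xx (TT j) k - xx (TT j) l \<noteq> 0"
    if kl: "k \<in> {1..n}" "l \<in> {1..n}" "k < l" for k l
  proof -
    let ?a = "of_int (box_content D \<Omega> k) - of_int (box_content D \<Omega> l) :: complex"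
    let ?b = "of_nat (lnl k) - of_nat (lnl l) :: complex"
    have "?a \<noteq> 0 \<or> ?b \<noteq> 0"
    proof (rule ccontr)
      assume "\<not> ?thesis"
      then have "lnl k = lnl l" and "?a = 0" by auto
      then have "eps_of g * (of_nat (psl k) - of_nat (psl l)) = (0::complex)"
        unfolding content_eq by (simp add: algebra_simps)
      then have "psl k = psl l" by (cases g) auto
      then show False using label_eq[OF kl(1,2)] \<open>lnl k = lnl l\<close> kl(3) by auto
    qed
    then have "\<forall>\<^sub>F j in sequentially. ?a + ?b / of_nat (Suc j) \<noteq> 0" by (rule eventually_affine_nonzero)
    moreover have "xx (TT j) k - xx (TT j) l = ?a + ?b / of_nat (Suc j)" for j
      by (simp add: xx_def TT_def diff_divide_distrib del: of_nat_Suc)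
    ultimately show ?thesis by simp
  qed
  have "\<forall>\<^sub>F j in sequentially. \<forall>k\<in>{1..n}. \<forall>l\<in>{1..n}. k < l \<longrightarrow> xx (TT j) k + xx (TT j) l \<noteq> 0 \<and> xx (TT j) k - xx (TT j) l \<noteq> 0"
    using sum diff by (intro eventually_ball_finite ballI) (auto intro!: eventually_conj simp: eventually_conj_iff)
  then show "\<forall>\<^sub>F j in sequentially. TT j \<in> GG"
    by eventually_elim (auto simp: generic_points_eq constrained_eq TT_def)
qed

lemma xx_inj: "t \<in> GG \<Longrightarrow> inj_on (xx t) {1..n}"
  by (rule inj_onI) (metis generic_points_eq linorder_neqE_nat eq_iff_diff_eq_0)

lemma separated_labelled:
  assumes "transpositions (P :: nat \<Rightarrow> nat \<Rightarrow> 'a endo)"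
  shows "separated_labelled_shape P (eps_of g) {1..n} GG (special_point g) xx n lnl psl (special_value g + of_nat K / 2)"
proof -
  interpret transpositions P by fact
  show ?thesis
  proof
    show "eps_of g * eps_of g = 1" by (cases g) auto
    show "polynomial_fun {1..n} (\<lambda>t. xx t k)" if "k \<in> {1..n}" for k
      unfolding xx_def using that by (intro polynomial_fun.intros)
    show "inj_on (xx t) {1..n}" if "t \<in> GG" for t by (rule xx_inj[OF that])
    show "xx (special_point g) k = special_value g + of_nat K / 2 + eps_of g * (of_nat (psl k) - of_nat (lnl k))" for k
      by (simp add: xx_def content_eq special_point_eq)
    show "xx t l = xx t k + eps_of g"
      if "k \<in> {1..n}" "l \<in> {1..n}" "lnl k = lnl l" "psl l = Suc (psl k)" "t \<in> GG" for k l t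
    proof -
      have "constrained g D \<Omega> t" using that(5) generic_points_eq by blast
      then have "t k = t l" using that(1-3) unfolding constrained_eq by blast
      then show ?thesis using that by (simp add: xx_def content_eq algebra_simps)
    qed
    show "1 \<le> lnl k" if "k \<in> {1..n}" for k by (rule ln_pos'[OF that])
    show "y = y'" if "regv {1..n} GG (special_point g) r y" "regv {1..n} GG (special_point g) r y'"
      for r and y y' :: "'a endo"
      by (rule regv_unique[OF that])
  qed
qed

end

section \<open>Representations of the symmetric group\<close>

text \<open>\<open>hom\<close> carries the product \<open>Bl\<close> of the group algebra to the
  product of the model, so that it suffices to identify values in the group algebra.\<close>

locale sym_rep = transpositions P' for P' :: "nat \<Rightarrow> nat \<Rightarrow> 'r::calg" +
  fixes n :: nat and \<rho> :: "(nat \<Rightarrow> nat) \<Rightarrow> 'r"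
  assumes rho_id: "\<rho> id = 1"
    and rho_comp: "s \<in> Sym n \<Longrightarrow> t \<in> Sym n \<Longrightarrow> \<rho> (s \<circ> t) = \<rho> s * \<rho> t"
    and rho_P: "a \<in> {1..n} \<Longrightarrow> b \<in> {1..n} \<Longrightarrow> a \<noteq> b \<Longrightarrow> \<rho> (Transposition.transpose a b) = P' a b"
begin

definition hom :: "(nat \<Rightarrow> nat) endo \<Rightarrow> 'r" where
  "hom X = (\<Sum>s\<in>Sym n. co X s *\<^sub>C \<rho> s)"

lemma hom_diff: "hom (X - Z) = hom X - hom Z"
  by (simp add: hom_def cs_diff_left sum_subtractf)

lemma hom_scale: "hom (c *\<^sub>C X) = c *\<^sub>C hom X"
  by (simp add: hom_def cs_sum_right)

lemma hom_Gact: "s \<in> Sym n \<Longrightarrow> hom (Gact s) = \<rho> s"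
  by (simp add: hom_def co_Gact[of s n] if_distrib[of "\<lambda>c. c *\<^sub>C _"] cong: if_cong)

lemma hom_one: "hom 1 = 1"
  using hom_Gact[OF Sym_id] by (simp add: rho_id)

lemma hom_mult:
  assumes "X \<in> AA n"
  shows "hom (X * Z) = hom X * hom Z"
proof -
  have "hom (X * Z) = (\<Sum>p\<in>Sym n. \<Sum>s\<in>Sym n. (co X p * co Z (inv p \<circ> s)) *\<^sub>C \<rho> s)"
    unfolding hom_def co_mult[OF assms] cs_sum_left by (rule sum.swap)
  also have "\<dots> = (\<Sum>p\<in>Sym n. \<Sum>s\<in>Sym n. (co X p * co Z s) *\<^sub>C \<rho> (p \<circ> s))"
  proof (rule sum.cong)
    fix p assume p: "p \<in> Sym n"
    show "(\<Sum>s\<in>Sym n. (co X p * co Z (inv p \<circ> s)) *\<^sub>C \<rho> s) = (\<Sum>s\<in>Sym n. (co X p * co Z s) *\<^sub>C \<rho> (p \<circ> s))"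
      using p by (subst sum_Sym_comp[OF p, symmetric]) simp
  qed simp
  also have "\<dots> = hom X * hom Z"
    unfolding hom_def sum_product by (intro sum.cong) (auto simp: rho_comp mult.commute)
  finally show ?thesis .
qed

lemma Gr_R_in_AA: "a \<in> {1..n} \<Longrightarrow> b \<in> {1..n} \<Longrightarrow> Gr.R x a b \<in> AA n"
  unfolding Gr.R_def by (intro AA_diff AA_scale Pg_in_AA AA_one)

lemma hom_R: "a \<in> {1..n} \<Longrightarrow> b \<in> {1..n} \<Longrightarrow> a \<noteq> b \<Longrightarrow> hom (Gr.R x a b) = R x a b"
  by (simp add: Gr.R_def R_def hom_diff hom_scale hom_one Pg_def hom_Gact[OF Sym_transpose] rho_P)

lemma hom_rowR:
  assumes "a \<in> {1..n}" "set bs \<subseteq> {1..n}" "a \<notin> set bs"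
  shows "Gr.rowR x a bs \<in> AA n \<and> hom (Gr.rowR x a bs) = rowR x a bs"
  using assms by (induction bs) (auto simp: hom_one hom_mult Gr_R_in_AA hom_R)

lemma hom_Bl:
  assumes "set ks \<subseteq> {1..n}" "distinct ks"
  shows "Gr.Bl x ks \<in> AA n \<and> hom (Gr.Bl x ks) = Bl x ks"
  using assms by (induction ks) (use hom_rowR in \<open>auto simp: hom_one hom_mult\<close>)

end

text \<open>The anti-automorphism fixes every factor and reverses their order, so it produces
  \<open>Gr.Blr\<close>, which is the same product.\<close>

lemma twist_Bl:
  assumes "set ks \<subseteq> {1..n}" "distinct ks" "inj_on x (set ks)"
  shows "twist (\<lambda>c. c) n (Gr.Bl x ks) = Gr.Bl x ks"
proof -
  have R: "Gr.R x a b \<in> AA n \<and> twist (\<lambda>c. c) n (Gr.R x a b) = Gr.R x a b" if "a \<in> {1..n}" "b \<in> {1..n}" for a b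
  proof -
    define d where "d = - (1 / (x a - x b))"
    have "Gr.R x a b = 1 + d *\<^sub>C Pg a b" by (simp add: Gr.R_def d_def)
    then show ?thesis
      using that by (auto simp: plain.twist_add plain.twist_scale plain.twist_one plain.twist_Pg
          intro!: AA_add AA_scale Pg_in_AA)
  qed
  have row: "Gr.rowR x a bs \<in> AA n \<and> twist (\<lambda>c. c) n (Gr.rowR x a bs) = Gr.rowR x a (rev bs)"
    if "a \<in> {1..n}" "set bs \<subseteq> {1..n}" for a bs
    using that(2) by (induction bs) (use that(1) R in \<open>auto simp: plain.twist_one plain.twist_mult\<close>)
  have "Gr.Bl x ks \<in> AA n \<and> twist (\<lambda>c. c) n (Gr.Bl x ks) = Gr.Blr x ks"
    using assms(1) by (induction ks) (use row in \<open>auto simp: plain.twist_one plain.twist_mult\<close>)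
  then show ?thesis using Gr.Bl_eq_Blr[OF assms(2,3)] by simp
qed

section \<open>Coefficients at permutations fixing some labels\<close>

definition fixes_label :: "nat \<Rightarrow> (nat \<Rightarrow> nat) endo \<Rightarrow> bool" where
  "fixes_label k X \<longleftrightarrow> (\<forall>s. co X s \<noteq> 0 \<longrightarrow> s k = k)"

lemma co_Pg_mult: "co (Pg a b * X) s = co X (Transposition.transpose a b \<circ> s)"
  by (simp add: Pg_def co_Gact_mult)

lemma co_one: "co 1 = unitvec"
  by (simp add: co_def)

lemma fixes_label_rowR:
  assumes "fixes_label k X" "k \<noteq> a" "k \<notin> set bs"
  shows "fixes_label k (Gr.rowR x a bs * X)"
  using assms(3)
proof (induction bs)
  case (Cons b bs)
  then have IH: "fixes_label k (Gr.rowR x a bs * X)" by simp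
  have eq: "Gr.rowR x a (b # bs) * X = Gr.rowR x a bs * X - (1 / (x a - x b)) *\<^sub>C (Pg a b * (Gr.rowR x a bs * X))"
    by (simp add: Gr.R_def left_diff_distrib mult.assoc)
  have tr: "s k = k" if "Transposition.transpose a b (s k) = k" for s
    using that Cons.prems assms(2) by (auto simp: Transposition.transpose_def split: if_splits)
  show ?case
    unfolding fixes_label_def
  proof (intro allI impI)
    fix s assume "co (Gr.rowR x a (b # bs) * X) s \<noteq> 0"
    then have "co (Gr.rowR x a bs * X) s \<noteq> 0 \<or> co (Gr.rowR x a bs * X) (Transposition.transpose a b \<circ> s) \<noteq> 0"
      unfolding eq by (auto simp: co_Pg_mult)
    then show "s k = k" using IH tr unfolding fixes_label_def by force
  qed
qed (use assms in simp)

lemma fixes_label_Bl: "k \<notin> set ks \<Longrightarrow> fixes_label k (Gr.Bl x ks)"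
  by (induction ks) (auto intro: fixes_label_rowR simp: co_one fixes_label_def[of k 1] unitvec_def)

text \<open>In an expanded row, the transposition that acts first sends \<open>k\<close> to one of
  the distinct \<open>bs\<close>, and none of the others moves it from there. Hence \<open>k\<close>
  stays fixed only in the term where every factor contributes 1.\<close>

lemma co_rowR_mult:
  assumes "fixes_label k X" "distinct (k # bs)"
  shows "(\<forall>s. s k = k \<longrightarrow> co (Gr.rowR x k bs * X) s = co X s) \<and>
    (\<forall>s. co (Gr.rowR x k bs * X) s \<noteq> 0 \<longrightarrow> s k \<in> insert k (set bs))"
  using assms(2)
proof (induction bs)
  case (Cons b bs)
  let ?W = "Gr.rowR x k bs * X"
  have IH: "\<And>s. s k = k \<Longrightarrow> co ?W s = co X s" "\<And>s. co ?W s \<noteq> 0 \<Longrightarrow> s k \<in> insert k (set bs)"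
    using Cons by auto
  have eq: "co (Gr.rowR x k (b # bs) * X) s = co ?W s - 1 / (x k - x b) * co ?W (Transposition.transpose k b \<circ> s)" for s
    by (simp add: Gr.R_def left_diff_distrib mult.assoc co_Pg_mult)
  show ?case
  proof (intro conjI allI impI)
    fix s :: "nat \<Rightarrow> nat"
    assume s: "s k = k"
    then have "(Transposition.transpose k b \<circ> s) k \<notin> insert k (set bs)" using Cons.prems by auto
    then have "co ?W (Transposition.transpose k b \<circ> s) = 0" using IH(2) by blast
    then show "co (Gr.rowR x k (b # bs) * X) s = co X s" using IH(1)[of s] s unfolding eq by simp
  next
    fix s :: "nat \<Rightarrow> nat"
    assume "co (Gr.rowR x k (b # bs) * X) s \<noteq> 0"
    then have "co ?W s \<noteq> 0 \<or> co ?W (Transposition.transpose k b \<circ> s) \<noteq> 0" unfolding eq by auto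
    then have "s k \<in> insert k (set bs) \<or> Transposition.transpose k b (s k) \<in> insert k (set bs)" using IH(2) by force
    then show "s k \<in> insert k (set (b # bs))"
      by (auto simp: Transposition.transpose_def split: if_splits)
  qed
qed (use assms(1) in \<open>auto simp: fixes_label_def\<close>)

text \<open>At a permutation fixing \<open>as\<close> the rows of \<open>as\<close> have no effect.
  This is how the product for a skew tableau sits inside that for a straight one; with empty
  \<open>bs\<close> and the identity it gives the coefficient 1.\<close>

lemma co_Bl_append:
  assumes "distinct (as @ bs)" "\<forall>a\<in>set as. s a = a"
  shows "co (Gr.Bl x (as @ bs)) s = co (Gr.Bl x bs) s"
  using assms
proof (induction as)
  case (Cons a as)
  have "co (Gr.rowR x a (as @ bs) * Gr.Bl x (as @ bs)) s = co (Gr.Bl x (as @ bs)) s"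
    using co_rowR_mult[of a "Gr.Bl x (as @ bs)" "as @ bs" x] fixes_label_Bl[of a "as @ bs" x] Cons.prems by auto
  then show ?case using Cons by simp
qed simp

section \<open>The element of a skew tableau\<close>

lemma shift_perm_comp:
  assumes "t \<in> Sym n"
  shows "shift_perm m (s \<circ> t) = shift_perm m s \<circ> shift_perm m t"
proof
  fix i
  have "1 \<le> t (i - m)" if "m < i"
    using that assms permutes_in_image[of t "{1..n}" "i - m"] permutes_not_in[of t "{1..n}" "i - m"]
    by (cases "i - m \<in> {1..n}") (auto simp: Sym_def)
  then show "shift_perm m (s \<circ> t) i = (shift_perm m s \<circ> shift_perm m t) i"
    by (auto simp: shift_perm_def not_le)
qed

lemma shift_perm_id [simp]: "shift_perm m id = id"
  by (auto simp: shift_perm_def)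

lemma shift_perm_Sym: "s \<in> Sym n \<Longrightarrow> shift_perm m s \<in> Sym (m + n)"
proof -
  assume s: "s \<in> Sym n"
  have 1: "shift_perm m s \<circ> shift_perm m (inv s) = id" "shift_perm m (inv s) \<circ> shift_perm m s = id"
    using shift_perm_comp[OF Sym_inv[OF s], of m s] shift_perm_comp[OF s, of m "inv s"] s by simp_all
  have "bij (shift_perm m s)" using 1 by (intro o_bij) auto
  moreover have "shift_perm m s i = i" if "i \<notin> {1..m + n}" for i
  proof (cases "i \<le> m")
    case False
    then have "i - m \<notin> {1..n}" using that by auto
    then have "s (i - m) = i - m" using s by (simp add: Sym_def permutes_not_in)
    then show ?thesis using False by (simp add: shift_perm_def)
  qed (simp add: shift_perm_def)
  ultimately have "shift_perm m s permutes {1..m + n}"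
    by (simp add: permutes_def bij_iff)
  then show ?thesis by (simp add: Sym_def)
qed

lemma shift_perm_inject:
  assumes "s \<in> Sym n" "t \<in> Sym n" "shift_perm m s = shift_perm m t"
  shows "s = t"
proof
  fix i
  show "s i = t i"
  proof (cases "i \<in> {1..n}")
    case True
    then show ?thesis using fun_cong[OF assms(3), of "m + i"] by (auto simp: shift_perm_def split: if_splits)
  qed (use assms in \<open>auto simp: Sym_def permutes_def\<close>)
qed

lemma shift_perm_fixes: "i \<le> m \<Longrightarrow> shift_perm m s i = i"
  by (simp add: shift_perm_def)

lemma product_decomposition_unique:
  assumes "s \<in> Sym m" "s' \<in> Sym m" "t \<in> Sym n" "t' \<in> Sym n" "s \<circ> shift_perm m t = s' \<circ> shift_perm m t'"
  shows "s = s'" "t = t'"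
proof -
  show "s = s'"
  proof
    fix i
    show "s i = s' i"
      using fun_cong[OF assms(5), of i] assms(1,2)
      by (cases "i \<le> m") (auto simp: shift_perm_fixes Sym_def permutes_not_in)
  qed
  then have "inv s \<circ> (s \<circ> shift_perm m t) = inv s \<circ> (s \<circ> shift_perm m t')" using assms(5) by metis
  then have "shift_perm m t = shift_perm m t'" by (simp only: Sym_inv_o(4)[OF assms(1)])
  then show "t = t'" by (rule shift_perm_inject[OF assms(3,4)])
qed

text \<open>A permutation is in at most one way a product of members of the two subgroups, so the
  convolution has a single term.\<close>

lemma gmult_iota:
  assumes f: "\<And>q. q \<notin> Sym m \<Longrightarrow> f q = 0" and e: "e \<in> group_algebra n"
  shows "s \<in> Sym m \<Longrightarrow> t \<in> Sym n \<Longrightarrow> gmult (m + n) f (iota m n e) (s \<circ> shift_perm m t) = f s * e t"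
    and "\<not> (\<exists>s\<in>Sym m. \<exists>t\<in>Sym n. p = s \<circ> shift_perm m t) \<Longrightarrow> gmult (m + n) f (iota m n e) p = 0"
proof -
  have iota: "iota m n e r = 0" if "\<not> (\<exists>t\<in>Sym n. r = shift_perm m t)" for r
    using that by (auto simp: iota_def intro: sum.neutral)
  have iota': "iota m n e (shift_perm m t) = e t" if t: "t \<in> Sym n" for t
  proof -
    have "{s. s \<in> Sym n \<and> shift_perm m s = shift_perm m t} = {t}"
      using t shift_perm_inject by auto
    then show ?thesis by (simp add: iota_def)
  qed
  show "gmult (m + n) f (iota m n e) (s \<circ> shift_perm m t) = f s * e t" if s: "s \<in> Sym m" and t: "t \<in> Sym n"
  proof -
    have "f q * iota m n e (inv q \<circ> (s \<circ> shift_perm m t)) = (if q = s then f s * e t else 0)"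
      if q: "q \<in> Sym (m + n)" for q
    proof (cases "q \<in> Sym m \<and> q \<noteq> s")
      case True
      have "\<not> (\<exists>t'\<in>Sym n. inv q \<circ> (s \<circ> shift_perm m t) = shift_perm m t')"
      proof
        assume "\<exists>t'\<in>Sym n. inv q \<circ> (s \<circ> shift_perm m t) = shift_perm m t'"
        then obtain t' where t': "t' \<in> Sym n" "q \<circ> (inv q \<circ> (s \<circ> shift_perm m t)) = q \<circ> shift_perm m t'" by auto
        then have "s \<circ> shift_perm m t = q \<circ> shift_perm m t'" using True by (simp add: Sym_inv_o(5)[of q m])
        then show False using product_decomposition_unique(1)[OF s _ t t'(1)] True by blast
      qed
      then show ?thesis using True iota by simp
    next
      case False
      show ?thesis
      proof (cases "q = s")
        case True
        then show ?thesis using iota'[OF t] Sym_inv_o(4)[OF s] by simp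
      next
        case not_s: False
        then have "f q = 0" using False f by blast
        then show ?thesis using not_s by simp
      qed
    qed
    then have "gmult (m + n) f (iota m n e) (s \<circ> shift_perm m t) = (\<Sum>q\<in>Sym (m + n). if q = s then f s * e t else 0)"
      by (simp add: gmult_def)
    then show ?thesis using s Sym_mono[of m "m + n"] by auto
  qed
  show "gmult (m + n) f (iota m n e) p = 0" if p: "\<not> (\<exists>s\<in>Sym m. \<exists>t\<in>Sym n. p = s \<circ> shift_perm m t)"
    unfolding gmult_def
  proof (rule sum.neutral, rule ballI)
    fix q assume "q \<in> Sym (m + n)"
    show "f q * iota m n e (inv q \<circ> p) = 0"
    proof (cases "q \<in> Sym m")
      case True
      have "\<not> (\<exists>t\<in>Sym n. inv q \<circ> p = shift_perm m t)"
        using p True by (metis Sym_inv_o(5))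
      then show ?thesis using iota by simp
    qed (use f in simp)
  qed
qed

text \<open>For \<open>t\<close> acting on the last labels, right multiplication by its inverse
  commutes with \<open>XX k\<close> for \<open>k \<le> m\<close>. The restriction of
  \<open>X\<close> to \<open>Sym m\<close> therefore has the weight on both sides and is a multiple
  of \<open>F\<close>, by the coefficient of \<open>E\<close> at the shifted
  \<open>t\<close>.\<close>

lemma (in real_weight) unit_weight_factor:
  assumes E: "unit_weight (m + n) c E" and F: "unit_weight m c F" and st: "s \<in> Sym m" "t \<in> Sym n"
  shows "co E (s \<circ> shift_perm m t) = co F s * co E (shift_perm m t)"
proof -
  let ?t = "shift_perm m t"
  define X where "X = E * Gact (inv ?t)"
  have tS: "?t \<in> Sym (m + n)" by (rule shift_perm_Sym[OF st(2)])
  have EA: "E \<in> AA (m + n)" "weight (m + n) c E" "right_weight (m + n) c E" using E by (auto simp: unit_weight_def)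
  have FA: "F \<in> AA m" "weight m c F" "right_weight m c F" "tau F = 1" using F by (auto simp: unit_weight_def)
  have XA: "X \<in> AA (m + n)" using EA tS by (auto simp: X_def)
  have coX: "co X p = co E (p \<circ> ?t)" if p: "p \<in> Sym (m + n)" for p
  proof -
    have "co X p = tau (X * Gact (inv p))" using tau_Gact[OF XA p] by simp
    also have "X * Gact (inv p) = E * Gact (inv (p \<circ> ?t))"
      using p tS by (simp add: X_def Sym_inv_comp[OF p tS] Gact_mult[of _ "m + n"] Sym_inv mult.assoc)
    also have "tau \<dots> = co E (p \<circ> ?t)" using p tS EA(1) by (intro tau_Gact) auto
    finally show ?thesis .
  qed
  have "Gact (inv ?t) * XX k = XX k * Gact (inv ?t)" if k: "k \<in> {1..m}" for k
  proof -
    have inv: "inv ?t = shift_perm m (inv t)"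
      using shift_perm_comp[OF st(2), of m "inv t"] st(2) tS
      by (metis Sym_inv_o(1,7) shift_perm_id id_o comp_assoc comp_id Sym_inv_o(2))
    then have "inv ?t j = j" if "j \<le> k" for j using that k by (simp add: shift_perm_fixes)
    then have "Gact (inv ?t) * Pg j k = Pg j k * Gact (inv ?t)" if "j \<in> {1..<k}" for j
      using Gact_Pg[OF Sym_bij[OF Sym_inv[OF tS]], of j k] that by simp
    then show ?thesis by (simp add: XX_def sum_distrib_left sum_distrib_right)
  qed
  then have "X * XX k = E * XX k * Gact (inv ?t)" if "k \<in> {1..m}" for k
    using that by (simp add: X_def mult.assoc)
  then have "X * XX k = c k *\<^sub>C X" if "k \<in> {1..m}" for k
    using EA(3) that by (simp add: X_def right_weight_def)
  then have "right_weight m c X" by (simp add: right_weight_def)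
  moreover have "weight m c X" unfolding X_def by (rule weight_mult, rule weight_mono[OF EA(2)]) simp
  moreover have "tau (res m X) = tau (co E ?t *\<^sub>C F)"
    using FA(4) coX[OF Sym_id] by (simp add: tau_res) (simp add: tau_def)
  ultimately have "res m X = co E ?t *\<^sub>C F"
    using res_weight[OF XA, of m c] FA by (intro weight_eqI[of _ m] weight_scale right_weight_scale AA_scale res_in_AA) auto
  then have "co (res m X) s = co E ?t * co F s" by simp
  moreover have "co (res m X) s = co E (s \<circ> ?t)"
    using co_res[OF st(1), of X] coX[of s] Sym_mono[of m "m + n"] st(1) by auto
  ultimately show ?thesis by simp
qed

context gtableau
begin

lemma xx_subset: "t \<in> GG \<Longrightarrow> inj_on (xx t) (set [1..<Suc n])"
  using xx_inj by (simp add: atLeastLessThanSuc_atLeastAtMost del: upt_Suc)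

lemma upt_set: "set [1..<Suc n] = {1..n}"
  by auto

lemma value_exists:
  "\<exists>b. regv {1..n} GG (special_point g) (\<lambda>t. Gr.Bl (xx t) [1..<Suc n]) b"
proof -
  interpret S: separated_labelled_shape Pg "eps_of g" "{1..n}" GG "special_point g" xx n lnl psl
    "special_value g + of_nat K / 2" by (rule separated_labelled[OF transpositions_Pg])
  show ?thesis by (rule S.ex_value)
qed

lemma value_coefficient:
  assumes "regv {1..n} GG (special_point g) (\<lambda>t. Gr.Bl (xx t) [1..<Suc n]) b"
  shows "(\<lambda>j. co (Gr.Bl (xx (TT j)) [1..<Suc n]) s) \<longlonglongrightarrow> co b s"
  using regv_tendsto[OF assms, of unitvec s] by (simp add: co_def)

text \<open>\<open>hom\<close> is a finite sum over coefficients, so it commutes with the limit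
  along the curve.\<close>

lemma value_hom:
  assumes "sym_rep P' n \<rho>"
    and b: "regv {1..n} GG (special_point g) (\<lambda>t. Gr.Bl (xx t) [1..<Suc n]) b"
    and y: "regv {1..n} GG (special_point g) (\<lambda>t. transpositions.Bl P' (xx t) [1..<Suc n]) y"
  shows "(y :: 'a endo) = sym_rep.hom n \<rho> b"
proof (rule endo_eqI)
  interpret sym_rep P' n \<rho> by fact
  fix f w
  have "Bl (xx t) [1..<Suc n] = hom (Gr.Bl (xx t) [1..<Suc n])" for t
    using hom_Bl[of "[1..<Suc n]" "xx t"] upt_set by simp
  then have "ap (Bl (xx t) [1..<Suc n]) f w = (\<Sum>s\<in>Sym n. co (Gr.Bl (xx t) [1..<Suc n]) s * ap (\<rho> s) f w)" for t
    by (simp add: hom_def ap_sum_left cscale_def sum_fun_apply del: upt_Suc)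
  moreover have "(\<lambda>j. \<Sum>s\<in>Sym n. co (Gr.Bl (xx (TT j)) [1..<Suc n]) s * ap (\<rho> s) f w)
      \<longlonglongrightarrow> (\<Sum>s\<in>Sym n. co b s * ap (\<rho> s) f w)"
    by (intro tendsto_sum tendsto_mult value_coefficient[OF b] tendsto_const)
  moreover have "(\<Sum>s\<in>Sym n. co b s * ap (\<rho> s) f w) = ap (hom b) f w"
    by (simp add: hom_def ap_sum_left cscale_def sum_fun_apply)
  ultimately show "ap y f w = ap (hom b) f w"
    using regv_tendsto[OF y, of f w] by (simp add: LIMSEQ_unique del: upt_Suc)
qed

lemma sym_rep_Gact: "sym_rep Pg n Gact"
  by unfold_locales (auto simp: Gact_mult[of _ n] Pg_def)

text \<open>For the regular representation \<open>hom\<close> maps into \<open>AA n\<close>, and the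
  value is its own image.\<close>

lemma value_in_AA:
  assumes "regv {1..n} GG (special_point g) (\<lambda>t. Gr.Bl (xx t) [1..<Suc n]) b"
  shows "b \<in> AA n"
proof -
  interpret sym_rep Pg n Gact by (rule sym_rep_Gact)
  have "b = hom b" by (rule value_hom[OF sym_rep_Gact assms assms])
  moreover have "hom b \<in> AA n" unfolding hom_def by (intro AA_sum AA_scale AA_Gact)
  ultimately show ?thesis by simp
qed

text \<open>The left weight comes from the Jucys-Murphy relations of the value. The right weight
  follows by inverting permutations, under which the product and hence its limit are
  invariant.\<close>

lemma value_unit_weight:
  assumes young: "young_diagram D"
    and b: "regv {1..n} GG (special_point g) (\<lambda>t. Gr.Bl (xx t) [1..<Suc n]) b"
  shows "unit_weight n (young_tableau.cn D \<Omega>) b"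
proof -
  interpret Y: young_tableau D \<Omega> by unfold_locales fact
  interpret S: separated_labelled_shape Pg "eps_of g" "{1..n}" GG "special_point g" xx n lnl psl
    "special_value g + of_nat K / 2" by (rule separated_labelled[OF transpositions_Pg])
  have bA: "b \<in> AA n" by (rule value_in_AA[OF b])
  have sl: "straight_labels n lnl psl" using straight_labels[OF young] by (cases g) simp_all
  have w: "weight n Y.cn b"
    unfolding weight_def
  proof
    fix k assume k: "k \<in> {1..n}"
    have "S.JM [1..<Suc n] k = XX k" unfolding S.JM_def XX_eq_takeWhile[OF k] XX_def ..
    moreover have "xx (special_point g) k - (special_value g + of_nat K / 2) = Y.cn k"
      by (simp add: xx_def special_point_eq Y.cn_def)
    moreover have "k \<in> set [1..<Suc n]" using k upt_set by simp
    ultimately show "XX k * b = Y.cn k *\<^sub>C b"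
      using S.straight_value[OF sl b, unfolded S.JM_eigen_def, rule_format, of k] by simp
  qed
  have "co (Gr.Bl y [1..<Suc n]) id = 1" for y
    using co_Bl_append[of "[1..<Suc n]" "[]" id y] by (simp add: co_one unitvec_def del: upt_Suc)
  then have "tau b = 1"
    using value_coefficient[OF b, of id] by (simp add: tau_def LIMSEQ_const_iff del: upt_Suc)
  moreover have "twist (\<lambda>c. c) n b = b"
  proof (rule AA_eqI[of _ n])
    fix s assume s: "s \<in> Sym n"
    have inverse_eq: "co (Gr.Bl (xx t) [1..<Suc n]) (inv s) = co (Gr.Bl (xx t) [1..<Suc n]) s" if "t \<in> GG" for t
    proof -
      have "twist (\<lambda>c. c) n (Gr.Bl (xx t) [1..<Suc n]) = Gr.Bl (xx t) [1..<Suc n]"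
        using xx_subset[OF that] upt_set by (intro twist_Bl) auto
      then show ?thesis using co_twist[OF s, of "\<lambda>c. c" "Gr.Bl (xx t) [1..<Suc n]"] by simp
    qed
    have "\<forall>\<^sub>F j in sequentially. co (Gr.Bl (xx (TT j)) [1..<Suc n]) s = co (Gr.Bl (xx (TT j)) [1..<Suc n]) (inv s)"
      by (intro eventually_mono[OF T_generic] inverse_eq[symmetric])
    then have "(\<lambda>j. co (Gr.Bl (xx (TT j)) [1..<Suc n]) (inv s)) \<longlonglongrightarrow> co b s"
      by (rule Lim_transform_eventually[OF value_coefficient[OF b]])
    then have "co b (inv s) = co b s"
      using LIMSEQ_unique[OF value_coefficient[OF b]] by blast
    then show "co (twist (\<lambda>c. c) n b) s = co b s" using s by (simp add: co_twist)
  qed (use bA in auto)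
  then have "right_weight n Y.cn b"
    using plain.twist_weight(1)[OF bA, of Y.cn n] w by simp
  ultimately show ?thesis using bA w by (simp add: unit_weight_def)
qed

end

section \<open>Skew diagrams\<close>

lemma partition_antimono:
  assumes "is_partition \<nu>" "1 \<le> i" "i \<le> i'"
  shows "\<nu> i' \<le> \<nu> i"
  using assms(3,2)
proof (induction i' rule: dec_induct)
  case (step k)
  then have "\<nu> (Suc k) \<le> \<nu> k" using assms(1) by (auto simp: is_partition_def)
  with step show ?case by simp
qed simp

lemma young_diagram_partition:
  assumes "is_partition \<nu>"
  shows "young_diagram (diagram \<nu>)"
  unfolding young_diagram_def
proof (intro conjI allI impI)
  have "diagram \<nu> \<subseteq> (SIGMA i:{i. 1 \<le> i \<and> \<nu> i \<noteq> 0}. {1..\<nu> i})"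
    by (auto simp: diagram_def skew_diagram_def)
  moreover have "finite (SIGMA i:{i. 1 \<le> i \<and> \<nu> i \<noteq> 0}. {1..\<nu> i})"
    using assms by (intro finite_SigmaI) (auto simp: is_partition_def)
  ultimately show "finite (diagram \<nu>)" by (rule finite_subset)
  fix i j p q
  assume ij: "(i, j) \<in> diagram \<nu>"
  then show "1 \<le> i" "1 \<le> j" by (auto simp: diagram_def skew_diagram_def)
  assume "1 \<le> p" "p \<le> i" "1 \<le> q" "q \<le> j"
  then show "(p, q) \<in> diagram \<nu>"
    using ij partition_antimono[OF assms, of p i] by (auto simp: diagram_def skew_diagram_def)
qed

lemma convex_skew_diagram:
  assumes "is_partition lam" "is_partition mu"
  shows "convex_diagram (skew_diagram lam mu)"
  unfolding convex_diagram_def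
proof (intro conjI allI impI)
  have "skew_diagram lam mu \<subseteq> diagram lam" by (auto simp: diagram_def skew_diagram_def)
  moreover have "finite (diagram lam)"
    using young_diagram_partition[OF assms(1)] by (simp add: young_diagram_def)
  ultimately show "finite (skew_diagram lam mu)" by (rule finite_subset)
  fix i j i' j' p q
  assume *: "(i, j) \<in> skew_diagram lam mu" "(i', j') \<in> skew_diagram lam mu" "i \<le> p" "p \<le> i'" "j \<le> q" "q \<le> j'"
  then have "mu p \<le> mu i" "lam i' \<le> lam p"
    using partition_antimono[OF assms(2), of i p] partition_antimono[OF assms(1), of p i']
    by (auto simp: skew_diagram_def)
  then show "(p, q) \<in> skew_diagram lam mu" using * by (auto simp: skew_diagram_def)
qed

locale skew_tableau =
  fixes lam mu :: "nat \<Rightarrow> nat" and \<Upsilon> \<Omega> :: "nat \<times> nat \<Rightarrow> nat" and g :: gtype and K :: nat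
  assumes part: "is_partition lam" "is_partition mu" and sub: "\<forall>i\<ge>1. mu i \<le> lam i"
    and std_Om: "standard_tableau (skew_diagram lam mu) \<Omega>" and std_Ups: "standard_tableau (diagram mu) \<Upsilon>"
begin

abbreviation "D \<equiv> skew_diagram lam mu"
abbreviation "m \<equiv> card (diagram mu)"
abbreviation "n \<equiv> card D"
abbreviation "Lam \<equiv> glue_tableau (diagram mu) \<Upsilon> \<Omega>"

lemma diagrams: "diagram lam = diagram mu \<union> D" "diagram mu \<inter> D = {}"
  using sub by (auto simp: diagram_def skew_diagram_def)

lemma finite_diagrams: "finite (diagram lam)" "finite (diagram mu)" "finite D"
  using young_diagram_partition[OF part(1)] young_diagram_partition[OF part(2)] convex_skew_diagram[OF part]
  by (auto simp: young_diagram_def convex_diagram_def)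

lemma card_diagram: "card (diagram lam) = m + n"
  unfolding diagrams(1) using finite_diagrams diagrams(2) by (intro card_Un_disjoint) auto

sublocale O: gtableau D \<Omega> g K
  using convex_skew_diagram[OF part] std_Om by unfold_locales (auto simp: skew_diagram_def)

sublocale U: young_tableau "diagram mu" \<Upsilon>
  using young_convex[OF young_diagram_partition[OF part(2)]] young_diagram_partition[OF part(2)] std_Ups
  by unfold_locales

text \<open>Labels of the inner diagram are at most \<open>m\<close> and the others exceed
  \<open>m\<close>; a box of the outer diagram weakly above and to the left of a box of the inner
  one belongs to the inner one.\<close>

lemma std_Lam: "standard_tableau (diagram lam) Lam"
  unfolding standard_tableau_def
proof (intro conjI allI impI)
  have 1: "bij_betw Lam (diagram mu) {1..m}"
    using U.bij by (subst bij_betw_cong[of _ _ \<Upsilon>]) (auto simp: glue_tableau_def)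
  have "bij_betw (\<lambda>k. k + m) {1..n} {m + 1..m + n}"
    by (rule bij_betw_byWitness[of _ "\<lambda>k. k - m"]) auto
  then have "bij_betw ((\<lambda>k. k + m) \<circ> \<Omega>) D {m + 1..m + n}"
    by (rule bij_betw_trans[OF O.bij])
  then have 2: "bij_betw Lam D {m + 1..m + n}"
    using diagrams(2) by (subst bij_betw_cong[of _ _ "(\<lambda>k. k + m) \<circ> \<Omega>"]) (auto simp: glue_tableau_def)
  have "bij_betw Lam (diagram mu \<union> D) ({1..m} \<union> {m + 1..m + n})"
    using 1 2 by (rule bij_betw_combine) auto
  moreover have "{1..m} \<union> {m + 1..m + n} = {1..card (diagram lam)}" by (auto simp: card_diagram)
  ultimately show "bij_betw Lam (diagram lam) {1..card (diagram lam)}" by (simp add: diagrams(1))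
  have lo: "Lam b = \<Upsilon> b" "Lam b \<le> m" if "b \<in> diagram mu" for b
    using that U.label[OF that] by (auto simp: glue_tableau_def)
  have hi: "Lam b = \<Omega> b + m" "m < Lam b" if "b \<in> D" for b
    using that O.label[OF that] diagrams(2) by (auto simp: glue_tableau_def)
  have down: "(i, j) \<in> diagram mu" if "(i', j') \<in> diagram mu" "(i, j) \<in> diagram lam" "i \<le> i'" "j \<le> j'" for i j i' j'
    using young_down[OF U.young that(1)] young_pos[OF young_diagram_partition[OF part(1)] that(2)] that(3,4) by blast
  have mono: "Lam (i, j) < Lam (i', j')"
    if b: "(i, j) \<in> diagram lam" "(i', j') \<in> diagram lam" "i \<le> i'" "j \<le> j'" "(i, j) \<noteq> (i', j')" "i = i' \<or> j = j'" for i j i' j'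
  proof -
    consider "(i', j') \<in> diagram mu" "(i, j) \<in> diagram mu" | "(i', j') \<in> D" "(i, j) \<in> diagram mu" | "(i', j') \<in> D" "(i, j) \<in> D"
      using b down diagrams(1) by blast
    then show ?thesis
    proof cases
      case 1
      then have "\<Upsilon> (i, j) < \<Upsilon> (i', j')"
        using std_Ups b by (auto simp: standard_tableau_def le_less)
      then show ?thesis using lo 1 by simp
    next
      case 2
      then show ?thesis using lo(2)[of "(i, j)"] hi(2)[of "(i', j')"] by simp
    next
      case 3
      then have "\<Omega> (i, j) < \<Omega> (i', j')"
        using std_Om b by (auto simp: standard_tableau_def le_less)
      then show ?thesis using hi 3 by simp
    qed
  qed
  show "Lam (i, j) < Lam (i, j')" if "(i, j) \<in> diagram lam" "(i, j') \<in> diagram lam" "j < j'" for i j j'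
    using that by (intro mono) auto
  show "Lam (i, j) < Lam (i', j)" if "(i, j) \<in> diagram lam" "(i', j) \<in> diagram lam" "i < i'" for i i' j
    using that by (intro mono) auto
qed

sublocale L: young_tableau "diagram lam" Lam
  using young_convex[OF young_diagram_partition[OF part(1)]] young_diagram_partition[OF part(1)] std_Lam
  by unfold_locales

sublocale LG: gtableau "diagram lam" Lam g K
  by unfold_locales (auto simp: diagram_def skew_diagram_def)

lemma Lam_low: "k \<in> {1..m} \<Longrightarrow> L.rw k = U.rw k \<and> L.cl k = U.cl k"
proof -
  assume "k \<in> {1..m}"
  then have b: "(U.rw k, U.cl k) \<in> diagram mu" "\<Upsilon> (U.rw k, U.cl k) = k" using U.box by blast+
  then have "(U.rw k, U.cl k) \<in> diagram lam" "Lam (U.rw k, U.cl k) = k"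
    unfolding diagrams(1) by (auto simp: glue_tableau_def)
  then show ?thesis using L.label[of "(U.rw k, U.cl k)"] by simp
qed

lemma Lam_high: "k \<in> {1..n} \<Longrightarrow> L.rw (k + m) = O.rw k \<and> L.cl (k + m) = O.cl k"
proof -
  assume "k \<in> {1..n}"
  then have b: "(O.rw k, O.cl k) \<in> D" "\<Omega> (O.rw k, O.cl k) = k" using O.box by blast+
  then have "(O.rw k, O.cl k) \<in> diagram lam" "Lam (O.rw k, O.cl k) = k + m"
    unfolding diagrams(1) using diagrams(2) by (auto simp: glue_tableau_def)
  then show ?thesis using L.label[of "(O.rw k, O.cl k)"] by simp
qed

text \<open>\<open>unit_weight_factor\<close> exhibits a solution of the defining equation. It is
  the only one: at a shifted permutation the factor of the inner tableau contributes its coefficient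
  at the identity, which is 1.\<close>

lemma e_skew_eq:
  assumes E: "unit_weight (m + n) L.cn E" "e_straight (diagram lam) Lam = co E"
  shows "e_skew lam mu \<Upsilon> \<Omega> = (\<lambda>t. if t \<in> Sym n then co E (shift_perm m t) else 0)"
proof -
  obtain F where F: "unit_weight m U.cn F" "e_straight (diagram mu) \<Upsilon> = co F" by (rule U.e_straight_unit)
  have FA: "F \<in> AA m" "co F id = 1" using F(1) by (auto simp: unit_weight_def tau_def)
  have "L.cn k = U.cn k" if "k \<in> {1..m}" for k
    using Lam_low[OF that] by (simp add: L.cn_eq U.cn_eq)
  then have F': "unit_weight m L.cn F" using F(1) by (simp add: unit_weight_def weight_def right_weight_def)
  define e where "e = (\<lambda>t. if t \<in> Sym n then co E (shift_perm m t) else 0)"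
  have eG: "e \<in> group_algebra n" by (simp add: e_def group_algebra_def)
  have F0: "co F q = 0" if "q \<notin> Sym m" for q by (rule co_outside[OF FA(1) that])
  have gm1: "gmult (m + n) (co F) (iota m n f) (s \<circ> shift_perm m t) = co F s * f t"
    if "f \<in> group_algebra n" "s \<in> Sym m" "t \<in> Sym n" for f s t
    using F0 that by (intro gmult_iota(1))
  have gm2: "gmult (m + n) (co F) (iota m n f) p = 0"
    if "f \<in> group_algebra n" "\<not> (\<exists>s\<in>Sym m. \<exists>t\<in>Sym n. p = s \<circ> shift_perm m t)" for f p
    using F0 that by (intro gmult_iota(2))
  have factor: "co E (s \<circ> shift_perm m t) = co F s * co E (shift_perm m t)" if "s \<in> Sym m" "t \<in> Sym n" for s t
    by (rule L.unit_weight_factor[OF E(1) F' that])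
  have "theta m n (co E) = gmult (m + n) (co F) (iota m n e)"
  proof
    fix p
    show "theta m n (co E) p = gmult (m + n) (co F) (iota m n e) p"
    proof (cases "\<exists>s\<in>Sym m. \<exists>t\<in>Sym n. p = s \<circ> shift_perm m t")
      case True
      then obtain s t where st: "s \<in> Sym m" "t \<in> Sym n" "p = s \<circ> shift_perm m t" by blast
      then have "theta m n (co E) p = co E (s \<circ> shift_perm m t)" by (auto simp: theta_def)
      then show ?thesis using gm1[OF eG st(1,2)] factor[OF st(1,2)] st by (simp add: e_def)
    qed (simp add: theta_def gm2[OF eG])
  qed
  moreover have "f = e"
    if f: "f \<in> group_algebra n" "theta m n (co E) = gmult (m + n) (co F) (iota m n f)" for f
  proof
    fix t
    show "f t = e t"
    proof (cases "t \<in> Sym n")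
      case True
      have "theta m n (co E) (id \<circ> shift_perm m t) = co E (shift_perm m t)"
        using True Sym_id[of m] unfolding theta_def by (metis id_comp)
      then show ?thesis
        using gm1[OF f(1) Sym_id True] True by (simp add: f(2) FA(2) e_def)
    qed (use f(1) in \<open>simp add: e_def group_algebra_def\<close>)
  qed
  ultimately have "(THE e. e \<in> group_algebra n \<and> theta m n (co E) = gmult (m + n) (co F) (iota m n e)) = e"
    using eG by (intro the_equality) auto
  then show ?thesis by (simp add: e_skew_def Let_def card_diagram E(2) F(2) e_def)
qed

lemma sym_rep_shift: "sym_rep (\<lambda>a b. Pg (a + m) (b + m)) n (\<lambda>s. Gact (shift_perm m s))"
proof
  show "Pg (a + m) (b + m) = Pg (b + m) (a + m)" for a b by (rule Pg_sym)
  show "Pg (a + m) (b + m) * Pg (a + m) (b + m) = 1" if "a \<noteq> b" for a b using that by (intro Gr.P_sq) auto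
  show "Pg (a + m) (b + m) * Pg (a + m) (c + m) = Pg (b + m) (c + m) * Pg (a + m) (b + m)"
    if "a \<noteq> b" "a \<noteq> c" "b \<noteq> c" for a b c using that by (intro Gr.P_conj) auto
  show "Pg (a + m) (b + m) * Pg (c + m) (d + m) = Pg (c + m) (d + m) * Pg (a + m) (b + m)"
    if "a \<noteq> c" "a \<noteq> d" "b \<noteq> c" "b \<noteq> d" for a b c d using that by (intro Gr.P_comm) auto
  show "Gact (shift_perm m id) = 1" by simp
  show "Gact (shift_perm m (s \<circ> t)) = Gact (shift_perm m s) * Gact (shift_perm m t)"
    if "s \<in> Sym n" "t \<in> Sym n" for s t
    using shift_perm_comp[OF that(2), of m s] shift_perm_Sym[OF that(1), of m] shift_perm_Sym[OF that(2), of m]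
    by (simp add: Gact_mult)
  show "Gact (shift_perm m (Transposition.transpose a b)) = Pg (a + m) (b + m)"
    if "a \<in> {1..n}" "b \<in> {1..n}" for a b
  proof -
    have "shift_perm m (Transposition.transpose a b) = Transposition.transpose (a + m) (b + m)"
      using that by (auto simp: fun_eq_iff shift_perm_def Transposition.transpose_def)
    then show ?thesis by (simp add: Pg_def)
  qed
qed

text \<open>Shifting labels by \<open>m\<close> identifies the product with one on the last
  \<open>n\<close> labels, and at a permutation fixing the first \<open>m\<close> labels their rows
  may be added by \<open>co_Bl_append\<close>.\<close>

lemma Bl_shift_coefficient:
  assumes x: "\<And>k. k \<in> {1..n} \<Longrightarrow> x' (k + m) = x k" and s: "s \<in> Sym n"
  shows "co (Gr.Bl x [1..<Suc n]) s = co (Gr.Bl x' [1..<Suc (m + n)]) (shift_perm m s)"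
proof -
  interpret S: sym_rep "\<lambda>a b. Pg (a + m) (b + m)" n "\<lambda>s. Gact (shift_perm m s)" by (rule sym_rep_shift)
  have R: "S.R x a b = Gr.R x' (a + m) (b + m)" if "a \<in> {1..n}" "b \<in> {1..n}" for a b
    using x that by (simp add: S.R_def Gr.R_def)
  have row: "S.rowR x a bs = Gr.rowR x' (a + m) (map (\<lambda>k. k + m) bs)" if "a \<in> {1..n}" "set bs \<subseteq> {1..n}" for a bs
    using that(2) by (induction bs) (use that(1) R in auto)
  have Bl: "S.Bl x ks = Gr.Bl x' (map (\<lambda>k. k + m) ks)" if "set ks \<subseteq> {1..n}" for ks
    using that by (induction ks) (use row in auto)
  have hom: "co (S.hom X) (shift_perm m s) = co X s" for X
  proof -
    have "co (S.hom X) (shift_perm m s) = (\<Sum>t\<in>Sym n. if t = s then co X t else 0)"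
      unfolding S.hom_def co_sum
      using s shift_perm_inject[OF s, of _ m]
      by (intro sum.cong) (auto simp: co_Gact[OF shift_perm_Sym])
    then show ?thesis using s by simp
  qed
  have "co (Gr.Bl x [1..<Suc n]) s = co (S.hom (Gr.Bl x [1..<Suc n])) (shift_perm m s)" by (simp add: hom)
  also have "S.hom (Gr.Bl x [1..<Suc n]) = S.Bl x [1..<Suc n]"
    using S.hom_Bl[of "[1..<Suc n]" x] O.upt_set by simp
  also have "\<dots> = Gr.Bl x' (map (\<lambda>k. k + m) [1..<Suc n])"
    using Bl[of "[1..<Suc n]"] O.upt_set by simp
  also have "map (\<lambda>k. k + m) [1..<Suc n] = [Suc m..<Suc (m + n)]"
    by (intro nth_equalityI) (auto simp del: upt_Suc)
  also have "co (Gr.Bl x' [Suc m..<Suc (m + n)]) (shift_perm m s)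
      = co (Gr.Bl x' ([1..<Suc m] @ [Suc m..<Suc (m + n)])) (shift_perm m s)"
    by (rule co_Bl_append[symmetric]) (auto simp: shift_perm_fixes simp del: upt_Suc)
  also have "[1..<Suc m] @ [Suc m..<Suc (m + n)] = [1..<Suc (m + n)]"
    using upt_add_eq_append[of 1 "Suc m" n] by (simp del: upt_Suc)
  finally show ?thesis .
qed

text \<open>Both sides are coefficients, at the shifted permutation, of one element
  \<open>E\<close>: the value of the product for the glued straight tableau.\<close>

lemma value_eq_e_skew:
  assumes b: "regv {1..n} O.GG (special_point g) (\<lambda>t. Gr.Bl (O.xx t) [1..<Suc n]) b" and s: "s \<in> Sym n"
  shows "co b s = e_skew lam mu \<Upsilon> \<Omega> s"
proof -
  obtain E where E: "unit_weight (m + n) L.cn E" "e_straight (diagram lam) Lam = co E"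
    using L.e_straight_unit unfolding card_diagram by blast
  obtain b' where b': "regv {1..m + n} LG.GG (special_point g) (\<lambda>t. Gr.Bl (LG.xx t) [1..<Suc (m + n)]) b'"
    using LG.value_exists unfolding card_diagram by blast
  have "unit_weight (m + n) L.cn b'"
    using LG.value_unit_weight[OF L.young] b' unfolding card_diagram by blast
  then have bE: "b' = E" using L.unit_weight_unique E(1) by blast
  \<comment> \<open>The two sequences of points agree on these labels, since they depend only on the
    row or column of a box, which is the same in both diagrams.\<close>
  have "LG.xx (LG.TT j) (k + m) = O.xx (O.TT j) k" if "k \<in> {1..n}" for k j
  proof -
    have "line_of g (diagram lam) Lam (k + m) = line_of g D \<Omega> k"
      using Lam_high[OF that] by (cases g) simp_all
    moreover have "box_content (diagram lam) Lam (k + m) = box_content D \<Omega> k"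
      using Lam_high[OF that] by (simp add: box_content_def)
    ultimately show ?thesis by (simp add: LG.xx_def O.xx_def LG.TT_def O.TT_def)
  qed
  then have eq: "co (Gr.Bl (O.xx (O.TT j)) [1..<Suc n]) s
      = co (Gr.Bl (LG.xx (LG.TT j)) [1..<Suc (m + n)]) (shift_perm m s)" for j
    by (intro Bl_shift_coefficient s)
  have "(\<lambda>j. co (Gr.Bl (LG.xx (LG.TT j)) [1..<Suc (m + n)]) (shift_perm m s)) \<longlonglongrightarrow> co E (shift_perm m s)"
    using LG.value_coefficient[of b' "shift_perm m s"] b' bE unfolding card_diagram by blast
  moreover have "(\<lambda>j. co (Gr.Bl (LG.xx (LG.TT j)) [1..<Suc (m + n)]) (shift_perm m s)) \<longlonglongrightarrow> co b s"
    using O.value_coefficient[OF b, of s] unfolding eq .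
  ultimately have "co b s = co E (shift_perm m s)" by (rule LIMSEQ_unique[symmetric])
  then show ?thesis using e_skew_eq[OF E] s by simp
qed

end

section \<open>Operators on tensors\<close>

lift_definition perm_endo :: "(nat \<Rightarrow> nat) \<Rightarrow> (nat \<Rightarrow> 'N) endo" is perm_op
  by (rule linear_cscaleI) (simp_all add: perm_op_def cscale_def fun_eq_iff)

text \<open>The projection of all functions on index sequences onto the \<open>n\<close>-th tensor
  power.\<close>

lift_definition support_endo :: "nat \<Rightarrow> (nat \<Rightarrow> 'N) endo"
  is "\<lambda>n f x. if x \<in> ({1..n} \<rightarrow>\<^sub>E UNIV) then f x else 0"
  by (rule linear_cscaleI) (simp_all add: cscale_def fun_eq_iff)

lift_definition contraction_endo ::
  "('N::finite \<Rightarrow> 'N \<Rightarrow> complex) \<Rightarrow> ('N \<Rightarrow> 'N \<Rightarrow> complex) \<Rightarrow> nat \<Rightarrow> nat \<Rightarrow> (nat \<Rightarrow> 'N) endo"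
  is "\<lambda>w h k l f x. w (x k) (x l) * (\<Sum>a\<in>UNIV. \<Sum>b\<in>UNIV. h a b * f (x(k := a, l := b)))"
  by (rule linear_cscaleI) (simp_all add: cscale_def fun_eq_iff algebra_simps sum.distrib sum_distrib_left)

lemma perm_endo_mult: "perm_endo s * perm_endo t = perm_endo (s \<circ> t)"
  by (rule endo_eqI) (simp add: perm_endo.rep_eq perm_op_def o_assoc)

lemma perm_endo_id: "perm_endo id = 1"
  by (rule endo_eqI) (simp add: perm_endo.rep_eq perm_op_def)

abbreviation "swap_endo a b \<equiv> perm_endo (Transposition.transpose a b)"

lemma transpositions_swap: "transpositions swap_endo"
proof
  show "swap_endo a b = swap_endo b a" for a b by (simp add: transpose_commute)
  show "swap_endo a b * swap_endo a b = 1" if "a \<noteq> b" for a b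
    by (simp add: perm_endo_mult perm_endo_id)
  show "swap_endo a b * swap_endo a c = swap_endo b c * swap_endo a b" if "a \<noteq> b" "a \<noteq> c" "b \<noteq> c" for a b c
    unfolding perm_endo_mult
    by (rule arg_cong[of _ _ perm_endo]) (use that in \<open>auto simp: fun_eq_iff Transposition.transpose_def\<close>)
  show "swap_endo a b * swap_endo c d = swap_endo c d * swap_endo a b"
    if "a \<noteq> c" "a \<noteq> d" "b \<noteq> c" "b \<noteq> d" for a b c d
    unfolding perm_endo_mult
    by (rule arg_cong[of _ _ perm_endo]) (use that in \<open>auto simp: fun_eq_iff Transposition.transpose_def\<close>)
qed

lemma sym_rep_perm: "sym_rep swap_endo n perm_endo"
proof -
  interpret transpositions swap_endo by (rule transpositions_swap)
  show ?thesis by unfold_locales (simp_all add: perm_endo_id perm_endo_mult)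
qed

lemma perm_contraction:
  fixes w h :: "'N::finite \<Rightarrow> 'N \<Rightarrow> complex"
  assumes "bij s"
  shows "perm_endo s * contraction_endo w h k l = contraction_endo w h (s k) (s l) * perm_endo s"
proof (rule endo_eqI)
  fix f and x :: "nat \<Rightarrow> 'N"
  have "(x \<circ> s)(k := a, l := b) = x(s k := a, s l := b) \<circ> s" for a b
    using bij_is_inj[OF assms] by (auto simp: fun_eq_iff inj_eq)
  then show "ap (perm_endo s * contraction_endo w h k l) f x
      = ap (contraction_endo w h (s k) (s l) * perm_endo s) f x"
    by (simp add: perm_endo.rep_eq contraction_endo.rep_eq perm_op_def)
qed

text \<open>\<open>h\<close> is the matrix of the form and \<open>w\<close> that of the invariant
  tensor; \<open>contract\<close> says that \<open>w\<close> is inverse to the transpose of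
  \<open>h\<close>.\<close>

locale dual_tensors =
  fixes w h :: "'N::finite \<Rightarrow> 'N \<Rightarrow> complex" and \<delta> :: complex
  assumes delta: "\<delta> * \<delta> = 1"
    and h_sym: "h b a = \<delta> * h a b" and w_sym: "w b a = \<delta> * w a b"
    and contract: "(\<Sum>q\<in>UNIV. w a q * h p q) = (if p = a then 1 else 0)"
begin

abbreviation "QQ \<equiv> contraction_endo w h"

lemma QQ_sym: "QQ a b = QQ b a"
proof (cases "a = b")
  case False
  show ?thesis
  proof (rule endo_eqI)
    fix f and x :: "nat \<Rightarrow> 'N"
    have term_eq: "h q p * f (x(b := q, a := p)) = (\<delta> * h p q) * f (x(a := p, b := q))" for p q
      using False by (subst h_sym) (simp add: fun_upd_twist)
    have "ap (QQ b a) f x = \<delta> * w (x a) (x b) * (\<Sum>q\<in>UNIV. \<Sum>p\<in>UNIV. (\<delta> * h p q) * f (x(a := p, b := q)))"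
      by (simp add: contraction_endo.rep_eq w_sym[of "x b" "x a"] term_eq)
    also have "\<dots> = (\<delta> * \<delta>) * w (x a) (x b) * (\<Sum>q\<in>UNIV. \<Sum>p\<in>UNIV. h p q * f (x(a := p, b := q)))"
      by (simp add: sum_distrib_left mult_ac)
    also have "\<dots> = ap (QQ a b) f x"
      by (subst sum.swap) (simp add: delta contraction_endo.rep_eq)
    finally show "ap (QQ a b) f x = ap (QQ b a) f x" ..
  qed
qed simp

lemma swap_QQ: "swap_endo a b * QQ a b = \<delta> *\<^sub>C QQ a b" if "a \<noteq> b"
proof (rule endo_eqI)
  fix f and x :: "nat \<Rightarrow> 'N"
  have "(x \<circ> Transposition.transpose a b)(a := p, b := q) = x(a := p, b := q)" for p q
    by (auto simp: fun_eq_iff Transposition.transpose_def)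
  then show "ap (swap_endo a b * QQ a b) f x = ap (\<delta> *\<^sub>C QQ a b) f x"
    by (simp add: perm_endo.rep_eq perm_op_def contraction_endo.rep_eq cscale_def w_sym[of "x b" "x a"] mult.assoc)
qed

lemma QQ_QQ_comm:
  assumes "a \<noteq> c" "a \<noteq> d" "b \<noteq> c" "b \<noteq> d"
  shows "QQ a b * QQ c d = QQ c d * QQ a b"
proof (rule endo_eqI)
  fix f and x :: "nat \<Rightarrow> 'N"
  have tw: "x(a := p, b := q, c := r, d := s) = x(c := r, d := s, a := p, b := q)" for p q r s
    using assms by (auto simp: fun_eq_iff)
  have swap: "(\<Sum>p\<in>UNIV. \<Sum>q\<in>UNIV. \<Sum>r\<in>UNIV. \<Sum>s\<in>UNIV. F p q r s)
      = (\<Sum>r\<in>UNIV. \<Sum>s\<in>UNIV. \<Sum>p\<in>UNIV. \<Sum>q\<in>UNIV. F p q r s)" for F :: "'N \<Rightarrow> 'N \<Rightarrow> 'N \<Rightarrow> 'N \<Rightarrow> complex"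
  proof -
    have pair: "(\<Sum>p\<in>UNIV. \<Sum>q\<in>UNIV. f p q) = (\<Sum>y\<in>UNIV \<times> UNIV. f (fst y) (snd y))"
      for f :: "'N \<Rightarrow> 'N \<Rightarrow> complex"
      by (simp add: sum.cartesian_product case_prod_unfold)
    show ?thesis unfolding pair by (rule sum.swap)
  qed
  have "ap (QQ a b * QQ c d) f x = w (x a) (x b) * w (x c) (x d) *
      (\<Sum>p\<in>UNIV. \<Sum>q\<in>UNIV. \<Sum>r\<in>UNIV. \<Sum>s\<in>UNIV. h p q * (h r s * f (x(a := p, b := q, c := r, d := s))))"
    using assms by (simp add: contraction_endo.rep_eq sum_distrib_left mult_ac)
  also have "\<dots> = w (x a) (x b) * w (x c) (x d) *
      (\<Sum>r\<in>UNIV. \<Sum>s\<in>UNIV. \<Sum>p\<in>UNIV. \<Sum>q\<in>UNIV. h p q * (h r s * f (x(c := r, d := s, a := p, b := q))))"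
    unfolding tw by (subst swap) (rule refl)
  also have "\<dots> = ap (QQ c d * QQ a b) f x"
    using assms by (simp add: contraction_endo.rep_eq sum_distrib_left mult_ac)
  finally show "ap (QQ a b * QQ c d) f x = ap (QQ c d * QQ a b) f x" .
qed

text \<open>By \<open>contract\<close>, the tensor at places \<open>b\<close>, \<open>c\<close>
  paired with the form at places \<open>a\<close>, \<open>c\<close> is the identity map from place
  \<open>a\<close> to place \<open>b\<close>.\<close>

lemma QQ_QQ:
  assumes "a \<noteq> b" "a \<noteq> c" "b \<noteq> c"
  shows "QQ a c * QQ b c = swap_endo a b * QQ b c"
proof (rule endo_eqI)
  fix f and x :: "nat \<Rightarrow> 'N"
  define H where "H p = (\<Sum>r\<in>UNIV. \<Sum>s\<in>UNIV. h r s * f (x(a := p, b := r, c := s)))" for p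
  have upd: "x(a := p, c := q, b := r, c := s) = x(a := p, b := r, c := s)" for p q r s
    using assms by (auto simp: fun_eq_iff)
  have "ap (QQ a c * QQ b c) f x = w (x a) (x c) * (\<Sum>p\<in>UNIV. \<Sum>q\<in>UNIV. h p q * (w (x b) q * H p))"
    using assms by (simp add: contraction_endo.rep_eq H_def upd)
  also have "(\<Sum>p\<in>UNIV. \<Sum>q\<in>UNIV. h p q * (w (x b) q * H p)) = (\<Sum>p\<in>UNIV. (\<Sum>q\<in>UNIV. w (x b) q * h p q) * H p)"
    by (simp add: sum_distrib_left sum_distrib_right mult_ac)
  also have "\<dots> = H (x b)" unfolding contract by (simp add: if_distrib[of "\<lambda>c. c * _"] cong: if_cong)
  also have "w (x a) (x c) * H (x b) = ap (swap_endo a b * QQ b c) f x"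
  proof -
    have "(x \<circ> Transposition.transpose a b)(b := r, c := s) = x(a := x b, b := r, c := s)" for r s
      using assms by (auto simp: fun_eq_iff Transposition.transpose_def)
    then show ?thesis
      using assms by (simp add: perm_endo.rep_eq perm_op_def contraction_endo.rep_eq H_def)
  qed
  finally show "ap (QQ a c * QQ b c) f x = ap (swap_endo a b * QQ b c) f x" .
qed

sublocale brauer swap_endo QQ \<delta>
proof -
  interpret transpositions swap_endo by (rule transpositions_swap)
  show "brauer swap_endo QQ \<delta>"
  proof
    have bij: "bij (Transposition.transpose a b)" for a b :: nat by simp
    show "QQ a b = QQ b a" for a b by (rule QQ_sym)
    show PQ: "swap_endo a b * QQ a b = \<delta> *\<^sub>C QQ a b" if "a \<noteq> b" for a b by (rule swap_QQ[OF that])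
    show "QQ a b * swap_endo a b = \<delta> *\<^sub>C QQ a b" if "a \<noteq> b" for a b
      using PQ[OF that] perm_contraction[OF bij, of a b w h b a] by (simp add: QQ_sym[of b a])
    show "swap_endo a b * QQ a c = QQ b c * swap_endo a b" if "a \<noteq> b" "a \<noteq> c" "b \<noteq> c" for a b c
      using perm_contraction[OF bij, of a b w h a c] that by simp
    show "swap_endo a b * QQ c d = QQ c d * swap_endo a b"
      if "a \<noteq> c" "a \<noteq> d" "b \<noteq> c" "b \<noteq> d" for a b c d
      using perm_contraction[OF bij, of a b w h c d] that by (simp add: transpose_apply_other)
    show "QQ a b * QQ c d = QQ c d * QQ a b" if "a \<noteq> c" "a \<noteq> d" "b \<noteq> c" "b \<noteq> d" for a b c d
      by (rule QQ_QQ_comm[OF that])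
    show "QQ a c * QQ b c = swap_endo a b * QQ b c" if "a \<noteq> b" "a \<noteq> c" "b \<noteq> c" for a b c
      by (rule QQ_QQ[OF that])
  qed
qed

end

fun delta_of :: "gtype \<Rightarrow> complex" where
  "delta_of Orth = 1"
| "delta_of Symp = - 1"

lemma form_swap:
  fixes form :: "complex ^ 'N::finite \<Rightarrow> complex ^ 'N \<Rightarrow> complex"
  assumes "form_of_type g form"
  shows "form y x = delta_of g * form x y"
proof (cases g)
  case Symp
  then have "bilinear_form form" and alt: "\<forall>x. form x x = 0" using assms by auto
  then have add: "form (a + b) c = form a c + form b c" "form c (a + b) = form c a + form c b" for a b c
    unfolding bilinear_form_def by (metis Vector_Spaces.linear.axioms(1) module_hom.add Vector_Spaces.linear_def module_hom_iff_linear)+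
  have "form x y + form y x = form (x + y) (x + y)" unfolding add by (simp add: alt)
  also have "\<dots> = 0" using alt by blast
  finally have "form y x = - form x y" by (simp add: eq_neg_iff_add_eq_0 add.commute)
  then show ?thesis unfolding Symp by simp
qed (use assms in simp)

text \<open>Expanding a coordinate vector in the basis \<open>u\<close> gives
  \<open>contract\<close>. The symmetry of \<open>w\<close> is that of an inverse matrix:
  \<open>W\<close> is a left and \<open>W'\<close> a right inverse of \<open>H\<close>, so they
  agree.\<close>

lemma dual_tensors_form:
  fixes form :: "complex ^ 'N::finite \<Rightarrow> complex ^ 'N \<Rightarrow> complex"
  assumes form: "form_of_type g form" and bases: "dual_bases form u v"
  shows "dual_tensors (w_coord u v) (\<lambda>a b. form (axis a 1) (axis b 1)) (delta_of g)"
proof -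
  define h where "h a b = form (axis a 1) (axis b 1)" for a b
  define w where "w = w_coord u v"
  have bf: "bilinear_form form" using form by (cases g) auto
  interpret L: Vector_Spaces.linear "(*s)" "(*)" "\<lambda>x. form x y" for y
    using bf by (auto simp: bilinear_form_def)
  have dd: "delta_of g * delta_of g = 1" by (cases g) simp_all
  have h_sym: "h b a = delta_of g * h a b" for a b unfolding h_def by (rule form_swap[OF form])
  have fc: "form (axis p 1) y = (\<Sum>q\<in>UNIV. h p q * y $ q)" for p y
  proof -
    have "form (axis p 1) y = (\<Sum>a\<in>UNIV. if a = p then \<Sum>b\<in>UNIV. h a b * y $ b else 0)"
      unfolding bilinear_form_coords[OF bf, of "axis p 1"] by (intro sum.cong) (auto simp: h_def axis_def)
    then show ?thesis by simp
  qed
  have expand: "z = (\<Sum>i\<in>UNIV. form z (v i) *s u i)" for z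
  proof -
    have "z \<in> vec.span (range u)" using bases by (simp add: dual_bases_def)
    then obtain \<alpha> where "z = (\<Sum>y\<in>range u. \<alpha> y *s y)"
      by (auto simp: vec.span_finite)
    then have z: "z = (\<Sum>i\<in>UNIV. \<alpha> (u i) *s u i)"
      using bases by (simp add: dual_bases_def sum.reindex)
    have "form z (v j) = \<alpha> (u j)" for j
    proof -
      have "form z (v j) = (\<Sum>i\<in>UNIV. \<alpha> (u i) * form (u i) (v j))"
        unfolding z by (simp only: L.sum L.scale)
      also have "\<dots> = (\<Sum>i\<in>UNIV. if i = j then \<alpha> (u i) else 0)"
        using bases by (intro sum.cong) (auto simp: dual_bases_def)
      finally show ?thesis by simp
    qed
    then show ?thesis using z by simp
  qed
  have contract: "(\<Sum>q\<in>UNIV. w a q * h p q) = (if p = a then 1 else 0)" for a p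
  proof -
    have "(\<Sum>q\<in>UNIV. w a q * h p q) = (\<Sum>i\<in>UNIV. form (axis p 1) (v i) * u i $ a)"
      unfolding fc w_def w_coord_def sum_distrib_right by (subst sum.swap) (simp add: mult_ac)
    also have "\<dots> = axis p 1 $ a"
      by (subst (2) expand) (simp add: sum_component)
    finally show ?thesis by (simp add: axis_def)
  qed
  have w_sym: "w a b = delta_of g * w b a" for a b
  proof -
    define W H W' where "W = (\<chi> a b. w a b)" and "H = (\<chi> a b. h b a)" and "W' = (\<chi> a b. delta_of g * w b a)"
    have WH: "W ** H = mat 1"
      by (simp add: W_def H_def matrix_matrix_mult_def mat_def vec_eq_iff contract)
    have "(\<Sum>y\<in>UNIV. h y a * (delta_of g * w b y)) = (if a = b then 1 else 0)" for a b
    proof -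
      have "h y a * (delta_of g * w b y) = w b y * h a y" for y
        unfolding h_sym[of a y] by (simp add: mult_ac)
      then have "(\<Sum>y\<in>UNIV. h y a * (delta_of g * w b y)) = (\<Sum>y\<in>UNIV. w b y * h a y)" by (intro sum.cong refl)
      then show ?thesis unfolding contract .
    qed
    then have HW: "H ** W' = mat 1"
      unfolding vec_eq_iff by (simp only: W'_def H_def matrix_matrix_mult_def mat_def vec_lambda_beta simp_thms)
    have "W = W ** (H ** W')" by (simp add: HW)
    also have "\<dots> = W'" by (simp add: matrix_mul_assoc WH)
    finally have "W = W'" .
    from arg_cong[OF this, of "\<lambda>X. X $ a $ b"] show ?thesis by (simp only: W_def W'_def vec_lambda_beta)
  qed
  show ?thesis
    using dd h_sym w_sym contract unfolding h_def w_def by unfold_locales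
qed

section \<open>Ordered products of maps as products of operators\<close>

lemma foldr_lex_pairs:
  assumes X: "\<And>k l. k \<in> {i..<N} \<Longrightarrow> l \<in> {i..<N} \<Longrightarrow> k < l \<Longrightarrow> X k l = ap (Z k l)"
    and rw: "\<And>k. rw k [] = 1" "\<And>k l ls. rw k (l # ls) = Z k l * rw k ls"
    and pr: "pr [] = 1" "\<And>k ks. pr (k # ks) = rw k ks * pr ks"
  shows "foldr (\<lambda>(k, l) Y. X k l \<circ> Y) [(k, l). k \<leftarrow> [i..<N], l \<leftarrow> [Suc k..<N]] id = ap (pr [i..<N])"
  using X
proof (induction "N - i" arbitrary: i)
  case 0
  then show ?case by (simp add: pr fun_eq_iff)
next
  case (Suc d)
  have inner: "foldr (\<lambda>(k, l) Y. X k l \<circ> Y) (map (Pair i) ls) (ap U) = ap (rw i ls * U)"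
    if "set ls \<subseteq> {Suc i..<N}" for ls U
    using that
  proof (induction ls)
    case (Cons l ls)
    then have "X i l = ap (Z i l)" using Suc.prems[of i l] by auto
    then show ?case using Cons by (simp add: rw)
  qed (simp add: rw)
  have IH: "foldr (\<lambda>(k, l) Y. X k l \<circ> Y) [(k, l). k \<leftarrow> [Suc i..<N], l \<leftarrow> [Suc k..<N]] id = ap (pr [Suc i..<N])"
    using Suc by auto
  have "[i..<N] = i # [Suc i..<N]" using Suc.hyps(2) by (simp add: upt_conv_Cons)
  then show ?case using inner[of "[Suc i..<N]" "pr [Suc i..<N]"] by (simp add: IH pr)
qed

lemma ordered_prod_eq:
  assumes "\<And>k l. k \<in> {1..n} \<Longrightarrow> l \<in> {1..n} \<Longrightarrow> k < l \<Longrightarrow> X k l = ap (Z k l)"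
    and "\<And>k. rw k [] = 1" "\<And>k l ls. rw k (l # ls) = Z k l * rw k ls"
    and "pr [] = 1" "\<And>k ks. pr (k # ks) = rw k ks * pr ks"
  shows "ordered_prod n X = ap (pr [1..<Suc n])"
  unfolding ordered_prod_def lex_pairs_def
  by (rule foldr_lex_pairs[of 1 "Suc n" X Z rw pr]) (use assms in auto)

context gtableau
begin

lemma B_prod_eq: "B_prod n (box_content D \<Omega>) t = ap (transpositions.Bl swap_endo (xx t) [1..<Suc n])"
proof -
  interpret transpositions swap_endo by (rule transpositions_swap)
  show ?thesis
    unfolding B_prod_def
    by (rule ordered_prod_eq[where Z = "R (xx t)" and rw = "rowR (xx t)"])
      (auto simp: fun_eq_iff R_def B_denom_eq P_op_def perm_endo.rep_eq)
qed

lemma A_prod_eq: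
  assumes "dual_tensors (w_coord u v) (\<lambda>a b. form (axis a 1) (axis b 1)) \<delta>"
  shows "A_prod form u v n (box_content D \<Omega>) K t
    = ap (brauer.Al (contraction_endo (w_coord u v) (\<lambda>a b. form (axis a 1) (axis b 1))) (xx t) [1..<Suc n])"
proof -
  interpret dual_tensors "w_coord u v" "\<lambda>a b. form (axis a 1) (axis b 1)" \<delta> by fact
  show ?thesis
    unfolding A_prod_def
    by (rule ordered_prod_eq[where Z = "S (xx t)" and rw = "rowS (xx t)"])
      (auto simp: fun_eq_iff S_def A_denom_eq Q_op_def contraction_endo.rep_eq)
qed

end

section \<open>Compatibility with the tensor power\<close>

lemma support_perm:
  assumes "s \<in> Sym n"
  shows "(support_endo n :: (nat \<Rightarrow> 'N) endo) * perm_endo s = perm_endo s * support_endo n"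
proof (rule endo_eqI)
  fix f and x :: "nat \<Rightarrow> 'N"
  have s: "s permutes {1..n}" using assms by (simp add: Sym_def)
  have "x \<circ> s \<in> {1..n} \<rightarrow>\<^sub>E UNIV \<longleftrightarrow> x \<in> {1..n} \<rightarrow>\<^sub>E UNIV"
    using permutes_not_in[OF s] by (auto simp: PiE_def extensional_def)
  then show "ap (support_endo n * perm_endo s) f x = ap (perm_endo s * support_endo n) f x"
    by (simp add: support_endo.rep_eq perm_endo.rep_eq perm_op_def)
qed

lemma support_contraction:
  fixes w h :: "'N::finite \<Rightarrow> 'N \<Rightarrow> complex"
  assumes "k \<in> {1..n}" "l \<in> {1..n}"
  shows "support_endo n * contraction_endo w h k l = contraction_endo w h k l * support_endo n"
proof (rule endo_eqI)
  fix f and x :: "nat \<Rightarrow> 'N"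
  have "x(k := a, l := b) \<in> {1..n} \<rightarrow>\<^sub>E UNIV \<longleftrightarrow> x \<in> {1..n} \<rightarrow>\<^sub>E UNIV" for a b
    using assms by (auto simp: PiE_def extensional_def)
  then show "ap (support_endo n * contraction_endo w h k l) f x = ap (contraction_endo w h k l * support_endo n) f x"
    by (simp add: support_endo.rep_eq contraction_endo.rep_eq)
qed

lemma support_tensor: "f \<in> tensor_power n \<Longrightarrow> ap (support_endo n) f = f"
  by (auto simp: support_endo.rep_eq tensor_power_def fun_eq_iff)

lemma tensor_operator_support: "tensor_operator n (ap (support_endo n * X))"
  by (auto simp: tensor_operator_def ap_linear tensor_power_def support_endo.rep_eq)

section \<open>Admissibility\<close>

lemma row_le_conjugate:
  assumes "is_partition \<nu>" "1 \<le> p" "p \<le> \<nu> i"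
  shows "i \<le> conjugate \<nu> p"
proof -
  have "finite {k. 1 \<le> k \<and> p \<le> \<nu> k}"
    using assms(1,2) by (auto simp: is_partition_def elim!: rev_finite_subset)
  moreover have "{1..i} \<subseteq> {k. 1 \<le> k \<and> p \<le> \<nu> k}"
    using partition_antimono[OF assms(1), of _ i] assms(3) by fastforce
  ultimately have "card {1..i} \<le> conjugate \<nu> p"
    unfolding conjugate_def by (rule card_mono)
  then show ?thesis by simp
qed

context skew_tableau
begin

text \<open>Every box has content at least 1 minus the length of the first column, and outside the
  first column at least 2 minus the length of the second. The last summand of \<open>c\<close> is
  twice the special value. Admissibility then makes \<open>c\<close> positive.\<close>

lemma special_sum_nonzero:
  assumes adm: "admissible g K lam" and kl: "k \<in> {1..n}" "l \<in> {1..n}"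
    and ex: "\<not> (g = Orth \<and> O.lnl k = 1 \<and> O.lnl l = 1)"
  shows "O.xx (special_point g) k + O.xx (special_point g) l \<noteq> 0"
proof -
  have box: "1 \<le> O.cl k \<and> O.rw k \<le> conjugate lam 1 \<and> (O.cl k = 1 \<or> O.rw k \<le> conjugate lam 2)" if "k \<in> {1..n}" for k
  proof -
    have "1 \<le> O.rw k \<and> 1 \<le> O.cl k \<and> O.cl k \<le> lam (O.rw k)"
      using O.box[OF that] by (auto simp: skew_diagram_def)
    moreover from this have "2 \<le> lam (O.rw k)" if "O.cl k \<noteq> 1" using that by simp
    ultimately show ?thesis
      using row_le_conjugate[OF part(1), of 1 "O.rw k"] row_le_conjugate[OF part(1), of 2 "O.rw k"]
      by (cases "O.cl k = 1") auto
  qed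
  have le: "conjugate lam 2 \<le> conjugate lam 1"
  proof -
    have "finite {i. 1 \<le> i \<and> (1::nat) \<le> lam i}"
      using part(1) by (auto simp: is_partition_def elim!: rev_finite_subset)
    then show ?thesis unfolding conjugate_def by (rule card_mono) auto
  qed
  define c where "c = box_content D \<Omega> k + box_content D \<Omega> l + int K + (if g = Orth then - 1 else 1)"
  have "O.xx (special_point g) k + O.xx (special_point g) l = of_int c"
    by (cases g) (simp_all add: O.xx_def c_def)
  moreover have "c > 0"
  proof (cases g)
    case Orth
    then have "O.cl k \<noteq> 1 \<or> O.cl l \<noteq> 1" "conjugate lam 1 + conjugate lam 2 \<le> K" using ex adm by auto
    then show ?thesis using box[OF kl(1)] box[OF kl(2)] le Orth by (auto simp: c_def box_content_def)
  next
    case Symp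
    then have "2 * conjugate lam 1 \<le> K" using adm by simp
    then show ?thesis using box[OF kl(1)] box[OF kl(2)] Symp by (auto simp: c_def box_content_def)
  qed
  ultimately show ?thesis by simp
qed

text \<open>The value of \<open>B\<close> alone is \<open>E_op\<close> as an operator, being the
  image of the group algebra element with coefficients \<open>e_skew\<close>; the multipliers come
  from \<open>good\<close>. They are composed with the projection \<open>?I\<close> so that they
  preserve the tensor power.\<close>

lemma divisible_value:
  fixes form :: "complex ^ 'N::finite \<Rightarrow> complex ^ 'N \<Rightarrow> complex"
  assumes form: "form_of_type g form" and bases: "dual_bases form u v" and adm: "admissible g K lam"
  defines "AB \<equiv> (\<lambda>t. A_prod form u v n (box_content D \<Omega>) K t \<circ> B_prod n (box_content D \<Omega>) t)"
  shows "regular_operator_at n O.GG AB (special_point g) \<and>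
    (\<exists>X Y. tensor_operator n X \<and> tensor_operator n Y \<and>
       (\<forall>f\<in>tensor_power n. operator_value n O.GG AB (special_point g) f = E_op lam mu \<Upsilon> \<Omega> (X f) \<and>
          operator_value n O.GG AB (special_point g) f = Y (E_op lam mu \<Upsilon> \<Omega> f)))"
proof -
  let ?w = "w_coord u v" and ?h = "\<lambda>a b. form (axis a 1) (axis b 1)"
  have dt: "dual_tensors ?w ?h (delta_of g)" by (rule dual_tensors_form[OF form bases])
  interpret W: dual_tensors ?w ?h "delta_of g" by (rule dt)
  interpret S: separated_labelled_shape "swap_endo :: nat \<Rightarrow> nat \<Rightarrow> (nat \<Rightarrow> 'N) endo" "eps_of g" "{1..n}" O.GG
    "special_point g" O.xx n O.lnl O.psl "special_value g + of_nat K / 2"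
    by (rule O.separated_labelled[OF transpositions_swap])
  interpret B: brauer_labelled_shape "swap_endo :: nat \<Rightarrow> nat \<Rightarrow> (nat \<Rightarrow> 'N) endo" W.QQ "eps_of g" "delta_of g" "{1..n}" O.GG
    "special_point g" O.xx n O.lnl O.psl "special_value g + of_nat K / 2"
  proof
    show "eps_of g \<noteq> delta_of g" by (cases g) simp_all
    show "W.nonopposite (O.xx t) {1..n}" if "t \<in> O.GG" for t
      unfolding W.nonopposite_def
    proof (intro ballI impI)
      fix k l assume kl: "k \<in> {1..n}" "l \<in> {1..n}" "k \<noteq> l"
      then show "O.xx t k + O.xx t l \<noteq> 0"
      proof (cases "k < l")
        case False
        then have "l < k" using kl(3) by simp
        then have "O.xx t l + O.xx t k \<noteq> 0" using that O.generic_points_eq kl(1,2) by blast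
        then show ?thesis by (simp add: add.commute)
      qed (use that O.generic_points_eq kl(1,2) in blast)
    qed
  qed
  interpret H: sym_rep "swap_endo :: nat \<Rightarrow> nat \<Rightarrow> (nat \<Rightarrow> 'N) endo" n perm_endo by (rule sym_rep_perm)
  let ?A = "\<lambda>t. W.Al (O.xx t) [1..<Suc n]" and ?B = "\<lambda>t. W.Bl (O.xx t) [1..<Suc n]"
  let ?z = "special_point g"
  have AB: "AB t = ap (?A t * ?B t)" for t
    unfolding AB_def O.B_prod_eq O.A_prod_eq[OF dt] by (simp add: fun_eq_iff)
  obtain b where good: "B.good [1..<Suc n] b"
    using B.ex_good[of "g = Orth"] special_sum_nonzero[OF adm] by blast
  then have b: "regv {1..n} O.GG ?z ?B b" by (simp only: B.good_def)
  obtain y X X' where y: "regv {1..n} O.GG ?z (\<lambda>t. ?A t * ?B t) y" "y = X * b" "y = b * X'"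
    using good unfolding B.good_def by blast
  have val: "has_regular_value {1..n} O.GG (\<lambda>t. AB t f x) ?z (ap y f x)" for f x
    unfolding AB by (rule regv_has_regular_value[OF y(1)])
  then have F: "operator_value n O.GG AB ?z f = ap y f" for f
    by (simp add: operator_value_def fun_eq_iff O.regular_value_eq)
  have reg: "regular_operator_at n O.GG AB ?z"
    unfolding regular_operator_at_def regular_at_def using val by blast
  obtain b' where b': "regv {1..n} O.GG ?z (\<lambda>t. Gr.Bl (O.xx t) [1..<Suc n]) b'"
    using O.value_exists by blast
  have hom: "b = H.hom b'" by (rule O.value_hom[OF sym_rep_perm b' b])
  have E: "E_op lam mu \<Upsilon> \<Omega> f = ap b f" for f
  proof
    fix x
    have "E_op lam mu \<Upsilon> \<Omega> f x = (\<Sum>s\<in>Sym n. co b' s * perm_op s f x)"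
      unfolding E_op_def algebra_op_def by (intro sum.cong) (simp_all add: value_eq_e_skew[OF b'])
    then show "E_op lam mu \<Upsilon> \<Omega> f x = ap b f x"
      by (simp add: hom H.hom_def ap_sum_left sum_fun_apply cscale_def perm_endo.rep_eq)
  qed
  let ?I = "support_endo n :: (nat \<Rightarrow> 'N) endo"
  have Ib: "?I * b = b * ?I"
    unfolding hom H.hom_def sum_distrib_left sum_distrib_right
    by (intro sum.cong) (simp_all add: support_perm)
  \<comment> \<open>Every factor of \<open>A\<close> and \<open>B\<close> commutes with
    \<open>?I\<close>, so \<open>?I * y\<close> and \<open>y * ?I\<close> are values of one and the
    same function.\<close>
  have Iy: "?I * y = y * ?I"
  proof (rule O.regv_unique)
    show "regv {1..n} O.GG ?z (\<lambda>t. ?I * (?A t * ?B t)) (?I * y)"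
      by (intro regv_mult regv_const y(1))
    have cA: "?I * ?A t = ?A t * ?I" for t
      using O.upt_set by (intro W.Al_commute) (auto simp: W.S_def right_diff_distrib left_diff_distrib support_contraction simp del: upt_Suc)
    have cB: "?I * ?B t = ?B t * ?I" for t
      using O.upt_set by (intro W.Bl_commute) (auto simp: W.R_def right_diff_distrib left_diff_distrib support_perm[OF Sym_transpose] simp del: upt_Suc)
    have comm: "?A t * ?B t * ?I = ?I * (?A t * ?B t)" for t
    proof -
      have "?A t * ?B t * ?I = ?A t * (?I * ?B t)" by (simp only: mult.assoc cB)
      also have "\<dots> = ?I * (?A t * ?B t)" by (simp only: cA mult.assoc[symmetric])
      finally show ?thesis .
    qed
    have "regv {1..n} O.GG ?z (\<lambda>t. ?A t * ?B t * ?I) (y * ?I)"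
      by (intro regv_mult[of _ _ _ "\<lambda>t. ?A t * ?B t"] regv_const y(1))
    then show "regv {1..n} O.GG ?z (\<lambda>t. ?I * (?A t * ?B t)) (y * ?I)" by (simp only: comm)
  qed
  have fac: "ap y f = E_op lam mu \<Upsilon> \<Omega> (ap (?I * X') f) \<and> ap y f = ap (?I * X) (E_op lam mu \<Upsilon> \<Omega> f)"
    if f: "f \<in> tensor_power n" for f
  proof -
    have "ap y f = ap (y * ?I) f" using f by (simp add: support_tensor)
    then have yf: "ap y f = ap (?I * y) f" by (simp only: Iy)
    have "?I * y = b * (?I * X')" using Ib y(3) by (metis mult.assoc)
    moreover have "?I * y = (?I * X) * b" using y(2) by (simp add: mult.assoc)
    ultimately show ?thesis using yf by (metis E ap_simps(6))
  qed
  show ?thesis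
    unfolding F
  proof (intro conjI reg)
    show "\<exists>X Y. tensor_operator n X \<and> tensor_operator n Y \<and>
        (\<forall>f\<in>tensor_power n. ap y f = E_op lam mu \<Upsilon> \<Omega> (X f) \<and> ap y f = Y (E_op lam mu \<Upsilon> \<Omega> f))"
      by (rule exI[of _ "ap (?I * X')"], rule exI[of _ "ap (?I * X)"])
        (intro conjI ballI tensor_operator_support fac[THEN conjunct1] fac[THEN conjunct2])
  qed
qed

end

theorem theorem1p4:
  fixes G :: gtype
    and form :: "complex ^ 'N::finite \<Rightarrow> complex ^ 'N \<Rightarrow> complex"
    and u v :: "'N \<Rightarrow> complex ^ 'N"
    and M :: nat
    and lam mu :: "nat \<Rightarrow> nat"
    and \<Omega> \<Upsilon> :: "nat \<times> nat \<Rightarrow> nat"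
  defines "N \<equiv> CARD('N)"
    and "D \<equiv> skew_diagram lam mu"
    and "n \<equiv> card (skew_diagram lam mu)"
  assumes even: "G = Symp \<longrightarrow> even N \<and> even M"
    and form: "form_of_type G form"
    and bases: "dual_bases form u v"
    and partitions: "is_partition lam" "is_partition mu" "\<forall>i\<ge>1. mu i \<le> lam i"
    and admissible: "admissible G (N + M) lam" "admissible G M mu"
    and \<Omega>: "standard_tableau D \<Omega>"
    and \<Upsilon>: "standard_tableau (diagram mu) \<Upsilon>"
  defines "AB \<equiv> (\<lambda>t. A_prod form u v n (box_content D \<Omega>) (N + M) t \<circ> B_prod n (box_content D \<Omega>) t)"
  defines "F \<equiv> operator_value n (generic_points G D \<Omega> (N + M)) AB (special_point G)"
  shows "regular_operator_at n (generic_points G D \<Omega> (N + M)) AB (special_point G) \<and>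
    (\<exists>X Y. tensor_operator n X \<and> tensor_operator n Y \<and>
       (\<forall>f\<in>tensor_power n. F f = E_op lam mu \<Upsilon> \<Omega> (X f) \<and> F f = Y (E_op lam mu \<Upsilon> \<Omega> f)))"
proof -
  interpret skew_tableau lam mu \<Upsilon> \<Omega> G "N + M"
    using partitions \<Omega> \<Upsilon> by unfold_locales (simp_all add: D_def)
  show ?thesis
    unfolding F_def AB_def D_def n_def by (rule divisible_value[OF form bases admissible(1)])
qed

end
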